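(* Let $G=G_1\times G_2\times\cdots\times G_n$ ($n\ge 2$) be a product of second countable, locally compact, non compact groups, and let $(\Omega,\mu)$ be a standard probability space endowed with a measurable measure-preserving $G$-action such that each $G_i$ acts ergodically on $\Omega$. Let $X$ be a complete separable irreducible median space of finite rank and let $\alpha:G\times\Omega\to \mathrm{Isom}(X)$ be a non-elementary cocycle. Then there exists an $\mathrm{Isom}(X)$-invariant median subspace $Y\subseteq X$ such that the cocycle $\alpha$ (acting on $Y$ by restriction) is cohomologous to a group homomorphism $h:G\to \mathrm{Isom}(Y)$ that factors through the projection of $G$ onto one factor $G_i$.
   Context: A metric space $(X,d)$ is a median space if for all $x,y,z\in X$ the intersection $[x,y]\cap[x,z]\cap[y,z]$ is a single point $m(x,y,z)$, where $[a,b]=\{c\in X: d(a,b)=d(a,c)+d(c,b)\}$. A subset $A\subseteq X$ is convex if $[a,b]\subseteq A$ for all $a,b\in A$. A halfspace is a subset $\mathfrak h\subseteq X$ such that $\mathfrak h$ and its complement $\mathfrak h^c$ are both convex; it is thick if both $\mathfrak h$ and $\mathfrak h^c$ have nonempty interior. Two halfspaces $\mathfrak h_1,\mathfrak h_2$ are transverse if $\mathfrak h_1\cap\mathfrak h_2$, $\mathfrak h_1\cap\mathfrak h_2^c$, $\mathfrak h_1^c\cap\mathfrak h_2$, $\mathfrak h_1^c\cap\mathfrak h_2^c$ are all nonempty. The rank is the maximal number of pairwise transverse halfspaces; finite rank means this number is finite. $X$ is irreducible if it is not the $\ell^1$-product of two median spaces neither of which is a single point. A median subspace is a nonempty subset closed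 under $m$, with the restricted metric. For $X$ complete of finite rank, intervals are compact, and the Roller compactification $\bar X$ is the closure of the image of $X\to\prod_{a,b\in X}[a,b]$, $x\mapsto (m(x,a,b))_{a,b}$, in the product topology; it is a compact median algebra with coordinatewise median operation $m$, with intervals $[x,y]=\{z: m(x,y,z)=z\}$. $X$ is lineal if $\bar X$ is an interval. $\mathrm{Isom}(X)$ carries the topology of pointwise convergence and its Borel structure. A (measurable) cocycle is a measurable map $\alpha:G\times\Omega\to \mathrm{Isom}(X)$ such that for all $g_1,g_2\in G$, $\alpha(g_1g_2,\omega)=\alpha(g_1,g_2.\omega)\circ\alpha(g_2,\omega)$ for almost all $\omega$; cocycles are assumed strict, i.e. the equality holds for all $\omega\in\Omega$. Two cocycles $\alpha,\beta$ with values in the same group $L$ are cohomologous if there is a measurable $\phi:\Omega\to L$ such that for all $g\in G$, $\alpha(g,\omega)=\phi(g.\omega)^{-1}\circ\beta(g,\omega)\circ\phi(\omega)$ for almost all $\omega$. A homomorphism $h$ is viewed as the cocycle $(g,\omega)\mapsto h(g)$; for an $\mathrm{Isom}(X)$-invariant subspace $Y$, $\alpha$ is viewed as an $\mathrm{Isom}(Y)$-valued cocycle by restricting isometries to $Y$, and "cohomologous" is taken in $L=\mathrm{Isom}(Y)$. A cocycle $\alpha:G\times\Omega\to\mathrm{Isom}(X)$, with $X$ complete, non lineal, of finite rank, is non-elementary if for any thick halfspace $\mathfrak h$ of $X$ and any subset $A\subseteq\Omega$ of positive measure there exist $g\in G$ and $\omega\in A\cap g^{-1}.A$ such that $\alpha(g,\omega).\mathfrak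 h\subseteq\mathfrak h^c$. (In particular, a non-elementary cocycle presupposes that $X$ is non lineal.) *)

theory Defs
  imports "HOL-Probability.Probability" "HOL-Algebra.Group_Action" "HOL-Algebra.Product_Groups"
begin

section \<open>Median spaces\<close>

definition metric_interval :: "'x metric \<Rightarrow> 'x \<Rightarrow> 'x \<Rightarrow> 'x set" where
  "metric_interval X a b =
     {c \<in> mspace X. mdist X a b = mdist X a c + mdist X c b}"

text \<open>Median spaces are nonempty by convention: the empty metric space satisfies the defining
  condition vacuously, but has no median subspace (which is nonempty by definition).\<close>

definition median_space :: "'x metric \<Rightarrow> bool" where
  "median_space X \<longleftrightarrow> mspace X \<noteq> {} \<and>
     (\<forall>x \<in> mspace X. \<forall>y \<in> mspace X. \<forall>z \<in> mspace X.
        \<exists>!p. p \<in> metric_interval X x y \<inter> metric_interval X x z \<inter> metric_interval X y z)"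

definition med :: "'x metric \<Rightarrow> 'x \<Rightarrow> 'x \<Rightarrow> 'x \<Rightarrow> 'x" where
  "med X x y z =
     (THE p. p \<in> metric_interval X x y \<inter> metric_interval X x z \<inter> metric_interval X y z)"

definition median_convex :: "'x metric \<Rightarrow> 'x set \<Rightarrow> bool" where
  "median_convex X A \<longleftrightarrow> A \<subseteq> mspace X \<and> (\<forall>a \<in> A. \<forall>b \<in> A. metric_interval X a b \<subseteq> A)"

definition halfspace :: "'x metric \<Rightarrow> 'x set \<Rightarrow> bool" where
  "halfspace X H \<longleftrightarrow>
     H \<subseteq> mspace X \<and> median_convex X H \<and> median_convex X (mspace X - H)"

definition thick_halfspace :: "'x metric \<Rightarrow> 'x set \<Rightarrow> bool" where
  "thick_halfspace X H \<longleftrightarrow> halfspace X H \<and>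
     mtopology_of X interior_of H \<noteq> {} \<and>
     mtopology_of X interior_of (mspace X - H) \<noteq> {}"

definition transverse :: "'x metric \<Rightarrow> 'x set \<Rightarrow> 'x set \<Rightarrow> bool" where
  "transverse X H K \<longleftrightarrow>
     H \<inter> K \<noteq> {} \<and> H \<inter> (mspace X - K) \<noteq> {} \<and>
     (mspace X - H) \<inter> K \<noteq> {} \<and> (mspace X - H) \<inter> (mspace X - K) \<noteq> {}"

definition finite_rank :: "'x metric \<Rightarrow> bool" where
  "finite_rank X \<longleftrightarrow>
     (\<exists>r::nat. \<forall>\<H>. (\<forall>H \<in> \<H>. halfspace X H) \<and> pairwise (transverse X) \<H>
        \<longrightarrow> finite \<H> \<and> card \<H> \<le> r)"

text \<open>Each factor of an \<open>\<ell>\<^sup>1\<close>-product decomposition of \<^term>\<open>X\<close> is isometric to a fibre,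
  i.e. to a subset of \<^term>\<open>X\<close>. Hence there is no loss of generality in taking the factors
  on the same type as \<^term>\<open>X\<close>.\<close>

definition is_l1_product :: "'x metric \<Rightarrow> 'y metric \<Rightarrow> 'z metric \<Rightarrow> bool" where
  "is_l1_product X A B \<longleftrightarrow>
     (\<exists>f. bij_betw f (mspace X) (mspace A \<times> mspace B) \<and>
        (\<forall>x \<in> mspace X. \<forall>y \<in> mspace X.
           mdist X x y = mdist A (fst (f x)) (fst (f y)) + mdist B (snd (f x)) (snd (f y))))"

definition irreducible_median_space :: "'x metric \<Rightarrow> bool" where
  "irreducible_median_space X \<longleftrightarrow> median_space X \<and>
     \<not> (\<exists>(A :: 'x metric) (B :: 'x metric). median_space A \<and> median_space B \<and>
          \<not> is_singleton (mspace A) \<and> \<not> is_singleton (mspace B) \<and> is_l1_product X A B)"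

definition median_subspace :: "'x metric \<Rightarrow> 'x set \<Rightarrow> bool" where
  "median_subspace X Y \<longleftrightarrow> Y \<subseteq> mspace X \<and> Y \<noteq> {} \<and>
     (\<forall>x \<in> Y. \<forall>y \<in> Y. \<forall>z \<in> Y. med X x y z \<in> Y)"


section \<open>The Roller compactification\<close>

definition roller_topology :: "'x metric \<Rightarrow> ('x \<times> 'x \<Rightarrow> 'x) topology" where
  "roller_topology X =
     product_topology (\<lambda>(a, b). subtopology (mtopology_of X) (metric_interval X a b))
       (mspace X \<times> mspace X)"

definition roller_embedding :: "'x metric \<Rightarrow> 'x \<Rightarrow> 'x \<times> 'x \<Rightarrow> 'x" where
  "roller_embedding X x = (\<lambda>(a, b) \<in> mspace X \<times> mspace X. med X x a b)"

definition roller_compactification :: "'x metric \<Rightarrow> ('x \<times> 'x \<Rightarrow> 'x) set" where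
  "roller_compactification X =
     roller_topology X closure_of (roller_embedding X ` mspace X)"

definition roller_med ::
  "'x metric \<Rightarrow> ('x \<times> 'x \<Rightarrow> 'x) \<Rightarrow> ('x \<times> 'x \<Rightarrow> 'x) \<Rightarrow> ('x \<times> 'x \<Rightarrow> 'x) \<Rightarrow> 'x \<times> 'x \<Rightarrow> 'x" where
  "roller_med X x y z = (\<lambda>p \<in> mspace X \<times> mspace X. med X (x p) (y p) (z p))"

definition roller_interval ::
  "'x metric \<Rightarrow> ('x \<times> 'x \<Rightarrow> 'x) \<Rightarrow> ('x \<times> 'x \<Rightarrow> 'x) \<Rightarrow> ('x \<times> 'x \<Rightarrow> 'x) set" where
  "roller_interval X x y = {z \<in> roller_compactification X. roller_med X x y z = z}"

definition lineal :: "'x metric \<Rightarrow> bool" where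
  "lineal X \<longleftrightarrow>
     (\<exists>x \<in> roller_compactification X. \<exists>y \<in> roller_compactification X.
        roller_compactification X = roller_interval X x y)"


section \<open>Isometry groups\<close>

text \<open>As for \<^const>\<open>Bij\<close>, isometries are extensional functions, so that equality of isometries
  is equality of functions.\<close>

definition isometries :: "'x metric \<Rightarrow> ('x \<Rightarrow> 'x) set" where
  "isometries X = {f \<in> Bij (mspace X).
     \<forall>x \<in> mspace X. \<forall>y \<in> mspace X. mdist X (f x) (f y) = mdist X x y}"

definition isom_group :: "'x metric \<Rightarrow> ('x \<Rightarrow> 'x) monoid" where
  "isom_group X = BijGroup (mspace X) \<lparr>carrier := isometries X\<rparr>"

text \<open>The product topology is the topology of pointwise convergence.\<close>

definition isom_topology :: "'x metric \<Rightarrow> ('x \<Rightarrow> 'x) topology" where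
  "isom_topology X =
     subtopology (product_topology (\<lambda>_. mtopology_of X) (mspace X)) (isometries X)"

lemma topspace_isom_topology: "topspace (isom_topology X) = isometries X"
  unfolding isom_topology_def isometries_def Bij_def bij_betw_def
  by (auto simp: PiE_iff extensional_def)

lemma group_isom_group: "group (isom_group X)"
proof -
  interpret B: group "BijGroup (mspace X)" by (rule group_BijGroup)
  have "subgroup (isometries X) (BijGroup (mspace X))"
  proof (rule B.subgroupI)
    show "isometries X \<subseteq> carrier (BijGroup (mspace X))"
      by (auto simp: isometries_def BijGroup_def)
    show "isometries X \<noteq> {}"
      using id_Bij[of "mspace X"] by (auto simp: isometries_def)
    show "inv\<^bsub>BijGroup (mspace X)\<^esub> f \<in> isometries X" if f: "f \<in> isometries X" for f
    proof -
      have fB: "f \<in> Bij (mspace X)" using f by (simp add: isometries_def)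
      then have bij: "bij_betw f (mspace X) (mspace X)" by (simp add: Bij_def)
      let ?g = "inv_into (mspace X) f"
      have "mdist X (?g x) (?g y) = mdist X x y" if "x \<in> mspace X" "y \<in> mspace X" for x y
      proof -
        have "mdist X (f (?g x)) (f (?g y)) = mdist X (?g x) (?g y)"
          using f that bij by (simp add: isometries_def bij_betw_def inv_into_into)
        then show ?thesis
          using that bij by (simp add: bij_betw_def f_inv_into_f)
      qed
      then show ?thesis
        using fB by (simp add: inv_BijGroup isometries_def restrict_inv_into_Bij)
    qed
    show "f \<otimes>\<^bsub>BijGroup (mspace X)\<^esub> g \<in> isometries X"
      if "f \<in> isometries X" "g \<in> isometries X" for f g
    proof -
      have "g x \<in> mspace X" if "x \<in> mspace X" for x
        using \<open>g \<in> isometries X\<close> that by (auto simp: isometries_def Bij_def bij_betw_def)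
      then show ?thesis
        using that by (auto simp: isometries_def BijGroup_def compose_Bij compose_eq)
    qed
  qed
  then show ?thesis
    unfolding isom_group_def by (rule B.subgroup_imp_group)
qed


section \<open>Topological groups and actions on probability spaces\<close>

definition borel_of :: "'a topology \<Rightarrow> 'a measure" where
  "borel_of T = sigma (topspace T) {U. openin T U}"

definition topological_group :: "('g, 'm) monoid_scheme \<Rightarrow> 'g topology \<Rightarrow> bool" where
  "topological_group G T \<longleftrightarrow> group G \<and> topspace T = carrier G \<and>
     continuous_map (prod_topology T T) T (\<lambda>(x, y). x \<otimes>\<^bsub>G\<^esub> y) \<and>
     continuous_map T T (\<lambda>x. inv\<^bsub>G\<^esub> x)"

definition standard_probability_space :: "'w measure \<Rightarrow> bool" where
  "standard_probability_space M \<longleftrightarrow> prob_space M \<and>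
     (\<exists>T. completely_metrizable_space T \<and> second_countable T \<and>
          space M = topspace T \<and> sets M = sets (borel_of T))"

definition measurable_mp_action ::
  "('g, 'm) monoid_scheme \<Rightarrow> 'g topology \<Rightarrow> 'w measure \<Rightarrow> ('g \<Rightarrow> 'w \<Rightarrow> 'w) \<Rightarrow> bool" where
  "measurable_mp_action G T M act \<longleftrightarrow> group_action G (space M) act \<and>
     (\<lambda>(g, \<omega>). act g \<omega>) \<in> measurable (borel_of T \<Otimes>\<^sub>M M) M \<and>
     (\<forall>g \<in> carrier G. distr M M (act g) = M)"

definition ergodic_action ::
  "('g, 'm) monoid_scheme \<Rightarrow> 'w measure \<Rightarrow> ('g \<Rightarrow> 'w \<Rightarrow> 'w) \<Rightarrow> bool" where
  "ergodic_action G M act \<longleftrightarrow>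
     (\<forall>A \<in> sets M. (\<forall>g \<in> carrier G. act g ` A = A) \<longrightarrow> measure M A = 0 \<or> measure M A = 1)"

definition factor_embedding ::
  "'i set \<Rightarrow> ('i \<Rightarrow> ('g, 'm) monoid_scheme) \<Rightarrow> 'i \<Rightarrow> 'g \<Rightarrow> 'i \<Rightarrow> 'g" where
  "factor_embedding I G i x = (\<lambda>j \<in> I. if j = i then x else \<one>\<^bsub>G j\<^esub>)"


section \<open>Cocycles\<close>

text \<open>Multiplication in \<^term>\<open>isom_group X\<close> is composition. Measurability includes that
  \<^term>\<open>\<alpha> g \<omega>\<close> is an isometry of \<^term>\<open>X\<close>.\<close>

definition cocycle ::
  "('g, 'm) monoid_scheme \<Rightarrow> 'g topology \<Rightarrow> 'w measure \<Rightarrow> ('g \<Rightarrow> 'w \<Rightarrow> 'w) \<Rightarrow> 'x metric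
     \<Rightarrow> ('g \<Rightarrow> 'w \<Rightarrow> 'x \<Rightarrow> 'x) \<Rightarrow> bool" where
  "cocycle G T M act X \<alpha> \<longleftrightarrow>
     (\<lambda>(g, \<omega>). \<alpha> g \<omega>) \<in> measurable (borel_of T \<Otimes>\<^sub>M M) (borel_of (isom_topology X)) \<and>
     (\<forall>g\<^sub>1 \<in> carrier G. \<forall>g\<^sub>2 \<in> carrier G. \<forall>\<omega> \<in> space M.
        \<alpha> (g\<^sub>1 \<otimes>\<^bsub>G\<^esub> g\<^sub>2) \<omega> = \<alpha> g\<^sub>1 (act g\<^sub>2 \<omega>) \<otimes>\<^bsub>isom_group X\<^esub> \<alpha> g\<^sub>2 \<omega>)"

definition cohomologous ::
  "('g, 'm) monoid_scheme \<Rightarrow> 'g topology \<Rightarrow> 'w measure \<Rightarrow> ('g \<Rightarrow> 'w \<Rightarrow> 'w) \<Rightarrow> 'x metric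
     \<Rightarrow> ('g \<Rightarrow> 'w \<Rightarrow> 'x \<Rightarrow> 'x) \<Rightarrow> ('g \<Rightarrow> 'w \<Rightarrow> 'x \<Rightarrow> 'x) \<Rightarrow> bool" where
  "cohomologous G T M act X \<alpha> \<beta> \<longleftrightarrow>
     cocycle G T M act X \<alpha> \<and> cocycle G T M act X \<beta> \<and>
     (\<exists>\<phi> \<in> measurable M (borel_of (isom_topology X)). \<forall>g \<in> carrier G. AE \<omega> in M.
        \<alpha> g \<omega> = inv\<^bsub>isom_group X\<^esub> (\<phi> (act g \<omega>)) \<otimes>\<^bsub>isom_group X\<^esub> \<beta> g \<omega> \<otimes>\<^bsub>isom_group X\<^esub> \<phi> \<omega>)"

definition non_elementary ::
  "('g, 'm) monoid_scheme \<Rightarrow> 'w measure \<Rightarrow> ('g \<Rightarrow> 'w \<Rightarrow> 'w) \<Rightarrow> 'x metric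
     \<Rightarrow> ('g \<Rightarrow> 'w \<Rightarrow> 'x \<Rightarrow> 'x) \<Rightarrow> bool" where
  "non_elementary G M act X \<alpha> \<longleftrightarrow> \<not> lineal X \<and>
     (\<forall>H A. thick_halfspace X H \<and> A \<in> sets M \<and> measure M A > 0 \<longrightarrow>
        (\<exists>g \<in> carrier G. \<exists>\<omega> \<in> A. act g \<omega> \<in> A \<and> \<alpha> g \<omega> ` H \<subseteq> mspace X - H))"

end

theory Submission
 imports Defs
begin

text \<open>Rigidity of non-elementary cocycles of product groups, by an argument inside \<open>X\<close>: only countable families
of points and subsets of \<open>X\<close> enter the measure theory.

Non-elementarity makes every thick halfspace flippable: an isometry maps it into its complement. In an irreducible space
flips let any thick halfspace be moved into any other one (\<open>transport\<close>), because the halfspaces that can be reached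
form a class closed under complements and supersets, and a proper such class would split \<open>X\<close> as an \<open>\<ell>\<^sup>1\<close>-product
(\<open>wall_class_all\<close>). With finite rank this yields a pair of strongly separated halfspaces (\<open>ex_sst\<close>), and, since
\<open>X\<close> is not lineal, three disjoint thick halfspaces (\<open>facing\<close>). Deep inside them the median of three points
does not depend on the points. The values so obtained, the centers, form a countable set invariant under all isometries; the
median subspace they generate is the set \<open>Y = core\<close> of the theorem. From two centers comes a countable invariant family of
test sets, which carries the measure theory.

Let two commuting subsets \<open>P\<close>, \<open>Q\<close> of the group act, \<open>P\<close> ergodically. An averaging
argument produces a measurable family of means on the test sets that is stationary for \<open>P\<close> (\<open>ex_stationary\<close>).
Either it is invariant under \<open>Q\<close>, or the difference between it and its translate by an element of \<open>Q\<close> is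
again stationary, and by the maximum principle the test sets where this difference is almost extremal form a
\<open>P\<close>-invariant pattern. In both cases one of \<open>P\<close>, \<open>Q\<close> leaves invariant a random family of pairwise
intersecting test sets (\<open>commuting_filter\<close>). If such a family exists for an ergodic \<open>P\<close> normalised by the group, Fubini's
theorem for Haar measure and non-elementarity show that translates of the family reach every thick halfspace
(\<open>reach_all\<close>), so that three of them pin down any center. This gives \<open>P\<close>-equivariant maps
\<open>\<Omega> \<rightarrow> core\<close>, enough of them to pass through all points of the core over almost every \<open>w\<close>. By
ergodicity two such sections agree almost everywhere or almost nowhere. So countably many of them form a frame: they trivialise
\<open>\<Omega> \<times> core\<close> (\<open>ex_frame\<close>).

Applied to each factor against the product of the others, either this provides a frame for the product of all factors but one,
or every single factor has a frame, and frames of commuting subgroups can be merged, because in the coordinates of one frame a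
section of the other has a distribution, which is a jointly invariant mean (\<open>merge_filter\<close>). In both cases some product
\<open>Q\<close> of all factors but one has a frame (\<open>frame_of_commuting\<close>). As \<open>Q\<close> is normal, each
\<open>g\<close> permutes the frame, and this permutation is a homomorphism that kills \<open>Q\<close> and is cohomologous to the
cocycle (\<open>trivialisation\<close>).\<close>

section \<open>Median geometry\<close>

locale median_geometry =
 fixes X :: "'x metric"
 assumes median: "median_space X"
begin

abbreviation "S \<equiv> mspace X"
abbreviation "thick \<equiv> thick_halfspace X"
abbreviation "d \<equiv> mdist X"
abbreviation "I \<equiv> metric_interval X"
abbreviation "m \<equiv> med X"

lemma mem_I: "c \<in> I a b \<longleftrightarrow> c \<in> S \<and> d a b = d a c + d c b"
 by (simp add: metric_interval_def)

lemma d_self [simp]: "a \<in> S ==> d a a = 0"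
 by simp

lemma I_commute: "I a b = I b a"
 by (auto simp: mem_I mdist_commute)

lemma I_sub: "I a b \<subseteq> S"
 by (auto simp: mem_I)

lemma tri: "a \<in> S ==> b \<in> S ==> c \<in> S ==> d a c \<le> d a b + d b c"
 by (rule mdist_triangle)

lemma I_ends: assumes "a \<in> S" "b \<in> S" shows "a \<in> I a b" "b \<in> I a b"
 using assms by (auto simp: mem_I)

lemma I_self: assumes "a \<in> S" shows "I a a = {a}"
proof -
 have "c = a" if "c \<in> I a a" for c
 proof -
  have c: "c \<in> S" "d a a = d a c + d c a" using that by (auto simp: mem_I)
  thus ?thesis
   using mdist_zero[OF assms assms] mdist_commute[of X a c] mdist_zero[OF assms c(1)] by simp
 qed
 thus ?thesis using assms by (auto simp: mem_I)
qed

lemma I_antisym: assumes "u \<in> S" "a \<in> I u b" "b \<in> I u a" shows "a = b"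
 using assms by (auto simp: mem_I mdist_commute)

lemma I_trans:
 assumes "x \<in> S" "y \<in> S" "u \<in> I x y" "v \<in> I x u"
 shows "v \<in> I x y" "u \<in> I v y"
proof -
 have S: "u \<in> S" "v \<in> S" using assms by (auto simp: mem_I)
 have "d x y \<le> d x v + d v y" "d v y \<le> d v u + d u y"
  using tri S assms by blast+
 moreover have "d x y = d x u + d u y" "d x u = d x v + d v u"
  using assms by (auto simp: mem_I)
 ultimately show "v \<in> I x y" "u \<in> I v y" using S by (auto simp: mem_I)
qed

lemma I_mono: "x \<in> S ==> y \<in> S ==> u \<in> I x y ==> I x u \<subseteq> I x y"
 using I_trans by blast

lemma ex1_med:
 assumes "x \<in> S" "y \<in> S" "z \<in> S"
 shows "\<exists>!p. p \<in> I x y \<inter> I x z \<inter> I y z"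
 using median assms unfolding median_space_def by blast

lemma med_in:
 assumes "x \<in> S" "y \<in> S" "z \<in> S"
 shows "m x y z \<in> I x y" "m x y z \<in> I x z" "m x y z \<in> I y z" "m x y z \<in> S"
proof -
 have "m x y z \<in> I x y \<inter> I x z \<inter> I y z"
  unfolding med_def using theI'[OF ex1_med[OF assms]] .
 thus "m x y z \<in> I x y" "m x y z \<in> I x z" "m x y z \<in> I y z" "m x y z \<in> S"
  using I_sub by auto
qed

lemma med_eqI:
 assumes "x \<in> S" "y \<in> S" "z \<in> S" "p \<in> I x y" "p \<in> I x z" "p \<in> I y z"
 shows "m x y z = p"
 using ex1_med[OF assms(1-3)] med_in[OF assms(1-3)] assms(4-6) by blast

lemma med_perm:
 assumes "x \<in> S" "y \<in> S" "z \<in> S"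
 shows "m y x z = m x y z" "m x z y = m x y z"
 using assms by (auto intro!: med_eqI simp: med_in I_commute[of y x] I_commute[of z x] I_commute[of z y])

lemma med_ends: assumes "x \<in> S" "y \<in> S" "z \<in> I x y" shows "m x y z = z"
proof -
 have "z \<in> S" using assms(3) I_sub by blast
 thus ?thesis using assms by (intro med_eqI) (auto intro: I_ends)
qed

lemma med_iff: assumes "x \<in> S" "y \<in> S" "z \<in> S" shows "m x y z = z \<longleftrightarrow> z \<in> I x y"
 using assms med_ends med_in by metis

text \<open>The median is the gate of \<open>z\<close> in the interval: refining \<open>[x,u]\<close> and \<open>[u,y]\<close> towards
 \<open>z\<close> and taking a median once more gives a point of \<open>[x,y] \<inter> [x,z] \<inter> [y,z]\<close>.\<close>

lemma med_gate:
 assumes "x \<in> S" "y \<in> S" "z \<in> S" "u \<in> I x y"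
 shows "m x y z \<in> I z u"
proof -
 have u: "u \<in> S" using assms I_sub by auto
 define q where "q = m x u z"
 define r where "r = m y u z"
 have q: "q \<in> I x u" "q \<in> I x z" "q \<in> I u z" "q \<in> S"
  unfolding q_def using med_in assms u by auto
 have r: "r \<in> I y u" "r \<in> I y z" "r \<in> I u z" "r \<in> S"
  unfolding r_def using med_in assms u by auto
 define s where "s = m q r z"
 have s: "s \<in> I q r" "s \<in> I q z" "s \<in> I r z" "s \<in> S"
  unfolding s_def using med_in assms q r by auto
 have t: "d x y \<le> d x s + d s y" "d x s \<le> d x q + d q s" "d s y \<le> d s r + d r y"
  "d q r \<le> d q u + d u r" "d x z \<le> d x s + d s z" "d y z \<le> d y s + d s z" "d y s \<le> d y r + d r s"
  "d u z \<le> d u s + d s z" "d u s \<le> d u q + d q s"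
  using tri assms q r s u by blast+
 note eqs = assms(4)[unfolded mem_I] q[unfolded mem_I] r[unfolded mem_I] s[unfolded mem_I]
  mdist_commute[of X r u] mdist_commute[of X r y] mdist_commute[of X s r] mdist_commute[of X s y]
  mdist_commute[of X u q] mdist_commute[of X u y]
 have "s \<in> I x y" "s \<in> I x z" "s \<in> I y z" "s \<in> I u z"
  using t eqs by (auto simp: mem_I)
 hence "m x y z = s" using med_eqI assms by auto
 thus ?thesis using \<open>s \<in> I u z\<close> I_commute[of z u] by simp
qed

definition convex where "convex A \<longleftrightarrow> median_convex X A"

lemma convex_iff: "convex A \<longleftrightarrow> A \<subseteq> S \<and> (\<forall>a\<in>A. \<forall>b\<in>A. I a b \<subseteq> A)"
 by (simp add: convex_def median_convex_def)

lemma convex_interval: assumes "x \<in> S" "y \<in> S" shows "convex (I x y)"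
proof -
 have "w \<in> I x y" if "u \<in> I x y" "v \<in> I x y" "w \<in> I u v" for u v w
 proof -
  have S: "u \<in> S" "v \<in> S" "w \<in> S" using that I_sub by auto
  have p: "m x y w \<in> I w u" "m x y w \<in> I w v" using med_gate assms that S by auto
  have "m u v w = w" using med_ends S that by auto
  moreover have "m u v w = m x y w"
  proof -
   have "w = m w u v" using med_perm S \<open>m u v w = w\<close> by metis
   have *: "m x y w \<in> S" using med_in assms S by auto
   have t: "d u v \<le> d u (m x y w) + d (m x y w) v" using tri S * by auto
   have "w = m x y w"
    using p that(3) t mdist_nonneg[of X w "m x y w"] by (auto simp: mem_I mdist_commute)
   thus ?thesis using \<open>m u v w = w\<close> by simp
  qed
  ultimately show ?thesis using med_in assms S by metis
 qed
 thus ?thesis unfolding convex_iff using I_sub by blast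
qed

lemma convex_sub: "convex A ==> A \<subseteq> S" by (simp add: convex_iff)
lemma convexI:
 assumes "A \<subseteq> S" and *: "!!u v w. u \<in> A ==> v \<in> A ==> w \<in> I u v ==> w \<in> A"
 shows "convex A"
 unfolding convex_iff
proof (intro conjI ballI subsetI)
 fix a b x assume "a \<in> A" "b \<in> A" "x \<in> I a b"
 thus "x \<in> A" by (rule *)
qed (use assms(1) in blast)

lemma convexD: "convex A ==> a \<in> A ==> b \<in> A ==> c \<in> I a b ==> c \<in> A" by (auto simp: convex_iff)
lemma convex_med: assumes "convex A" "x \<in> A" "y \<in> A" "z \<in> S"
 shows "m x y z \<in> A" "m x z y \<in> A" "m z x y \<in> A"
proof -
 have S: "x \<in> S" "y \<in> S" using assms convex_sub by auto
 note * = convexD[OF assms(1-3)]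
 show "m x y z \<in> A" "m x z y \<in> A" "m z x y \<in> A"
  by (rule *, rule med_in; use S assms in auto)+
qed

lemma convex_S: "convex S" using I_sub by (auto simp: convex_iff)

text \<open>The gate of \<open>x\<close> in \<open>A\<close> is the point of \<open>A\<close> passed on the way from \<open>x\<close> to any point of \<open>A\<close>.\<close>

definition gate where "gate A x g \<longleftrightarrow> g \<in> A \<and> (\<forall>a\<in>A. g \<in> I x a)"

lemma gate_med: assumes "x \<in> S" "y \<in> S" "z \<in> S" shows "gate (I x y) z (m x y z)"
 unfolding gate_def using med_gate med_in assms by auto

lemma gate_lipschitz:
 assumes A: "convex A" and S: "x \<in> S" "y \<in> S" and g: "gate A x g" "gate A y h"
 shows "d g h \<le> d x y"
proof -
 have gS: "g \<in> S" "h \<in> S" using g convex_sub[OF A] unfolding gate_def by auto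
 have "g \<in> I x h" "h \<in> I y g" using g unfolding gate_def by auto
 hence "d x h = d x g + d g h" "d y g = d y h + d h g" by (auto simp: mem_I)
 moreover have "d x h \<le> d x y + d y h" "d y g \<le> d y x + d x g" using tri S gS by auto
 moreover have "d h g = d g h" "d y x = d x y" by (simp_all add: mdist_commute)
 ultimately show ?thesis by linarith
qed

text \<open>The median \<open>t\<close> of the gates \<open>a\<close>, \<open>b\<close>, \<open>c\<close> lies between \<open>w\<close> and \<open>c\<close>, since the median of \<open>u\<close>, \<open>v\<close> and
 \<open>c\<close> equals that of \<open>u\<close>, \<open>v\<close> and \<open>t\<close>; as \<open>c\<close> is the gate of \<open>w\<close>, this forces \<open>t = c\<close>.\<close>

lemma gate_interval:
 assumes A: "convex A" and S: "u \<in> S" "v \<in> S" and w: "w \<in> I u v"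
  and g: "gate A u a" "gate A v b" "gate A w c"
 shows "c \<in> I a b"
proof -
 have wS: "w \<in> S" using w I_sub by auto
 have ab: "a \<in> A" "b \<in> A" "c \<in> A" using g unfolding gate_def by auto
 hence abS: "a \<in> S" "b \<in> S" "c \<in> S" using convex_sub[OF A] by auto
 define t where "t = m a b c"
 have t: "t \<in> I a b" "t \<in> I a c" "t \<in> I b c" "t \<in> S"
  unfolding t_def using med_in abS by auto
 have tA: "t \<in> A" using A ab t convexD by blast
 have "a \<in> I u c" "b \<in> I v c" "c \<in> I w t" using g tA unfolding gate_def by auto
 have tc: "t \<in> I u c" "t \<in> I v c"
  using I_trans(1)[of c u a t] I_trans(1)[of c v b t] \<open>a \<in> I u c\<close> \<open>b \<in> I v c\<close> t S abS
  by (auto simp: I_commute)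
 define s where "s = m u v c"
 have s: "s \<in> I u v" "s \<in> I u c" "s \<in> I v c" "s \<in> S" unfolding s_def using med_in abS S by auto
 have "s \<in> I c w" unfolding s_def using med_gate[OF S abS(3) w] .
 have st: "m u v t = s"
 proof -
  have p: "m u v t \<in> I u v" "m u v t \<in> I u t" "m u v t \<in> I v t" using med_in S t by auto
  have "m u v c = m u v t"
   using I_mono[of u c t] I_mono[of v c t] tc med_eqI S abS p by blast
  thus ?thesis by (simp add: s_def)
 qed
 hence "t \<in> I s c" using med_in(2)[of u v t] t I_trans(2)[of u c t s] tc S abS by auto
 hence "t \<in> I c w" using I_trans(1)[of c w s t] \<open>s \<in> I c w\<close> abS wS by (auto simp: I_commute)
 hence "t \<in> I w c" by (simp add: I_commute)
 hence "t = c" using I_antisym[OF wS _ \<open>c \<in> I w t\<close>] by auto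
 thus ?thesis using t by simp
qed

lemma med_interval:
 assumes "x \<in> S" "y \<in> S" "u \<in> S" "v \<in> S" "w \<in> I u v"
 shows "m x y w \<in> I (m x y u) (m x y v)"
using I_sub gate_interval[OF convex_interval[of x y], of u v w] gate_med assms by blast

text \<open>For \<open>w\<close> between \<open>u \<in> [x,c]\<close> and \<open>v \<in> [x,c']\<close>, project to \<open>[x,w]\<close> by the median \<open>\<rho>\<close>. It maps the median \<open>c''\<close> of \<open>c\<close>, \<open>c'\<close>, \<open>w\<close> to a point beyond
 the images of \<open>c\<close> and \<open>c'\<close>, hence beyond those of \<open>u\<close> and \<open>v\<close>, which have \<open>w\<close> between them.\<close>

lemma convex_join:
 assumes C: "convex C" and x: "x \<in> S" shows "convex (\<Union>c\<in>C. I x c)"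
proof -
 have "\<exists>c''\<in>C. w \<in> I x c''"
  if c: "c \<in> C" "c' \<in> C" and uv: "u \<in> I x c" "v \<in> I x c'" and w: "w \<in> I u v" for c c' u v w
 proof -
  have S: "c \<in> S" "c' \<in> S" "u \<in> S" "v \<in> S" "w \<in> S"
   using c convex_sub[OF C] uv w I_sub by auto
  define \<rho> where "\<rho> z = m x w z" for z
  have \<rho>_in: "\<rho> z \<in> I x w" "\<rho> z \<in> S" if "z \<in> S" for z
   unfolding \<rho>_def using med_in x S that by auto
  have \<rho>I: "\<rho> e \<in> I (\<rho> a) (\<rho> b)" if "a \<in> S" "b \<in> S" "e \<in> I a b" for a b e
   unfolding \<rho>_def using med_interval x S that by auto
  have \<rho>x: "\<rho> x = x" "\<rho> w = w" unfolding \<rho>_def using med_ends x S I_ends by auto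
  define c'' where "c'' = m c c' w"
  have c'': "c'' \<in> I c c'" "c'' \<in> I c w" "c'' \<in> I c' w" "c'' \<in> S"
   unfolding c''_def using med_in S by auto
  have "c'' \<in> C" by (rule convexD[OF C c c''(1)])
  define z where "z = \<rho> c''"
  have zS: "z \<in> S" "z \<in> I x w" unfolding z_def using \<rho>_in c'' by auto
  have "z \<in> I (\<rho> c) w" "z \<in> I (\<rho> c') w" unfolding z_def using \<rho>I[of c w c''] \<rho>I[of c' w c''] S c'' \<rho>x by auto
  have "\<rho> c \<in> I x z"
   using I_trans(2)[of w x "\<rho> c" z] \<open>z \<in> I (\<rho> c) w\<close> \<rho>_in[of c] S x by (auto simp: I_commute)
  have "\<rho> c' \<in> I x z"
   using I_trans(2)[of w x "\<rho> c'" z] \<open>z \<in> I (\<rho> c') w\<close> \<rho>_in[of c'] S x by (auto simp: I_commute)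
  have "\<rho> u \<in> I x (\<rho> c)" "\<rho> v \<in> I x (\<rho> c')" using \<rho>I[of x c u] \<rho>I[of x c' v] uv \<rho>x S x by auto
  hence "\<rho> u \<in> I x z" "\<rho> v \<in> I x z"
   using I_mono[OF x zS(1)] \<open>\<rho> c \<in> I x z\<close> \<open>\<rho> c' \<in> I x z\<close> by auto
  moreover have "w \<in> I (\<rho> u) (\<rho> v)" using \<rho>I[of u v w] S w \<rho>x by auto
  ultimately have "w \<in> I x z" using convex_interval[OF x zS(1)] convexD by blast
  hence "w \<in> I x c''"
   using zS z_def \<rho>_def med_perm med_iff x S c'' by metis
  thus ?thesis using \<open>c'' \<in> C\<close> by auto
 qed
 note key = this
 have "I u v \<subseteq> (\<Union>c\<in>C. I x c)" if uv: "u \<in> (\<Union>c\<in>C. I x c)" "v \<in> (\<Union>c\<in>C. I x c)" for u v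
 using uv key by auto
 moreover have "(\<Union>c\<in>C. I x c) \<subseteq> S" using I_sub by blast
 ultimately show ?thesis unfolding convex_iff by blast
qed

lemma halfspace_iff: "halfspace X H \<longleftrightarrow> convex H \<and> convex (S - H)"
 by (auto simp: halfspace_def convex_def median_convex_def)

text \<open>The retraction \<open>\<rho>\<close> to \<open>[r,z]\<close> maps \<open>b\<close> and \<open>b'\<close> to \<open>z\<close>. The configuration arises in \<open>halfspace_separation\<close>.\<close>

lemma separation_median_point:
 assumes S: "a \<in> S" "a' \<in> S" "p \<in> S" "q \<in> S"
  and b: "b \<in> I a p" "b' \<in> I a' q" and r: "r \<in> I p q"
 defines "z \<equiv> m b b' r"
 shows "z \<in> I r (m a a' z)"
proof -
 have S': "b \<in> S" "b' \<in> S" "r \<in> S" using b r I_sub by auto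
 have z: "z \<in> I b b'" "z \<in> I b r" "z \<in> I b' r" "z \<in> S"
  unfolding z_def using med_in S' by auto
 define \<rho> where "\<rho> e = m r z e" for e
 have \<rho>_in: "\<rho> e \<in> I r z" "\<rho> e \<in> S" if "e \<in> S" for e
  unfolding \<rho>_def using med_in S' z that by auto
 have \<rho>I: "\<rho> e \<in> I (\<rho> f) (\<rho> g)" if "f \<in> S" "g \<in> S" "e \<in> I f g" for e f g
  unfolding \<rho>_def using med_interval[of r z f g e] S' z that by auto
 have \<rho>_ends: "\<rho> r = r" "\<rho> z = z"
  unfolding \<rho>_def using med_ends[of r z r] med_ends[of r z z] S' z I_ends[of r z] by auto
 have "\<rho> b = z"
  unfolding \<rho>_def using med_eqI[of r z b z] S' z I_ends[of r z] I_ends[of z b] I_commute[of b r] by auto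
 have "\<rho> b' = z"
  unfolding \<rho>_def using med_eqI[of r z b' z] S' z I_ends[of r z] I_ends[of z b'] I_commute[of b' r] by auto
 define e where "e = m a a' z"
 have e: "e \<in> I a z" "e \<in> I a' z" "e \<in> S" unfolding e_def using med_in S z by auto
 define t where "t = \<rho> e"
 have t: "t \<in> I r z" "t \<in> S" unfolding t_def using \<rho>_in e by auto
 have zt: "z \<in> I t (\<rho> p)" if "a0 \<in> S" "p \<in> S" "b0 \<in> I a0 p" "\<rho> b0 = z" "e \<in> I a0 z" for a0 p b0
 using \<rho>I[of a0 p b0] that \<rho>I[of a0 z e] \<rho>_ends z I_trans(2)[of "\<rho> a0" "\<rho> p" z t] \<rho>_in unfolding t_def by auto
 have z1: "z \<in> I t (\<rho> p)" using zt[OF S(1,3) b(1) \<open>\<rho> b = z\<close> e(1)] .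
 have z2: "z \<in> I t (\<rho> q)" using zt[OF S(2,4) b(2) \<open>\<rho> b' = z\<close> e(2)] .
 have rpq: "r \<in> I (\<rho> p) (\<rho> q)" using \<rho>I[of p q r] S r \<rho>_ends by auto
 have pq: "\<rho> p \<in> S" "\<rho> q \<in> S" using \<rho>_in S by auto
 define s where "s = m (\<rho> p) (\<rho> q) t"
 have s: "s \<in> I (\<rho> p) (\<rho> q)" "s \<in> I (\<rho> p) t" "s \<in> I (\<rho> q) t" "s \<in> S"
  unfolding s_def using med_in pq t by auto
 have "m (\<rho> p) (\<rho> q) z = s"
 proof -
  have i: "m (\<rho> p) (\<rho> q) z \<in> I (\<rho> p) (\<rho> q)" "m (\<rho> p) (\<rho> q) z \<in> I (\<rho> p) z" "m (\<rho> p) (\<rho> q) z \<in> I (\<rho> q) z"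
   using med_in pq z by auto
  have "z \<in> I (\<rho> p) t" "z \<in> I (\<rho> q) t" using z1 z2 by (simp_all add: I_commute)
  hence "m (\<rho> p) (\<rho> q) z \<in> I (\<rho> p) t" "m (\<rho> p) (\<rho> q) z \<in> I (\<rho> q) t"
   using i(2) i(3) I_mono[of "\<rho> p" t z] I_mono[of "\<rho> q" t z] pq t by blast+
  thus ?thesis unfolding s_def using med_eqI[of "\<rho> p" "\<rho> q" t] pq t i by auto
 qed
 hence "s \<in> I (\<rho> p) z" using med_in(2)[OF pq z(4)] by auto
 have z1': "z \<in> I (\<rho> p) t" using z1 I_commute[of t] by auto
 have "z \<in> I s t" using I_trans(2)[OF pq(1) t(2) z1' \<open>s \<in> I (\<rho> p) z\<close>] .
 moreover have "s \<in> I t r" unfolding s_def using med_gate[OF pq t(2) rpq] .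
 ultimately have "z \<in> I t r" using I_mono[of t r s] t S' I_commute[of s t] by auto
 hence "m r e z = z"
  using I_commute[of t r] I_antisym[OF S'(3)] t med_perm[of r z e] S' z e by (simp add: t_def \<rho>_def)
 thus ?thesis using med_iff[of r e z] S' e z by (simp add: e_def)
qed

text \<open>Kakutani separation. If \<open>M\<close> is a maximal convex set disjoint from \<open>B\<close> and its complement were not convex, two joins of
 \<open>M\<close> with outside points \<open>p\<close>, \<open>q\<close> would meet \<open>B\<close>, and by \<open>separation_median_point\<close> the median of the two meeting
 points and a point of \<open>M\<close> between \<open>p\<close> and \<open>q\<close> would lie in both \<open>M\<close> and \<open>B\<close>.\<close>

lemma halfspace_separation:
 assumes AB: "convex A" "convex B" "A \<inter> B = {}"
 obtains H where "halfspace X H" "A \<subseteq> H" "B \<subseteq> S - H"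
proof -
 let ?P = "{C. convex C \<and> A \<subseteq> C \<and> C \<inter> B = {}}"
 have "\<exists>M\<in>?P. \<forall>C\<in>?P. M \<subseteq> C --> C = M"
 proof (rule subset_Zorn_nonempty)
  show "?P ~= {}" using AB by auto
  fix \<C> assume "\<C> ~= {}" "subset.chain ?P \<C>"
  hence C: "\<C> ~= {}" "!!U. U \<in> \<C> ==> convex U" "!!U. U \<in> \<C> ==> A \<subseteq> U \<and> U \<inter> B = {}"
   "!!U V. U \<in> \<C> ==> V \<in> \<C> ==> U \<subseteq> V \<or> V \<subseteq> U" unfolding subset_chain_def by auto
  have "convex (\<Union>\<C>)" unfolding convex_iff
  proof (intro conjI ballI)
   show "\<Union>\<C> \<subseteq> S" using C(2) convex_sub by blast
   fix a b assume "a \<in> \<Union>\<C>" "b \<in> \<Union>\<C>"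
   then obtain U V where UV: "U \<in> \<C>" "V \<in> \<C>" "a \<in> U" "b \<in> V" by blast
   from C(4)[OF UV(1,2)] obtain W where W: "W \<in> \<C>" "a \<in> W" "b \<in> W"
   proof
    assume "U \<subseteq> V" thus ?thesis using UV that[of V] by auto
   next
    assume "V \<subseteq> U" thus ?thesis using UV that[of U] by auto
   qed
   thus "I a b \<subseteq> \<Union>\<C>" using C(2)[OF W(1)] unfolding convex_iff by blast
  qed
  moreover have "A \<subseteq> \<Union>\<C>" "\<Union>\<C> \<inter> B = {}" using C(1,3) by auto
  ultimately show "\<Union>\<C> \<in> ?P" by simp
 qed
 then obtain M where M: "convex M" "A \<subseteq> M" "M \<inter> B = {}"
  and max': "\<forall>C. convex C \<and> A \<subseteq> C \<and> C \<inter> B = {} --> M \<subseteq> C --> C = M"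
  by auto
 have max: "C = M" if "convex C" "M \<subseteq> C" "C \<inter> B = {}" for C
  using max' that M(2) by blast
 have join: "\<exists>a\<in>M. \<exists>b\<in>B. b \<in> I a p" if p: "p \<in> S" "p \<notin> M" "M ~= {}" for p
 proof (rule ccontr)
  assume n: "\<not> ?thesis"
  let ?J = "\<Union>c\<in>M. I p c"
  have "convex ?J" by (rule convex_join[OF M(1) p(1)])
  moreover have "M \<subseteq> ?J" using I_ends[OF p(1)] convex_sub[OF M(1)] by blast
  moreover have "?J \<inter> B = {}" using n I_commute by auto
  ultimately have "?J = M" using max by blast
  moreover have "p \<in> ?J" using p I_ends(1)[OF p(1)] convex_sub[OF M(1)] by blast
  ultimately show False using p by simp
 qed
 have "convex (S - M)"
 proof (cases "M = {}")
  case True thus ?thesis using convex_S by simp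
 next
  case False
  have "r \<notin> M" if pq: "p \<in> S - M" "q \<in> S - M" and r: "r \<in> I p q" for p q r
  proof
   assume rM: "r \<in> M"
   obtain a b where ab: "a \<in> M" "b \<in> B" "b \<in> I a p" using join[of p] pq False by blast
   obtain a' b' where ab': "a' \<in> M" "b' \<in> B" "b' \<in> I a' q" using join[of q] pq False by blast
   have S: "a \<in> S" "a' \<in> S" "p \<in> S" "q \<in> S" "b \<in> S" "b' \<in> S" "r \<in> S"
    using ab ab' pq convex_sub[OF M(1)] convex_sub[OF AB(2)] rM by auto
   define z where "z = m b b' r"
   have z: "z \<in> I r (m a a' z)" unfolding z_def
    by (rule separation_median_point[OF S(1-4) ab(3) ab'(3) r])
   have zS: "z \<in> S" unfolding z_def using med_in S by auto
   have "m a a' z \<in> M" using convex_med(1)[OF M(1) ab(1) ab'(1) zS] .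
   hence "z \<in> M" using convexD[OF M(1) rM _ z] by auto
   moreover have "z \<in> B" unfolding z_def using convex_med(1)[OF AB(2) ab(2) ab'(2) S(7)] .
   ultimately show False using M by auto
  qed
  thus ?thesis unfolding convex_iff using I_sub by blast
 qed
 hence "halfspace X M" using M halfspace_iff by auto
 moreover have "B \<subseteq> S - M" using M convex_sub[OF AB(2)] by auto
 ultimately show ?thesis using that M by auto
qed

lemma halfspace_sub: "halfspace X H ==> H \<subseteq> S" by (simp add: halfspace_def)

lemma halfspace_compl: "halfspace X H ==> halfspace X (S - H)"
 by (auto simp: halfspace_iff double_diff convex_sub)

lemma halfspace_med:
 assumes "halfspace X H" "x \<in> S" "y \<in> S" "z \<in> S"
 shows "m x y z \<in> H \<longleftrightarrow> (x \<in> H \<and> y \<in> H) \<or> (x \<in> H \<and> z \<in> H) \<or> (y \<in> H \<and> z \<in> H)"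
proof -
 have c: "convex H" "convex (S - H)" using assms halfspace_iff by auto
 have 1: "m x y z \<in> C" if "convex C" "(x \<in> C \<and> y \<in> C) \<or> (x \<in> C \<and> z \<in> C) \<or> (y \<in> C \<and> z \<in> C)" for C
  using that(2) convex_med(1)[OF that(1), of x y z] convex_med(2)[OF that(1), of x z y]
   convex_med(3)[OF that(1), of y z x] assms(2-4) by metis
 show ?thesis using 1[OF c(1)] 1[OF c(2)] assms(2-4) by auto
qed

lemma point_separation:
 assumes "x \<in> S" "y \<in> S" "x ~= y"
 obtains H where "halfspace X H" "x \<notin> H" "y \<in> H"
using I_self halfspace_separation[of "{y}" "{x}"] assms that unfolding convex_iff by auto

definition chull where "chull A = S \<inter> \<Inter>{C. convex C \<and> A \<subseteq> C}"

lemma convex_chull: "convex (chull A)"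
 proof -
 have "I a b \<subseteq> chull A" if "a \<in> chull A" "b \<in> chull A" for a b
 proof
  fix c assume c: "c \<in> I a b"
  have "c \<in> C" if C: "convex C" "A \<subseteq> C" for C
   using convexD[OF C(1) _ _ c] that \<open>a \<in> chull A\<close> \<open>b \<in> chull A\<close> unfolding chull_def by simp
  thus "c \<in> chull A" using c I_sub[of a b] unfolding chull_def by auto
 qed
 thus ?thesis unfolding convex_iff by (auto simp: chull_def)
qed

lemma chull_min: "convex C ==> A \<subseteq> C ==> chull A \<subseteq> C" by (auto simp: chull_def)
lemma chull_inc: "A \<subseteq> S ==> A \<subseteq> chull A" by (auto simp: chull_def)
lemma chull_mono: "A \<subseteq> B ==> chull A \<subseteq> chull B" by (auto simp: chull_def)
lemma chull_sub: "chull A \<subseteq> S" by (auto simp: chull_def)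

lemma chull_finite:
 assumes "A \<subseteq> S" "z \<in> chull A"
 obtains F where "finite F" "F \<subseteq> A" "z \<in> chull F"
proof -
 let ?U = "\<Union>{chull F |F. finite F \<and> F \<subseteq> A}"
 have "convex ?U" unfolding convex_iff
 proof (intro conjI ballI)
  show "?U \<subseteq> S" using chull_sub by blast
  fix a b assume "a \<in> ?U" "b \<in> ?U"
  then obtain F G where F: "finite F" "F \<subseteq> A" "a \<in> chull F" and G: "finite G" "G \<subseteq> A" "b \<in> chull G" by blast
  have "I a b \<subseteq> chull (F \<union> G)"
   using F G chull_mono[of F "F \<union> G"] chull_mono[of G "F \<union> G"] convex_chull unfolding convex_iff by blast
  moreover have "finite (F \<union> G)" "F \<union> G \<subseteq> A" using F G by auto
  ultimately show "I a b \<subseteq> ?U" by blast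
 qed
 moreover have "A \<subseteq> ?U"
 proof
  fix x assume "x \<in> A"
  hence "x \<in> chull {x}" using chull_inc[of "{x}"] assms by auto
  thus "x \<in> ?U" using \<open>x \<in> A\<close> by blast
 qed
 ultimately have "z \<in> ?U" using chull_min assms by blast
 thus ?thesis using that by blast
qed

text \<open>A minimal finite set \<open>F\<close> that meets all halfspaces \<open>K\<close> with \<open>z \<in> K\<close>, \<open>x \<notin> K\<close> has, for each \<open>a \<in> F\<close>,
 such a halfspace meeting \<open>F\<close> in \<open>a\<close> only; these are pairwise transverse. So \<open>card F\<close> is at most the rank, and
 \<open>z\<close> is reached from \<open>x\<close> by successively joining the points of \<open>F\<close>.\<close>

lemma chull_ball_radius:
 assumes r: "!!\<H>. \<forall>H\<in>\<H>. halfspace X H ==> pairwise (transverse X) \<H> ==> finite \<H> \<and> card \<H> \<le> r"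
  and x: "x \<in> S" and e: "e \<ge> 0" and z: "z \<in> chull {a\<in>S. d x a \<le> e}"
 shows "d x z \<le> real r * e"
proof -
 let ?B = "{a\<in>S. d x a \<le> e}"
 let ?\<Phi> = "\<lambda>F. finite F \<and> F \<subseteq> ?B \<and> (\<forall>K. halfspace X K --> z \<in> K --> x \<notin> K --> K \<inter> F ~= {})"
 have zS: "z \<in> S" using z chull_sub by auto
 obtain F0 where F0: "finite F0" "F0 \<subseteq> ?B" "z \<in> chull F0"
  using chull_finite[of ?B z] z by auto
 have "?\<Phi> F0"
 using chull_min F0 halfspace_iff by blast
 then obtain F where F: "?\<Phi> F" and min: "!!F'. ?\<Phi> F' ==> card F \<le> card F'"
  using ex_has_least_nat[of ?\<Phi> F0 card] by blast
 have "\<exists>K. halfspace X K \<and> z \<in> K \<and> x \<notin> K \<and> K \<inter> F = {a}" if a: "a \<in> F" for a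
 proof -
  have "\<not> ?\<Phi> (F - {a})" using min[of "F - {a}"] F a card_Diff1_less[of F a] by auto
  then obtain K where K: "halfspace X K" "z \<in> K" "x \<notin> K" "K \<inter> (F - {a}) = {}" using F by blast
  hence "K \<inter> F ~= {}" using F by blast
  thus ?thesis using K by blast
 qed
 then obtain K where K: "!!a. a \<in> F ==> halfspace X (K a) \<and> z \<in> K a \<and> x \<notin> K a \<and> K a \<inter> F = {a}" by metis
 have inj: "inj_on K F" using K by (metis inj_onI singleton_inject)
 have "pairwise (transverse X) (K ` F)"
 proof (rule pairwiseI, clarsimp)
  fix a b assume ab: "a \<in> F" "b \<in> F" "K a ~= K b"
  hence "a ~= b" by auto
  have "a \<in> S" "b \<in> S" using F ab by auto
  have "z \<in> K a \<inter> K b" "a \<in> K a \<inter> (S - K b)" "b \<in> (S - K a) \<inter> K b" "x \<in> (S - K a) \<inter> (S - K b)"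
   using K[OF ab(1)] K[OF ab(2)] \<open>a ~= b\<close> ab(1,2) x \<open>a \<in> S\<close> \<open>b \<in> S\<close> by auto
  thus "transverse X (K a) (K b)" unfolding transverse_def by blast
 qed
 moreover have "\<forall>H\<in>K ` F. halfspace X H" using K by simp
 ultimately have "card (K ` F) \<le> r" using r[of "K ` F"] by simp
 hence card: "card F \<le> r" using inj by (simp add: card_image)
 have "\<exists>q. q \<in> I x z \<and> d x q \<le> real (card F') * e \<and> (\<forall>H. halfspace X H --> z \<in> H --> F' \<inter> H ~= {} --> q \<in> H)"
  if "finite F'" "F' \<subseteq> F" for F'
  using that
 proof (induction F' rule: finite_induct)
  case empty
  show ?case using I_ends[OF x zS] x by (intro exI[of _ x]) auto
 next
  case (insert a F')
  then obtain q where q: "q \<in> I x z" "d x q \<le> real (card F') * e"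
   "!!H. halfspace X H ==> z \<in> H ==> F' \<inter> H ~= {} ==> q \<in> H" by auto
  have qS: "q \<in> S" using q(1) by (simp add: mem_I)
  have a: "a \<in> S" "d x a \<le> e" using insert F by auto
  define q' where "q' = m q z a"
  have q': "q' \<in> I q z" "q' \<in> S" unfolding q'_def using med_in qS zS a by auto
  have 1: "gate (I q z) a q'" unfolding q'_def using gate_med qS zS a by auto
  have "m q z x = q"
  using q I_commute[of z x] I_ends[OF qS x] I_ends[OF qS zS] med_eqI[OF qS zS x] by auto
  hence 2: "gate (I q z) x q" using gate_med[OF qS zS x] by simp
  have "d q q' \<le> d x a" using gate_lipschitz[OF convex_interval[OF qS zS] x a(1) 2 1] .
  hence "d x q' \<le> real (card F') * e + e" using tri[OF x qS q'(2)] q a by auto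
  hence "d x q' \<le> real (card (insert a F')) * e" using insert by (simp add: algebra_simps)
  moreover have "q' \<in> I x z"
   using I_trans(1)[OF zS x, of q q'] q(1) q'(1) by (simp add: I_commute)
  moreover have "q' \<in> H" if H: "halfspace X H" "z \<in> H" "insert a F' \<inter> H ~= {}" for H
  using q(3)[OF H(1,2)] H(3) halfspace_med[OF H(1) qS zS a(1)] H(2) unfolding q'_def by auto
  ultimately show ?case by blast
 qed
 from this[of F] obtain q where q: "q \<in> I x z" "d x q \<le> real (card F) * e"
  "!!H. halfspace X H ==> z \<in> H ==> F \<inter> H ~= {} ==> q \<in> H" using F by auto
 have "q = z"
 proof (rule ccontr)
  assume "q ~= z"
  have qS: "q \<in> S" using q(1) by (simp add: mem_I)
  obtain H where H: "halfspace X H" "q \<notin> H" "z \<in> H" using point_separation[OF qS zS \<open>q ~= z\<close>] .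
  have "x \<notin> H" using H q(1) convexD[of H x z q] halfspace_iff by auto
  hence "F \<inter> H ~= {}" using F H by blast
  thus False using q(3) H by blast
 qed
 moreover have "real (card F) * e \<le> real r * e" using card e by (intro mult_right_mono) auto
 ultimately show ?thesis using q by auto
qed

end

section \<open>Thick halfspaces in complete spaces of finite rank\<close>

locale fr_median_geometry = median_geometry +
 assumes finite_rank: "finite_rank X" and complete: "mcomplete_of X"
begin

sublocale MS: Metric_space S d by (rule Metric_space_mspace_mdist)

lemma mtop: "mtopology_of X = MS.mtopology" by (simp add: mtopology_of_def)

text \<open>Separation with room: \<open>y\<close> is an interior point of \<open>H\<close> and \<open>x\<close> one of its complement.\<close>

definition strict where
 "strict H x y \<longleftrightarrow> halfspace X H \<and> x \<in> S \<and> y \<in> S \<and>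
   (\<exists>e>0. (\<forall>a\<in>S. d x a < e --> a \<notin> H) \<and> (\<forall>a\<in>S. d y a < e --> a \<in> H))"

lemma strict_compl: "strict H x y ==> strict (S - H) y x"
 unfolding strict_def using halfspace_compl by blast

lemma strictD: "strict H x y ==> x \<in> S \<and> y \<in> S \<and> x \<notin> H \<and> y \<in> H \<and> halfspace X H"
 unfolding strict_def by (metis d_self)

lemma interior_iff: assumes "A \<subseteq> S"
 shows "mtopology_of X interior_of A ~= {} \<longleftrightarrow> (\<exists>y\<in>S. \<exists>e>0. \<forall>a\<in>S. d y a < e --> a \<in> A)"
proof -
 have "mtopology_of X interior_of A = {x\<in>S. \<exists>e>0. MS.mball x e \<subseteq> A}"
  unfolding mtop by (rule MS.metric_interior_of)
 moreover have "MS.mball x e \<subseteq> A \<longleftrightarrow> (\<forall>a\<in>S. d x a < e --> a \<in> A)" if "x \<in> S" for x e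
  using that by (auto simp: subset_iff)
 ultimately have "mtopology_of X interior_of A = {x\<in>S. \<exists>e>0. \<forall>a\<in>S. d x a < e --> a \<in> A}"
  by (simp cong: conj_cong)
 moreover have "!!P. {x\<in>S. P x} ~= {} \<longleftrightarrow> (\<exists>x\<in>S. P x)" by blast
 ultimately show ?thesis by (simp only:)
qed

lemma thick_iff: "thick H \<longleftrightarrow> (\<exists>x y. strict H x y)"
proof
 assume "thick H"
 hence H: "halfspace X H" "mtopology_of X interior_of H ~= {}" "mtopology_of X interior_of (S - H) ~= {}"
  unfolding thick_halfspace_def by blast+
 have sub: "H \<subseteq> S" "S - H \<subseteq> S" using halfspace_sub[OF H(1)] by auto
 obtain y e where 1: "y \<in> S" "e > 0" "\<forall>a\<in>S. d y a < e --> a \<in> H"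
  using H(2) unfolding interior_iff[OF sub(1)] by blast
 obtain x e' where 2: "x \<in> S" "e' > 0" "\<forall>a\<in>S. d x a < e' --> a \<in> S - H"
  using H(3) unfolding interior_iff[OF sub(2)] by blast
 have "strict H x y" unfolding strict_def using 1 2 H(1)
  by (auto intro!: exI[of _ "min e e'"])
 thus "\<exists>x y. strict H x y" by blast
next
 assume "\<exists>x y. strict H x y"
 then obtain x y where "strict H x y" by blast
 then obtain e where 1: "halfspace X H" "x \<in> S" "y \<in> S" "e > 0"
  "\<forall>a\<in>S. d x a < e --> a \<notin> H" "\<forall>a\<in>S. d y a < e --> a \<in> H"
  unfolding strict_def by blast
 have sub: "H \<subseteq> S" "S - H \<subseteq> S" using halfspace_sub[OF 1(1)] by auto
 have "\<forall>a\<in>S. d x a < e --> a \<in> S - H" using 1(5) by simp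
 hence "mtopology_of X interior_of H ~= {}" "mtopology_of X interior_of (S - H) ~= {}"
  unfolding interior_iff[OF sub(1)] interior_iff[OF sub(2)] using 1(2,3,4,6) by meson+
 thus "thick H" unfolding thick_halfspace_def using 1 by auto
qed

lemma strict_thick: "strict H x y ==> thick H" using thick_iff by blast

lemma thick_half: "thick H ==> halfspace X H" by (simp add: thick_halfspace_def)

lemma thick_compl: "thick H ==> thick (S - H)"
 unfolding thick_iff using strict_compl by blast

lemma thick_ne: "thick H ==> H ~= {} \<and> S - H ~= {} \<and> H \<subseteq> S"
 unfolding thick_iff using strictD halfspace_sub by blast

text \<open>By \<open>chull_ball_radius\<close> the convex hulls of small balls around \<open>x\<close> and \<open>y\<close> are disjoint; a halfspace
 separating the hulls has both points in the interior of its two sides.\<close>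

lemma thick_separation:
 assumes "x \<in> S" "y \<in> S" "x ~= y" obtains H where "strict H x y"
proof -
 obtain r where r: "!!\<H>. \<forall>H\<in>\<H>. halfspace X H ==> pairwise (transverse X) \<H> ==> finite \<H> \<and> card \<H> \<le> r"
  using finite_rank unfolding finite_rank_def by blast
 have dpos: "d x y > 0" using assms by (metis mdist_nonneg mdist_zero order_le_less)
 define e where "e = d x y / (2 * real r + 1)"
 have e: "e > 0" "2 * (real r * e) < d x y" unfolding e_def using dpos by (auto simp: field_simps)
 let ?B = "\<lambda>x. {a\<in>S. d x a \<le> e}"
 have "chull (?B x) \<inter> chull (?B y) = {}"
 proof (rule ccontr)
  assume "\<not> ?thesis"
  then obtain z where z: "z \<in> chull (?B x)" "z \<in> chull (?B y)" by blast
  have "z \<in> S" using z chull_sub by auto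
  have "d x z \<le> real r * e" "d y z \<le> real r * e"
   using chull_ball_radius[OF r] z e assms by auto
  moreover have "d x y \<le> d x z + d z y" using tri assms \<open>z \<in> S\<close> by auto
  ultimately show False using e mdist_commute[of X z y] by simp
 qed
 then obtain H where H: "halfspace X H" "chull (?B y) \<subseteq> H" "chull (?B x) \<subseteq> S - H"
  using halfspace_separation[of "chull (?B y)" "chull (?B x)"] convex_chull by blast
 have "?B x \<subseteq> S - H" "?B y \<subseteq> H" using H chull_inc[of "?B x"] chull_inc[of "?B y"] by auto
 thus ?thesis using H(1) assms e that unfolding strict_def by (fastforce simp: less_imp_le)
qed

lemma thick_separation': assumes "x \<in> S" "y \<in> S" "x ~= y"
 obtains H where "thick H" "x \<notin> H" "y \<in> H"
 using thick_separation[OF assms] strictD strict_thick by metis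

lemma med_lipschitz: assumes "x \<in> S" "y \<in> S" "z \<in> S" "z' \<in> S" shows "d (m x y z) (m x y z') \<le> d z z'"
 using gate_lipschitz[OF convex_interval[OF assms(1,2)] assms(3,4) gate_med gate_med] assms by auto

text \<open>A minimising sequence for the distance to a convex set is Cauchy, since medians of \<open>x\<close> with two of its
 terms do not come closer to \<open>x\<close>. Its limit lies between \<open>x\<close> and each point of the set.\<close>

lemma limit_gate:
 assumes C: "convex C" "C ~= {}" and x: "x \<in> S"
 obtains g where "g \<in> S" "!!c. c \<in> C ==> g \<in> I x c" "!!e. e > 0 ==> \<exists>c\<in>C. d c g < e"
proof -
 define \<delta> where "\<delta> = (INF c\<in>C. d x c)"
 have bdd: "bdd_below (d x ` C)" by (rule bdd_belowI[of _ 0]) auto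
 have \<delta>: "\<delta> \<le> d x c" if "c \<in> C" for c unfolding \<delta>_def by (rule cINF_lower[OF bdd that])
 have "\<exists>c\<in>C. d x c < \<delta> + 1 / real (Suc n)" for n
 using cInf_lessD[of "d x ` C"] C unfolding \<delta>_def by auto
 then obtain c where "\<forall>n. c n \<in> C \<and> d x (c n) < \<delta> + 1 / real (Suc n)" by (metis choice[THEN exE])
 hence c: "!!n. c n \<in> C" "!!n. d x (c n) < \<delta> + 1 / real (Suc n)" by auto
 have cS: "c n \<in> S" for n using c convex_sub[OF C(1)] by auto
 text \<open>Nearly closest points are nearly gates, since the median of \<open>x\<close>, \<open>c n\<close> and \<open>w\<close> lies in \<open>C\<close>.\<close>
 have key: "d (c n) w \<le> d x w - \<delta> + 1 / real (Suc n)" if "w \<in> C" for n w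
 proof -
  have wS: "w \<in> S" using that convex_sub[OF C(1)] by auto
  define p where "p = m x (c n) w"
  have p: "p \<in> I x (c n)" "p \<in> I x w" "p \<in> I (c n) w" "p \<in> S"
   unfolding p_def using med_in x cS wS by auto
  have "p \<in> C" unfolding p_def using convex_med(3)[OF C(1) c(1) that x] .
  thus ?thesis using \<delta> p c(2)[of n] mdist_commute[of X p] by (fastforce simp: mem_I)
 qed
 have "MS.MCauchy c" unfolding MS.MCauchy_def
 proof (intro conjI allI impI)
  show "range c \<subseteq> S" using cS by auto
  fix e :: real assume "e > 0"
  from \<open>e > 0\<close> have "0 < e / 2" by simp
  then obtain N where N: "1 / real (Suc N) < e / 2" by (rule nat_approx_posE)
  have "d (c n) (c n') < e" if "N \<le> n" "N \<le> n'" for n n'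
  proof -
   have "1 / real (Suc n) \<le> 1 / real (Suc N)" "1 / real (Suc n') \<le> 1 / real (Suc N)"
    using that by (auto simp: field_simps)
   thus ?thesis using key[of "c n'" n] c(1)[of n'] c(2)[of n'] N by auto
  qed
  thus "\<exists>N. \<forall>n n'. N \<le> n --> N \<le> n' --> d (c n) (c n') < e" by blast
 qed
 moreover have "MS.mcomplete" using complete by (simp add: mcomplete_of_def)
 ultimately obtain g where g: "limitin MS.mtopology c g sequentially" unfolding MS.mcomplete_def by blast
 have gS: "g \<in> S" using g by (simp add: MS.limitin_mspace)
 have lim: "(\<lambda>n. d (c n) g) \<longlonglongrightarrow> 0"
  using g MS.limitin_metric_dist_null[of c g] by auto
 have 1: "g \<in> I x w" if "w \<in> C" for w
 proof -
  have wS: "w \<in> S" using that convex_sub[OF C(1)] by auto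
  have "(\<lambda>n. 1 / real (Suc n)) \<longlonglongrightarrow> 0" using LIMSEQ_inverse_real_of_nat by (simp add: inverse_eq_divide)
  hence "(\<lambda>n. \<delta> + 1 / real (Suc n) + d (c n) g) \<longlonglongrightarrow> \<delta> + 0 + 0"
   by (intro tendsto_intros lim)
  moreover have "d x g \<le> \<delta> + 1 / real (Suc n) + d (c n) g" for n
   using tri[OF x cS gS, of n] c(2)[of n] by auto
  ultimately have 1: "d x g \<le> \<delta>" by (intro LIMSEQ_le_const[of _ \<delta>]) auto
  have "(\<lambda>n. d x w - \<delta> + 1 / real (Suc n) + d (c n) g) \<longlonglongrightarrow> d x w - \<delta> + 0 + 0"
   using \<open>(\<lambda>n. 1 / real (Suc n)) \<longlonglongrightarrow> 0\<close> by (intro tendsto_intros lim)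
  moreover have "d g w \<le> d x w - \<delta> + 1 / real (Suc n) + d (c n) g" for n
   using tri[OF gS cS wS, of n] key[OF that, of n] mdist_commute[of X g] by auto
  ultimately have "d g w \<le> d x w - \<delta>" by (intro LIMSEQ_le_const[of _ "d x w - \<delta>"]) auto
  moreover have "d x w \<le> d x g + d g w" using tri x gS wS by auto
  ultimately show ?thesis using 1 gS by (auto simp: mem_I)
 qed
 have 2: "\<exists>w\<in>C. d w g < e" if "e > 0" for e
 proof -
  have "eventually (\<lambda>n. d (c n) g < e) sequentially" using lim that by (rule order_tendstoD)
  then obtain n where "d (c n) g < e" unfolding eventually_sequentially by blast
  thus ?thesis using c(1) by blast
 qed
 show ?thesis by (rule that[OF gS 1 2])
qed

text \<open>Enlarging a halfspace at positive distance from \<open>x\<close> makes the separation of its points from \<open>x\<close> strict.\<close>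

lemma strict_enlarge:
 assumes W: "halfspace X W" and x: "x \<in> S" and z: "z \<in> W" and e: "e > 0" "!!w. w \<in> W ==> e \<le> d x w"
 obtains U where "strict U x z" "W \<subseteq> U"
proof -
 have "convex W" using W halfspace_iff by auto
 obtain g where g: "g \<in> S" "!!c. c \<in> W ==> g \<in> I x c" "!!e. e > 0 ==> \<exists>c\<in>W. d c g < e"
  using limit_gate[OF \<open>convex W\<close> _ x] z by blast
 have "x ~= g"
 proof
  assume "x = g"
  obtain c where "c \<in> W" "d c g < e" using g(3) e by blast
  thus False using e(2)[of c] \<open>x = g\<close> mdist_commute[of X c] by auto
 qed
 then obtain U where U: "strict U x g" using thick_separation[OF x g(1)] by blast
 then obtain e' where e': "e' > 0" "\<forall>a\<in>S. d x a < e' --> a \<notin> U" "\<forall>a\<in>S. d g a < e' --> a \<in> U"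
  unfolding strict_def by blast
 have Uh: "halfspace X U" "x \<notin> U" "g \<in> U" using strictD[OF U] by auto
 have zS: "z \<in> S" using z halfspace_sub W by auto
 have "W \<subseteq> U"
 proof
  fix w assume w: "w \<in> W"
  show "w \<in> U"
  using w halfspace_sub[OF W] Uh x convexD[of "S - U" x w g] g(2)[OF w] halfspace_iff by auto
 qed
 moreover have "a \<in> U" if a: "a \<in> S" "d z a < e'" for a
 proof -
  have "m x z g = g" using med_ends[OF x zS g(2)[OF z]] .
  thus ?thesis
   using med_perm[of x z g] x zS g med_lipschitz[OF x g(1) zS a(1)] a e' med_in[OF x g(1) a(1)] halfspace_med[OF Uh(1) x g(1) a(1)] by auto
 qed
 ultimately show ?thesis using that[of U] U zS e' unfolding strict_def by blast
qed

text \<open>A set of walls that is a union of connected components of the graph in which two walls are adjacent if they are not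
 transverse: walls are not transverse iff a side of one is contained in a side of the other.\<close>

definition wall_class where
 "wall_class \<H> \<longleftrightarrow> (\<forall>W\<in>\<H>. thick W \<and> S - W \<in> \<H> \<and> (\<forall>U. thick U \<and> W \<subseteq> U --> U \<in> \<H>))"

lemma wall_classD:
 assumes "wall_class \<H>" "W \<in> \<H>"
 shows "thick W" "S - W \<in> \<H>" "thick U ==> W \<subseteq> U ==> U \<in> \<H>"
 using assms unfolding wall_class_def by blast+

lemma wall_class_compl:
 assumes "wall_class \<H>" shows "wall_class {W. thick W \<and> W \<notin> \<H>}"
 unfolding wall_class_def
proof (safe)
 fix W assume W: "thick W" "W \<notin> \<H>"
 have c: "S - (S - W) = W" using thick_ne[OF W(1)] by auto
 show "thick (S - W)" by (rule thick_compl[OF W(1)])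
 show False if "S - W \<in> \<H>" using wall_classD(2)[OF assms that] c W by simp
 show False if U: "thick U" "W \<subseteq> U" "U \<in> \<H>" for U
 proof -
  have "S - U \<in> \<H>" by (rule wall_classD(2)[OF assms U(3)])
  moreover have "S - U \<subseteq> S - W" using U by auto
  ultimately have "S - W \<in> \<H>" using wall_classD(3)[OF assms] thick_compl[OF W(1)] by blast
  thus False using wall_classD(2)[OF assms] c W by fastforce
 qed
qed

text \<open>The classes of \<open>E\<close> will be the fibres of a product.\<close>

definition E where "E \<H> x y \<longleftrightarrow> (\<forall>W\<in>\<H>. \<not> strict W x y)"

lemma E_refl: "E \<H> x x" unfolding E_def using strictD by blast

lemma E_sym: "wall_class \<H> ==> E \<H> x y ==> E \<H> y x"
 unfolding E_def using strict_compl wall_classD(2) by blast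

lemma strict_dist: assumes "strict H x y"
 obtains e where "e > 0" "!!w. w \<in> H ==> e \<le> d x w" "!!w. w \<in> S - H ==> e \<le> d y w"
proof -
 obtain e where e: "e > 0" "\<forall>a\<in>S. d x a < e --> a \<notin> H" "\<forall>a\<in>S. d y a < e --> a \<in> H"
  using assms unfolding strict_def by blast
 have "H \<subseteq> S" using assms strictD halfspace_sub by blast
 show ?thesis
 proof (rule that[OF e(1)])
  show "e \<le> d x w" if "w \<in> H" for w using e(2) that \<open>H \<subseteq> S\<close> not_less by auto
  show "e \<le> d y w" if "w \<in> S - H" for w using e(3) that by auto
 qed
qed

text \<open>Separation from \<open>x\<close> at positive distance suffices, as \<open>W\<close> can be enlarged within the class
 (\<open>strict_enlarge\<close>). This is what makes \<open>E\<close> transitive.\<close>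

lemma E_strong:
 assumes "wall_class \<H>" "E \<H> x z" "x \<in> S" "W \<in> \<H>" "z \<in> W" "e > 0" "!!w. w \<in> W ==> e \<le> d x w"
 shows False
proof -
 obtain U where U: "strict U x z" "W \<subseteq> U"
  using wall_classD(1)[OF assms(1,4)] thick_half strict_enlarge[OF _ assms(3,5,6,7)] by blast
 have "U \<in> \<H>" using wall_classD(3)[OF assms(1,4) strict_thick[OF U(1)] U(2)] .
 thus False using U assms(2) unfolding E_def by blast
qed

lemma E_trans:
 assumes "wall_class \<H>" "E \<H> x z" "E \<H> z w" "x \<in> S" "z \<in> S" "w \<in> S" shows "E \<H> x w"
 unfolding E_def
proof (intro ballI notI)
 fix W assume W: "W \<in> \<H>" "strict W x w"
 obtain e where e: "e > 0" "!!v. v \<in> W ==> e \<le> d x v" "!!v. v \<in> S - W ==> e \<le> d w v"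
  by (rule strict_dist[OF W(2)], rule that)
 show False
 proof (cases "z \<in> W")
  case True thus False using E_strong[OF assms(1,2,4) W(1) True e(1,2)] by blast
 next
  case False
  thus False
   using assms E_strong[OF assms(1) E_sym[OF assms(1,3)] assms(6) wall_classD(2)[OF assms(1) W(1)] _ e(1,3)] by blast
 qed
qed

lemma E_class_convex:
 assumes "wall_class \<H>" "x \<in> S" shows "convex {z\<in>S. E \<H> x z}"
proof -
 have *: "E \<H> x w" if uv: "u \<in> S" "v \<in> S" "E \<H> x u" "E \<H> x v" "w \<in> I u v" for u v w
  unfolding E_def
 proof (intro ballI notI)
  fix W assume W: "W \<in> \<H>" "strict W x w"
  obtain e where e: "e > 0" "!!v. v \<in> W ==> e \<le> d x v"
   by (rule strict_dist[OF W(2)], rule that)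
  show False
   using strictD[OF W(2)] convexD[of "S - W" u v w] halfspace_iff E_strong[OF assms(1) _ assms(2) W(1) _ e] uv by blast
 qed
 show ?thesis by (rule convexI) (use * in \<open>auto simp: mem_I\<close>)
qed

lemma E_class_closed:
 assumes "wall_class \<H>" "x \<in> S" "z \<in> S" "!!e. e > 0 ==> \<exists>c\<in>{z\<in>S. E \<H> x z}. d c z < e"
 shows "E \<H> x z"
 unfolding E_def
proof (intro ballI notI)
 fix W assume W: "W \<in> \<H>" "strict W x z"
 obtain e where e: "e > 0" "!!v. v \<in> W ==> e \<le> d x v" "!!v. v \<in> S - W ==> e \<le> d z v"
  by (rule strict_dist[OF W(2)], rule that)
 obtain c where c: "c \<in> S" "E \<H> x c" "d c z < e" using assms(4)[OF e(1)] by blast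
 show False
  using e(3)[of c] c mdist_commute[of X c z] E_strong[OF assms(1) c(2) assms(2) W(1) _ e(1,2)] by auto
qed

end

text \<open>Halfspaces of different classes are transverse, since no side of one is contained in a side of the other.\<close>

locale wall_split = fr_median_geometry +
 fixes \<H>1 \<H>2
 assumes H1: "wall_class \<H>1" and H2: "wall_class \<H>2"
  and disj: "\<H>1 \<inter> \<H>2 = {}" and cover: "!!W. thick W ==> W \<in> \<H>1 \<union> \<H>2"
begin

lemma swap: "wall_split X \<H>2 \<H>1"
 by unfold_locales (use H1 H2 disj cover in auto)

lemma E_both: assumes "x \<in> S" "y \<in> S" "E \<H>1 x y" "E \<H>2 x y" shows "x = y"
proof (rule ccontr)
 assume "x ~= y"
 then obtain W where "strict W x y" using thick_separation[OF assms(1,2)] by blast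
 thus False using cover[OF strict_thick] assms(3,4) unfolding E_def by blast
qed

lemma E_unique:
 assumes "x \<in> S" "y \<in> S" "z \<in> S" "z' \<in> S" "E \<H>2 x z" "E \<H>2 x z'" "E \<H>1 z y" "E \<H>1 z' y"
 shows "z = z'"
proof (rule E_both)
 show "E \<H>1 z z'" using E_trans[OF H1 assms(7) E_sym[OF H1 assms(8)]] assms by blast
 show "E \<H>2 z z'" using E_trans[OF H2 E_sym[OF H2 assms(5)] assms(6)] assms by blast
qed (use assms in auto)

text \<open>The gate of \<open>y\<close> in the \<open>\<H>2\<close>-class of \<open>x\<close> is separated from \<open>y\<close> by walls of \<open>\<H>2\<close> only: a halfspace of \<open>\<H>1\<close>
 separating them would have a gate that is closer to \<open>y\<close>, and all walls between this gate and the first one contain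
 that halfspace.\<close>

lemma class_gate:
 assumes xy: "x \<in> S" "y \<in> S"
 obtains g where "g \<in> S" "E \<H>2 x g" "E \<H>1 g y" "gate {z\<in>S. E \<H>2 x z} y g"
proof -
 let ?A = "{z\<in>S. E \<H>2 x z}"
 have cA: "convex ?A" by (rule E_class_convex[OF H2 xy(1)])
 have ne: "?A ~= {}" using xy E_refl by blast
 obtain g where g: "g \<in> S" "!!c. c \<in> ?A ==> g \<in> I y c" "!!e. e > 0 ==> \<exists>c\<in>?A. d c g < e"
  using limit_gate[OF cA ne xy(2)] by blast
 have xg: "E \<H>2 x g" by (rule E_class_closed[OF H2 xy(1) g(1) g(3)])
 have gy: "E \<H>1 g y" unfolding E_def
 proof (intro ballI notI)
  fix W assume W: "W \<in> \<H>1" "strict W g y"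
  obtain e where e: "e > 0" "!!v. v \<in> W ==> e \<le> d g v" by (rule strict_dist[OF W(2)], rule that)
  have Wh: "halfspace X W" "y \<in> W" "W ~= {}" "convex W" using strictD[OF W(2)] halfspace_iff by auto
  obtain h where h: "h \<in> S" "!!c. c \<in> W ==> h \<in> I g c" "!!e. e > 0 ==> \<exists>c\<in>W. d c h < e"
   using limit_gate[OF Wh(4,3) g(1)] by blast
  have "h ~= g" using h(3)[OF e(1)] e(2) mdist_commute[of X g] by (metis not_less)
  have "E \<H>2 g h" unfolding E_def
  proof (intro ballI notI)
   fix U assume U: "U \<in> \<H>2" "strict U g h"
   have Uh: "halfspace X U" "g \<notin> U" "h \<in> U" using strictD[OF U(2)] by auto
   have "w \<in> U" if w: "w \<in> W" for w
   using w halfspace_sub[OF Wh(1)] Uh g convexD[of "S - U" g w h] h(2)[OF w] halfspace_iff by auto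
   hence "U \<in> \<H>1" using wall_classD(3)[OF H1 W(1) strict_thick[OF U(2)]] by blast
   thus False using U disj by blast
  qed
  hence "E \<H>2 x h" using E_trans[OF H2 xg _ xy(1) g(1) h(1)] by blast
  hence "g \<in> I y h" using g(2) h(1) by blast
  moreover have "h \<in> I y g" using h(2)[OF Wh(2)] I_commute by blast
  ultimately show False using I_antisym[OF xy(2)] \<open>h ~= g\<close> by blast
 qed
 have "gate ?A y g" unfolding gate_def using g xg by blast
 thus ?thesis using that g(1) xg gy by blast
qed

lemma gate_class_iff:
 assumes "x \<in> S" "y \<in> S" "a \<in> S" "E \<H>2 x a" "E \<H>1 a y" shows "gate {z\<in>S. E \<H>2 x z} y a"
proof -
 obtain g where g: "g \<in> S" "E \<H>2 x g" "E \<H>1 g y" "gate {z\<in>S. E \<H>2 x z} y g" using class_gate[OF assms(1,2)] .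
 have "g = a" by (rule E_unique[OF assms(1,2) g(1) assms(3) g(2) assms(4) g(3) assms(5)])
 thus ?thesis using g by simp
qed

lemma parallel:
 assumes S: "x \<in> S" "w \<in> S" "a \<in> S" "b \<in> S" and "E \<H>2 x w" "E \<H>1 a x" "E \<H>1 b w" "E \<H>2 a b"
 shows "d x w = d a b"
proof -
 have le: "d a b \<le> d x w" if "x \<in> S" "w \<in> S" "a \<in> S" "b \<in> S" "E \<H>1 a x" "E \<H>1 b w" "E \<H>2 a b" for x w a b
 using gate_class_iff[of a x a] gate_class_iff[of a w b] that E_refl gate_lipschitz[OF E_class_convex[OF H2 that(3)] that(1,2)] by auto
 have "d a b \<le> d x w" using le assms by blast
 moreover have "d x w \<le> d a b" using le[of a b x w] assms E_sym[OF H1] by blast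
 ultimately show ?thesis by simp
qed

lemma bridge:
 assumes "x \<in> S" "y \<in> S" obtains z where "z \<in> I x y" "z \<in> S" "E \<H>2 x z" "E \<H>1 z y"
proof -
 obtain g where g: "g \<in> S" "E \<H>2 x g" "E \<H>1 g y" "gate {z\<in>S. E \<H>2 x z} y g" using class_gate[OF assms] .
 show ?thesis using assms(1) E_refl that[of g] g I_commute unfolding gate_def by blast
qed

end

lemma (in median_geometry) median_space_convex:
 assumes "convex A" "A ~= {}" shows "median_space (submetric X A)"
proof -
 have s: "mspace (submetric X A) = A" using convex_sub[OF assms(1)] by auto
 have i: "metric_interval (submetric X A) a b = I a b" if "a \<in> A" "b \<in> A" for a b
  using convexD[OF assms(1) that]
  unfolding metric_interval_def by auto
 show ?thesis unfolding median_space_def s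
 proof (intro conjI ballI)
  fix x y z assume xyz: "x \<in> A" "y \<in> A" "z \<in> A"
  hence "x \<in> S" "y \<in> S" "z \<in> S" using convex_sub[OF assms(1)] by auto
  from ex1_med[OF this] show "\<exists>!p. p \<in> metric_interval (submetric X A) x y \<inter>
   metric_interval (submetric X A) x z \<inter> metric_interval (submetric X A) y z"
   using i xyz by simp
 qed (rule assms(2))
qed

context wall_split begin

text \<open>A point is determined by its projections to an \<open>\<H>1\<close>-class and an \<open>\<H>2\<close>-class; by \<open>parallel\<close> distances add up along a bridge.\<close>

lemma product:
 assumes ne: "\<H>1 ~= {}" "\<H>2 ~= {}" shows "\<not> irreducible_median_space X"
proof -
 interpret sw: wall_split X \<H>2 \<H>1 by (rule swap)
 obtain x0 where x0: "x0 \<in> S" using median unfolding median_space_def by blast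
 define A where "A = {z\<in>S. E \<H>2 x0 z}"
 define B where "B = {z\<in>S. E \<H>1 x0 z}"
 have "\<forall>x\<in>S. \<exists>a\<in>S. E \<H>2 x0 a \<and> E \<H>1 a x" using bridge[OF x0] by metis
 then obtain pA where pA: "!!x. x \<in> S ==> pA x \<in> S \<and> E \<H>2 x0 (pA x) \<and> E \<H>1 (pA x) x" by metis
 have "\<forall>x\<in>S. \<exists>a\<in>S. E \<H>1 x0 a \<and> E \<H>2 a x" using sw.bridge[OF x0] by metis
 then obtain pB where pB: "!!x. x \<in> S ==> pB x \<in> S \<and> E \<H>1 x0 (pB x) \<and> E \<H>2 (pB x) x" by metis
 have pA_eq: "pA x = a" if "x \<in> S" "a \<in> S" "E \<H>2 x0 a" "E \<H>1 a x" for x a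
  using E_unique[OF x0 that(1) _ that(2) _ that(3) _ that(4)] pA[OF that(1)] by blast
 have pB_eq: "pB x = a" if "x \<in> S" "a \<in> S" "E \<H>1 x0 a" "E \<H>2 a x" for x a
  using sw.E_unique[OF x0 that(1) _ that(2) _ that(3) _ that(4)] pB[OF that(1)] by blast
 have dist: "d x y = d (pA x) (pA y) + d (pB x) (pB y)" if xy: "x \<in> S" "y \<in> S" for x y
 proof -
  obtain w where w: "w \<in> I x y" "w \<in> S" "E \<H>2 x w" "E \<H>1 w y" using bridge[OF xy] .
  have 1: "pA w = pA y"
   using pA_eq[OF w(2), of "pA y"] pA[OF xy(2)] E_trans[OF H1 _ E_sym[OF H1 w(4)]] xy w(2) by blast
  have 2: "pB w = pB x"
   using pB_eq[OF w(2), of "pB x"] pB[OF xy(1)] E_trans[OF H2 _ w(3)] xy w(2) by blast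
  have "E \<H>2 (pA x) (pA w)" using E_trans[OF H2 E_sym[OF H2]] pA xy w(2) x0 by blast
  hence "d x w = d (pA x) (pA w)" using parallel[OF xy(1) w(2) _ _ w(3)] pA xy(1) w(2) by blast
  moreover have "E \<H>1 (pB w) (pB y)" using E_trans[OF H1 E_sym[OF H1]] pB xy w(2) x0 by blast
  hence "d w y = d (pB w) (pB y)" using sw.parallel[OF w(2) xy(2) _ _ w(4)] pB xy(2) w(2) by blast
  moreover have "d x y = d x w + d w y" using w(1) by (simp add: mem_I)
  ultimately show ?thesis using 1 2 by simp
 qed
 have cA: "convex A" "A ~= {}" and cB: "convex B" "B ~= {}"
  unfolding A_def B_def using E_class_convex H1 H2 x0 E_refl by blast+
 have sub: "A \<subseteq> S" "B \<subseteq> S" unfolding A_def B_def by auto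
 have ms: "mspace (submetric X A) = A" "mspace (submetric X B) = B" using sub by auto
 have "bij_betw (\<lambda>x. (pA x, pB x)) S (A \<times> B)" unfolding bij_betw_def
 proof
  show "inj_on (\<lambda>x. (pA x, pB x)) S"
  proof (rule inj_onI)
   fix x y assume xy: "x \<in> S" "y \<in> S" "(pA x, pB x) = (pA y, pB y)"
   hence "d x y = 0" using dist[OF xy(1,2)] pA pB by simp
   thus "x = y" using xy by simp
  qed
  show "(\<lambda>x. (pA x, pB x)) ` S = A \<times> B"
  proof
   show "(\<lambda>x. (pA x, pB x)) ` S \<subseteq> A \<times> B" unfolding A_def B_def using pA pB by blast
   show "A \<times> B \<subseteq> (\<lambda>x. (pA x, pB x)) ` S"
   proof clarify
    fix a b assume ab: "a \<in> A" "b \<in> B"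
    hence abS: "a \<in> S" "b \<in> S" "E \<H>2 x0 a" "E \<H>1 x0 b" unfolding A_def B_def by auto
    obtain z where z: "z \<in> S" "E \<H>2 b z" "E \<H>1 z a" using bridge[OF abS(2,1)] by blast
    have "pA z = a" using pA_eq[OF z(1) abS(1,3)] E_sym[OF H1 z(3)] by blast
    moreover have "pB z = b" using pB_eq[OF z(1) abS(2,4) z(2)] .
    ultimately show "(a, b) \<in> (\<lambda>x. (pA x, pB x)) ` S" using z(1) by blast
   qed
  qed
 qed
 hence "is_l1_product X (submetric X A) (submetric X B)"
  unfolding is_l1_product_def ms using dist by (intro exI[of _ "\<lambda>x. (pA x, pB x)"]) simp
 moreover have "\<not> is_singleton A"
 proof
  assume "is_singleton A"
  then obtain t where t: "A = {t}" by (auto simp: is_singleton_def)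
  obtain W where W: "W \<in> \<H>1" using ne by blast
  then obtain x y where s: "strict W x y" using wall_classD(1)[OF H1] thick_iff by blast
  have xy: "x \<in> S" "y \<in> S" using strictD[OF s] by auto
  have "pA x = t" "pA y = t" using t pA[OF xy(1)] pA[OF xy(2)] unfolding A_def by blast+
  hence "t \<in> S" "E \<H>1 t x" "E \<H>1 t y" using pA[OF xy(1)] pA[OF xy(2)] by auto
  hence "E \<H>1 x y" using E_trans[OF H1 E_sym[OF H1 \<open>E \<H>1 t x\<close>]] xy by blast
  thus False using s W unfolding E_def by blast
 qed
 moreover have "\<not> is_singleton B"
 proof
  assume "is_singleton B"
  then obtain t where t: "B = {t}" by (auto simp: is_singleton_def)
  obtain W where W: "W \<in> \<H>2" using ne by blast
  then obtain x y where s: "strict W x y" using wall_classD(1)[OF H2] thick_iff by blast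
  have xy: "x \<in> S" "y \<in> S" using strictD[OF s] by auto
  have "pB x = t" "pB y = t" using t pB[OF xy(1)] pB[OF xy(2)] unfolding B_def by blast+
  hence "t \<in> S" "E \<H>2 t x" "E \<H>2 t y" using pB[OF xy(1)] pB[OF xy(2)] by auto
  hence "E \<H>2 x y" using E_trans[OF H2 E_sym[OF H2 \<open>E \<H>2 t x\<close>]] xy by blast
  thus False using s W unfolding E_def by blast
 qed
 ultimately show ?thesis
  unfolding irreducible_median_space_def using median_space_convex[OF cA] median_space_convex[OF cB] ms by metis
qed

end

lemma (in fr_median_geometry) wall_class_all:
 assumes irr: "irreducible_median_space X" and H: "wall_class \<H>" "\<H> ~= {}" and W: "thick W"
 shows "W \<in> \<H>"
proof (rule ccontr)
 assume n: "W \<notin> \<H>"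
 let ?H2 = "{W. thick W \<and> W \<notin> \<H>}"
 interpret wall_split X \<H> ?H2
  by unfold_locales (use H wall_class_compl[OF H(1)] in auto)
 show False using product[OF H(2)] n W irr by blast
qed

section \<open>Flips and strong separation\<close>

context fr_median_geometry begin

text \<open>Unlike the members of \<open>isometries X\<close>, these maps may take any values outside \<open>X\<close>, so that ordinary composition,
 powers and \<open>inv_into\<close> can be used.\<close>

definition iso where "iso f \<longleftrightarrow> bij_betw f S S \<and> (\<forall>x\<in>S. \<forall>y\<in>S. d (f x) (f y) = d x y)"

lemma iso_in: "iso f ==> x \<in> S ==> f x \<in> S" unfolding iso_def bij_betw_def by blast
lemma iso_dist: "iso f ==> x \<in> S ==> y \<in> S ==> d (f x) (f y) = d x y" unfolding iso_def by blast
lemma iso_inj: "iso f ==> inj_on f S" unfolding iso_def bij_betw_def by blast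
lemma iso_image: "iso f ==> f ` S = S" unfolding iso_def bij_betw_def by blast

lemma iso_id: "iso id" unfolding iso_def by auto

lemma iso_comp: assumes "iso f" "iso g" shows "iso (f \<circ> g)"
 unfolding iso_def
 using assms bij_betw_trans iso_in unfolding iso_def by force

lemma iso_inv: assumes "iso f" shows "iso (inv_into S f)" "!!x. x \<in> S ==> f (inv_into S f x) = x"
 "!!x. x \<in> S ==> inv_into S f (f x) = x"
proof -
 show f: "f (inv_into S f x) = x" if "x \<in> S" for x
  using assms that iso_image by (metis f_inv_into_f)
 show "inv_into S f (f x) = x" if "x \<in> S" for x using assms that iso_inj by (metis inv_into_f_f)
 have i: "inv_into S f x \<in> S" if "x \<in> S" for x using assms that iso_image by (metis inv_into_into)
 show "iso (inv_into S f)" unfolding iso_def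
 using assms bij_betw_inv_into iso_dist[OF assms i i] f unfolding iso_def by auto
qed

lemma iso_pow: "iso f ==> iso (f ^^ n)"
 by (induction n) (auto intro: iso_comp iso_id)

lemma iso_mem_I: assumes "iso f" "a \<in> S" "b \<in> S" "c \<in> S" shows "f c \<in> I (f a) (f b) \<longleftrightarrow> c \<in> I a b"
 using assms iso_dist iso_in by (simp add: mem_I)

lemma iso_med: assumes "iso f" "x \<in> S" "y \<in> S" "z \<in> S" shows "f (m x y z) = m (f x) (f y) (f z)"
 using med_eqI[of "f x" "f y" "f z" "f (m x y z)"] iso_in[OF assms(1)] assms med_in[OF assms(2-4)]
  iso_mem_I[OF assms(1)] by auto

lemma iso_convex: assumes "iso f" "convex A" shows "convex (f ` A)"
proof (rule convexI)
 show "f ` A \<subseteq> S" using iso_in assms convex_sub by blast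
 fix u v w assume uvw: "u \<in> f ` A" "v \<in> f ` A" "w \<in> I u v"
 then obtain a b where ab: "a \<in> A" "b \<in> A" "u = f a" "v = f b" by blast
 obtain c where c: "c \<in> S" "w = f c" using uvw iso_image[OF assms(1)] by (auto simp: mem_I)
 show "w \<in> f ` A"
  using iso_mem_I[OF assms(1) _ _ c(1)] ab uvw convex_sub[OF assms(2)] convexD[OF assms(2) ab(1,2)] c by blast
qed

lemma iso_diff: "iso f ==> A \<subseteq> S ==> f ` (S - A) = S - f ` A"
 using inj_on_image_set_diff[OF iso_inj, of f S A] iso_image[of f] by auto

lemma iso_sub: "iso f ==> A \<subseteq> S ==> f ` A \<subseteq> S" using iso_in by blast

lemma iso_mem: "iso f ==> A \<subseteq> S ==> x \<in> S ==> f x \<in> f ` A \<longleftrightarrow> x \<in> A"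
 using iso_inj inj_on_image_mem_iff by metis

lemma iso_halfspace: assumes "iso f" "halfspace X H" shows "halfspace X (f ` H)"
 using iso_convex[OF assms(1)] iso_diff[OF assms(1)] halfspace_sub assms(2) halfspace_iff by metis

lemma iso_strict: assumes f: "iso f" and s: "strict H x y" shows "strict (f ` H) (f x) (f y)"
proof -
 obtain e where e: "e > 0" "\<forall>a\<in>S. d x a < e --> a \<notin> H" "\<forall>a\<in>S. d y a < e --> a \<in> H"
  using s unfolding strict_def by blast
 have H: "halfspace X H" "x \<in> S" "y \<in> S" "H \<subseteq> S" using strictD[OF s] halfspace_sub by auto
 have *: "(d (f z) b < e --> P) \<longleftrightarrow> (d z (inv_into S f b) < e --> P)" if "b \<in> S" "z \<in> S" for b z P
  using iso_dist[OF f that(2) iso_in[OF iso_inv(1)[OF f] that(1)]] iso_inv(2)[OF f that(1)] by simp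
 have m: "b \<in> f ` H \<longleftrightarrow> inv_into S f b \<in> H" if "b \<in> S" for b
  using iso_mem[OF f H(4) iso_in[OF iso_inv(1)[OF f] that]] iso_inv(2)[OF f that] by simp
 show ?thesis unfolding strict_def
 proof (intro conjI exI[of _ e] ballI)
  show "halfspace X (f ` H)" "f x \<in> S" "f y \<in> S" using iso_halfspace iso_in f H by auto
  fix b assume b: "b \<in> S"
  have i: "inv_into S f b \<in> S" using iso_in[OF iso_inv(1)[OF f] b] .
  show "d (f x) b < e --> b \<notin> f ` H" unfolding *[OF b H(2)] m[OF b] using e(2) i by blast
  show "d (f y) b < e --> b \<in> f ` H" unfolding *[OF b H(3)] m[OF b] using e(3) i by blast
 qed (rule e(1))
qed

lemma iso_thick: "iso f ==> thick H ==> thick (f ` H)"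
 unfolding thick_iff using iso_strict by blast

lemma iso_transverse: assumes "iso f" "A \<subseteq> S" "B \<subseteq> S"
 shows "transverse X (f ` A) (f ` B) \<longleftrightarrow> transverse X A B"
proof -
 have i: "f ` C \<inter> f ` D ~= {} \<longleftrightarrow> C \<inter> D ~= {}" if "C \<subseteq> S" "D \<subseteq> S" for C D
  using inj_on_image_Int[OF iso_inj[OF assms(1)] that] by blast
 have "S - A \<subseteq> S" "S - B \<subseteq> S" by auto
 thus ?thesis unfolding transverse_def iso_diff[OF assms(1,2), symmetric] iso_diff[OF assms(1,3), symmetric]
  using i assms(2,3) by simp
qed

lemma transverse_sym: "transverse X A B \<longleftrightarrow> transverse X B A"
 unfolding transverse_def by (auto simp: Int_commute)

lemma transverse_compl: "A \<subseteq> S ==> transverse X (S - A) B \<longleftrightarrow> transverse X A B"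
 unfolding transverse_def by (auto simp: double_diff)

lemma transverse_compl2: "B \<subseteq> S ==> transverse X A (S - B) \<longleftrightarrow> transverse X A B"
 using transverse_compl transverse_sym by metis

text \<open>Strong separation: no thick halfspace cuts both sets. Then any point of one set sees the other one in the same way
 (\<open>sst_med\<close>).\<close>

definition sst where "sst u v \<longleftrightarrow> (\<forall>W. thick W --> \<not> (W \<inter> u ~= {} \<and> u - W ~= {} \<and> W \<inter> v ~= {} \<and> v - W ~= {}))"

lemma no_infinite_transverse:
 assumes "!!n. halfspace X (w n)" shows "\<exists>i j. i < (j::nat) \<and> \<not> transverse X (w i) (w j)"
proof (rule ccontr)
 assume "\<not> ?thesis"
 hence t: "transverse X (w i) (w j)" if "i ~= j" for i j
  using that transverse_sym linorder_neqE_nat by metis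
 have "\<not> transverse X (w i) (w i)" for i unfolding transverse_def by blast
 hence "infinite (range w)" using t by (metis injI range_inj_infinite)
 moreover have "pairwise (transverse X) (range w)"
 proof (rule pairwiseI)
  fix A B assume "A \<in> range w" "B \<in> range w" "A ~= B"
  then obtain i j where "A = w i" "B = w j" "i ~= j" by blast
  thus "transverse X A B" using t by simp
 qed
 moreover have "\<forall>H\<in>range w. halfspace X H" using assms by simp
 ultimately show False using finite_rank unfolding finite_rank_def by metis
qed

end

text \<open>All that the cocycle contributes to the geometry: isometries flip every thick halfspace.\<close>

locale flip_geometry = fr_median_geometry +
 assumes irreducible: "irreducible_median_space X"
  and flip: "!!H. thick H ==> \<exists>f. iso f \<and> f ` H \<subseteq> S - H"
begin

text \<open>By \<open>flip\<close> the halfspaces that contain an isometric copy of \<open>h\<close> form a wall class, so all halfspaces do.\<close>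

lemma transport:
 assumes h: "thick h" and k: "thick k"
 obtains f where "iso f" "f ` h \<subseteq> k"
proof -
 let ?H = "{k. thick k \<and> (\<exists>f. iso f \<and> f ` h \<subseteq> k)}"
 have "wall_class ?H" unfolding wall_class_def
 proof (intro ballI conjI)
  fix W assume "W \<in> ?H"
  then obtain f where W: "thick W" and f: "iso f" "f ` h \<subseteq> W" by blast
  show "thick W" by (rule W)
  show "\<forall>U. thick U \<and> W \<subseteq> U --> U \<in> ?H" using f by blast
  obtain g where g: "iso g" "g ` W \<subseteq> S - W" using flip[OF W] by blast
  have "(g \<circ> f) ` h \<subseteq> S - W" using f g by (auto simp: image_comp[symmetric])
  thus "S - W \<in> ?H" using iso_comp[OF g(1) f(1)] thick_compl[OF W] by blast
 qed
 moreover have "h \<in> ?H" using h iso_id by (auto intro!: exI[of _ id])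
 ultimately have "k \<in> ?H" using wall_class_all[OF irreducible _ _ k] by blast
 thus ?thesis using that by blast
qed

text \<open>Iterating an isometry that pushes \<open>s\<close> into the corner \<open>u\<close> moves \<open>e\<close> to a halfspace not transverse to \<open>e\<close>, by
 finite rank. Pulling back, the complement of \<open>e\<close> lands on the other side of \<open>s\<close>.\<close>

lemma corner_reflect:
 assumes s: "thick s" and e: "thick e" and u: "thick u"
  and tr: "transverse X e s" and us: "u \<subseteq> s" "u \<subseteq> e"
 obtains x where "thick x" "x \<subseteq> S - s" "x \<subseteq> e \<or> x \<subseteq> S - e"
proof -
 obtain \<delta> where \<delta>: "iso \<delta>" "\<delta> ` s \<subseteq> u" using transport[OF s u] .
 have sub: "s \<subseteq> S" "e \<subseteq> S" using thick_ne s e by auto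
 have half: "halfspace X ((\<delta> ^^ n) ` e)" for n using thick_half[OF iso_thick[OF iso_pow[OF \<delta>(1)] e]] .
 obtain i j where ij: "i < j" "\<not> transverse X ((\<delta> ^^ i) ` e) ((\<delta> ^^ j) ` e)"
  using no_infinite_transverse[of "\<lambda>n. (\<delta> ^^ n) ` e"] half by blast
 define n where "n = j - i"
 define f where "f = \<delta> ^^ n"
 have f: "iso f" unfolding f_def by (rule iso_pow[OF \<delta>(1)])
 have "\<delta> ^^ j = \<delta> ^^ i \<circ> f" unfolding f_def n_def using ij(1) by (simp add: funpow_add[symmetric])
 hence nt: "\<not> transverse X e (f ` e)"
  using ij(2) iso_transverse[OF iso_pow[OF \<delta>(1)] sub(2) iso_sub[OF f sub(2)]] by (simp add: image_comp)
 have "(\<delta> ^^ Suc k) ` s \<subseteq> u" for k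
 proof (induction k)
  case (Suc k)
  have "(\<delta> ^^ Suc (Suc k)) ` s = \<delta> ` ((\<delta> ^^ Suc k) ` s)" by (simp add: image_comp)
  also have "\<dots> \<subseteq> \<delta> ` s" using Suc us by blast
  finally show ?case using \<delta> by blast
 qed (use \<delta> in simp)
 moreover have "n = Suc (n - 1)" using ij(1) unfolding n_def by simp
 ultimately have fs: "f ` s \<subseteq> u" unfolding f_def by metis
 have ne: "e \<inter> s ~= {}" "s - e ~= {}" using tr sub unfolding transverse_def by blast+
 have 1: "e \<inter> f ` e ~= {}" using ne(1) fs us by blast
 have 2: "e \<inter> (S - f ` e) ~= {}"
 proof -
  obtain y where y: "y \<in> s" "y \<notin> e" using ne(2) by blast
  hence "f y \<notin> f ` e" "f y \<in> e" "f y \<in> S" using iso_mem[OF f sub(2), of y] sub fs us iso_in[OF f] by blast+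
  thus ?thesis by blast
 qed
 have 3: "(S - e) \<inter> f ` e = {} \<or> (S - e) \<inter> (S - f ` e) = {}" using nt 1 2 unfolding transverse_def by blast
 define g where "g = inv_into S f"
 have g: "iso g" "!!y. y \<in> S ==> f (g y) = y" unfolding g_def using iso_inv[OF f] by blast+
 have gS: "g y \<in> S" if "y \<in> S" for y using iso_in[OF g(1) that] .
 define x where "x = g ` (S - e)"
 have "thick x" unfolding x_def by (rule iso_thick[OF g(1) thick_compl[OF e]])
 moreover have "x \<subseteq> S - s"
 proof (unfold x_def, rule image_subsetI)
  fix y assume y: "y \<in> S - e"
  show "g y \<in> S - s" using fs us g(2)[of y] gS y by fastforce
 qed
 moreover have "x \<subseteq> e \<or> x \<subseteq> S - e"
 proof -
  have m: "g y \<in> e \<longleftrightarrow> y \<in> f ` e" if "y \<in> S" for y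
   using iso_mem[OF f sub(2) gS[OF that]] g(2)[OF that] by simp
  show ?thesis using 3
  using m gS unfolding x_def by auto
 qed
 ultimately show ?thesis using that by blast
qed

lemma corner_reflect':
 assumes s: "thick s" and e: "thick e" and u: "thick u"
  and tr: "transverse X e s" and us: "u \<subseteq> s" "u \<subseteq> e \<or> u \<subseteq> S - e"
 obtains x where "thick x" "x \<subseteq> S - s" "x \<subseteq> e \<or> x \<subseteq> S - e"
proof (cases "u \<subseteq> e")
 case True thus ?thesis using corner_reflect[OF s e u tr us(1)] that by blast
next
 case False
 have eS: "e \<subseteq> S" using thick_ne[OF e] by blast
 have "transverse X (S - e) s" using transverse_compl[OF eS] tr by blast
 moreover have "u \<subseteq> S - e" using us False by blast
 ultimately obtain x where "thick x" "x \<subseteq> S - s" "x \<subseteq> S - e \<or> x \<subseteq> S - (S - e)"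
  using corner_reflect[OF s thick_compl[OF e] u _ us(1)] by blast
 thus ?thesis using that[of x] by auto
qed

lemma not_sst_transverse:
 assumes "thick a" "thick b" "b \<subseteq> a" "\<not> sst b (S - a)"
 obtains W where "thick W" "transverse X W a" "transverse X W b"
proof -
 obtain W where W: "thick W" "W \<inter> b ~= {}" "b - W ~= {}" "W \<inter> (S - a) ~= {}" "(S - a) - W ~= {}"
  using assms(4) unfolding sst_def by blast
 have sub: "a \<subseteq> S" using thick_ne[OF assms(1)] by blast
 obtain p q r s where "p \<in> W" "p \<in> b" "q \<in> b" "q \<notin> W" "r \<in> W" "r \<in> S" "r \<notin> a" "s \<in> S" "s \<notin> a" "s \<notin> W"
  using W by blast
 hence "transverse X W a" "transverse X W b" unfolding transverse_def using assms(3) sub by blast+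
 thus ?thesis using that W by blast
qed

lemma transverse_between:
 assumes "transverse X W a" "transverse X W b" "b \<subseteq> k" "k \<subseteq> a" shows "transverse X W k"
 using assms unfolding transverse_def by blast

definition sandwich where
 "sandwich n a b \<longleftrightarrow> thick a \<and> thick b \<and> b \<subseteq> a \<and>
  (\<exists>K. finite K \<and> card K = n \<and> (\<forall>k\<in>K. thick k \<and> b \<subseteq> k \<and> k \<subseteq> a) \<and> pairwise (transverse X) K)"

lemma sandwich_iso: assumes f: "iso f" and "sandwich n a b" shows "sandwich n (f ` a) (f ` b)"
proof -
 have ab: "thick a" "thick b" "b \<subseteq> a" using assms(2) unfolding sandwich_def by auto
 obtain K where K0: "finite K" "card K = n" "\<forall>k\<in>K. thick k \<and> b \<subseteq> k \<and> k \<subseteq> a" "pairwise (transverse X) K"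
  using assms(2) unfolding sandwich_def by auto
 have K: "finite K" "card K = n" "!!k. k \<in> K ==> thick k \<and> b \<subseteq> k \<and> k \<subseteq> a" "pairwise (transverse X) K"
  using K0 by auto
 have sub: "k \<subseteq> S" if "k \<in> K" for k using K(3)[OF that] thick_ne by blast
 have "inj_on (image f) K"
 proof (rule inj_onI)
  fix k l assume "k \<in> K" "l \<in> K" "f ` k = f ` l"
  thus "k = l" using inj_on_image_eq_iff[OF iso_inj[OF f]] sub by blast
 qed
 hence c: "card ((image f) ` K) = n" using K by (simp add: card_image)
 have "transverse X (f ` k) (f ` l)" if "k \<in> K" "l \<in> K" "f ` k ~= f ` l" for k l
  using iso_transverse[OF f sub[OF that(1)] sub[OF that(2)]] K(4) that unfolding pairwise_def by blast
 hence "pairwise (transverse X) ((image f) ` K)" unfolding pairwise_def by blast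
 moreover have "\<forall>k\<in>(image f) ` K. thick k \<and> f ` b \<subseteq> k \<and> k \<subseteq> f ` a"
  using K(3) iso_thick[OF f] by blast
 moreover have "f ` b \<subseteq> f ` a" using ab by blast
 ultimately show ?thesis unfolding sandwich_def using c K(1) iso_thick[OF f] ab by blast
qed

lemma sandwich_extend:
 assumes "sandwich n a b" and W: "thick W" "transverse X W a" "transverse X W b"
  and uv: "thick u" "thick v" "u \<subseteq> b" "u \<subseteq> W" "v \<subseteq> S - a" "v \<subseteq> S - W"
 shows "sandwich (Suc n) (S - v) u"
proof -
 have ab: "thick a" "thick b" "b \<subseteq> a" using assms(1) unfolding sandwich_def by auto
 obtain K where K0: "finite K" "card K = n" "\<forall>k\<in>K. thick k \<and> b \<subseteq> k \<and> k \<subseteq> a" "pairwise (transverse X) K"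
  using assms(1) unfolding sandwich_def by auto
 have K: "finite K" "card K = n" "!!k. k \<in> K ==> thick k \<and> b \<subseteq> k \<and> k \<subseteq> a" "pairwise (transverse X) K"
  using K0 by auto
 have WK: "transverse X W k" if "k \<in> K" for k using transverse_between[OF W(2,3)] K(3)[OF that] by blast
 have "W \<notin> K"
 proof
  assume "W \<in> K" hence "transverse X W W" by (rule WK)
  thus False unfolding transverse_def by blast
 qed
 hence "card (insert W K) = Suc n" using K by simp
 moreover have "pairwise (transverse X) (insert W K)"
  using WK transverse_sym K(4) unfolding pairwise_insert by blast
 moreover have "a \<subseteq> S" "W \<subseteq> S" using thick_ne ab W by auto
 hence "\<forall>k\<in>insert W K. thick k \<and> u \<subseteq> k \<and> k \<subseteq> S - v" using K(3) uv W(1) by blast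
 moreover have "u \<subseteq> S - v" using uv \<open>W \<subseteq> S\<close> by blast
 moreover have "finite (insert W K)" using K(1) by simp
 ultimately show ?thesis unfolding sandwich_def using uv(1) thick_compl[OF uv(2)] by (intro conjI exI[of _ "insert W K"]) simp_all
qed

text \<open>If \<open>b\<close> and \<open>S - a\<close> are not strongly separated, some \<open>W\<close> crosses \<open>a\<close> and \<open>b\<close>, hence the whole family between them.
 Adding \<open>W\<close> requires thick corners of \<open>W\<close> inside \<open>b\<close> and outside \<open>a\<close> on opposite sides of \<open>W\<close>. One corner
 arises because the walls crossing \<open>a\<close> and \<open>e4\<close> do not form a wall class: some such \<open>W\<close> has a superset \<open>U\<close> that
 fails to cross one of them. Reflecting it (\<open>corner_reflect\<close>) produces the other corners; the shifted copy \<open>e4 \<subseteq> e3\<close> of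
 \<open>b \<subseteq> a\<close> leaves enough room to choose where the family sits.\<close>

lemma sandwich_step:
 assumes nsst: "!!a b. thick a ==> thick b ==> b \<subseteq> a ==> \<not> sst b (S - a)"
  and sw: "sandwich n a b"
 shows "\<exists>a b. sandwich (Suc n) a b"
proof -
 have ab: "thick a" "thick b" "b \<subseteq> a" using sw unfolding sandwich_def by auto
 obtain \<tau> where \<tau>: "iso \<tau>" "\<tau> ` a \<subseteq> b" using transport[OF ab(1,2)] .
 define e3 where "e3 = \<tau> ` a"
 define e4 where "e4 = \<tau> ` b"
 have sw2: "sandwich n e3 e4" unfolding e3_def e4_def by (rule sandwich_iso[OF \<tau>(1) sw])
 have e': "thick e3" "thick e4" "e4 \<subseteq> e3" "e3 \<subseteq> b"
  using sw2 \<tau> unfolding sandwich_def e3_def by auto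
 have e: "thick e3" "thick e4" "e4 \<subseteq> e3" "e3 \<subseteq> b" "e4 \<subseteq> a"
  using e' ab(3) by auto
 have sub: "a \<subseteq> S" "b \<subseteq> S" "e3 \<subseteq> S" "e4 \<subseteq> S" using thick_ne ab e by auto
 let ?T = "{W. thick W \<and> transverse X W a \<and> transverse X W e4}"
 have Tne: "?T ~= {}" using not_sst_transverse[OF ab(1) e(2,5) nsst[OF ab(1) e(2,5)]] by blast
 have "\<not> wall_class ?T"
  using wall_class_all[OF irreducible _ Tne ab(1)] unfolding transverse_def by blast
 moreover have "S - W \<in> ?T" if "W \<in> ?T" for W
  using that thick_compl transverse_compl thick_ne by blast
 ultimately obtain W U where W: "W \<in> ?T" and U: "thick U" "W \<subseteq> U" "U \<notin> ?T"
  unfolding wall_class_def by blast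
 have Wt: "thick W" "transverse X W a" "transverse X W e4" using W by auto
 have WS: "W \<subseteq> S" "U \<subseteq> S" using thick_ne U by auto
 have Wt': "transverse X W b" "transverse X W e3"
  using transverse_between[OF Wt(2,3)] e ab(3) by blast+
 have corner: "S - U \<subseteq> h \<or> S - U \<subseteq> S - h" if "transverse X W h" "\<not> transverse X U h" for h
  using that U(2) unfolding transverse_def by blast
 have thU: "thick (S - U)" "S - U \<subseteq> S - W" using thick_compl[OF U(1)] U(2) by auto
 have thc: "thick (S - a)" "thick (S - e4)" using thick_compl ab e by auto
 have Wc: "transverse X W (S - a)" "transverse X W (S - e4)"
  using transverse_compl2 sub Wt by auto
 have dd: "S - (S - a) = a" "S - (S - e4) = e4" "S - (S - W) = W" using sub WS by auto
 have "\<exists>u. thick u \<and> u \<subseteq> e4 \<and> (u \<subseteq> W \<or> u \<subseteq> S - W)"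
 proof -
  have "\<not> transverse X U a \<or> \<not> transverse X U e4" using U by blast
  thus ?thesis
  proof
   assume n: "\<not> transverse X U e4"
   from corner[OF Wt(3) n] show ?thesis
   proof
    assume "S - U \<subseteq> S - e4"
    then obtain x where "thick x" "x \<subseteq> S - (S - e4)" "x \<subseteq> W \<or> x \<subseteq> S - W"
     using corner_reflect'[OF thc(2) Wt(1) thU(1) Wc(2)] thU(2) by blast
    thus ?thesis by auto
   qed (use thU in blast)
  next
   assume n: "\<not> transverse X U a"
   have "\<exists>v. thick v \<and> v \<subseteq> S - a \<and> (v \<subseteq> W \<or> v \<subseteq> S - W)"
    using corner[OF Wt(2) n]
   proof
    assume "S - U \<subseteq> a"
    then obtain x where "thick x" "x \<subseteq> S - a" "x \<subseteq> W \<or> x \<subseteq> S - W"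
     using corner_reflect'[OF ab(1) Wt(1) thU(1) Wt(2) _ disjI2[OF thU(2)]] by blast
    thus ?thesis by blast
   qed (use thU in blast)
   then obtain v where v: "thick v" "v \<subseteq> S - a" "v \<subseteq> W \<or> v \<subseteq> S - W" by blast
   obtain x where "thick x" "x \<subseteq> S - (S - e4)" "x \<subseteq> W \<or> x \<subseteq> S - W"
    using v e(5) corner_reflect'[OF thc(2) Wt(1) v(1) Wc(2) _ v(3)] by blast
   thus ?thesis by auto
  qed
 qed
 then obtain u where u: "thick u" "u \<subseteq> e4" "u \<subseteq> W \<or> u \<subseteq> S - W" by blast
 define V where "V = (if u \<subseteq> W then W else S - W)"
 have V: "thick V" "u \<subseteq> V" "transverse X V a" "transverse X V b" "transverse X V e3" "transverse X V e4"
  unfolding V_def using u Wt Wt' thick_compl transverse_compl[OF WS(1)] by auto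
 have VS: "V \<subseteq> S" using thick_ne V by blast
 obtain v where v: "thick v" "v \<subseteq> S - a" "v \<subseteq> V \<or> v \<subseteq> S - V"
  using corner_reflect'[OF ab(1) V(1) u(1) V(3)] u(2) e(5) V(2) by blast
 show ?thesis
 proof (cases "v \<subseteq> S - V")
  case True
  have "v \<subseteq> S - e3" using v(2) e(4) ab(3) by blast
  thus ?thesis using sandwich_extend[OF sw2 V(1,5,6) u(1) v(1) u(2) V(2) _ True] by blast
 next
  case False
  hence vV: "v \<subseteq> V" using v by blast
  obtain x where x: "thick x" "x \<subseteq> S - V" "x \<subseteq> b \<or> x \<subseteq> S - b"
   using corner_reflect'[OF V(1) ab(2) u(1)] V(4) transverse_sym V(2) u(2) e by blast
  show ?thesis
  proof (cases "x \<subseteq> b")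
   case True
   have "v \<subseteq> S - (S - V)" using vV VS by blast
   moreover have "transverse X (S - V) a" "transverse X (S - V) b" using transverse_compl[OF VS] V by auto
   ultimately show ?thesis using sandwich_extend[OF sw thick_compl[OF V(1)] _ _ x(1) v(1) True x(2) v(2)] by blast
  next
   case False
   hence "x \<subseteq> S - e3" using x(3) e(4) by blast
   thus ?thesis using sandwich_extend[OF sw2 V(1,5,6) u(1) x(1) u(2) V(2) _ x(2)] by blast
  qed
 qed
qed

text \<open>Otherwise \<open>sandwich_step\<close> would enlarge transverse families beyond the rank.\<close>

lemma ex_sst:
 assumes "thick h"
 obtains a b where "thick a" "thick b" "b \<subseteq> a" "sst b (S - a)"
proof (rule ccontr)
 note ex = that
 assume c: "\<not> thesis"
 have n: "\<not> sst b (S - a)" if "thick a" "thick b" "b \<subseteq> a" for a b using that c ex by blast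
 have "\<exists>a b. sandwich k a b" for k
 proof (induction k)
  case 0
  show ?case using assms unfolding sandwich_def by fastforce
 next
  case (Suc k)
  thus ?case using sandwich_step[OF n] by blast
 qed
 moreover obtain r where r: "!!\<H>. \<forall>H\<in>\<H>. halfspace X H ==> pairwise (transverse X) \<H> ==> finite \<H> \<and> card \<H> \<le> r"
  using finite_rank unfolding finite_rank_def by blast
 ultimately obtain a b where "sandwich (Suc r) a b" by blast
 then obtain K where "card K = Suc r" "\<forall>k\<in>K. thick k" "pairwise (transverse X) K"
  unfolding sandwich_def by blast
 thus False using r[of K] thick_half by auto
qed

end

section \<open>Non-lineal spaces contain three disjoint thick halfspaces\<close>

context median_geometry begin

lemma roller_embedding_in:
 assumes "x \<in> S" shows "roller_embedding X x \<in> topspace (roller_topology X)"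
proof -
 have "m x a b \<in> S \<inter> I a b" if "a \<in> S" "b \<in> S" for a b
  using med_in[OF assms that] by blast
 thus ?thesis unfolding roller_embedding_def roller_topology_def by auto
qed

lemma roller_embedding_compactification:
 assumes "x \<in> S" shows "roller_embedding X x \<in> roller_compactification X"
proof -
 have "roller_embedding X ` S \<subseteq> topspace (roller_topology X)" using roller_embedding_in by blast
 from closure_of_subset[OF this] show ?thesis unfolding roller_compactification_def using assms by blast
qed

end

context fr_median_geometry begin

lemma med_const_interval:
 assumes "p \<in> S" "q \<in> S" "u \<in> S" "z \<in> S" "m p q u = u" shows "d (m p q z) z \<le> 2 * d u z"
proof -
 have m: "m p q z \<in> S" using med_in(4) assms(1,2,4) by simp
 have "d (m p q z) z \<le> d (m p q z) u + d u z" using tri[OF m assms(3,4)] .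
 moreover have "d (m p q z) u \<le> d z u" using med_lipschitz[OF assms(1,2,4,3)] assms(5) by simp
 ultimately show ?thesis using mdist_commute[of X z u] by linarith
qed

text \<open>The relation passes from the points of \<open>X\<close> to their limits in the compactification because medians are
 1-Lipschitz.\<close>

lemma linealI:
 assumes \<xi>: "\<xi> \<in> roller_compactification X" and \<eta>: "\<eta> \<in> roller_compactification X"
  and *: "!!a b x. a \<in> S ==> b \<in> S ==> x \<in> S ==> m (\<xi> (a, b)) (\<eta> (a, b)) (m x a b) = m x a b"
 shows "lineal X"
proof -
 let ?T = "roller_topology X" and ?C = "roller_compactification X"
 have topC: "?C \<subseteq> topspace ?T" unfolding roller_compactification_def by (rule closure_of_subset_topspace)
 have top: "topspace ?T = (\<Pi>\<^sub>E (a, b)\<in>S \<times> S. I a b)"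
 proof -
  have "S \<inter> I a b = I a b" for a b using I_sub[of a b] by blast
  thus ?thesis unfolding roller_topology_def topspace_product_topology
   by (intro PiE_cong) (simp split: prod.split)
 qed
 have inI: "z (a, b) \<in> I a b" if "z \<in> ?C" "a \<in> S" "b \<in> S" for z a b
 using subsetD[OF topC that(1)] that(2,3) unfolding top by auto
 have inS: "z (a, b) \<in> S" if "z \<in> ?C" "a \<in> S" "b \<in> S" for z a b
  using inI[OF that] by (simp add: mem_I)
 have key: "m (\<xi> (a, b)) (\<eta> (a, b)) (z (a, b)) = z (a, b)" if z: "z \<in> ?C" and ab: "a \<in> S" "b \<in> S" for z a b
 proof -
  let ?z = "z (a, b)" and ?M = "m (\<xi> (a, b)) (\<eta> (a, b)) (z (a, b))"
  have zS: "?z \<in> S" "?M \<in> S" using inS[OF z ab] inS[OF \<xi> ab] inS[OF \<eta> ab] med_in by auto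
  have small: "d ?M ?z \<le> 2 * e" if e: "e > 0" for e
  proof -
   let ?U = "{y \<in> topspace ?T. y (a, b) \<in> I a b \<inter> MS.mball ?z e}"
   have cm: "continuous_map ?T (subtopology (mtopology_of X) (I a b)) (\<lambda>y. y (a, b))"
    unfolding roller_topology_def
    using continuous_map_product_projection[of "(a, b)" "S \<times> S" "\<lambda>(a, b). subtopology (mtopology_of X) (I a b)"] ab
    by simp
   have "openin (subtopology (mtopology_of X) (I a b)) (I a b \<inter> MS.mball ?z e)"
    unfolding openin_subtopology mtop by blast
   hence U1: "openin ?T ?U" using openin_continuous_map_preimage[OF cm] by blast
   have U2: "z \<in> ?U" using subsetD[OF topC z] inI[OF z ab] zS e by simp
   have U3: "\<forall>T. z \<in> T \<and> openin ?T T --> (\<exists>y. y \<in> roller_embedding X ` S \<and> y \<in> T)"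
    using z unfolding roller_compactification_def in_closure_of by blast
   obtain y where y: "y \<in> roller_embedding X ` S" "y \<in> ?U"
    using U3[THEN spec, THEN mp, OF conjI[OF U2 U1]] by blast
   then obtain x where x: "x \<in> S" "y = roller_embedding X x" by blast
   have "y (a, b) = m x a b" using x ab by (simp add: roller_embedding_def)
   hence "d ?z (m x a b) < e" "m x a b \<in> S" using y by auto
   moreover have "d ?M ?z \<le> 2 * d (m x a b) ?z"
    using med_const_interval[OF inS[OF \<xi> ab] inS[OF \<eta> ab] \<open>m x a b \<in> S\<close> zS(1) *[OF ab x(1)]] .
   ultimately show ?thesis using mdist_commute[of X ?z] by auto
  qed
  have "d ?M ?z = 0"
  proof (rule ccontr)
   assume "d ?M ?z ~= 0"
   hence "d ?M ?z > 0" using mdist_nonneg[of X ?M ?z] by linarith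
   thus False using small[of "d ?M ?z / 4"] by linarith
  qed
  thus ?thesis using zS by simp
 qed
 have "?C \<subseteq> roller_interval X \<xi> \<eta>"
 proof
  fix z assume z: "z \<in> ?C"
  have "roller_med X \<xi> \<eta> z = z"
  using subsetD[OF topC z] key[OF z] unfolding top by (auto simp: PiE_iff roller_med_def restrict_def extensional_def)
  thus "z \<in> roller_interval X \<xi> \<eta>" unfolding roller_interval_def using z by blast
 qed
 thus ?thesis unfolding lineal_def using \<xi> \<eta> unfolding roller_interval_def by blast
qed

lemma lineal_interval:
 assumes "p \<in> S" "q \<in> S" "S \<subseteq> I p q" shows "lineal X"
proof (rule linealI)
 show "roller_embedding X p \<in> roller_compactification X" "roller_embedding X q \<in> roller_compactification X"
  using roller_embedding_compactification assms by auto
 fix a b x assume ab: "a \<in> S" "b \<in> S" and x: "x \<in> S"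
 have "m a b x \<in> I (m a b p) (m a b q)" using med_interval[OF ab assms(1,2)] assms(3) x by blast
 hence "m (m a b p) (m a b q) (m a b x) = m a b x"
  by (intro med_ends med_in(4) ab assms(1,2))
 moreover have "m y a b = m a b y" if "y \<in> S" for y using med_perm(1)[of a y b] med_perm(2)[of a y b] ab that by simp
 ultimately show "m (roller_embedding X p (a, b)) (roller_embedding X q (a, b)) (m x a b) = m x a b"
  using ab x assms by (simp add: roller_embedding_def)
qed

lemma sst_med:
 assumes s: "sst u v" and uv: "u \<subseteq> S" "v \<subseteq> S" and x: "x \<in> u" "x' \<in> u" and y: "y \<in> v" "y' \<in> v"
 shows "m x y y' = m x' y y'"
proof (rule ccontr)
 assume ne: "m x y y' ~= m x' y y'"
 have S: "x \<in> S" "x' \<in> S" "y \<in> S" "y' \<in> S" using assms by auto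
 obtain W where W: "thick W" "m x y y' \<notin> W" "m x' y y' \<in> W"
  using med_in S thick_separation' ne by metis
 have h: "halfspace X W" using thick_half[OF W(1)] .
 have "(y \<in> W \<and> y' \<notin> W \<or> y \<notin> W \<and> y' \<in> W) \<and> x \<notin> W \<and> x' \<in> W"
  using W(2,3) unfolding halfspace_med[OF h S(1,3,4)] halfspace_med[OF h S(2,3,4)] by blast
 thus False using s W(1) x y unfolding sst_def by blast
qed

lemma sst_mono: "sst u v ==> u' \<subseteq> u ==> v' \<subseteq> v ==> sst u' v'" unfolding sst_def by blast
lemma sst_sym: "sst u v ==> sst v u" unfolding sst_def by blast

lemma sst_iso: assumes f: "iso f" and s: "sst u v" and uv: "u \<subseteq> S" "v \<subseteq> S" shows "sst (f ` u) (f ` v)"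
 unfolding sst_def
proof (intro allI impI notI)
 fix W assume W: "thick W" "W \<inter> f ` u ~= {} \<and> f ` u - W ~= {} \<and> W \<inter> f ` v ~= {} \<and> f ` v - W ~= {}"
 define g where "g = inv_into S f"
 have g: "iso g" "!!x. x \<in> S ==> g (f x) = x" unfolding g_def using iso_inv[OF f] by auto
 have WS: "W \<subseteq> S" using thick_ne[OF W(1)] by blast
 have m: "x \<in> g ` W \<longleftrightarrow> f x \<in> W" if "x \<in> S" for x
  using iso_mem[OF g(1) WS iso_in[OF f that]] g(2)[OF that] by simp
 have "g ` W \<inter> w ~= {} \<and> w - g ` W ~= {}" if w: "w \<subseteq> S" "W \<inter> f ` w ~= {}" "f ` w - W ~= {}" for w
 using w(2,3) m w(1) by blast
 thus False using s iso_thick[OF g(1) W(1)] W(2) uv unfolding sst_def by metis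
qed

end

text \<open>An isometry that moves \<open>a\<close> strictly into the strongly separated halfspace \<open>b\<close>. Its powers produce a descending chain
 \<open>A n\<close> of halfspaces, each \<open>A (Suc n)\<close> being strongly separated from the complement of \<open>A n\<close>.\<close>

locale skewer = fr_median_geometry +
 fixes a b \<gamma>
 assumes a: "thick a" and b: "thick b" and ba: "b \<subseteq> a" and sst_ba: "sst b (S - a)"
  and \<gamma>: "iso \<gamma>" "\<gamma> ` a \<subseteq> b" "\<gamma> ` a ~= a"
begin

definition A where "A n = (\<gamma> ^^ n) ` a"
definition B where "B n = (\<gamma> ^^ n) ` b"

lemma AB_sub: "A n \<subseteq> S" "B n \<subseteq> S"
 unfolding A_def B_def using iso_sub[OF iso_pow[OF \<gamma>(1)]] thick_ne[OF a] thick_ne[OF b] by blast+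

lemma A_thick: "thick (A n)" unfolding A_def using iso_thick iso_pow \<gamma> a by blast

lemma A_half: "halfspace X (A n)" using A_thick thick_half by blast

lemma B_A: "B n \<subseteq> A n" unfolding A_def B_def using ba by blast

lemma A_Suc_B: "A (Suc n) \<subseteq> B n"
proof -
 have "A (Suc n) = (\<gamma> ^^ n) ` (\<gamma> ` a)" unfolding A_def by (simp add: image_comp funpow_Suc_right del: funpow.simps)
 thus ?thesis unfolding B_def using \<gamma> by blast
qed

lemma A_Suc: "A (Suc n) \<subseteq> A n" using A_Suc_B B_A by blast

lemma A_mono: "i \<le> j ==> A j \<subseteq> A i" by (rule lift_Suc_antimono_le[of A]) (rule A_Suc)

lemma A_ne: "A (Suc n) ~= A n"
proof
 assume "A (Suc n) = A n"
 have "A (Suc n) = (\<gamma> ^^ n) ` (\<gamma> ` a)" unfolding A_def by (simp add: image_comp funpow_Suc_right del: funpow.simps)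
 hence "(\<gamma> ^^ n) ` (\<gamma> ` a) = (\<gamma> ^^ n) ` a" using \<open>A (Suc n) = A n\<close> unfolding A_def by simp
 moreover have "a \<subseteq> S" "\<gamma> ` a \<subseteq> S" using iso_sub[OF \<gamma>(1)] thick_ne[OF a] by auto
 ultimately have "\<gamma> ` a = a" using inj_on_image_eq_iff[OF iso_inj[OF iso_pow[OF \<gamma>(1), of n]]] by auto
 thus False using \<gamma> by blast
qed

lemma A_sst: "sst (B n) (S - A n)"
proof -
 have "a \<subseteq> S" "b \<subseteq> S" using thick_ne a b by auto
 hence "sst ((\<gamma> ^^ n) ` b) ((\<gamma> ^^ n) ` (S - a))" by (intro sst_iso[OF iso_pow[OF \<gamma>(1)] sst_ba]) auto
 thus ?thesis unfolding A_def B_def using iso_diff[OF iso_pow[OF \<gamma>(1)]] \<open>a \<subseteq> S\<close> by simp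
qed

lemma A_shift: "(\<gamma> ^^ k) ` A n = A (k + n)" unfolding A_def by (simp add: image_comp funpow_add)

text \<open>By strong separation the median of \<open>x\<close>, \<open>y\<close>, \<open>z\<close> does not change with \<open>x\<close> outside \<open>A 0\<close> or \<open>z\<close> in
 \<open>A 4\<close>, so all geodesics between these sets pass through it.\<close>

lemma bottleneck:
 obtains p where "p \<in> A 2" "p \<notin> A 3" "!!x z. x \<in> S - A 0 ==> z \<in> A 4 ==> p \<in> I x z"
proof -
 obtain y where y: "y \<in> A 2" "y \<notin> A 3"
  using A_Suc[of 2] A_ne[of 2] by (auto simp: eval_nat_numeral)
 have c: "A 4 \<subseteq> B 3" "A 2 \<subseteq> B 0" "A 4 \<subseteq> B 0" "A 3 \<subseteq> A 0" "A 4 \<subseteq> A 2"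
  using A_Suc_B[of 3] A_Suc_B[of 0] A_mono[of 1 2] A_mono[of 0 3] A_mono[of 2 4] by auto
 obtain x0 where x0: "x0 \<in> S - A 0" using thick_ne[OF A_thick[of 0]] by blast
 obtain z0 where z0: "z0 \<in> A 4" using thick_ne[OF A_thick[of 4]] by blast
 define p where "p = m x0 y z0"
 have S: "x0 \<in> S" "y \<in> S" "z0 \<in> S" using x0 y z0 AB_sub by auto
 have "p \<in> A 2" unfolding p_def using halfspace_med[OF A_half[of 2] S] y(1) z0 c(5) by auto
 moreover have "p \<notin> A 3" unfolding p_def using halfspace_med[OF A_half[of 3] S] y(2) x0 c(4) by auto
 moreover have "p \<in> I x z" if x: "x \<in> S - A 0" and z: "z \<in> A 4" for x z
 proof -
  have xS: "x \<in> S" "z \<in> S" using x z AB_sub by auto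
  have "m x0 y z0 = m x y z0"
   by (rule sst_med[OF sst_sym[OF A_sst[of 0]] Diff_subset AB_sub(2) x0 x subsetD[OF c(2) y(1)] subsetD[OF c(3) z0]])
  also have "\<dots> = m z0 x y" using med_perm(2)[of x y z0] med_perm(1)[of x z0 y] xS(1) S(2,3) by simp
  also have "\<dots> = m z x y"
  proof (rule sst_med[OF A_sst[of 3] AB_sub(2) Diff_subset subsetD[OF c(1) z0] subsetD[OF c(1) z]])
   show "x \<in> S - A 3" "y \<in> S - A 3" using x y S c(4) by auto
  qed
  also have "\<dots> \<in> I x z" using med_in(1)[of z x y] xS S I_commute[of x z] by auto
  finally show ?thesis unfolding p_def .
 qed
 ultimately show ?thesis using that by blast
qed

text \<open>Each translate of the bottleneck by \<open>\<gamma> ^^ 4\<close> adds a fixed length to the geodesics.\<close>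

lemma growth: obtains n where "!!x z. x \<in> S - A 0 ==> z \<in> A n ==> R < d x z"
proof -
 obtain p where p: "p \<in> A 2" "p \<notin> A 3" "!!x z. x \<in> S - A 0 ==> z \<in> A 4 ==> p \<in> I x z" by (rule bottleneck, rule that)
 define f where "f = \<gamma> ^^ 4"
 have f: "iso f" unfolding f_def by (rule iso_pow[OF \<gamma>(1)])
 have fA: "f ` A n = A (4 + n)" for n unfolding f_def by (rule A_shift)
 have pS: "p \<in> S" using p(1) AB_sub(1)[of 2] by auto
 hence pS: "p \<in> S" "f p \<in> S" using iso_in[OF f] by auto
 define D where "D = d p (f p)"
 have D: "D > 0"
  using p(1) fA[of 2] p(2) A_mono[of 3 6] pS unfolding D_def by fastforce
 have grow: "real k * D \<le> d p z" if "z \<in> A (4 * k + 4)" for k z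
  using that
 proof (induction k arbitrary: z)
  case (Suc k)
  have zS: "z \<in> S" using Suc AB_sub by auto
  obtain z' where z': "z' \<in> A (4 * k + 4)" "z = f z'"
   using Suc(2) fA[of "4 * k + 4"] by (auto simp: algebra_simps)
  have z'S: "z' \<in> S" using z' AB_sub by auto
  have "z' \<in> A 4" using z'(1) A_mono[of 4 "4 * k + 4"] by auto
  have "f p \<in> I p z"
  proof -
   have "p \<in> S - A 4" using p(2) pS A_mono[of 3 4] by auto
   moreover have "A 4 = f ` A 0" using fA[of 0] by simp
   ultimately have "p \<in> f ` (S - A 0)" using iso_diff[OF f AB_sub(1)] by simp
   then obtain x where x: "x \<in> S - A 0" "p = f x" by blast
   have "p \<in> I x z'" using p(3)[OF x(1) \<open>z' \<in> A 4\<close>] .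
   thus ?thesis using iso_mem_I[OF f _ z'S pS(1)] x z' by simp
  qed
  hence "d p z = D + d (f p) z" unfolding D_def by (simp add: mem_I)
  also have "d (f p) z = d p z'" using iso_dist[OF f pS(1) z'S] z' by simp
  finally show ?case using Suc.IH[OF z'(1)] by (simp add: algebra_simps)
 qed simp
 obtain k where k: "R < real k * D" using ex_less_of_nat_mult[OF D] by blast
 show ?thesis
 proof (rule that[of "4 * k + 4"])
  fix x z assume xz: "x \<in> S - A 0" "z \<in> A (4 * k + 4)"
  have "d x z = d x p + d p z"
   using xz(2) A_mono[of 4 "4 * k + 4"] p(3)[OF xz(1)] by (auto simp: mem_I)
  thus "R < d x z" using grow[OF xz(2)] k mdist_nonneg[of X x p] by linarith
 qed
qed

lemma eventually_outside: assumes "x \<in> S" obtains n where "x \<notin> A n"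
proof -
 obtain x0 where x0: "x0 \<in> S - A 0" using thick_ne[OF A_thick[of 0]] by blast
 obtain n where n: "!!z z'. z \<in> S - A 0 ==> z' \<in> A n ==> d x0 x < d z z'" by (rule growth[of "d x0 x"], rule that)
 thus ?thesis using n[OF x0, of x] that by blast
qed

lemma A_ex: "\<exists>z. z \<in> A n" using thick_ne[OF A_thick] by blast

lemma med_const_deep:
 assumes "p \<in> S" "q \<in> S" obtains n where "!!z z'. z \<in> A n ==> z' \<in> A n ==> m z p q = m z' p q"
proof -
 obtain i where i: "p \<notin> A i" by (rule eventually_outside[OF assms(1)])
 obtain j where j: "q \<notin> A j" by (rule eventually_outside[OF assms(2)])
 define n where "n = max i j"
 have "m z p q = m z' p q" if "z \<in> A (Suc n)" "z' \<in> A (Suc n)" for z z'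
  using i j assms A_mono[of i n] A_mono[of j n] sst_med[OF A_sst[of n] AB_sub(2) Diff_subset subsetD[OF A_Suc_B that(1)] subsetD[OF A_Suc_B that(2)]] unfolding n_def by auto
 thus ?thesis using that by blast
qed

text \<open>On \<open>A n\<close> with \<open>n\<close> large the coordinate \<open>m z p q\<close> is constant, so the points \<open>(\<gamma> ^^ n) z0\<close> converge in the Roller compactification.\<close>

lemma limit_point:
 obtains \<xi> where "\<xi> \<in> roller_compactification X"
  "!!p q. p \<in> S ==> q \<in> S ==> \<exists>n. \<forall>z\<in>A n. \<xi> (p, q) = m z p q"
proof -
 obtain z0 where z0: "z0 \<in> a" using thick_ne[OF a] by blast
 define z where "z n = (\<gamma> ^^ n) z0" for n
 have zA: "z n \<in> A n" for n unfolding z_def A_def using z0 by blast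
 have zS: "z n \<in> S" for n using zA AB_sub(1)[of n] by auto
 have "\<forall>p\<in>S. \<forall>q\<in>S. \<exists>n. \<forall>y y'. y \<in> A n --> y' \<in> A n --> m y p q = m y' p q"
  using med_const_deep by metis
 then obtain N where N: "!!p q y y'. p \<in> S ==> q \<in> S ==> y \<in> A (N p q) ==> y' \<in> A (N p q) ==> m y p q = m y' p q"
  by metis
 define \<xi> where "\<xi> = (\<lambda>(p, q) \<in> S \<times> S. m (z (N p q)) p q)"
 have \<xi>: "\<xi> (p, q) = m y p q" if "p \<in> S" "q \<in> S" "y \<in> A (N p q)" for p q y
  unfolding \<xi>_def using N[OF that(1,2) zA that(3)] that by simp
 have "limitin (roller_topology X) (\<lambda>n. roller_embedding X (z n)) \<xi> sequentially"
  unfolding roller_topology_def limitin_componentwise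
 proof (intro conjI ballI)
  show "\<xi> \<in> extensional (S \<times> S)" unfolding \<xi>_def by simp
  show "\<forall>\<^sub>F n in sequentially. roller_embedding X (z n) \<in>
   topspace (product_topology (\<lambda>(a, b). subtopology (mtopology_of X) (I a b)) (S \<times> S))"
   using roller_embedding_in[OF zS] unfolding roller_topology_def by simp
  fix i assume "i \<in> S \<times> S"
  then obtain p q where i: "i = (p, q)" "p \<in> S" "q \<in> S" by blast
  have "\<xi> i \<in> S \<inter> I p q"
   using \<xi>[OF i(2,3) zA] med_in[OF zS[of "N p q"] i(2,3)] i(1) by simp
  moreover have "\<forall>\<^sub>F n in sequentially. roller_embedding X (z n) i = \<xi> i"
  proof (rule eventually_sequentiallyI[of "N p q"])
   fix n assume "N p q \<le> n"
   hence "z n \<in> A (N p q)" using zA A_mono by blast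
   thus "roller_embedding X (z n) i = \<xi> i" using \<xi>[OF i(2,3)] i by (simp add: roller_embedding_def)
  qed
  ultimately show "limitin ((\<lambda>(a, b). subtopology (mtopology_of X) (I a b)) i) (\<lambda>n. roller_embedding X (z n) i) (\<xi> i) sequentially"
   using i(1) by (auto intro!: limitin_eventually)
 qed
 hence lim: "\<xi> \<in> topspace (roller_topology X)"
   "!!U. openin (roller_topology X) U ==> \<xi> \<in> U ==> \<forall>\<^sub>F n in sequentially. roller_embedding X (z n) \<in> U"
  unfolding limitin_def by auto
 have "\<xi> \<in> roller_compactification X" unfolding roller_compactification_def in_closure_of
 proof (intro conjI allI impI)
  fix T assume "\<xi> \<in> T \<and> openin (roller_topology X) T"
  hence "\<forall>\<^sub>F n in sequentially. roller_embedding X (z n) \<in> T" using lim(2) by blast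
  then obtain n where "roller_embedding X (z n) \<in> T" unfolding eventually_sequentially by blast
  thus "\<exists>y. y \<in> roller_embedding X ` S \<and> y \<in> T" using zS by blast
 qed (rule lim(1))
 thus ?thesis using that[of \<xi>] \<xi> by blast
qed

lemma reverse: "skewer X (S - b) (S - a) (inv_into S \<gamma>)"
proof -
 have sub: "a \<subseteq> S" "b \<subseteq> S" using thick_ne a b by auto
 note g = iso_inv[OF \<gamma>(1)]
 have 1: "inv_into S \<gamma> ` (S - b) \<subseteq> S - a"
 proof (rule image_subsetI)
  fix y assume y: "y \<in> S - b"
  show "inv_into S \<gamma> y \<in> S - a" using \<gamma>(2) g(2)[of y] iso_in[OF g(1)] y by auto
 qed
 have 2: "inv_into S \<gamma> ` (S - b) ~= S - b"
 proof
  assume e: "inv_into S \<gamma> ` (S - b) = S - b"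
  have "a \<subseteq> b" using e 1 sub by blast
  moreover have "\<gamma> ` (S - b) = S - b"
  proof -
   have "\<gamma> ` (S - b) = \<gamma> ` (inv_into S \<gamma> ` (S - b))" using e by simp
   also have "\<dots> = S - b" using g(2) by (force simp: image_iff)
   finally show ?thesis .
  qed
  hence "S - \<gamma> ` b = S - b" using iso_diff[OF \<gamma>(1) sub(2)] by simp
  hence "\<gamma> ` b = b" using iso_sub[OF \<gamma>(1) sub(2)] sub(2) by blast
  ultimately show False using \<gamma>(3) ba by blast
 qed
 have 3: "sst (S - a) (S - (S - b))" using sst_sym[OF sst_ba] sub(2) by (simp add: double_diff)
 have 4: "S - a \<subseteq> S - b" using ba by auto
 show ?thesis by unfold_locales (rule thick_compl[OF a] thick_compl[OF b] 1 2 3 4 g(1))+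
qed

text \<open>If the two limit points of \<open>\<gamma>\<close> do not span the compactification, in some interval \<open>[p,q]\<close> a thick halfspace \<open>W\<close> separates a median \<open>m x p q\<close> from
 the coordinates of both.
 \<open>W\<close> is disjoint from deep members of the two chains.\<close>

lemma lineal_or_facing:
 assumes "\<not> lineal X"
 obtains H1 H2 H3 where "thick H1" "thick H2" "thick H3"
  "H1 \<inter> H2 = {}" "H1 \<inter> H3 = {}" "H2 \<inter> H3 = {}"
proof -
 interpret r: skewer X "S - b" "S - a" "inv_into S \<gamma>" by (rule reverse)
 obtain \<xi> where \<xi>: "\<xi> \<in> roller_compactification X"
  "!!p q. p \<in> S ==> q \<in> S ==> \<exists>n. \<forall>z\<in>A n. \<xi> (p, q) = m z p q" by (rule limit_point, rule that)
 obtain \<eta> where \<eta>: "\<eta> \<in> roller_compactification X"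
  "!!p q. p \<in> S ==> q \<in> S ==> \<exists>n. \<forall>z\<in>r.A n. \<eta> (p, q) = m z p q" by (rule r.limit_point, rule that)
 obtain p q x where pqx: "p \<in> S" "q \<in> S" "x \<in> S" and ne: "m (\<xi> (p, q)) (\<eta> (p, q)) (m x p q) ~= m x p q"
  using linealI[OF \<xi>(1) \<eta>(1)] assms by blast
 obtain i where i: "\<forall>z\<in>A i. \<xi> (p, q) = m z p q" using \<xi>(2)[OF pqx(1,2)] by blast
 obtain j where j: "\<forall>z\<in>r.A j. \<eta> (p, q) = m z p q" using \<eta>(2)[OF pqx(1,2)] by blast
 obtain zi zj where z: "zi \<in> A i" "zj \<in> r.A j" using A_ex r.A_ex by blast
 have S: "m zi p q \<in> S" "m zj p q \<in> S" "m x p q \<in> S"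
  using z AB_sub(1)[of i] r.AB_sub(1)[of j] med_in(4) pqx by auto
 have ne': "m (m zi p q) (m zj p q) (m x p q) ~= m x p q" using ne bspec[OF i z(1)] bspec[OF j z(2)] by simp
 obtain W where W: "thick W" "m (m zi p q) (m zj p q) (m x p q) \<notin> W" "m x p q \<in> W"
  by (rule thick_separation'[OF med_in(4)[OF S] S(3) ne'])
 have h: "halfspace X W" using thick_half[OF W(1)] .
 have n: "m zi p q \<notin> W" "m zj p q \<notin> W" using W(2,3) halfspace_med[OF h S] by auto
 have one: "p \<in> W \<or> q \<in> W" using W(3) halfspace_med[OF h pqx(3,1,2)] by auto
 have d1: "y \<notin> W" if "y \<in> A i" for y
 proof -
  have yS: "y \<in> S" using that AB_sub(1)[of i] by auto
  show ?thesis
   using n(1) bspec[OF i that] bspec[OF i z(1)] halfspace_med[OF h yS pqx(1,2)] one by auto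
 qed
 have d2: "y \<notin> W" if "y \<in> r.A j" for y
 proof -
  have yS: "y \<in> S" using that r.AB_sub(1)[of j] by auto
  show ?thesis
   using n(2) bspec[OF j that] bspec[OF j z(2)] halfspace_med[OF h yS pqx(1,2)] one by auto
 qed
 have "A (Suc i) \<subseteq> A i" by (rule A_Suc)
 have "A (Suc i) \<subseteq> b" using A_mono[of 1 "Suc i"] A_Suc_B[of 0] unfolding B_def by auto
 moreover have "r.A j \<subseteq> S - b" using r.A_mono[of 0 j] unfolding r.A_def by auto
 ultimately have "A (Suc i) \<inter> r.A j = {}" by blast
 moreover have "W \<inter> A (Suc i) = {}" "W \<inter> r.A j = {}" using d1 d2 A_Suc[of i] by auto
 ultimately show ?thesis using that[OF W(1) A_thick[of "Suc i"] r.A_thick[of j]] by blast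
qed

end

section \<open>Centers and test sets\<close>

locale main_geometry = flip_geometry +
 assumes nonlineal: "\<not> lineal X" and separable: "separable_space (mtopology_of X)"
begin

lemma ex_thick: obtains h where "thick h"
proof -
 obtain x where x: "x \<in> S" using median unfolding median_space_def by blast
 obtain y where "y \<in> S" "y ~= x" using lineal_interval[OF x x] nonlineal I_self[OF x] by blast
 thus ?thesis using thick_separation'[of x y] x that by metis
qed

text \<open>Only if \<open>b = a\<close> can the isometry given by \<open>transport\<close> fail to move \<open>a\<close>. In that case \<open>a\<close> and its complement do not
 exhaust the walls, since otherwise \<open>X\<close> would have two points and be lineal; a halfspace properly containing \<open>a\<close> or
 \<open>S - a\<close> helps out.\<close>

lemma ex_skewer: obtains a b \<gamma> where "skewer X a b \<gamma>"
proof -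
 obtain h where "thick h" by (rule ex_thick)
 then obtain a b where ab: "thick a" "thick b" "b \<subseteq> a" "sst b (S - a)" by (rule ex_sst)
 have sub: "a \<subseteq> S" "b \<subseteq> S" using thick_ne ab by auto
 have "\<exists>\<gamma>. iso \<gamma> \<and> \<gamma> ` a \<subseteq> b \<and> \<gamma> ` a ~= a"
 proof (cases "b = a")
  case False
  obtain f where "iso f" "f ` a \<subseteq> b" by (rule transport[OF ab(1,2)])
  thus ?thesis using False ab(3) by blast
 next
  case True
  have "\<not> wall_class {a, S - a}"
  proof
   assume w: "wall_class {a, S - a}"
   obtain x y where xy: "x \<in> a" "y \<in> S - a" using thick_ne[OF ab(1)] by blast
   have all: "W = a \<or> W = S - a" if "thick W" for W
    using wall_class_all[OF irreducible w _ that] by blast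
   have "z = x \<or> z = y" if z: "z \<in> S" for z
   proof (rule ccontr)
    assume n: "\<not> (z = x \<or> z = y)"
    have xyS: "x \<in> S" "y \<in> S" using xy sub by auto
    obtain W where W: "thick W" "x \<notin> W" "z \<in> W" using thick_separation'[of x z] n z xyS by metis
    obtain V where V: "thick V" "y \<notin> V" "z \<in> V" using thick_separation'[of y z] n z xyS by metis
    show False using all[OF W(1)] all[OF V(1)] W V xy by blast
   qed
   hence "S \<subseteq> {x, y}" by blast
   moreover have "x \<in> S" "y \<in> S" using xy sub by auto
   ultimately have "S \<subseteq> I x y" using I_ends[of x y] by blast
   thus False using lineal_interval[OF \<open>x \<in> S\<close> \<open>y \<in> S\<close>] nonlineal by blast
  qed
  moreover have "\<forall>W\<in>{a, S - a}. thick W \<and> S - W \<in> {a, S - a}"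
   using ab thick_compl sub by (auto simp: double_diff)
  ultimately obtain W U where U: "W \<in> {a, S - a}" "thick U" "W \<subseteq> U" "U ~= a" "U ~= S - a"
   unfolding wall_class_def by blast
  have US: "U \<subseteq> S" using thick_ne U by auto
  show ?thesis
  proof (cases "W = a")
   case True
   obtain f where f: "iso f" "f ` U \<subseteq> a" by (rule transport[OF U(2) ab(1)])
   have "f ` a ~= a"
   using f inj_on_image_subset_iff[OF iso_inj[OF f(1)] US sub(1)] U True by auto
   moreover have "f ` a \<subseteq> a" using f U True by blast
   ultimately show ?thesis using f \<open>b = a\<close> by blast
  next
   case False
   obtain f where f: "iso f" "f ` a \<subseteq> S - U" by (rule transport[OF ab(1) thick_compl[OF U(2)]])
   have "S - U \<subseteq> a" "S - U ~= a" using U False US sub by blast+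
   thus ?thesis using f \<open>b = a\<close> by blast
  qed
 qed
 then obtain \<gamma> where "iso \<gamma>" "\<gamma> ` a \<subseteq> b" "\<gamma> ` a ~= a" by blast
 hence "skewer X a b \<gamma>" by unfold_locales (use ab in auto)
 thus ?thesis by (rule that)
qed

lemma facing:
 obtains H1 H2 H3 where "thick H1" "thick H2" "thick H3"
  "H1 \<inter> H2 = {}" "H1 \<inter> H3 = {}" "H2 \<inter> H3 = {}"
proof -
 obtain a b \<gamma> where "skewer X a b \<gamma>" by (rule ex_skewer)
 thus ?thesis using skewer.lineal_or_facing[OF _ nonlineal] that by blast
qed

text \<open>Recursively, the third of three facing halfspaces has room for \<open>n\<close> more once the complement of the first is moved into \<open>k\<close>.\<close>

lemma many_disjoint:
 assumes "thick k"
 shows "\<exists>V::nat => _. (\<forall>i<n. thick (V i) \<and> V i \<subseteq> k) \<and> (\<forall>i<n. \<forall>j<n. i ~= j --> V i \<inter> V j = {})"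
 using assms
proof (induction n arbitrary: k)
 case 0 thus ?case by simp
next
 case (Suc n)
 obtain H1 H2 H3 where H: "thick H1" "thick H2" "thick H3"
  "H1 \<inter> H2 = {}" "H1 \<inter> H3 = {}" "H2 \<inter> H3 = {}" by (rule facing)
 have sub: "H1 \<subseteq> S" "H2 \<subseteq> S" "H3 \<subseteq> S" using thick_ne H by auto
 obtain f where f: "iso f" "f ` (S - H1) \<subseteq> k" by (rule transport[OF thick_compl[OF H(1)] Suc.prems])
 have th: "thick (f ` H2)" "thick (f ` H3)" using iso_thick f H by auto
 have "H2 \<subseteq> S - H1" "H3 \<subseteq> S - H1" using H sub by auto
 hence in_k: "f ` H2 \<subseteq> k" "f ` H3 \<subseteq> k" using f by blast+
 have dis: "f ` H2 \<inter> f ` H3 = {}"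
  using inj_on_image_Int[OF iso_inj[OF f(1)] sub(2,3)] H(6) by simp
 obtain V :: "nat => _" where V: "\<forall>i<n. thick (V i) \<and> V i \<subseteq> f ` H3"
  "\<forall>i<n. \<forall>j<n. i ~= j --> V i \<inter> V j = {}" using Suc.IH[OF th(2)] by blast
 define V' where "V' = V(n := f ` H2)"
 have "\<forall>i<Suc n. thick (V' i) \<and> V' i \<subseteq> k"
 using V(1) in_k(2) th(1) in_k(1) unfolding V'_def by (auto simp: less_Suc_eq)
 moreover have "V' i \<inter> V' j = {}" if ij: "i < Suc n" "j < Suc n" "i ~= j" for i j
 proof -
  consider "i < n" "j < n" | "i = n" "j < n" | "i < n" "j = n" using ij by linarith
  thus ?thesis
  proof cases
   case 1 thus ?thesis using V(2) ij unfolding V'_def by auto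
  next
   case 2
   thus ?thesis using V(1) dis unfolding V'_def by auto
  next
   case 3
   thus ?thesis using V(1) dis unfolding V'_def by auto
  qed
 qed
 ultimately show ?case by blast
qed

definition centered where
 "centered y K1 K2 K3 \<longleftrightarrow> (\<forall>x1\<in>K1. \<forall>x2\<in>K2. \<forall>x3\<in>K3. m x1 x2 x3 = y)"

text \<open>Branch points of \<open>X\<close> that do not move when the three points defining them vary in thick halfspaces.\<close>

definition centers where
 "centers = {y\<in>S. \<exists>K1 K2 K3. thick K1 \<and> thick K2 \<and> thick K3 \<and>
   y \<notin> K1 \<and> y \<notin> K2 \<and> y \<notin> K3 \<and> centered y K1 K2 K3}"

lemma centers_sub: "centers \<subseteq> S" unfolding centers_def by blast

lemma centers_iso:
 assumes f: "iso f" and y: "y \<in> centers" shows "f y \<in> centers"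
proof -
 obtain K1 K2 K3 where K: "thick K1" "thick K2" "thick K3"
  "y \<notin> K1" "y \<notin> K2" "y \<notin> K3" "centered y K1 K2 K3" and yS: "y \<in> S" using y unfolding centers_def by blast
 have sub: "K1 \<subseteq> S" "K2 \<subseteq> S" "K3 \<subseteq> S" using thick_ne K by auto
 have "m (f x1) (f x2) (f x3) = f y" if x: "x1 \<in> K1" "x2 \<in> K2" "x3 \<in> K3" for x1 x2 x3
 using K(7) x iso_med[OF f subsetD[OF sub(1) x(1)] subsetD[OF sub(2) x(2)] subsetD[OF sub(3) x(3)]] unfolding centered_def by auto
 hence "centered (f y) (f ` K1) (f ` K2) (f ` K3)" unfolding centered_def by blast
 moreover have "f y \<notin> f ` K1" "f y \<notin> f ` K2" "f y \<notin> f ` K3"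
  using iso_mem[OF f sub(1) yS] iso_mem[OF f sub(2) yS] iso_mem[OF f sub(3) yS] K by auto
 ultimately show ?thesis unfolding centers_def using iso_thick[OF f] K iso_in[OF f yS] by blast
qed

text \<open>Each of three facing halfspaces contains some \<open>K \<subseteq> U\<close> with \<open>K\<close> strongly separated from \<open>S - U\<close>; by \<open>sst_med\<close> the median is constant on the three \<open>K\<close>.\<close>

lemma ex_center: obtains y where "y \<in> centers"
proof -
 obtain a b \<gamma> where "skewer X a b \<gamma>" by (rule ex_skewer)
 then interpret sk: skewer X a b \<gamma> .
 obtain H1 H2 H3 where H: "thick H1" "thick H2" "thick H3"
  "H1 \<inter> H2 = {}" "H1 \<inter> H3 = {}" "H2 \<inter> H3 = {}" by (rule facing)
 have "\<exists>U K. thick U \<and> thick K \<and> K \<subseteq> U \<and> U \<subseteq> H \<and> sst K (S - U)" if H: "thick H" for H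
 proof -
  obtain f where f: "iso f" "f ` a \<subseteq> H" by (rule transport[OF sk.a H])
  have sub: "a \<subseteq> S" "b \<subseteq> S" using thick_ne sk.a sk.b by auto
  have "sst (f ` b) (f ` (S - a))" by (rule sst_iso[OF f(1) sk.sst_ba sub(2) Diff_subset])
  hence "sst (f ` b) (S - f ` a)" using iso_diff[OF f(1) sub(1)] by simp
  moreover have "f ` b \<subseteq> f ` a" using sk.ba by blast
  ultimately show ?thesis using f(2) iso_thick[OF f(1) sk.a] iso_thick[OF f(1) sk.b] by blast
 qed
 then obtain U K where UK: "!!H. thick H ==> thick (U H) \<and> thick (K H) \<and> K H \<subseteq> U H \<and> U H \<subseteq> H \<and> sst (K H) (S - U H)"
  by metis
 note u1 = UK[OF H(1)] and u2 = UK[OF H(2)] and u3 = UK[OF H(3)]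
 have sub: "K H1 \<subseteq> S" "K H2 \<subseteq> S" "K H3 \<subseteq> S" using u1 u2 u3 thick_ne by auto
 have out: "x \<in> S - U H1" if "x \<in> K H2 \<or> x \<in> K H3" for x using that u1 u2 u3 H sub by blast
 have out2: "x \<in> S - U H2" if "x \<in> K H1 \<or> x \<in> K H3" for x using that u1 u2 u3 H sub by blast
 have out3: "x \<in> S - U H3" if "x \<in> K H1 \<or> x \<in> K H2" for x using that u1 u2 u3 H sub by blast
 obtain z1 z2 z3 where z: "z1 \<in> K H1" "z2 \<in> K H2" "z3 \<in> K H3" using thick_ne[of "K H1"] thick_ne[of "K H2"] thick_ne[of "K H3"] u1 u2 u3 by blast
 define y where "y = m z1 z2 z3"
 have zS: "z1 \<in> S" "z2 \<in> S" "z3 \<in> S" using z sub by auto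
 have "m x1 x2 x3 = y" if x: "x1 \<in> K H1" "x2 \<in> K H2" "x3 \<in> K H3" for x1 x2 x3
 proof -
  have xS: "x1 \<in> S" "x2 \<in> S" "x3 \<in> S" using x sub by auto
  have "m x1 x2 x3 = m z1 x2 x3"
   by (rule sst_med[of "K H1" "S - U H1"]) (use u1 sub x z out in auto)
  also have "\<dots> = m x2 z1 x3" using med_perm(1) xS zS by simp
  also have "\<dots> = m z2 z1 x3"
   by (rule sst_med[of "K H2" "S - U H2"]) (use u2 sub x z out2 in auto)
  also have "\<dots> = m z1 z2 x3" using med_perm(1) xS zS by simp
  also have "\<dots> = m z1 x3 z2" using med_perm(2) xS zS by simp
  also have "\<dots> = m x3 z1 z2" using med_perm(1) xS zS by simp
  also have "\<dots> = m z3 z1 z2"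
   by (rule sst_med[of "K H3" "S - U H3"]) (use u3 sub x z out3 in auto)
  also have "\<dots> = m z1 z3 z2" using med_perm(1) zS by simp
  also have "\<dots> = m z1 z2 z3" using med_perm(2) zS by simp
  finally show ?thesis unfolding y_def .
 qed
 hence "centered y (K H1) (K H2) (K H3)" unfolding centered_def by blast
 moreover have "y \<notin> K H1" "y \<notin> K H2" "y \<notin> K H3"
 proof -
  have h: "halfspace X (U H1)" "halfspace X (U H2)" "halfspace X (U H3)" using u1 u2 u3 thick_half by auto
  have "y \<notin> U H1" "y \<notin> U H2" "y \<notin> U H3" unfolding y_def
   using halfspace_med[OF h(1) zS] halfspace_med[OF h(2) zS] halfspace_med[OF h(3) zS] z out out2 out3 by auto
  thus "y \<notin> K H1" "y \<notin> K H2" "y \<notin> K H3" using u1 u2 u3 by auto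
 qed
 moreover have "y \<in> S" unfolding y_def using med_in(4) zS by blast
 ultimately have "y \<in> centers" unfolding centers_def using u1 u2 u3 by blast
 thus ?thesis by (rule that)
qed

lemma thick_dense: assumes "thick K" "MS.mtopology closure_of D = S" shows "\<exists>z\<in>D. z \<in> K"
proof -
 obtain x y where "strict K x y" using assms(1) thick_iff by blast
 then obtain e where e: "e > 0" "\<forall>a\<in>S. d y a < e --> a \<in> K" "y \<in> S" unfolding strict_def by blast
 then obtain z where "z \<in> D" "z \<in> MS.mball y e"
  using assms unfolding MS.metric_closure_of by blast
 thus ?thesis using e by auto
qed

text \<open>A center is the median of points of a countable dense set, as thick halfspaces meet such sets.\<close>

lemma countable_centers: "countable centers"
proof -
 obtain D where D: "countable D" "D \<subseteq> S" "MS.mtopology closure_of D = S"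
  using separable unfolding separable_space_def mtop by auto
 have "centers \<subseteq> (\<lambda>(x, y, z). m x y z) ` (D \<times> D \<times> D)"
 proof
  fix y assume "y \<in> centers"
  then obtain K1 K2 K3 where K: "thick K1" "thick K2" "thick K3"
   "centered y K1 K2 K3" unfolding centers_def by blast
  obtain d1 d2 d3 where "d1 \<in> D" "d1 \<in> K1" "d2 \<in> D" "d2 \<in> K2" "d3 \<in> D" "d3 \<in> K3"
   using thick_dense[OF K(1) D(3)] thick_dense[OF K(2) D(3)] thick_dense[OF K(3) D(3)] by blast
  thus "y \<in> (\<lambda>(x, y, z). m x y z) ` (D \<times> D \<times> D)" using K(4) unfolding centered_def by force
 qed
 thus ?thesis using D(1) by (meson countable_SIGMA countable_image countable_subset)
qed

text \<open>The points that \<open>q\<close> hides from \<open>p\<close>.\<close>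

definition shadow where "shadow p q = {x\<in>S. m p q x = q}"

lemma shadow_iff: "p \<in> S ==> q \<in> S ==> x \<in> shadow p q \<longleftrightarrow> x \<in> S \<and> q \<in> I p x"
 unfolding shadow_def using med_iff[of p x q] med_perm(2)[of p q x] by auto

lemma shadow_iso: assumes f: "iso f" and pq: "p \<in> S" "q \<in> S" shows "f ` shadow p q = shadow (f p) (f q)"
proof
 have e: "f x \<in> shadow (f p) (f q) \<longleftrightarrow> x \<in> shadow p q" if "x \<in> S" for x
  using shadow_iff[OF pq] shadow_iff[OF iso_in[OF f pq(1)] iso_in[OF f pq(2)]] iso_mem_I[OF f pq(1) that pq(2)]
   iso_in[OF f that] that by blast
 have s: "shadow p q \<subseteq> S" "shadow (f p) (f q) \<subseteq> S" unfolding shadow_def by auto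
 show "f ` shadow p q \<subseteq> shadow (f p) (f q)" using e s(1) by blast
 show "shadow (f p) (f q) \<subseteq> f ` shadow p q"
 using s(2) iso_image[OF f] e by force
qed

text \<open>A shadow of centers that contains a thick halfspace and is contained in one. Its translates and their complements are the
 test sets; there are countably many of them.\<close>

definition base where
 "base p q \<longleftrightarrow> p \<in> centers \<and> q \<in> centers \<and> (\<exists>K V. thick K \<and> thick V \<and> K \<subseteq> shadow p q \<and> shadow p q \<subseteq> V)"

lemma ex_base: obtains p q where "base p q"
proof -
 obtain q where q: "q \<in> centers" by (rule ex_center)
 then obtain K1 K2 K3 where K: "thick K1" "thick K2" "thick K3"
  "q \<notin> K1" "q \<notin> K2" "q \<notin> K3" "centered q K1 K2 K3" and qS: "q \<in> S" unfolding centers_def by blast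
 obtain f where f: "iso f" "f ` (S - K2) \<subseteq> K2" by (rule transport[OF thick_compl[OF K(2)] K(2)])
 define p where "p = f q"
 have p: "p \<in> centers" "p \<in> K2" unfolding p_def using centers_iso[OF f(1) q] f(2) qS K by auto
 have sub: "K1 \<subseteq> S" "K2 \<subseteq> S" "K3 \<subseteq> S" using thick_ne K by auto
 have pS: "p \<in> S" using p sub by auto
 obtain z3 where z3: "z3 \<in> K3" using thick_ne[OF K(3)] by blast
 have "K1 \<subseteq> shadow p q"
 proof
  fix x assume x: "x \<in> K1"
  have xS: "x \<in> S" "z3 \<in> S" using x z3 sub by auto
  show "x \<in> shadow p q"
   using K(7) x p(2) z3 med_in(1)[OF xS(1) pS xS(2)] shadow_iff[OF pS qS] xS I_commute[of x p] unfolding centered_def by simp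
 qed
 moreover have "shadow p q \<subseteq> S - K2"
 using shadow_iff[OF pS qS] thick_half[OF K(2)] halfspace_iff convexD p(2) K(5) by blast
 ultimately have "base p q" unfolding base_def using p(1) q K(1) thick_compl[OF K(2)] by blast
 thus ?thesis by (rule that)
qed

definition tests where
 "tests p q = {f ` shadow p q |f. iso f} \<union> {S - f ` shadow p q |f. iso f}"

lemma shadow_sub: "shadow p q \<subseteq> S" unfolding shadow_def by blast

lemma tests_sub: "B \<in> tests p q ==> B \<subseteq> S"
 unfolding tests_def using iso_sub[OF _ shadow_sub] by blast

lemma tests_compl: assumes "B \<in> tests p q" shows "S - B \<in> tests p q"
proof -
 obtain f where f: "iso f" "B = f ` shadow p q \<or> B = S - f ` shadow p q" using assms unfolding tests_def by blast
 show ?thesis using iso_sub[OF f(1) shadow_sub] f unfolding tests_def by blast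
qed

lemma tests_iso: assumes g: "iso g" and B: "B \<in> tests p q" shows "g ` B \<in> tests p q"
proof -
 have 1: "g ` (f ` shadow p q) = (g \<circ> f) ` shadow p q" for f by (simp add: image_comp)
 obtain f where f: "iso f" "B = f ` shadow p q \<or> B = S - f ` shadow p q" using B unfolding tests_def by blast
 from f(2) show ?thesis
 using 1 iso_comp[OF g f(1)] iso_diff[OF g iso_sub[OF f(1) shadow_sub]] unfolding tests_def by auto
qed

lemma countable_tests: assumes "base p q" shows "countable (tests p q)"
proof -
 have pq: "p \<in> centers" "q \<in> centers" "p \<in> S" "q \<in> S" using assms centers_sub unfolding base_def by auto
 let ?C = "(\<lambda>(p, q). shadow p q) ` (centers \<times> centers)"
 have 1: "f ` shadow p q \<in> ?C" if "iso f" for f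
  unfolding shadow_iso[OF that pq(3,4)] using centers_iso[OF that pq(1)] centers_iso[OF that pq(2)] by (intro image_eqI[of _ _ "(f p, f q)"]) simp_all
 have sub: "tests p q \<subseteq> ?C \<union> (\<lambda>B. S - B) ` ?C"
 using 1 unfolding tests_def by auto
 have C: "countable ?C" by (rule countable_image[OF countable_SIGMA[OF countable_centers countable_centers]])
 show ?thesis by (rule countable_subset[OF sub countable_Un[OF C countable_image[OF C]]])
qed

lemma tests_in_thick:
 assumes "base p q" "B \<in> tests p q" shows "\<exists>V. thick V \<and> B \<subseteq> V"
proof -
 obtain K V where K: "thick K" "thick V" "K \<subseteq> shadow p q" "shadow p q \<subseteq> V"
  using assms unfolding base_def by blast
 obtain f where f: "iso f" "B = f ` shadow p q \<or> B = S - f ` shadow p q" using assms unfolding tests_def by blast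
 from f(2) show ?thesis
 using iso_thick[OF f(1) K(2)] K(4) K(3) thick_compl[OF iso_thick[OF f(1) K(1)]] by auto
qed

lemma tests_ne: assumes "base p q" "B \<in> tests p q" shows "B ~= {}"
proof
 assume "B = {}"
 have "S - B \<in> tests p q" by (rule tests_compl[OF assms(2)])
 then obtain V where "thick V" "S - B \<subseteq> V" using tests_in_thick[OF assms(1)] by blast
 thus False using thick_ne \<open>B = {}\<close> by blast
qed

text \<open>A test set that cuts a translate of the base shadow pushed deep into a halfspace \<open>U\<close> is, up to
 complement, contained in \<open>U\<close>: the two points defining it are too close to each other to lie on both sides of the long
 strongly separated chain between the translate and \<open>U\<close>.\<close>

lemma tests_nested:
 assumes b: "base p q"
 obtains U B where "thick U" "B \<in> tests p q" "B \<subseteq> U"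
  "!!C. C \<in> tests p q ==> C \<inter> B ~= {} ==> B - C ~= {} ==> C \<subseteq> U \<or> S - C \<subseteq> U"
proof -
 have pq: "p \<in> S" "q \<in> S" using b centers_sub unfolding base_def by auto
 obtain K V where K: "thick K" "thick V" "K \<subseteq> shadow p q" "shadow p q \<subseteq> V"
  using b unfolding base_def by blast
 obtain a b' \<gamma> where "skewer X a b' \<gamma>" by (rule ex_skewer)
 then interpret sk: skewer X a b' \<gamma> .
 obtain n where n: "!!x z. x \<in> S - sk.A 0 ==> z \<in> sk.A n ==> d p q < d x z" by (rule sk.growth, rule that)
 text \<open>The chain is \<open>U4 \<supseteq> U3 \<supseteq> U2 \<supseteq> U1\<close> with a large gap between \<open>U2\<close> and the complement of \<open>U3\<close>. If \<open>c\<close>, \<open>e\<close> both lay outside \<open>U2\<close>,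
 their shadow would not cut \<open>U1\<close>; so one of them is in \<open>U2\<close> and both are in \<open>U3\<close>, and the shadow does not cut the complement of \<open>U4\<close>.\<close>
 define U4 where "U4 = sk.A 0"
 define U3 where "U3 = sk.A 1"
 define U2 where "U2 = sk.A (1 + n)"
 define U1 where "U1 = sk.A (2 + n)"
 have thick: "thick U4" "thick U1" unfolding U4_def U1_def by (rule sk.A_thick)+
 have sub: "U1 \<subseteq> S" "U2 \<subseteq> S" "U3 \<subseteq> S" "U4 \<subseteq> S" unfolding U1_def U2_def U3_def U4_def using sk.AB_sub(1) by auto
 have nest: "U1 \<subseteq> U2" "U2 \<subseteq> U3" "U3 \<subseteq> U4"
  unfolding U1_def U2_def U3_def U4_def using sk.A_mono by auto
 have s34: "sst U3 (S - U4)" unfolding U3_def U4_def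
  using sst_mono[OF sk.A_sst[of 0], of "sk.A 1"] sk.A_Suc_B[of 0] by simp
 have s12: "sst U1 (S - U2)" unfolding U1_def U2_def
  using sst_mono[OF sk.A_sst[of "1 + n"], of "sk.A (2 + n)"] sk.A_Suc_B[of "1 + n"] by simp
 have gap: "d p q < d x z" if x: "x \<in> S - U3" and z: "z \<in> U2" for x z
 proof -
  have U: "U3 = \<gamma> ` sk.A 0" "U2 = \<gamma> ` sk.A n" unfolding U3_def U2_def using sk.A_shift[of 1] by simp_all
  then obtain x' z' where xz: "x' \<in> S - sk.A 0" "x = \<gamma> x'" "z' \<in> sk.A n" "z = \<gamma> z'"
   using iso_diff[OF sk.\<gamma>(1) sk.AB_sub(1)] x z by blast
  thus ?thesis using iso_dist[OF sk.\<gamma>(1)] sk.AB_sub(1)[of n] n[OF xz(1,3)] by auto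
 qed
 obtain h where h: "iso h" "h ` V \<subseteq> U1" by (rule transport[OF K(2) thick(2)])
 define B where "B = h ` shadow p q"
 have B: "B \<in> tests p q" "B \<subseteq> U1" unfolding B_def tests_def using h K by blast+
 have "C \<subseteq> U4 \<or> S - C \<subseteq> U4" if C: "C \<in> tests p q" "C \<inter> B ~= {}" "B - C ~= {}" for C
 proof -
  obtain f where f: "iso f" "C = f ` shadow p q \<or> C = S - f ` shadow p q" using C(1) unfolding tests_def by blast
  define c e where "c = f p" and "e = f q"
  have ce: "c \<in> S" "e \<in> S" "d c e = d p q" unfolding c_def e_def using iso_in[OF f(1)] iso_dist[OF f(1)] pq by auto
  have fs: "f ` shadow p q = shadow c e" unfolding c_def e_def by (rule shadow_iso[OF f(1) pq])
  have cut: "shadow c e \<inter> B ~= {}" "B - shadow c e ~= {}" using f(2) C(2,3) fs B(2) sub(1) by blast+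
  have const: "x \<in> shadow c e \<longleftrightarrow> x' \<in> shadow c e" if "sst u v" "u \<subseteq> S" "v \<subseteq> S" "x \<in> u" "x' \<in> u" "c \<in> v" "e \<in> v" for u v x x'
  proof -
   have xS: "x \<in> S" "x' \<in> S" using that by auto
   have "m x c e = m x' c e" by (rule sst_med[OF that])
   moreover have "m x c e = m c e x" using med_perm(1)[OF ce(1) xS(1) ce(2)] med_perm(2)[OF ce(1,2) xS(1)] by simp
   moreover have "m x' c e = m c e x'" using med_perm(1)[OF ce(1) xS(2) ce(2)] med_perm(2)[OF ce(1,2) xS(2)] by simp
   ultimately show ?thesis unfolding shadow_def using xS by simp
  qed
  have "\<not> (c \<in> S - U2 \<and> e \<in> S - U2)"
   using const[OF s12 sub(1) Diff_subset] cut B(2) by blast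
  moreover have "\<not> (c \<in> S - U3 \<and> e \<in> U2)" using gap[of c e] ce(3) by auto
  moreover have "\<not> (e \<in> S - U3 \<and> c \<in> U2)" using gap[of e c] ce(3) mdist_commute[of X e c] by auto
  ultimately have "c \<in> U3 \<and> e \<in> U3" using ce nest by blast
  hence "S - U4 \<subseteq> shadow c e \<or> (S - U4) \<inter> shadow c e = {}"
   using const[OF sst_sym[OF s34] Diff_subset sub(3)] by blast
  thus ?thesis using f(2) fs shadow_sub[of c e] by blast
 qed
 moreover have "B \<subseteq> U4" using B(2) nest by blast
 ultimately show ?thesis using that[of U4 B] thick(1) B(1) by blast
qed

lemma tests_family:
 assumes b: "base p q"
 obtains U B :: "nat => _" where
  "!!i. i < n ==> B i \<in> tests p q \<and> B i \<subseteq> U i"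
  "!!i j. i < n ==> j < n ==> i ~= j ==> U i \<inter> U j = {}"
  "!!i C. i < n ==> C \<in> tests p q ==> C \<inter> B i ~= {} ==> B i - C ~= {} ==> C \<subseteq> U i \<or> S - C \<subseteq> U i"
proof -
 obtain U0 B0 where UB: "thick U0" "B0 \<in> tests p q" "B0 \<subseteq> U0"
  "!!C. C \<in> tests p q ==> C \<inter> B0 ~= {} ==> B0 - C ~= {} ==> C \<subseteq> U0 \<or> S - C \<subseteq> U0"
  by (rule tests_nested[OF b], rule that)
 obtain h where "thick h" by (rule ex_thick)
 from many_disjoint[OF this, of n] obtain V :: "nat => _" where
  V: "\<forall>i<n. thick (V i) \<and> V i \<subseteq> h" "\<forall>i<n. \<forall>j<n. i ~= j --> V i \<inter> V j = {}" by blast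
 have "\<forall>i. \<exists>g. i < n --> iso g \<and> g ` U0 \<subseteq> V i" using transport[OF UB(1)] V(1) by metis
 then obtain g where g: "!!i. i < n ==> iso (g i) \<and> g i ` U0 \<subseteq> V i" by metis
 show ?thesis
 proof (rule that[of "\<lambda>i. g i ` B0" "\<lambda>i. g i ` U0"])
  fix i assume i: "i < n"
  show "g i ` B0 \<in> tests p q \<and> g i ` B0 \<subseteq> g i ` U0" using tests_iso[OF _ UB(2)] g[OF i] UB(3) by blast
  fix C assume C: "C \<in> tests p q" "C \<inter> g i ` B0 ~= {}" "g i ` B0 - C ~= {}"
  have gi: "iso (g i)" using g i by blast
  define k where "k = inv_into S (g i)"
  have k: "iso k" "!!x. x \<in> S ==> k (g i x) = x" "!!x. x \<in> S ==> g i (k x) = x" unfolding k_def using iso_inv[OF gi] by auto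
  have CS: "C \<subseteq> S" "B0 \<subseteq> S" "U0 \<subseteq> S" using tests_sub C(1) UB thick_ne by auto
  have mem: "x \<in> k ` C \<longleftrightarrow> g i x \<in> C" if "x \<in> S" for x
   using iso_mem[OF k(1) CS(1) iso_in[OF gi that]] k(2)[OF that] by simp
  have "k ` C \<inter> B0 ~= {}" "B0 - k ` C ~= {}" using C(2,3) mem CS(2) by blast+
  hence "k ` C \<subseteq> U0 \<or> S - k ` C \<subseteq> U0" using UB(4)[OF tests_iso[OF k(1) C(1)]] by blast
  moreover have "g i ` (k ` C) = C" using k(3) CS(1) by (force simp: image_iff)
  moreover have "g i ` (S - k ` C) = S - g i ` (k ` C)" by (rule iso_diff[OF gi iso_sub[OF k(1) CS(1)]])
  ultimately show "C \<subseteq> g i ` U0 \<or> S - C \<subseteq> g i ` U0" by (metis image_mono)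
 next
  fix i j assume ij: "i < n" "j < n" "i ~= j"
  hence "V i \<inter> V j = {}" using V(2) by blast
  thus "g i ` U0 \<inter> g j ` U0 = {}" using g[OF ij(1)] g[OF ij(2)] by blast
 qed
qed

end

section \<open>Haar measure\<close>

locale lc_group =
 fixes G :: "('g, 'm) monoid_scheme" (structure) and T :: "'g topology"
 assumes topological_group: "topological_group G T"
  and Hausdorff: "Hausdorff_space T" and second_countable: "second_countable T"
  and locally_compact: "locally_compact_space T"
begin

lemma group: "group G" and top: "topspace T = carrier G"
 and cont_mult: "continuous_map (prod_topology T T) T (\<lambda>(x, y). x \<otimes>\<^bsub>G\<^esub> y)"
 and cont_inv: "continuous_map T T (\<lambda>x. inv\<^bsub>G\<^esub> x)"
 using topological_group unfolding topological_group_def by auto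

sublocale group G by (rule group)

definition tr where "tr x A = (\<lambda>y. x \<otimes>\<^bsub>G\<^esub> y) ` A"

lemma cont_tr: assumes "x \<in> carrier G" shows "continuous_map T T (\<lambda>y. x \<otimes>\<^bsub>G\<^esub> y)"
proof -
 have "continuous_map T (prod_topology T T) (\<lambda>y. (x, y))"
  using assms top by (intro continuous_map_pairedI) auto
 from continuous_map_compose[OF this cont_mult] show ?thesis by (simp add: o_def)
qed

lemma tr_sub: "x \<in> carrier G ==> A \<subseteq> carrier G ==> tr x A \<subseteq> carrier G"
 unfolding tr_def by auto

lemma tr_inv: "x \<in> carrier G ==> A \<subseteq> carrier G ==> tr (inv x) (tr x A) = A"
 "x \<in> carrier G ==> A \<subseteq> carrier G ==> tr x (tr (inv x) A) = A"
proof -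
 assume x: "x \<in> carrier G" "A \<subseteq> carrier G"
 have 1: "inv x \<otimes> (x \<otimes> y) = y" "x \<otimes> (inv x \<otimes> y) = y" if "y \<in> A" for y
  using that x by (auto simp: m_assoc[symmetric])
 show "tr (inv x) (tr x A) = A" "tr x (tr (inv x) A) = A"
  unfolding tr_def image_image using 1 by (auto simp: image_iff)
qed

lemma tr_mult: "x \<in> carrier G ==> y \<in> carrier G ==> A \<subseteq> carrier G ==> tr x (tr y A) = tr (x \<otimes> y) A"
 unfolding tr_def image_image by (rule image_cong) (auto simp: m_assoc)

lemma tr_mono: "A \<subseteq> B ==> tr x A \<subseteq> tr x B" unfolding tr_def by blast

lemma tr_open: assumes "x \<in> carrier G" "openin T U" shows "openin T (tr x U)"
proof -
 have U: "U \<subseteq> carrier G" using openin_subset[OF assms(2)] top by simp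
 have "tr x U = {y \<in> topspace T. inv x \<otimes> y \<in> U}"
 proof
  show "tr x U \<subseteq> {y \<in> topspace T. inv x \<otimes> y \<in> U}" unfolding tr_def top using assms(1) U by (auto simp: m_assoc[symmetric])
  show "{y \<in> topspace T. inv x \<otimes> y \<in> U} \<subseteq> tr x U"
  proof
   fix y assume "y \<in> {y \<in> topspace T. inv x \<otimes> y \<in> U}"
   hence "y \<in> carrier G" "inv x \<otimes> y \<in> U" using top by auto
   moreover have "y = x \<otimes> (inv x \<otimes> y)" using assms(1) \<open>y \<in> carrier G\<close> by (simp add: m_assoc[symmetric])
   ultimately show "y \<in> tr x U" unfolding tr_def by blast
  qed
 qed
 thus ?thesis using openin_continuous_map_preimage[OF cont_tr[OF inv_closed[OF assms(1)]] assms(2)] by simp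
qed

lemma tr_compact: "x \<in> carrier G ==> compactin T K ==> compactin T (tr x K)"
 unfolding tr_def by (rule image_compactin[OF _ cont_tr])

lemma ex_basis:
 obtains V :: "nat => 'g set" where "!!n. openin T (V n)" "!!n. \<one> \<in> V n"
  "!!U. openin T U ==> \<one> \<in> U ==> \<exists>n. \<forall>k\<ge>n. V k \<subseteq> U"
proof -
 obtain \<B> where B: "countable \<B>" "\<forall>V\<in>\<B>. openin T V" "\<forall>U. openin T U \<and> \<one> \<in> U --> (\<exists>V\<in>\<B>. \<one> \<in> V \<and> V \<subseteq> U)"
  using second_countable second_countable_imp_first_countable top one_closed unfolding first_countable_def by metis
 let ?B = "{V\<in>\<B>. \<one> \<in> V}"
 have ne: "?B ~= {}" using openin_topspace[of T] top B(3)[rule_format, of "carrier G"] by auto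
 have "countable ?B" using B(1) by auto
 then obtain W :: "nat => _" where W: "range W = ?B" using ne by (metis uncountable_def)
 define V where "V n = (\<Inter>k\<le>n. W k)" for n
 have "openin T (V n)" for n unfolding V_def using W B(2) by (intro openin_Inter) auto
 moreover have "\<one> \<in> V n" for n unfolding V_def using W by auto
 moreover have "\<exists>n. \<forall>k\<ge>n. V k \<subseteq> U" if U: "openin T U" "\<one> \<in> U" for U
 proof -
  obtain B0 where "B0 \<in> ?B" "B0 \<subseteq> U" using B(3) U by blast
  then obtain n where "W n \<subseteq> U" using W by (metis imageE)
  hence "\<forall>k\<ge>n. V k \<subseteq> U" unfolding V_def by blast
  thus ?thesis by blast
 qed
 ultimately show ?thesis using that by blast
qed

text \<open>The covering number \<open>(K : V)\<close> of Haar's construction.\<close>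

definition covers where
 "covers K V n \<longleftrightarrow> (\<exists>F. finite F \<and> card F \<le> n \<and> F \<subseteq> carrier G \<and> K \<subseteq> (\<Union>x\<in>F. tr x V))"

definition cov where "cov K V = (LEAST n. covers K V n)"

lemma ex_covers: assumes "compactin T K" "openin T V" "\<one> \<in> V" shows "\<exists>n. covers K V n"
proof -
 have K: "K \<subseteq> carrier G" using compactin_subset_topspace[OF assms(1)] top by simp
 have "\<forall>U\<in>(\<lambda>x. tr x V) ` K. openin T U" using tr_open K assms(2) by blast
 moreover have "K \<subseteq> \<Union>((\<lambda>x. tr x V) ` K)"
 using K assms(3) unfolding tr_def by force
 ultimately obtain \<F> where F: "finite \<F>" "\<F> \<subseteq> (\<lambda>x. tr x V) ` K" "K \<subseteq> \<Union>\<F>"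
  using assms(1) unfolding compactin_def by meson
 then obtain F where "finite F" "F \<subseteq> K" "\<F> = (\<lambda>x. tr x V) ` F" by (meson finite_subset_image)
 thus ?thesis using F(3) K unfolding covers_def by blast
qed

lemma covers_cov: assumes "compactin T K" "openin T V" "\<one> \<in> V" shows "covers K V (cov K V)"
 unfolding cov_def using ex_covers[OF assms] by (rule LeastI_ex)

lemma cov_le: "covers K V n ==> cov K V \<le> n" unfolding cov_def by (rule Least_le)

lemma covers_mono: "covers K V n ==> K' \<subseteq> K ==> covers K' V n" unfolding covers_def by blast

lemma cov_mono: assumes "compactin T K" "openin T V" "\<one> \<in> V" "K' \<subseteq> K" shows "cov K' V \<le> cov K V"
 using cov_le covers_mono covers_cov[OF assms(1-3)] assms(4) by blast

lemma cov_Un: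
 assumes "compactin T K" "compactin T L" "openin T V" "\<one> \<in> V" shows "cov (K \<union> L) V \<le> cov K V + cov L V"
proof -
 obtain F where F: "finite F" "card F \<le> cov K V" "F \<subseteq> carrier G" "K \<subseteq> (\<Union>x\<in>F. tr x V)"
  using covers_cov[OF assms(1,3,4)] unfolding covers_def by blast
 obtain E where E: "finite E" "card E \<le> cov L V" "E \<subseteq> carrier G" "L \<subseteq> (\<Union>x\<in>E. tr x V)"
  using covers_cov[OF assms(2,3,4)] unfolding covers_def by blast
 have "card (F \<union> E) \<le> cov K V + cov L V" using card_Un_le[of F E] F E by linarith
 hence "covers (K \<union> L) V (cov K V + cov L V)" unfolding covers_def
  using F E by (intro exI[of _ "F \<union> E"]) auto
 thus ?thesis by (rule cov_le)
qed

lemma cov_tr_le: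
 assumes "x \<in> carrier G" "compactin T K" "openin T V" "\<one> \<in> V" shows "cov (tr x K) V \<le> cov K V"
proof -
 have VC: "V \<subseteq> carrier G" using openin_subset[OF assms(3)] top by simp
 obtain F where F: "finite F" "card F \<le> cov K V" "F \<subseteq> carrier G" "K \<subseteq> (\<Union>x\<in>F. tr x V)"
  using covers_cov[OF assms(2,3,4)] unfolding covers_def by blast
 have "tr x K \<subseteq> (\<Union>y\<in>tr x F. tr y V)"
 proof -
  have "tr x K \<subseteq> (\<Union>y\<in>F. tr x (tr y V))" using F(4) unfolding tr_def by blast
  also have "\<dots> = (\<Union>y\<in>F. tr (x \<otimes> y) V)" using tr_mult[OF assms(1) _ VC] F(3) by auto
  also have "\<dots> = (\<Union>y\<in>tr x F. tr y V)" unfolding tr_def[of x F] by simp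
  finally show ?thesis .
 qed
 moreover have "card (tr x F) \<le> cov K V" unfolding tr_def using card_image_le[OF F(1)] F(2) order_trans by blast
 moreover have "finite (tr x F)" unfolding tr_def using F(1) by simp
 ultimately have "covers (tr x K) V (cov K V)" unfolding covers_def using tr_sub[OF assms(1) F(3)] by blast
 thus ?thesis by (rule cov_le)
qed

lemma cov_tr:
 assumes "x \<in> carrier G" "compactin T K" "openin T V" "\<one> \<in> V" shows "cov (tr x K) V = cov K V"
proof (rule antisym[OF cov_tr_le[OF assms]])
 show "cov K V \<le> cov (tr x K) V"
  using compactin_subset_topspace[OF assms(2)] top tr_inv assms(1) cov_tr_le[OF inv_closed[OF assms(1)] tr_compact[OF assms(1,2)] assms(3,4)] by simp
qed

lemma cov_prod:
 assumes "compactin T K" "openin T W" "\<one> \<in> W" "W \<subseteq> L" "compactin T L" "openin T V" "\<one> \<in> V"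
 shows "cov K V \<le> cov K W * cov L V"
proof -
 have VC: "V \<subseteq> carrier G" using openin_subset[OF assms(6)] top by simp
 obtain F where F: "finite F" "card F \<le> cov K W" "F \<subseteq> carrier G" "K \<subseteq> (\<Union>x\<in>F. tr x W)"
  using covers_cov[OF assms(1-3)] unfolding covers_def by blast
 obtain E where E: "finite E" "card E \<le> cov L V" "E \<subseteq> carrier G" "L \<subseteq> (\<Union>x\<in>E. tr x V)"
  using covers_cov[OF assms(5-7)] unfolding covers_def by blast
 let ?H = "(\<lambda>(x, y). x \<otimes> y) ` (F \<times> E)"
 have "card ?H \<le> card (F \<times> E)" using F E by (intro card_image_le) auto
 also have "\<dots> \<le> cov K W * cov L V" using F(2) E(2) by (simp add: card_cartesian_product mult_le_mono)
 finally have c: "card ?H \<le> cov K W * cov L V" .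
 have "K \<subseteq> (\<Union>z\<in>?H. tr z V)"
 proof
  fix k assume "k \<in> K"
  then obtain x where x: "x \<in> F" "k \<in> tr x W" using F(4) by blast
  then obtain l where l: "l \<in> L" "k = x \<otimes> l" using tr_mono[OF assms(4)] unfolding tr_def by blast
  then obtain y where y: "y \<in> E" "l \<in> tr y V" using E(4) by blast
  have "k \<in> tr x (tr y V)" using l y unfolding tr_def[of x] by blast
  thus "k \<in> (\<Union>z\<in>?H. tr z V)" using tr_mult[OF _ _ VC] F(3) E(3) x(1) y(1) by blast
 qed
 moreover have "?H \<subseteq> carrier G" using F(3) E(3) by auto
 ultimately have "covers K V (cov K W * cov L V)" unfolding covers_def using c F(1) E(1) by (intro exI[of _ ?H]) auto
 thus ?thesis by (rule cov_le)
qed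

text \<open>Two points of the same translate of \<open>U\<close> differ by an element of \<open>U\<^sup>-\<^sup>1 U\<close>, which for small \<open>U\<close> avoids the compact set
 \<open>K\<^sup>-\<^sup>1 L\<close>; this set does not contain \<open>\<one>\<close>.\<close>

lemma separated:
 assumes K: "compactin T K" and L: "compactin T L" and disj: "K \<inter> L = {}"
 obtains U where "openin T U" "\<one> \<in> U" "!!x. x \<in> carrier G ==> tr x U \<inter> K = {} \<or> tr x U \<inter> L = {}"
proof -
 have sub: "K \<subseteq> carrier G" "L \<subseteq> carrier G" using compactin_subset_topspace[OF K] compactin_subset_topspace[OF L] top by auto
 have c: "continuous_map (prod_topology T T) T (\<lambda>(x, y). inv x \<otimes> y)"
 proof -
  have "continuous_map (prod_topology T T) (prod_topology T T) (\<lambda>p. (inv (fst p), snd p))"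
   by (intro continuous_map_pairedI continuous_map_compose[OF continuous_map_fst cont_inv, unfolded o_def] continuous_map_snd)
  from continuous_map_compose[OF this cont_mult] show ?thesis by (simp add: o_def case_prod_unfold)
 qed
 define Q where "Q = (\<lambda>(x, y). inv x \<otimes> y) ` (K \<times> L)"
 have "compactin T Q" using K L c unfolding Q_def by (metis image_compactin compactin_Times)
 hence o: "openin T (topspace T - Q)" using Hausdorff compactin_imp_closedin by auto
 have "\<one> \<notin> Q"
 proof
  assume "\<one> \<in> Q"
  then obtain k l where kl: "k \<in> K" "l \<in> L" "inv k \<otimes> l = \<one>" unfolding Q_def by auto
  hence "l = k" using sub inv_solve_left[of \<one> k l] by auto
  thus False using kl disj by blast
 qed
 hence m1: "(\<one>, \<one>) \<in> {p \<in> topspace (prod_topology T T). (\<lambda>(x, y). inv x \<otimes> y) p \<in> topspace T - Q}"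
  using top by simp
 have m2: "openin (prod_topology T T) {p \<in> topspace (prod_topology T T). (\<lambda>(x, y). inv x \<otimes> y) p \<in> topspace T - Q}"
  by (rule openin_continuous_map_preimage[OF c o])
 obtain A B where AB: "openin T A" "openin T B" "\<one> \<in> A" "\<one> \<in> B"
  "A \<times> B \<subseteq> {p \<in> topspace (prod_topology T T). (\<lambda>(x, y). inv x \<otimes> y) p \<in> topspace T - Q}"
  using m2[unfolded openin_prod_topology_alt, rule_format, OF m1] by blast
 show ?thesis
 proof (rule that[of "A \<inter> B"])
  show "openin T (A \<inter> B)" "\<one> \<in> A \<inter> B" using AB by auto
  fix x assume x: "x \<in> carrier G"
  show "tr x (A \<inter> B) \<inter> K = {} \<or> tr x (A \<inter> B) \<inter> L = {}"
  proof (rule ccontr)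
   assume "\<not> ?thesis"
   then obtain u v where uv: "u \<in> A \<inter> B" "x \<otimes> u \<in> K" "v \<in> A \<inter> B" "x \<otimes> v \<in> L" unfolding tr_def by blast
   have uvC: "u \<in> carrier G" "v \<in> carrier G" using uv openin_subset[OF AB(1)] top by auto
   have "inv (x \<otimes> u) \<otimes> (x \<otimes> v) = inv u \<otimes> v"
    using x uvC by (simp add: inv_mult_group m_assoc) (simp add: m_assoc[symmetric])
   hence "inv u \<otimes> v \<in> Q" unfolding Q_def using uv by (intro image_eqI[of _ _ "(x \<otimes> u, x \<otimes> v)"]) auto
   moreover have "(u, v) \<in> A \<times> B" using uv by blast
   ultimately show False using AB(5) by auto
  qed
 qed
qed

lemma cov_separated:
 assumes K: "compactin T K" and L: "compactin T L" and V: "openin T V" "\<one> \<in> V"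
  and sep: "!!x. x \<in> carrier G ==> tr x V \<inter> K = {} \<or> tr x V \<inter> L = {}"
 shows "cov K V + cov L V \<le> cov (K \<union> L) V"
proof -
 obtain F where F: "finite F" "card F \<le> cov (K \<union> L) V" "F \<subseteq> carrier G" "K \<union> L \<subseteq> (\<Union>x\<in>F. tr x V)"
  using covers_cov[OF compactin_Un[OF K L] V] unfolding covers_def by blast
 define F1 where "F1 = {x\<in>F. tr x V \<inter> K ~= {}}"
 define F2 where "F2 = {x\<in>F. tr x V \<inter> L ~= {}}"
 have "F1 \<inter> F2 = {}" unfolding F1_def F2_def using sep F(3) by blast
 hence "card F1 + card F2 = card (F1 \<union> F2)" using F(1) unfolding F1_def F2_def by (intro card_Un_disjoint[symmetric]) auto
 also have "\<dots> \<le> card F" using F(1) unfolding F1_def F2_def by (intro card_mono) auto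
 finally have c: "card F1 + card F2 \<le> cov (K \<union> L) V" using F(2) by simp
 have "K \<subseteq> (\<Union>x\<in>F1. tr x V)" "L \<subseteq> (\<Union>x\<in>F2. tr x V)" using F(4) unfolding F1_def F2_def by blast+
 moreover have "finite F1" "F1 \<subseteq> carrier G" "finite F2" "F2 \<subseteq> carrier G" using F(1,3) unfolding F1_def F2_def by auto
 ultimately have "covers K V (card F1)" "covers L V (card F2)" unfolding covers_def by blast+
 thus ?thesis using cov_le c by (meson add_mono order_trans)
qed

text \<open>The normalised covering numbers of the members of a neighbourhood basis have a cluster point by Tychonoff's theorem;
 it is a left-invariant content on compact sets.\<close>

lemma ex_content:
 obtains h :: "'g set => real" and K0 where "compactin T K0" "h K0 = 1" "!!K. compactin T K ==> 0 \<le> h K"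
  "!!K L. compactin T K ==> compactin T L ==> K \<subseteq> L ==> h K \<le> h L"
  "!!K L. compactin T K ==> compactin T L ==> h (K \<union> L) \<le> h K + h L"
  "!!K L. compactin T K ==> compactin T L ==> K \<inter> L = {} ==> h K + h L \<le> h (K \<union> L)"
  "!!x K. x \<in> carrier G ==> compactin T K ==> h (tr x K) = h K"
proof -
 obtain V :: "nat => 'g set" where V: "!!n. openin T (V n)" "!!n. \<one> \<in> V n"
  "!!U. openin T U ==> \<one> \<in> U ==> \<exists>n. \<forall>k\<ge>n. V k \<subseteq> U" by (rule ex_basis, rule that)
 obtain W K0 where W: "openin T W" "compactin T K0" "\<one> \<in> W" "W \<subseteq> K0"
  using locally_compact top one_closed unfolding locally_compact_space_def by metis
 define c where "c K = real (cov K W)" for K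
 define hn where "hn n K = real (cov K (V n)) / real (cov K0 (V n))" for n K
 have K0pos: "cov K0 (V n) > 0" for n
 proof (rule ccontr)
  assume "\<not> ?thesis"
  thus False using covers_cov[OF W(2) V(1,2)[of n]] W(3,4) unfolding covers_def by auto
 qed
 have hn_bd: "hn n K \<in> {0..c K}" if "compactin T K" for n K
 proof -
  have "real (cov K (V n)) \<le> c K * real (cov K0 (V n))"
   using cov_prod[OF that W(1,3,4,2) V(1,2)[of n]] unfolding c_def by (metis of_nat_le_iff of_nat_mult)
  thus ?thesis unfolding hn_def using K0pos[of n] by (auto simp: field_simps)
 qed
 let ?K = "Collect (compactin T)"
 let ?P = "product_topology (\<lambda>K. top_of_set {0..c K}) ?K"
 have "compact_space (top_of_set {0..c K})" for K by (rule compact_space_subtopology) simp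
 hence "compact_space ?P" unfolding compact_space_product_topology by simp
 define f where "f n = (\<lambda>K\<in>?K. hn n K)" for n
 have fP: "f n \<in> topspace ?P" for n unfolding f_def using hn_bd[of _ n] by simp
 define C where "C n = ?P closure_of (f ` {n..})" for n
 have "(\<Inter>n. C n) ~= {}"
 proof (rule compact_space_imp_nest[OF \<open>compact_space ?P\<close>])
  show "closedin ?P (C n)" for n unfolding C_def by simp
  have "f n \<in> C n" for n unfolding C_def using closure_of_subset[of "f ` {n..}" ?P] fP by blast
  thus "C n ~= {}" for n by blast
  show "decseq C" unfolding decseq_def C_def by (intro allI impI closure_of_mono) auto
 qed
 then obtain h where h: "!!n. h \<in> C n" by blast
 have approx: "\<exists>m\<ge>n. \<bar>hn m K - h K\<bar> < e \<and> \<bar>hn m L - h L\<bar> < e \<and> \<bar>hn m J - h J\<bar> < e"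
  if "compactin T K" "compactin T L" "compactin T J" "e > 0" for K L J e n
 proof -
  have o: "openin ?P {g \<in> topspace ?P. g K \<in> {0..c K} \<inter> ball (h K) e}" if "compactin T K" for K
  proof (rule openin_continuous_map_preimage)
   show "continuous_map ?P (top_of_set {0..c K}) (\<lambda>g. g K)"
    using continuous_map_product_projection[of K ?K "\<lambda>K. top_of_set {0..c K}"] that by simp
   show "openin (top_of_set {0..c K}) ({0..c K} \<inter> ball (h K) e)" by (simp add: openin_open_Int)
  qed
  have hP: "h \<in> topspace ?P" using h[of 0] closure_of_subset_topspace[of ?P] unfolding C_def by blast
  let ?U = "\<lambda>K. {g \<in> topspace ?P. g K \<in> {0..c K} \<inter> ball (h K) e}"
  have "h K \<in> {0..c K}" if "compactin T K" for K using hP that by (auto simp: PiE_iff)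
  hence 1: "h \<in> ?U K \<inter> ?U L \<inter> ?U J" using that hP by simp
  have 2: "openin ?P (?U K \<inter> ?U L \<inter> ?U J)" using o that by (intro openin_Int) auto
  have "\<forall>U. h \<in> U \<and> openin ?P U --> (\<exists>y. y \<in> f ` {n..} \<and> y \<in> U)"
   using h[of n] unfolding C_def in_closure_of by (rule conjunct2)
  from this[THEN spec, THEN mp, OF conjI[OF 1 2]]
  obtain m where "m \<ge> n" "f m \<in> ?U K \<inter> ?U L \<inter> ?U J" by blast
  thus ?thesis using that(1-3) unfolding f_def by (auto simp: dist_real_def intro!: exI[of _ m])
 qed
 have le: "h K + h L \<le> h J" if A: "compactin T K" "compactin T L" "compactin T J" "!!n. n \<ge> N ==> hn n K + hn n L \<le> hn n J" for K L J N
 proof (rule field_le_epsilon)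
  fix e :: real assume "e > 0"
  then obtain k where k: "k \<ge> N" "\<bar>hn k K - h K\<bar> < e / 3" "\<bar>hn k L - h L\<bar> < e / 3" "\<bar>hn k J - h J\<bar> < e / 3"
   using approx[OF A(1-3), of "e / 3" N] by auto
  thus "h K + h L \<le> h J + e" using A(4)[OF k(1)] by linarith
 qed
 have ge: "h J \<le> h K + h L" if A: "compactin T K" "compactin T L" "compactin T J" "!!n. hn n J \<le> hn n K + hn n L" for K L J
 proof (rule field_le_epsilon)
  fix e :: real assume "e > 0"
  then obtain k where k: "\<bar>hn k K - h K\<bar> < e / 3" "\<bar>hn k L - h L\<bar> < e / 3" "\<bar>hn k J - h J\<bar> < e / 3"
   using approx[OF A(1-3), of "e / 3" 0] by auto
  thus "h J \<le> h K + h L + e" using A(4)[of k] by linarith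
 qed
 have emp: "compactin T {}" by simp
 have cov0: "cov {} V = 0" for V using cov_le[of "{}" V 0] unfolding covers_def by (metis card.empty empty_subsetI finite.emptyI le_zero_eq order_refl)
 have hn0: "hn n {} = 0" for n unfolding hn_def cov0 by simp
 have h0: "h {} = 0" using le[OF emp emp emp, of 0] ge[OF emp emp emp] hn0 by simp
 have mono1: "h K \<le> h L" if "compactin T K" "compactin T L" "!!n. hn n K \<le> hn n L" for K L
  using ge[OF that(2) emp that(1)] that(3) hn0 h0 by simp
 show ?thesis
 proof (rule that[of K0 h])
  show "compactin T K0" by (rule W(2))
  have "hn n K0 = 1" for n unfolding hn_def using K0pos[of n] by simp
  hence "\<bar>1 - h K0\<bar> < e" if "e > 0" for e using approx[OF W(2) W(2) W(2) that, of 0] by auto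
  thus "h K0 = 1" by (metis abs_le_zero_iff eq_iff_diff_eq_0 less_irrefl linorder_not_le)
  show "0 \<le> h K" if "compactin T K" for K using mono1[OF emp that] hn_bd[OF that] hn0 h0 by auto
  show "h K \<le> h L" if "compactin T K" "compactin T L" "K \<subseteq> L" for K L
  proof (rule mono1[OF that(1,2)])
   show "hn n K \<le> hn n L" for n unfolding hn_def
    using cov_mono[OF that(2) V(1,2)[of n] that(3)] by (intro divide_right_mono) auto
  qed
  show "h (K \<union> L) \<le> h K + h L" if KL: "compactin T K" "compactin T L" for K L
  proof (rule ge[OF KL compactin_Un[OF KL]])
   show "hn n (K \<union> L) \<le> hn n K + hn n L" for n unfolding hn_def add_divide_distrib[symmetric]
    using cov_Un[OF KL V(1,2)[of n]] by (intro divide_right_mono) auto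
  qed
  show "h K + h L \<le> h (K \<union> L)" if KL: "compactin T K" "compactin T L" and d: "K \<inter> L = {}" for K L
  proof -
   obtain U where U: "openin T U" "\<one> \<in> U" "!!x. x \<in> carrier G ==> tr x U \<inter> K = {} \<or> tr x U \<inter> L = {}"
    by (rule separated[OF KL d], rule that)
   obtain N where N: "!!n. n \<ge> N ==> V n \<subseteq> U" using V(3)[OF U(1,2)] by blast
   show ?thesis
   proof (rule le[OF KL compactin_Un[OF KL]])
    fix n assume "n \<ge> N"
    hence "tr x (V n) \<inter> K = {} \<or> tr x (V n) \<inter> L = {}" if "x \<in> carrier G" for x
     using U(3)[OF that] tr_mono[OF N[of n], of x] by blast
    from cov_separated[OF KL V(1,2)[of n] this] have "cov K (V n) + cov L (V n) \<le> cov (K \<union> L) (V n)" .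
    thus "hn n K + hn n L \<le> hn n (K \<union> L)" unfolding hn_def add_divide_distrib[symmetric]
     by (intro divide_right_mono) (auto simp flip: of_nat_add)
   qed
  qed
  show "h (tr x K) = h K" if "x \<in> carrier G" "compactin T K" for x K
  proof (rule antisym)
   have "hn n (tr x K) = hn n K" for n unfolding hn_def using cov_tr[OF that V(1,2)[of n]] by simp
   thus "h (tr x K) \<le> h K" "h K \<le> h (tr x K)"
    using mono1[OF tr_compact[OF that] that(2)] mono1[OF that(2) tr_compact[OF that]] by auto
  qed
 qed
qed

text \<open>Makes the inner content of open sets subadditive.\<close>

lemma compact_split:
 assumes K: "compactin T K" and U: "openin T U" and V: "openin T V" and sub: "K \<subseteq> U \<union> V"
 obtains K1 K2 where "compactin T K1" "compactin T K2" "K1 \<subseteq> U" "K2 \<subseteq> V" "K = K1 \<union> K2"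
proof -
 have c: "compactin T (K - W)" if "openin T W" for W
 proof -
  have "K - W = K \<inter> (topspace T - W)" using compactin_subset_topspace[OF K] by blast
  moreover have "closedin T (topspace T - W)" using that by blast
  ultimately show ?thesis using compact_Int_closedin[OF K] by simp
 qed
 have "disjnt (K - U) (K - V)" using sub unfolding disjnt_def by blast
 then obtain A B where AB: "openin T A" "openin T B" "K - U \<subseteq> A" "K - V \<subseteq> B" "disjnt A B"
  using Hausdorff c[OF U] c[OF V] unfolding Hausdorff_space_compact_sets by metis
 show ?thesis
 proof (rule that[OF c[OF AB(1)] c[OF AB(2)]])
  show "K - A \<subseteq> U" "K - B \<subseteq> V" using AB by auto
  show "K = (K - A) \<union> (K - B)" using AB unfolding disjnt_def by blast
 qed
qed

text \<open>The content gives an inner content \<open>ho\<close> of open sets and by outer regularity an outer measure \<open>\<mu>\<close>. Open sets are measurable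
 in the sense of Caratheodory, since \<open>\<mu>\<close> is superadditive when an open set is cut by an open set. Second countability makes the
 restriction to the Borel sets sigma-finite.\<close>

theorem ex_Haar:
 obtains lam where "space lam = carrier G" "sets lam = sets (borel_of T)" "sigma_finite_measure lam"
  "emeasure lam (carrier G) ~= 0" "!!x A. x \<in> carrier G ==> A \<in> sets lam ==> emeasure lam (tr x A) = emeasure lam A"
proof -
 obtain h :: "'g set => real" and K0 where K0: "compactin T K0" "h K0 = 1"
  and pos: "!!K. compactin T K ==> 0 \<le> h K"
  and mono: "!!K L. compactin T K ==> compactin T L ==> K \<subseteq> L ==> h K \<le> h L"
  and sub: "!!K L. compactin T K ==> compactin T L ==> h (K \<union> L) \<le> h K + h L"
  and add: "!!K L. compactin T K ==> compactin T L ==> K \<inter> L = {} ==> h K + h L \<le> h (K \<union> L)"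
  and inva: "!!x K. x \<in> carrier G ==> compactin T K ==> h (tr x K) = h K"
  by (rule ex_content, rule that)
 define ho where "ho U = (SUP K\<in>{K. compactin T K \<and> K \<subseteq> U}. ennreal (h K))" for U
 have ho_ge: "ennreal (h K) \<le> ho U" if "compactin T K" "K \<subseteq> U" for K U
  unfolding ho_def using that by (intro SUP_upper) auto
 have ho_le: "ho U \<le> c" if "!!K. compactin T K ==> K \<subseteq> U ==> ennreal (h K) \<le> c" for U c
  unfolding ho_def using that by (intro SUP_least) auto
 have ho_mono: "ho U \<le> ho V" if "U \<subseteq> V" for U V using that by (intro ho_le ho_ge) auto
 have ho_Un: "ho (U \<union> V) \<le> ho U + ho V" if UV: "openin T U" "openin T V" for U V
 proof (rule ho_le)
  fix K assume K: "compactin T K" "K \<subseteq> U \<union> V"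
  obtain K1 K2 where k: "compactin T K1" "compactin T K2" "K1 \<subseteq> U" "K2 \<subseteq> V" "K = K1 \<union> K2"
   by (rule compact_split[OF K(1) UV K(2)])
  have "ennreal (h K) \<le> ennreal (h K1) + ennreal (h K2)"
   using sub[OF k(1,2)] k(5) pos[OF k(1)] pos[OF k(2)] by (simp flip: ennreal_plus add: ennreal_leI)
  also have "\<dots> \<le> ho U + ho V" using ho_ge k by (intro add_mono) auto
  finally show "ennreal (h K) \<le> ho U + ho V" .
 qed
 have h0: "h {} = 0" using add[of "{}" "{}"] pos[of "{}"] by simp
 have ho0: "ho {} = 0"
 proof -
  have "ho {} \<le> 0" by (rule ho_le) (simp add: h0)
  thus ?thesis by simp
 qed
 have ho_fin: "ho (\<Union>i<n. U i) \<le> (\<Sum>i<n. ho (U i))" if U: "!!i. openin T (U i)" for U and n :: nat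
 proof (induction n)
  case (Suc n)
  have "ho (\<Union>i<Suc n. U i) = ho ((\<Union>i<n. U i) \<union> U n)" by (simp add: lessThan_Suc Un_commute)
  also have "\<dots> \<le> ho (\<Union>i<n. U i) + ho (U n)" using U by (intro ho_Un openin_Union) auto
  finally show ?case using Suc by (simp add: add_right_mono order_trans)
 qed (simp add: ho0)
 have ho_UN: "ho (\<Union>i. U i) \<le> (\<Sum>i. ho (U i))" if U: "!!i. openin T (U i)" for U :: "nat => 'g set"
 proof (rule ho_le)
  fix K assume K: "compactin T K" "K \<subseteq> (\<Union>i. U i)"
  have "\<forall>V\<in>range U. openin T V" using U by blast
  then obtain \<F> where F: "finite \<F>" "\<F> \<subseteq> range U" "K \<subseteq> \<Union>\<F>" using K unfolding compactin_def by metis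
  obtain F where F': "finite F" "\<F> = U ` F" using F(1,2) by (meson finite_subset_image)
  obtain n where "F \<subseteq> {..<n}" using finite_nat_iff_bounded[of F] F' by blast
  hence "K \<subseteq> (\<Union>i<n. U i)" using F(3) F' by blast
  hence "ennreal (h K) \<le> ho (\<Union>i<n. U i)" by (rule ho_ge[OF K(1)])
  also have "\<dots> \<le> (\<Sum>i<n. ho (U i))" by (rule ho_fin[OF U])
  also have "\<dots> \<le> (\<Sum>i. ho (U i))" by (rule sum_le_suminf) auto
  finally show "ennreal (h K) \<le> (\<Sum>i. ho (U i))" .
 qed
 define \<mu> where "\<mu> A = (INF U\<in>{U. openin T U \<and> A \<subseteq> U}. ho U)" for A
 have \<mu>_le: "\<mu> A \<le> ho U" if "openin T U" "A \<subseteq> U" for A U unfolding \<mu>_def using that by (intro INF_lower) auto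
 have \<mu>_ge: "c \<le> \<mu> A" if "!!U. openin T U ==> A \<subseteq> U ==> c \<le> ho U" for A c unfolding \<mu>_def using that by (intro INF_greatest) auto
 have \<mu>_open: "\<mu> U = ho U" if "openin T U" for U using that \<mu>_le[of U U] \<mu>_ge[of U "ho U"] ho_mono by (intro antisym) auto
 have \<mu>_mono: "\<mu> A \<le> \<mu> B" if "A \<subseteq> B" for A B using that by (intro \<mu>_ge \<mu>_le) auto
 have \<mu>0: "\<mu> {} = 0" using \<mu>_open[of "{}"] ho0 by simp
 have csub: "\<mu> (\<Union>i. A i) \<le> (\<Sum>i. \<mu> (A i))" if A: "range A \<subseteq> Pow (carrier G)" for A :: "nat => 'g set"
 proof (rule ennreal_le_epsilon)
  fix e :: real assume e: "0 < e" "(\<Sum>n. \<mu> (A n)) < Orderings.top"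
  hence *: "\<mu> (A n) < \<mu> (A n) + e * (1/2)^Suc n" for n
   by (auto simp add: less_top dest!: ennreal_suminf_lessD)
  have "\<exists>U. openin T U \<and> A n \<subseteq> U \<and> ho U \<le> \<mu> (A n) + e * (1/2)^Suc n" for n
   using *[of n] unfolding \<mu>_def[of "A n"] INF_less_iff by (auto intro: less_imp_le)
  then obtain U where U: "!!n. openin T (U n)" "!!n. A n \<subseteq> U n" "!!n. ho (U n) \<le> \<mu> (A n) + e * (1/2)^Suc n" by metis
  have "\<mu> (\<Union>i. A i) \<le> ho (\<Union>i. U i)" using U by (intro \<mu>_le openin_Union) auto
  also have "\<dots> \<le> (\<Sum>i. ho (U i))" by (rule ho_UN[OF U(1)])
  also have "\<dots> \<le> (\<Sum>n. \<mu> (A n) + e * (1/2) ^ Suc n)" by (intro suminf_le U(3)) auto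
  also have "\<dots> = (\<Sum>n. \<mu> (A n)) + (\<Sum>n. ennreal e * ennreal ((1/2) ^ Suc n))"
   using \<open>0 < e\<close> by (subst suminf_add[symmetric])
            (auto simp del: ennreal_suminf_cmult simp add: ennreal_mult[symmetric])
  also have "\<dots> = (\<Sum>n. \<mu> (A n)) + e"
   unfolding ennreal_suminf_cmult
   by (subst suminf_ennreal_eq[OF zero_le_power power_half_series]) auto
  finally show "\<mu> (\<Union>i. A i) \<le> (\<Sum>n. \<mu> (A n)) + e" .
 qed
 have oms: "outer_measure_space (Pow (carrier G)) \<mu>"
  unfolding outer_measure_space_def positive_def increasing_def countably_subadditive_def
  using \<mu>0 \<mu>_mono csub by (intro conjI ballI allI impI) auto
 let ?L = "lambda_system (carrier G) (Pow (carrier G)) \<mu>"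
 interpret P: sigma_algebra "carrier G" "Pow (carrier G)" by (rule sigma_algebra_Pow)
 have ms: "measure_space (carrier G) ?L \<mu>" by (rule P.caratheodory_lemma[OF oms])
 have Un: "\<mu> (A \<union> B) \<le> \<mu> A + \<mu> B" if "A \<subseteq> carrier G" "B \<subseteq> carrier G" for A B
 proof -
  have "subadditive (Pow (carrier G)) \<mu>"
   using P.countably_subadditive_subadditive oms unfolding outer_measure_space_def by blast
  moreover have "A \<inter> (B - A) = {}" "A \<in> Pow (carrier G)" "B - A \<in> Pow (carrier G)" using that by auto
  ultimately have "\<mu> (A \<union> (B - A)) \<le> \<mu> A + \<mu> (B - A)" unfolding subadditive_def by blast
  also have "\<dots> \<le> \<mu> A + \<mu> B" by (intro add_left_mono \<mu>_mono) auto
  finally show ?thesis by simp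
 qed
 have openL: "W \<in> ?L" if W: "openin T W" for W
 proof -
  have WC: "W \<subseteq> carrier G" using openin_subset[OF W] top by simp
  have key: "\<mu> (U \<inter> W) + \<mu> (U - W) \<le> ho U" if U: "openin T U" for U
  proof -
   have step: "ennreal (h K) + \<mu> (U - W) \<le> ho U" if K: "compactin T K" "K \<subseteq> U \<inter> W" for K
   proof -
    have oUK: "openin T (U - K)" using compactin_imp_closedin[OF Hausdorff K(1)] U by (simp add: openin_diff)
    have "\<mu> (U - W) \<le> ho (U - K)" using \<mu>_le[OF oUK, of "U - W"] K by blast
    hence "ennreal (h K) + \<mu> (U - W) \<le> ennreal (h K) + ho (U - K)" by (rule add_left_mono)
    also have "\<dots> \<le> ho U"
    proof -
     have "(SUP L\<in>{L. compactin T L \<and> L \<subseteq> U - K}. ennreal (h K) + ennreal (h L)) \<le> ho U"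
     proof (rule SUP_least)
      fix L assume "L \<in> {L. compactin T L \<and> L \<subseteq> U - K}"
      hence L: "compactin T L" "L \<subseteq> U - K" by auto
      have "h K + h L \<le> h (K \<union> L)" using L by (intro add[OF K(1)]) auto
      hence "ennreal (h K) + ennreal (h L) \<le> ennreal (h (K \<union> L))"
       using pos[OF K(1)] pos[OF L(1)] by (simp flip: ennreal_plus add: ennreal_leI)
      also have "\<dots> \<le> ho U" using K L by (intro ho_ge compactin_Un) auto
      finally show "ennreal (h K) + ennreal (h L) \<le> ho U" .
     qed
     moreover have "{L. compactin T L \<and> L \<subseteq> U - K} ~= {}" by (auto intro!: exI[of _ "{}"])
     ultimately show ?thesis unfolding ho_def[of "U - K"] by (simp add: ennreal_SUP_add_right)
    qed
    finally show ?thesis .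
   qed
   have "openin T (U \<inter> W)" using U W by auto
   hence "\<mu> (U \<inter> W) = (SUP K\<in>{K. compactin T K \<and> K \<subseteq> U \<inter> W}. ennreal (h K))" using \<mu>_open ho_def by simp
   moreover have "{K. compactin T K \<and> K \<subseteq> U \<inter> W} ~= {}" by (auto intro!: exI[of _ "{}"])
   ultimately have "\<mu> (U \<inter> W) + \<mu> (U - W) = (SUP K\<in>{K. compactin T K \<and> K \<subseteq> U \<inter> W}. ennreal (h K) + \<mu> (U - W))"
    by (simp add: ennreal_SUP_add_left)
   also have "\<dots> \<le> ho U" using step by (intro SUP_least) auto
   finally show ?thesis .
  qed
  have "\<mu> (A \<inter> W) + \<mu> (A - W) = \<mu> A" if A: "A \<subseteq> carrier G" for A
  proof (rule antisym)
   show "\<mu> (A \<inter> W) + \<mu> (A - W) \<le> \<mu> A"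
   proof (rule \<mu>_ge)
    fix U assume U: "openin T U" "A \<subseteq> U"
    have "\<mu> (A \<inter> W) + \<mu> (A - W) \<le> \<mu> (U \<inter> W) + \<mu> (U - W)" using U by (intro add_mono \<mu>_mono) auto
    thus "\<mu> (A \<inter> W) + \<mu> (A - W) \<le> ho U" using key[OF U(1)] by simp
   qed
   have "A = (A \<inter> W) \<union> (A - W)" by blast
   thus "\<mu> A \<le> \<mu> (A \<inter> W) + \<mu> (A - W)" using Un[of "A \<inter> W" "A - W"] A by auto
  qed
  thus ?thesis unfolding P.lambda_system_eq using WC by simp
 qed
 have "sigma_algebra (carrier G) ?L" using ms unfolding measure_space_def by blast
 then interpret L: sigma_algebra "carrier G" ?L .
 let ?B = "sigma_sets (carrier G) {U. openin T U}"
 have BL: "?B \<subseteq> ?L" using openL by (intro L.sigma_sets_subset) auto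
 have opens: "{U. openin T U} \<subseteq> Pow (carrier G)" using openin_subset top by auto
 have msB: "measure_space (carrier G) ?B \<mu>"
  using ms BL sigma_algebra_sigma_sets[OF opens] unfolding measure_space_def positive_def countably_additive_def by (auto simp: subset_iff)
 define lam where "lam = measure_of (carrier G) ?B \<mu>"
 have sp: "space lam = carrier G" unfolding lam_def using sigma_sets_into_sp[OF opens] by (intro space_measure_of) auto
 have bo: "sets (borel_of T) = ?B" unfolding borel_of_def top using opens by (simp add: sets_measure_of)
 have se: "sets lam = ?B" unfolding lam_def using msB by (simp add: measure_space_def sigma_algebra.sets_measure_of_eq)
 have em: "emeasure lam A = \<mu> A" if "A \<in> ?B" for A
  unfolding lam_def using msB that unfolding measure_space_def by (intro emeasure_measure_of_sigma) auto
 have ge1: "1 \<le> \<mu> (carrier G)"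
 proof (rule \<mu>_ge)
  fix U assume "openin T U" "carrier G \<subseteq> U"
  hence "ennreal (h K0) \<le> ho U" using compactin_subset_topspace[OF K0(1)] top by (intro ho_ge[OF K0(1)]) auto
  thus "1 \<le> ho U" using K0 by simp
 qed
 have carB: "carrier G \<in> ?B" by (rule sigma_sets_top)
 have inv_\<mu>: "\<mu> (tr x A) \<le> \<mu> A" if x: "x \<in> carrier G" "A \<subseteq> carrier G" for x A
 proof (rule \<mu>_ge)
  fix U assume U: "openin T U" "A \<subseteq> U"
  have UC: "U \<subseteq> carrier G" using openin_subset[OF U(1)] top by simp
  have "\<mu> (tr x A) \<le> ho (tr x U)" using U x by (intro \<mu>_le tr_open tr_mono)
  also have "\<dots> \<le> ho U"
  proof (rule ho_le)
   fix K assume K: "compactin T K" "K \<subseteq> tr x U"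
   have KC: "K \<subseteq> carrier G" using compactin_subset_topspace[OF K(1)] top by simp
   have ix: "inv x \<in> carrier G" using x by simp
   have "tr (inv x) K \<subseteq> U" using tr_mono[OF K(2), of "inv x"] tr_inv[OF x(1) UC] by simp
   hence "ennreal (h (tr (inv x) K)) \<le> ho U" by (rule ho_ge[OF tr_compact[OF ix K(1)]])
   thus "ennreal (h K) \<le> ho U" using inva[OF ix K(1)] by simp
  qed
  finally show "\<mu> (tr x A) \<le> ho U" .
 qed
 have inv_eq: "\<mu> (tr x A) = \<mu> A" if x: "x \<in> carrier G" "A \<subseteq> carrier G" for x A
 proof (rule antisym[OF inv_\<mu>[OF x]])
  have "\<mu> (tr (inv x) (tr x A)) \<le> \<mu> (tr x A)" using x tr_sub by (intro inv_\<mu>) auto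
  thus "\<mu> A \<le> \<mu> (tr x A)" using tr_inv[OF x] by simp
 qed
 have trB: "tr x A \<in> ?B" if x: "x \<in> carrier G" and A: "A \<in> ?B" for x A
  using A
 proof (induction rule: sigma_sets.induct)
  case (Basic a) thus ?case using tr_open[OF x] by (auto intro: sigma_sets.Basic)
 next
  case Empty thus ?case unfolding tr_def by (simp add: sigma_sets.Empty)
 next
  case (Compl a)
  have aC: "a \<subseteq> carrier G" using sigma_sets_into_sp[OF opens] Compl by auto
  have "tr x (carrier G - a) = carrier G - tr x a"
  proof
   show "tr x (carrier G - a) \<subseteq> carrier G - tr x a" unfolding tr_def using x aC by auto
   show "carrier G - tr x a \<subseteq> tr x (carrier G - a)"
   proof
    fix y assume y: "y \<in> carrier G - tr x a"
    hence e: "y = x \<otimes> (inv x \<otimes> y)" using x by (simp add: m_assoc[symmetric])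
    moreover have "inv x \<otimes> y \<notin> a" using y e unfolding tr_def by blast
    ultimately show "y \<in> tr x (carrier G - a)" unfolding tr_def using x y by blast
   qed
  qed
  thus ?case using Compl by (auto intro: sigma_sets.Compl)
 next
  case (Union a)
  have "tr x (\<Union>i. a i) = (\<Union>i. tr x (a i))" unfolding tr_def by blast
  thus ?case using Union by (auto intro: sigma_sets.Union)
 qed
 have sf: "sigma_finite_measure lam"
 proof
  have "\<forall>x\<in>topspace T. \<exists>U. openin T U \<and> x \<in> U \<and> \<mu> U < \<infinity>"
  proof
   fix x assume "x \<in> topspace T"
   then obtain U K where U: "openin T U" "compactin T K" "x \<in> U" "U \<subseteq> K"
    using locally_compact unfolding locally_compact_space_def by metis
   have "ho U \<le> ennreal (h K)" using U mono pos by (intro ho_le ennreal_leI) auto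
   hence "\<mu> U < \<infinity>" using \<mu>_open[OF U(1)] by (simp add: le_less_trans)
   thus "\<exists>U. openin T U \<and> x \<in> U \<and> \<mu> U < \<infinity>" using U by blast
  qed
  hence "\<Union>{U. openin T U \<and> \<mu> U < \<infinity>} = topspace T" by (auto dest: openin_subset)
  moreover have "Lindelof_space T" using second_countable second_countable_imp_Lindelof_space by blast
  ultimately obtain \<V> where V: "countable \<V>" "\<V> \<subseteq> {U. openin T U \<and> \<mu> U < \<infinity>}" "\<Union>\<V> = topspace T"
   unfolding Lindelof_space_def by (auto dest!: spec[of _ "{U. openin T U \<and> \<mu> U < \<infinity>}"])
  show "\<exists>A. countable A \<and> A \<subseteq> sets lam \<and> \<Union>A = space lam \<and> (\<forall>a\<in>A. emeasure lam a ~= \<infinity>)"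
  proof (intro exI[of _ \<V>] conjI ballI)
   have VB: "a \<in> ?B" "\<mu> a < \<infinity>" if "a \<in> \<V>" for a
    using V(2) that by (auto intro: sigma_sets.Basic)
   thus "\<V> \<subseteq> sets lam" unfolding se by blast
   show "emeasure lam a ~= \<infinity>" if "a \<in> \<V>" for a using em[OF VB(1)[OF that]] VB(2)[OF that] by simp
  qed (use V sp top in auto)
 qed
 show ?thesis
 proof (rule that[OF sp _ sf])
  show "sets lam = sets (borel_of T)" using se bo by simp
  show "emeasure lam (carrier G) ~= 0" using em[OF carB] ge1 by auto
  fix x A assume x: "x \<in> carrier G" and A: "A \<in> sets lam"
  have "A \<subseteq> carrier G" using A sets.sets_into_space sp by blast
  thus "emeasure lam (tr x A) = emeasure lam A"
   using em[of A] em[OF trB[OF x, of A]] A se inv_eq[OF x, of A] by simp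
 qed
qed

end

section \<open>Invariant fields over probability-measure-preserving actions\<close>

text \<open>By the parallelogram identity almost norm-minimal elements of the sets form a fast Cauchy sequence in \<open>L\<^sup>2\<close>. Passing to
 sufficiently late sets makes the increments summable, which gives convergence almost everywhere and not only in norm.\<close>

lemma (in prob_space) convex_minimisers_converge:
 fixes C :: "nat => ('a => real) set"
 assumes meas: "!!n f. f \<in> C n ==> f \<in> borel_measurable M"
  and bd: "!!n f x. f \<in> C n ==> x \<in> space M ==> 0 \<le> f x \<and> f x \<le> 1"
  and dec: "!!n. C (Suc n) \<subseteq> C n" and ne: "!!n. C n ~= {}"
  and mid: "!!n f g. f \<in> C n ==> g \<in> C n ==> (\<lambda>x. (f x + g x) / 2) \<in> C n"
 obtains u where "!!j. u j \<in> C j" "AE x in M. convergent (\<lambda>j. u j x)"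
proof -
 define N where "N f = (\<integral>x. (f x)\<^sup>2 \<partial>M)" for f :: "'a => real"
 have int: "integrable M (\<lambda>x. f x * g x)" if "f \<in> C n" "g \<in> C k" for f g n k
 proof (rule integrable_const_bound[of _ 1])
  show "AE x in M. norm (f x * g x) \<le> 1" using bd[OF that(1)] bd[OF that(2)] by (auto intro!: AE_I2 mult_le_one simp: abs_mult)
  show "(\<lambda>x. f x * g x) \<in> borel_measurable M" using meas[OF that(1)] meas[OF that(2)] by simp
 qed
 have decm: "C n \<subseteq> C k" if "k \<le> n" for k n using lift_Suc_antimono_le[of C, OF dec that] .
 have N01: "0 \<le> N f" "N f \<le> 1" if "f \<in> C n" for f n
 proof -
  show "0 \<le> N f" unfolding N_def by simp
  have "N f \<le> (\<integral>x. 1 \<partial>M)" unfolding N_def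
   using int[OF that that] bd[OF that] by (intro integral_mono) (auto simp: power2_eq_square mult_le_one)
  thus "N f \<le> 1" by (simp add: prob_space)
 qed
 define d where "d n = Inf (N ` C n)" for n
 have bb: "bdd_below (N ` C n)" for n using N01 by (intro bdd_belowI[of _ 0]) auto
 have d_le: "d n \<le> N f" if "f \<in> C n" for f n unfolding d_def using that bb by (intro cInf_lower) auto
 have "incseq d"
 proof (rule incseq_SucI)
  show "d n \<le> d (Suc n)" for n unfolding d_def
   by (rule cInf_superset_mono[OF _ bb image_mono[OF dec]]) (use ne in simp)
 qed
 have d1: "d n \<le> 1" for n using ne[of n] d_le[of _ n] N01[of _ n] by (meson equals0I order_trans)
 define D where "D = Sup (range d)"
 have bd_d: "bdd_above (range d)" using d1 by (intro bdd_aboveI[of _ 1]) auto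
 have dD: "d n \<le> D" for n unfolding D_def using bd_d by (intro cSup_upper) auto
 have "\<exists>n. D - e < d n" if "e > 0" for e
  using that less_cSupD[of "range d" "D - e"] unfolding D_def by auto
 hence "\<exists>n. D - (1/4)^j < d n" for j :: nat by simp
 then obtain n0 where n0: "!!j. D - (1/4)^j < d (n0 j)" by metis
 define n where "n j = (\<Sum>i\<le>j. n0 i) + j" for j
 have nge: "n0 j \<le> n j" "j \<le> n j" for j unfolding n_def using member_le_sum[of j "{..j}" n0] by auto
 have nmono: "n j \<le> n (Suc j)" for j unfolding n_def by simp
 have nd: "D - (1/4)^j < d (n j)" for j using n0[of j] incseqD[OF \<open>incseq d\<close> nge(1)[of j]] by simp
 have "\<exists>f\<in>C (n j). N f < d (n j) + (1/4)^j" for j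
 using cInf_lessD[of "N ` C (n j)"] ne unfolding d_def by auto
 then obtain u where u: "!!j. u j \<in> C (n j)" "!!j. N (u j) < d (n j) + (1/4)^j" by metis
 have uC: "u j \<in> C j" for j using u(1) decm[OF nge(2)] by blast
 have uS: "u (Suc j) \<in> C (n j)" for j using u(1)[of "Suc j"] decm[OF nmono] by blast
 have Nu: "N (u j) \<le> D + (1/4)^j" for j using u(2)[of j] dD[of "n j"] by simp
 have diff: "(\<integral>x. (u j x - u (Suc j) x)\<^sup>2 \<partial>M) \<le> 7 * (1/4)^j" for j
 proof -
  let ?f = "u j" and ?g = "u (Suc j)"
  note [simp] = int[OF u(1)[of j] u(1)[of j]] int[OF uS[of j] uS[of j]] int[OF u(1)[of j] uS[of j]]
  have "(\<integral>x. (?f x - ?g x)\<^sup>2 \<partial>M) = (\<integral>x. 2 * (?f x * ?f x) + 2 * (?g x * ?g x) - 4 * ((?f x + ?g x) / 2)\<^sup>2 \<partial>M)"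
   by (rule Bochner_Integration.integral_cong) (auto simp: power2_eq_square field_simps)
  also have "\<dots> = 2 * N ?f + 2 * N ?g - 4 * N (\<lambda>x. (?f x + ?g x) / 2)"
  proof -
   have h: "integrable M h" if "h = (\<lambda>x. ((?f x + ?g x) / 2)\<^sup>2)" for h
    using int[OF mid[OF u(1) uS[of j]] mid[OF u(1) uS[of j]]] that by (simp add: power2_eq_square)
   have "(\<integral>x. 2 * (?f x * ?f x) + 2 * (?g x * ?g x) - 4 * h x \<partial>M) = 2 * (\<integral>x. ?f x * ?f x \<partial>M) + 2 * (\<integral>x. ?g x * ?g x \<partial>M) - 4 * (\<integral>x. h x \<partial>M)"
    if "h = (\<lambda>x. ((?f x + ?g x) / 2)\<^sup>2)" for h using h[OF that] by simp
   from this[OF refl] show ?thesis unfolding N_def by (simp add: power2_eq_square[of "u _ _"])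
  qed
  also have "\<dots> \<le> 2 * (D + (1/4)^j) + 2 * (D + (1/4)^Suc j) - 4 * (D - (1/4)^j)"
  proof -
   have arith: "2 * a + 2 * b - 4 * c \<le> 2 * (D + q) + 2 * (D + q') - 4 * (D - q)"
    if "a \<le> D + q" "b \<le> D + q'" "e \<le> c" "D - q < e" for a b c q q' e D :: real using that by (simp add: algebra_simps)
   show ?thesis by (rule arith[OF Nu Nu d_le[OF mid[OF u(1) uS]] nd])
  qed
  also have "\<dots> \<le> 7 * (1/4)^j" by simp
  finally show ?thesis .
 qed
 have intd: "integrable M (\<lambda>x. (u j x - u (Suc j) x)\<^sup>2)" for j
 using int[OF uC uC] by (auto simp: power2_eq_square algebra_simps)
 have L1: "(\<integral>\<^sup>+x. ennreal \<bar>u j x - u (Suc j) x\<bar> \<partial>M) \<le> ennreal (4 * (1/2)^j)" for j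
 proof -
  have "(\<integral>\<^sup>+x. ennreal \<bar>u j x - u (Suc j) x\<bar> \<partial>M) \<le> (\<integral>\<^sup>+x. ennreal (((1/2)^j + (u j x - u (Suc j) x)\<^sup>2 * 2^j) / 2) \<partial>M)"
  proof (intro nn_integral_mono ennreal_leI)
   fix x
   have "0 \<le> (\<bar>u j x - u (Suc j) x\<bar> * 2^j - 1)\<^sup>2" by simp
   also have "\<dots> = ((1/2)^j + (u j x - u (Suc j) x)\<^sup>2 * 2^j - 2 * \<bar>u j x - u (Suc j) x\<bar>) * 2^j"
    by (simp add: power2_eq_square algebra_simps power_mult_distrib[symmetric])
   finally have "0 \<le> (1/2)^j + (u j x - u (Suc j) x)\<^sup>2 * 2^j - 2 * \<bar>u j x - u (Suc j) x\<bar>"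
    by (meson mult_neg_pos not_le zero_less_numeral zero_less_power)
   thus "\<bar>u j x - u (Suc j) x\<bar> \<le> ((1/2)^j + (u j x - u (Suc j) x)\<^sup>2 * 2^j) / 2" by simp
  qed
  also have "\<dots> = ennreal (\<integral>x. ((1/2)^j + (u j x - u (Suc j) x)\<^sup>2 * 2^j) / 2 \<partial>M)"
   using intd[of j] by (intro nn_integral_eq_integral) auto
  also have "(\<integral>x. ((1/2)^j + (u j x - u (Suc j) x)\<^sup>2 * 2^j) / 2 \<partial>M) = ((1/2)^j + (\<integral>x. (u j x - u (Suc j) x)\<^sup>2 \<partial>M) * 2^j) / 2"
   using intd[of j] by (simp add: prob_space)
  also have "\<dots> \<le> ((1/2)^j + (7 * (1/4)^j) * 2^j) / 2" using diff[of j] by simp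
  also have "(1/4)^j * (2::real)^j = (1/2)^j" by (simp add: power_mult_distrib[symmetric])
  hence "((1/2)^j + (7 * (1/4)^j) * (2::real)^j) / 2 = 4 * (1/2)^j" by (simp add: algebra_simps)
  finally show ?thesis by (simp add: ennreal_leI)
 qed
 have "(\<integral>\<^sup>+x. (\<Sum>j. ennreal \<bar>u j x - u (Suc j) x\<bar>) \<partial>M) = (\<Sum>j. \<integral>\<^sup>+x. ennreal \<bar>u j x - u (Suc j) x\<bar> \<partial>M)"
  using meas[OF uC] by (intro nn_integral_suminf) auto
 also have "\<dots> \<le> (\<Sum>j. ennreal (4 * (1/2)^j))" by (intro suminf_le L1) auto
 also have "\<dots> = ennreal (\<Sum>j. 4 * (1/2)^j)" by (intro suminf_ennreal2) auto
 finally have "(\<integral>\<^sup>+x. (\<Sum>j. ennreal \<bar>u j x - u (Suc j) x\<bar>) \<partial>M) ~= \<infinity>" by (auto simp: top_unique)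
 hence "AE x in M. (\<Sum>j. ennreal \<bar>u j x - u (Suc j) x\<bar>) ~= \<infinity>"
  using meas[OF uC] by (intro nn_integral_PInf_AE) auto
 hence "AE x in M. convergent (\<lambda>j. u j x)"
 proof eventually_elim
  fix x assume "(\<Sum>j. ennreal \<bar>u j x - u (Suc j) x\<bar>) ~= \<infinity>"
  hence "summable (\<lambda>j. u j x - u (Suc j) x)"
   using summable_suminf_not_top summable_rabs_cancel by (auto simp: less_top)
  hence "convergent (\<lambda>n. \<Sum>j<n. u (Suc j) x - u j x)"
   using summable_minus by (fastforce simp: summable_iff_convergent)
  then obtain L where "(\<lambda>n. u n x - u 0 x) \<longlonglongrightarrow> L" unfolding sum_lessThan_telescope[of "\<lambda>j. u j x"] convergent_def by blast
  from tendsto_add[OF this tendsto_const[of "u 0 x"]] show "convergent (\<lambda>j. u j x)" unfolding convergent_def by auto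
 qed
 thus ?thesis using that uC by blast
qed

datatype bterm = Atom nat | Compl bterm | Join bterm bterm

instance bterm :: countable by countable_datatype

primrec bval :: "'a set => (nat => 'a set) => bterm => 'a set" where
 "bval S B (Atom n) = B n"
| "bval S B (Compl t) = S - bval S B t"
| "bval S B (Join s t) = bval S B s \<union> bval S B t"

text \<open>The events that are approximated by Boolean combinations of the generators form a sigma-algebra. Boolean combinations are
 encoded by terms to see that they are countable.\<close>

lemma (in prob_space) countable_dense_sets:
 assumes sets: "sets M = sigma_sets (space M) (range B)" and B: "!!n::nat. B n \<subseteq> space M"
 obtains D :: "nat => 'a set" where "!!n. D n \<in> sets M"
  "!!A e. A \<in> sets M ==> 0 < e ==> \<exists>n. measure M ((A - D n) \<union> (D n - A)) < e"
proof -
 let ?v = "bval (space M) B"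
 let ?\<delta> = "\<lambda>A D. measure M ((A - D) \<union> (D - A))"
 have vM: "?v t \<in> sets M" for t
  by (induction t) (auto simp: sets intro: sigma_sets.Basic sigma_sets.Compl sigma_sets_Un)
 have tri: "?\<delta> A C \<le> ?\<delta> A B + ?\<delta> B C" if "A \<in> sets M" "B \<in> sets M" "C \<in> sets M" for A B C
 proof -
  have "?\<delta> A C \<le> measure M (((A - B) \<union> (B - A)) \<union> ((B - C) \<union> (C - B)))"
   using that by (intro finite_measure_mono) auto
  also have "\<dots> \<le> ?\<delta> A B + ?\<delta> B C" using that by (intro measure_Un_le) auto
  finally show ?thesis .
 qed
 have fin: "\<exists>t. ?\<delta> (\<Union>i<n. A i) (?v t) < e"
  if A: "!!i::nat. A i \<in> sets M" "!!i e. 0 < e ==> \<exists>t. ?\<delta> (A i) (?v t) < e" and e: "0 < e" for A n and e :: real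
  using e
 proof (induction n arbitrary: e)
  case 0
  define t0 where "t0 = Compl (Join (Atom 0) (Compl (Atom 0)))"
  have "?v t0 = {}" unfolding t0_def by auto
  thus ?case using 0 by (intro exI[of _ t0]) simp
 next
  case (Suc n)
  obtain s where s: "?\<delta> (\<Union>i<n. A i) (?v s) < e / 2" using Suc.IH[of "e / 2"] Suc.prems by auto
  obtain t where t: "?\<delta> (A n) (?v t) < e / 2" using A(2)[of "e / 2" n] Suc.prems by auto
  have U: "(\<Union>i<n. A i) \<in> sets M" using A(1) by auto
  have "?\<delta> (\<Union>i<Suc n. A i) (?v (Join s t)) \<le> measure M ((((\<Union>i<n. A i) - ?v s) \<union> (?v s - (\<Union>i<n. A i))) \<union> ((A n - ?v t) \<union> (?v t - A n)))"
   using U A(1) vM by (intro finite_measure_mono) (auto simp: less_Suc_eq)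
  also have "\<dots> \<le> ?\<delta> (\<Union>i<n. A i) (?v s) + ?\<delta> (A n) (?v t)"
   using U A(1) vM by (intro measure_Un_le) auto
  also have "\<dots> < e" using s t by simp
  finally show ?case by blast
 qed
 have appr: "\<exists>t. ?\<delta> A (?v t) < e" if "A \<in> sigma_sets (space M) (range B)" "0 < e" for A e
  using that
 proof (induction arbitrary: e rule: sigma_sets.induct)
  case (Basic a)
  then obtain n where "a = B n" by blast
  thus ?case using Basic by (intro exI[of _ "Atom n"]) simp
 next
  case Empty
  define t0 where "t0 = Compl (Join (Atom 0) (Compl (Atom 0)))"
  have "?v t0 = {}" unfolding t0_def by auto
  thus ?case using Empty by (intro exI[of _ t0]) simp
 next
  case (Compl a)
  obtain t where t: "?\<delta> a (?v t) < e" using Compl by blast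
  have "(space M - a - ?v (Compl t)) \<union> (?v (Compl t) - (space M - a)) = (a - ?v t) \<union> (?v t - a)"
   using Compl(1) sets.sets_into_space[OF vM] sets.sets_into_space[of a M] by (auto simp: sets)
  thus ?case using t by (intro exI[of _ "Compl t"]) simp
 next
  case (Union a)
  have aM: "a i \<in> sets M" for i using Union(1) sets by simp
  have "(\<lambda>n. measure M (\<Union>i<n. a i)) \<longlonglongrightarrow> measure M (\<Union>n. \<Union>i<n. a i)"
   using aM by (intro finite_Lim_measure_incseq) (auto simp: incseq_def intro: less_le_trans)
  moreover have "(\<Union>n. \<Union>i<n. a i) = (\<Union>i. a i)" by auto
  ultimately have "eventually (\<lambda>n. measure M (\<Union>i. a i) - e / 2 < measure M (\<Union>i<n. a i)) sequentially"
   using Union(3) by (intro order_tendstoD(1)) auto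
  then obtain n where n: "measure M (\<Union>i. a i) - e / 2 < measure M (\<Union>i<n. a i)" unfolding eventually_sequentially by blast
  obtain t where t: "?\<delta> (\<Union>i<n. a i) (?v t) < e / 2" using fin[of a "e / 2" n] aM Union by auto
  have "?\<delta> (\<Union>i. a i) (\<Union>i<n. a i) = measure M ((\<Union>i. a i) - (\<Union>i<n. a i))"
   by (rule arg_cong[of _ _ "measure M"]) auto
  also have "\<dots> = measure M (\<Union>i. a i) - measure M (\<Union>i<n. a i)" using aM by (intro finite_measure_Diff) auto
  finally have "?\<delta> (\<Union>i. a i) (\<Union>i<n. a i) < e / 2" using n by simp
  moreover have "?\<delta> (\<Union>i. a i) (?v t) \<le> ?\<delta> (\<Union>i. a i) (\<Union>i<n. a i) + ?\<delta> (\<Union>i<n. a i) (?v t)"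
   using aM vM by (intro tri) auto
  ultimately show ?case using t by (intro exI[of _ t]) linarith
 qed
 show ?thesis
 proof (rule that[of "\<lambda>n. ?v (from_nat n)"])
  fix A :: "'a set" and e :: real assume "A \<in> sets M" "0 < e"
  then obtain t where "?\<delta> A (?v t) < e" using appr[of A e] sets by blast
  thus "\<exists>n. measure M ((A - ?v (from_nat n)) \<union> (?v (from_nat n) - A)) < e"
   by (intro exI[of _ "to_nat t"]) simp
 qed (rule vM)
qed

lemma sets_borel_of: "sets (borel_of T) = sigma_sets (topspace T) {U. openin T U}"
 unfolding borel_of_def using openin_subset by (intro sets_measure_of) blast

lemma space_borel_of: "space (borel_of T) = topspace T"
 unfolding borel_of_def using openin_subset by (intro space_measure_of) blast

lemma open_in_borel_of: "openin T U ==> U \<in> sets (borel_of T)"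
 unfolding sets_borel_of by (auto intro: sigma_sets.Basic)

lemma closed_in_borel_of: "closedin T C ==> C \<in> sets (borel_of T)"
 using sets.compl_sets[OF open_in_borel_of[of T "topspace T - C"]] unfolding space_borel_of
 by (simp add: closedin_def double_diff)

lemma measurable_borel_ofI:
 assumes "f \<in> space M \<rightarrow> topspace T" "!!U. openin T U ==> f -` U \<inter> space M \<in> sets M"
 shows "f \<in> measurable M (borel_of T)"
 unfolding borel_of_def by (rule measurable_measure_of) (use assms openin_subset[of T] in \<open>blast+\<close>)

lemma continuous_measurable_borel_of:
 assumes "continuous_map T U f" shows "f \<in> measurable (borel_of T) (borel_of U)"
proof (rule measurable_borel_ofI)
 show "f \<in> space (borel_of T) \<rightarrow> topspace U" using continuous_map_funspace[OF assms] by (simp add: space_borel_of)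
 fix V assume "openin U V"
 hence "openin T {x \<in> topspace T. f x \<in> V}" using assms by (simp add: openin_continuous_map_preimage)
 moreover have "f -` V \<inter> space (borel_of T) = {x \<in> topspace T. f x \<in> V}" by (auto simp: space_borel_of)
 ultimately show "f -` V \<inter> space (borel_of T) \<in> sets (borel_of T)" by (simp add: open_in_borel_of)
qed

lemma borel_of_countable_generators:
 assumes "second_countable T"
 obtains B :: "nat => _ set" where "!!n. openin T (B n)" "sets (borel_of T) = sigma_sets (topspace T) (range B)"
proof -
 obtain \<B> where b: "countable \<B>" "\<forall>V\<in>\<B>. openin T V" "\<forall>U x. openin T U \<and> x \<in> U --> (\<exists>V\<in>\<B>. x \<in> V \<and> V \<subseteq> U)"
  using assms unfolding second_countable_def by blast
 have "countable (insert {} \<B>)" "insert {} \<B> ~= {}" using b(1) by auto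
 then obtain B :: "nat => _" where B: "range B = insert {} \<B>" by (metis uncountable_def)
 have o: "openin T (B n)" for n using rangeI[of B n] B b(2) by auto
 have "{U. openin T U} \<subseteq> sigma_sets (topspace T) (range B)"
 proof
  fix U assume "U \<in> {U. openin T U}"
  hence U: "openin T U" by simp
  have "U = \<Union>{V\<in>\<B>. V \<subseteq> U}" using b(3) U by blast
  moreover have "\<Union>{V\<in>\<B>. V \<subseteq> U} \<in> sigma_sets (topspace T) (range B)"
  proof -
   interpret sigma_algebra "topspace T" "sigma_sets (topspace T) (range B)"
    using o openin_subset by (intro sigma_algebra_sigma_sets) blast
   show ?thesis using b(1) B by (intro countable_Union) (auto intro: sigma_sets.Basic)
  qed
  ultimately show "U \<in> sigma_sets (topspace T) (range B)" by simp
 qed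
 hence "sigma_sets (topspace T) {U. openin T U} \<subseteq> sigma_sets (topspace T) (range B)"
  by (intro sigma_sets_mono) auto
 moreover have "sigma_sets (topspace T) (range B) \<subseteq> sigma_sets (topspace T) {U. openin T U}"
  using o by (intro sigma_sets_mono') auto
 ultimately show ?thesis using that[of B] o sets_borel_of[of T] by blast
qed

lemma half_summable:
 fixes w :: "nat => real" assumes "!!k. 0 \<le> w k \<and> w k \<le> 1"
 shows "summable (\<lambda>k. (1/2)^Suc k * w k)"
 by (rule summable_comparison_test'[of "\<lambda>k. (1/2)^Suc k" 0])
   (use assms power_half_series in \<open>auto intro!: sums_summable mult_left_le simp: abs_mult simp del: power_Suc\<close>)

text \<open>Here each element of the group acts measurably; joint measurability enters with \<open>mp_action\<close>.\<close>

locale pmp_action = prob_space M for M :: "'w measure" +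
 fixes G :: "('g, 'm) monoid_scheme" (structure) and act :: "'g => 'w => 'w"
 assumes group_action: "group_action G (space M) act"
  and act_meas: "!!g. g \<in> carrier G ==> act g \<in> measurable M M"
  and act_mp: "!!g. g \<in> carrier G ==> distr M M (act g) = M"
begin

sublocale action: group_action G "space M" act by (rule group_action)
sublocale group: group G using action.group_hom group_hom.axioms(1) by blast

lemma act_in: "g \<in> carrier G ==> w \<in> space M ==> act g w \<in> space M"
 using action.element_image by blast

lemma act_mult: "g \<in> carrier G ==> h \<in> carrier G ==> w \<in> space M ==> act (g \<otimes> h) w = act g (act h w)"
 using action.composition_rule by blast

lemma act_one: "w \<in> space M ==> act \<one> w = w"
 using action.id_eq_one by (metis restrict_apply')

lemma act_inv: assumes "g \<in> carrier G" "w \<in> space M"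
 shows "act (inv g) (act g w) = w" "act g (act (inv g) w) = w"
 using act_mult[of "inv g" g w] act_mult[of g "inv g" w] act_one assms by auto

lemma AE_act: assumes g: "g \<in> carrier G" and P: "AE w in M. P w" shows "AE w in M. P (act g w)"
 using P AE_distrD[OF act_meas[OF g]] unfolding act_mp[OF g] by auto

lemma act_vimage: "g \<in> carrier G ==> A \<in> sets M ==> {w\<in>space M. act g w \<in> A} \<in> sets M"
 using measurable_sets[OF act_meas, of g A] by (simp add: vimage_def Int_def conj_commute)

lemma prob_act: assumes "g \<in> carrier G" "A \<in> sets M" shows "prob {w\<in>space M. act g w \<in> A} = prob A"
proof -
 have "act g -` A \<inter> space M = {w\<in>space M. act g w \<in> A}" by auto
 thus ?thesis using measure_distr[OF act_meas assms(2), of g] act_mp assms(1) by simp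
qed

text \<open>Ergodicity of a subset of the group, in terms of almost invariant events. The subset will be a factor of a product, or
 a union of factors.\<close>

definition ergodic_on :: "'g set => bool" where
 "ergodic_on P \<longleftrightarrow> (\<forall>A\<in>sets M. (\<forall>g\<in>P. AE w in M. act g w \<in> A \<longleftrightarrow> w \<in> A) --> prob A = 0 \<or> prob A = 1)"

end

text \<open>The skew product: besides \<open>\<Omega>\<close> the group acts, through a cocycle \<open>\<rho>\<close>, on \<open>\<Omega> \<times> I\<close> for a countable set \<open>I\<close>. It is applied with
 the test sets as \<open>I\<close>.\<close>

locale skew_action = pmp_action M G act for M :: "'w measure" and G :: "('g, 'm) monoid_scheme" (structure) and act +
 fixes I :: "'i set" and \<rho> :: "'g => 'w => 'i => 'i"
 assumes I: "countable I" "I ~= {}"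
  and \<rho>_in: "!!g w i. g \<in> carrier G ==> w \<in> space M ==> i \<in> I ==> \<rho> g w i \<in> I"
  and \<rho>_mult: "!!g h w i. g \<in> carrier G ==> h \<in> carrier G ==> w \<in> space M ==> i \<in> I ==>
   \<rho> (g \<otimes> h) w i = \<rho> g (act h w) (\<rho> h w i)"
  and \<rho>_one: "!!w i. w \<in> space M ==> i \<in> I ==> \<rho> \<one> w i = i"
  and \<rho>_meas: "!!g i j. g \<in> carrier G ==> i \<in> I ==> j \<in> I ==> {w\<in>space M. \<rho> g w i = j} \<in> sets M"
begin

lemma \<rho>_inv: assumes "g \<in> carrier G" "w \<in> space M" "i \<in> I"
 shows "\<rho> (inv g) (act g w) (\<rho> g w i) = i" "\<rho> g (act (inv g) w) (\<rho> (inv g) w i) = i"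
 using \<rho>_mult[of "inv g" g w i] \<rho>_mult[of g "inv g" w i] \<rho>_one assms by auto

text \<open>A field assigns to each \<open>w\<close> a subset of \<open>I\<close>.\<close>

definition meas_field :: "('w => 'i => bool) => bool" where
 "meas_field C \<longleftrightarrow> (\<forall>i\<in>I. {w\<in>space M. C w i} \<in> sets M)"

definition inv_field :: "'g => ('w => 'i => bool) => bool" where
 "inv_field g C \<longleftrightarrow> (AE w in M. \<forall>i\<in>I. C (act g w) (\<rho> g w i) \<longleftrightarrow> C w i)"

text \<open>For events \<open>X\<close>, \<open>Y\<close>, the set where \<open>\<rho> g w i = j\<close> but \<open>w \<in> X\<close> and \<open>act g w \<in> Y\<close> disagree has a measure that depends
 continuously on \<open>X\<close> and \<open>Y\<close>, uniformly in \<open>g\<close>. So a violation of invariance is visible on members of the countable dense family \<open>D\<close>; for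
 each tuple of such members and each size of violation \<open>\<Gamma>\<close> contains one group element that exhibits it.\<close>

lemma countable_subfamily:
 fixes D :: "nat => 'w set"
 assumes D: "!!n. D n \<in> sets M" "!!A e. A \<in> sets M ==> 0 < e ==> \<exists>n. measure M ((A - D n) \<union> (D n - A)) < e"
  and P: "P \<subseteq> carrier G"
 obtains \<Gamma> where "\<Gamma> \<subseteq> P" "countable \<Gamma>" "!!C g. meas_field C ==> \<forall>g\<in>\<Gamma>. inv_field g C ==> g \<in> P ==> inv_field g C"
proof -
 define bad where "bad g X Y i j = {w\<in>space M. \<rho> g w i = j \<and> (act g w \<in> Y) ~= (w \<in> X)}" for g X Y i j
 have bad_meas: "bad g X Y i j \<in> sets M" if "g \<in> carrier G" "X \<in> sets M" "Y \<in> sets M" "i \<in> I" "j \<in> I" for g X Y i j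
 using \<rho>_meas[OF that(1,4,5)] act_vimage[OF that(1,3)] that(2) unfolding bad_def by (auto simp: Int_absorb1 sets.Int sets.Un sets.Diff)
 define sym where "sym A B = measure M ((A - B) \<union> (B - A))" for A B
 have bad_le: "measure M (bad g X Y i j) \<le> measure M (bad g X' Y' i j) + sym X X' + sym Y Y'"
  if "g \<in> carrier G" "X \<in> sets M" "Y \<in> sets M" "X' \<in> sets M" "Y' \<in> sets M" "i \<in> I" "j \<in> I" for g X Y X' Y' i j
 proof -
  let ?U = "(X - X') \<union> (X' - X)" and ?V = "{w\<in>space M. act g w \<in> (Y - Y') \<union> (Y' - Y)}"
  have V: "?V \<in> sets M" using that by (intro act_vimage) auto
  have "measure M (bad g X Y i j) \<le> measure M (bad g X' Y' i j \<union> ?U \<union> ?V)"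
   using bad_meas that V by (intro finite_measure_mono) (auto simp: bad_def)
  also have "\<dots> \<le> measure M (bad g X' Y' i j \<union> ?U) + measure M ?V"
   using bad_meas that V by (intro measure_Un_le) auto
  also have "\<dots> \<le> measure M (bad g X' Y' i j) + measure M ?U + measure M ?V"
   using bad_meas that by (intro add_right_mono measure_Un_le) auto
  also have "measure M ?V = sym Y Y'" unfolding sym_def using that by (intro prob_act) auto
  finally show ?thesis unfolding sym_def .
 qed
 let ?good = "\<lambda>(a, b, i, j, n) g. g \<in> P \<and> measure M (bad g (D a) (D b) i j) > 2 / real (Suc n)"
 let ?J = "{x \<in> (UNIV :: nat set) \<times> (UNIV :: nat set) \<times> I \<times> I \<times> (UNIV :: nat set). \<exists>g. ?good x g}"
 define \<Gamma> where "\<Gamma> = (\<lambda>x. SOME g. ?good x g) ` ?J"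
 have good: "?good x (SOME g. ?good x g)" if "x \<in> ?J" for x using that by (intro someI_ex[of "?good x"]) simp
 have "countable ((UNIV :: nat set) \<times> (UNIV :: nat set) \<times> I \<times> I \<times> (UNIV :: nat set))"
  by (intro countable_SIGMA I) auto
 hence "countable ?J" by (rule countable_subset[rotated]) blast
 hence "countable \<Gamma>" unfolding \<Gamma>_def by (rule countable_image)
 moreover have "\<Gamma> \<subseteq> P"
 using good unfolding \<Gamma>_def by fastforce
 moreover have "inv_field g C" if C: "meas_field C" and inv: "\<forall>g\<in>\<Gamma>. inv_field g C" and g: "g \<in> P" for C g
 proof (rule ccontr)
  assume n: "\<not> inv_field g C"
  have gC: "g \<in> carrier G" using g P by auto
  define X where "X i = {w\<in>space M. C w i}" for i
  have XM: "X i \<in> sets M" if "i \<in> I" for i using C that unfolding meas_field_def X_def by blast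
  have "\<exists>i\<in>I. \<exists>j\<in>I. measure M (bad g (X i) (X j) i j) > 0"
  proof (rule ccontr)
   assume "\<not> ?thesis"
   hence z: "measure M (bad g (X i) (X j) i j) = 0" if "i \<in> I" "j \<in> I" for i j
    using that by (metis measure_nonneg order_le_less)
   have "AE w in M. w \<notin> bad g (X i) (X j) i j" if "i \<in> I" "j \<in> I" for i j
    using z[OF that] bad_meas[OF gC XM[OF that(1)] XM[OF that(2)] that] by (simp add: prob_eq_0)
   hence "AE w in M. \<forall>i\<in>I. \<forall>j\<in>I. w \<notin> bad g (X i) (X j) i j"
    using I(1) by (simp add: AE_ball_countable)
   hence "inv_field g C" unfolding inv_field_def using AE_space
   proof eventually_elim
    case (elim w)
    show ?case
    proof
     fix i assume i: "i \<in> I"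
     show "C (act g w) (\<rho> g w i) \<longleftrightarrow> C w i"
      using \<rho>_in gC i elim act_in[OF gC] unfolding bad_def X_def by auto
    qed
   qed
   thus False using n by blast
  qed
  then obtain i j where ij: "i \<in> I" "j \<in> I" and pos: "measure M (bad g (X i) (X j) i j) > 0" by blast
  define \<eta> where "\<eta> = measure M (bad g (X i) (X j) i j)"
  obtain n where n: "1 / real (Suc n) < \<eta> / 4" using pos nat_approx_posE[of "\<eta> / 4"] unfolding \<eta>_def by auto
  define \<epsilon> where "\<epsilon> = 1 / real (Suc n)"
  have e: "\<epsilon> > 0" "4 * \<epsilon> < \<eta>" "2 / real (Suc n) = 2 * \<epsilon>" unfolding \<epsilon>_def using n by auto
  obtain a where a: "sym (X i) (D a) < \<epsilon>" using D(2)[OF XM[OF ij(1)] e(1)] unfolding sym_def by blast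
  obtain b where b: "sym (X j) (D b) < \<epsilon>" using D(2)[OF XM[OF ij(2)] e(1)] unfolding sym_def by blast
  have sym_comm: "sym A B = sym B A" for A B unfolding sym_def by (simp add: Un_commute)
  have "\<eta> \<le> measure M (bad g (D a) (D b) i j) + sym (X i) (D a) + sym (X j) (D b)"
   unfolding \<eta>_def by (rule bad_le[OF gC XM[OF ij(1)] XM[OF ij(2)] D(1) D(1) ij])
  hence x: "(a, b, i, j, n) \<in> ?J" using a b e g ij by auto
  define g' where "g' = (SOME g. ?good (a, b, i, j, n) g)"
  have g': "g' \<in> P" "measure M (bad g' (D a) (D b) i j) > 2 * \<epsilon>" using good[OF x] e(3) unfolding g'_def by auto
  have g'C: "g' \<in> carrier G" using g' P by auto
  have inv': "inv_field g' C" using x inv unfolding g'_def \<Gamma>_def by blast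
  have "measure M (bad g' (D a) (D b) i j) \<le> measure M (bad g' (X i) (X j) i j) + sym (D a) (X i) + sym (D b) (X j)"
   by (rule bad_le[OF g'C D(1) D(1) XM[OF ij(1)] XM[OF ij(2)] ij])
  hence "measure M (bad g' (X i) (X j) i j) > 0" using g'(2) a b sym_comm[of "D a" "X i"] sym_comm[of "D b" "X j"] by linarith
  moreover have "AE w in M. w \<notin> bad g' (X i) (X j) i j"
   using inv'[unfolded inv_field_def] AE_space
  proof eventually_elim
   case (elim w)
   thus ?case unfolding bad_def X_def using ij act_in[OF g'C] by auto
  qed
  hence "measure M (bad g' (X i) (X j) i j) = 0"
   using bad_meas[OF g'C XM[OF ij(1)] XM[OF ij(2)] ij] by (simp add: prob_eq_0)
  ultimately show False by simp
 qed
 ultimately show ?thesis using that by blast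
qed

text \<open>The integral of the weighted sum of \<open>(m \<circ> \<gamma> k - m)\<^sup>2\<close> is at most \<open>0\<close>: expand the square, use
 invariance of the measure for the first term and subharmonicity for the mixed term.\<close>

lemma subharmonic_invariant:
 fixes m :: "'w => real" and \<gamma> :: "nat => 'g"
 assumes \<gamma>: "!!k. \<gamma> k \<in> carrier G" and m: "m \<in> borel_measurable M" "!!w. w \<in> space M ==> 0 \<le> m w \<and> m w \<le> 1"
  and sub: "AE w in M. m w \<le> (\<Sum>k. (1/2)^Suc k * m (act (\<gamma> k) w))"
 shows "AE w in M. m (act (\<gamma> k) w) = m w"
proof -
 let ?p = "\<lambda>k. (1/2)^Suc k :: real" and ?m = "\<lambda>k w. m (act (\<gamma> k) w)"
 let ?D = "\<lambda>w. \<Sum>k. ennreal (?p k * (?m k w - m w)\<^sup>2)"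
 have mg[measurable]: "?m k \<in> borel_measurable M" for k using measurable_compose[OF act_meas[OF \<gamma>] m(1)] .
 note m(1)[measurable]
 have mb: "0 \<le> ?m k w" "?m k w \<le> 1" if "w \<in> space M" for k w using m(2)[OF act_in[OF \<gamma> that]] by auto
 have "AE w in M. ?D w + ennreal ((m w)\<^sup>2) \<le> (\<Sum>k. ennreal (?p k * (?m k w)\<^sup>2))"
  using sub AE_space
 proof eventually_elim
  case (elim w)
  note b = mb[OF elim(2)] and b0 = m(2)[OF elim(2)]
  have s1: "summable (\<lambda>k. ?p k * ?m k w)" and s2: "summable (\<lambda>k. ?p k * (?m k w)\<^sup>2)"
   using b by (auto intro!: half_summable power_le_one simp del: power_Suc)
  have "(\<lambda>k. ?p k * (?m k w)\<^sup>2 - 2 * m w * (?p k * ?m k w) + ?p k * (m w)\<^sup>2) sums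
   ((\<Sum>k. ?p k * (?m k w)\<^sup>2) - 2 * m w * (\<Sum>k. ?p k * ?m k w) + 1 * (m w)\<^sup>2)"
   by (intro sums_add sums_diff sums_mult sums_mult2 power_half_series summable_sums s1 s2)
  moreover have "(\<lambda>k. ?p k * (?m k w)\<^sup>2 - 2 * m w * (?p k * ?m k w) + ?p k * (m w)\<^sup>2) = (\<lambda>k. ?p k * (?m k w - m w)\<^sup>2)"
   by (auto simp: power2_eq_square algebra_simps)
  ultimately have D: "(\<lambda>k. ?p k * (?m k w - m w)\<^sup>2) sums ((\<Sum>k. ?p k * (?m k w)\<^sup>2) - 2 * m w * (\<Sum>k. ?p k * ?m k w) + (m w)\<^sup>2)" by simp
  have "m w * m w \<le> m w * (\<Sum>k. ?p k * ?m k w)" using elim(1) b0 by (intro mult_left_mono) auto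
  hence "(\<Sum>k. ?p k * (?m k w - m w)\<^sup>2) + (m w)\<^sup>2 \<le> (\<Sum>k. ?p k * (?m k w)\<^sup>2)"
   unfolding sums_unique[OF D, symmetric] by (simp add: power2_eq_square)
  moreover have "?D w = ennreal (\<Sum>k. ?p k * (?m k w - m w)\<^sup>2)" using sums_summable[OF D] by (intro suminf_ennreal2) auto
  moreover have "(\<Sum>k. ennreal (?p k * (?m k w)\<^sup>2)) = ennreal (\<Sum>k. ?p k * (?m k w)\<^sup>2)" using s2 by (intro suminf_ennreal2) auto
  moreover have "0 \<le> (\<Sum>k. ?p k * (?m k w - m w)\<^sup>2)" using sums_summable[OF D] by (intro suminf_nonneg) auto
  ultimately show ?case by (simp flip: ennreal_plus add: ennreal_leI)
 qed
 hence "(\<integral>\<^sup>+w. ?D w + ennreal ((m w)\<^sup>2) \<partial>M) \<le> (\<integral>\<^sup>+w. (\<Sum>k. ennreal (?p k * (?m k w)\<^sup>2)) \<partial>M)" by (rule nn_integral_mono_AE)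
 also have "\<dots> = (\<Sum>k. \<integral>\<^sup>+w. ennreal (?p k * (?m k w)\<^sup>2) \<partial>M)" by (intro nn_integral_suminf) measurable
 also have "\<dots> = (\<Sum>k. ennreal (?p k) * (\<integral>\<^sup>+w. ennreal ((m w)\<^sup>2) \<partial>M))"
 proof (rule suminf_cong)
  fix k
  have "(\<integral>\<^sup>+w. ennreal (?p k * (?m k w)\<^sup>2) \<partial>M) = ennreal (?p k) * (\<integral>\<^sup>+w. ennreal ((?m k w)\<^sup>2) \<partial>M)"
   by (simp add: ennreal_mult nn_integral_cmult del: power_Suc)
  also have "(\<integral>\<^sup>+w. ennreal ((?m k w)\<^sup>2) \<partial>M) = (\<integral>\<^sup>+w. ennreal ((m w)\<^sup>2) \<partial>M)"
   using nn_integral_distr[OF act_meas[OF \<gamma>], of "\<lambda>w. ennreal ((m w)\<^sup>2)" k] act_mp[OF \<gamma>, of k] by simp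
  finally show "(\<integral>\<^sup>+w. ennreal (?p k * (?m k w)\<^sup>2) \<partial>M) = ennreal (?p k) * (\<integral>\<^sup>+w. ennreal ((m w)\<^sup>2) \<partial>M)" .
 qed
 also have "\<dots> = (\<integral>\<^sup>+w. ennreal ((m w)\<^sup>2) \<partial>M)"
 using suminf_ennreal_eq[OF _ power_half_series] by fastforce
 finally have "(\<integral>\<^sup>+w. ?D w \<partial>M) + (\<integral>\<^sup>+w. ennreal ((m w)\<^sup>2) \<partial>M) \<le> (\<integral>\<^sup>+w. ennreal ((m w)\<^sup>2) \<partial>M)"
  by (subst (asm) nn_integral_add) auto
 moreover have "(\<integral>\<^sup>+w. ennreal ((m w)\<^sup>2) \<partial>M) \<le> (\<integral>\<^sup>+w. 1 \<partial>M)"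
  using m(2) by (intro nn_integral_mono) (simp add: power_le_one)
 hence "(\<integral>\<^sup>+w. ennreal ((m w)\<^sup>2) \<partial>M) ~= \<infinity>" by (auto simp: emeasure_space_1 top_unique)
 moreover have "x = 0" if "x + c \<le> c" "c ~= \<infinity>" for x c :: ennreal
  using that by (simp add: add.commute)
 ultimately have "(\<integral>\<^sup>+w. ?D w \<partial>M) = 0" by blast
 hence "AE w in M. ?D w = 0" by (subst (asm) nn_integral_0_iff_AE) auto
 thus ?thesis
 proof eventually_elim
  case (elim w)
  hence "ennreal (?p k * (?m k w - m w)\<^sup>2) = 0" by (auto simp: suminf_eq_zero_iff)
  moreover have "0 < ?p k" by simp
  ultimately show ?case by (simp add: ennreal_eq_0_iff mult_le_0_iff not_le[symmetric] del: power_Suc)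
 qed
qed

end

lemma half_series_tendsto:
 fixes a :: "nat => nat => real"
 assumes a: "!!k n. 0 \<le> a k n \<and> a k n \<le> 1" and lim: "!!k. (\<lambda>n. a k n) \<longlonglongrightarrow> b k"
 shows "(\<lambda>n. \<Sum>k. (1/2)^Suc k * a k n) \<longlonglongrightarrow> (\<Sum>k. (1/2)^Suc k * b k)"
proof -
 have "eventually (\<lambda>(k, n). norm ((1/2)^Suc k * a k n) \<le> (1/2)^Suc k) (sequentially \<times>\<^sub>F sequentially)"
  using a by (intro always_eventually) (auto simp: abs_mult mult_left_le simp del: power_Suc)
 thus ?thesis
  using tannerys_theorem[of "\<lambda>k n. (1/2)^Suc k * a k n" "\<lambda>k. (1/2)^Suc k * b k" sequentially "\<lambda>k. (1/2)^Suc k"]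
   lim sums_summable[OF power_half_series] by (auto intro: tendsto_mult_left simp del: power_Suc)
qed

context skew_action begin

text \<open>Properties of functions on \<open>I\<close> that define closed convex invariant sets of functions with values in the unit
 interval.\<close>

definition admissible :: "(('i => real) => bool) => bool" where
 "admissible Q \<longleftrightarrow> (\<forall>u. Q u --> (\<forall>i\<in>I. 0 \<le> u i \<and> u i \<le> 1)) \<and>
  (\<forall>u v a. Q u \<and> Q v \<and> 0 \<le> a \<and> a \<le> 1 --> Q (\<lambda>i. a * u i + (1 - a) * v i)) \<and>
  (\<forall>u v. (\<forall>n. Q (u n)) \<and> (\<forall>i\<in>I. (\<lambda>n. u n i) \<longlonglongrightarrow> v i) --> Q v) \<and>
  (\<forall>g\<in>carrier G. \<forall>w\<in>space M. \<forall>u. Q u --> Q (\<lambda>i. u (\<rho> g w i)))"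

text \<open>The Markov operator of the random walk with step \<open>\<gamma> k\<close> of probability \<open>2 ^ -(k+1)\<close> on the skew product.\<close>

definition avg :: "(nat => 'g) => ('w => 'i => real) => 'w => 'i => real" where
 "avg \<gamma> f w i = (\<Sum>k. (1/2)^Suc k * f (act (\<gamma> k) w) (\<rho> (\<gamma> k) w i))"

lemma skew_fun_meas:
 fixes f :: "'w => 'i => real"
 assumes f: "!!i. i \<in> I ==> (\<lambda>w. f w i) \<in> borel_measurable M" and g: "g \<in> carrier G" and i: "i \<in> I"
 shows "(\<lambda>w. f (act g w) (\<rho> g w i)) \<in> borel_measurable M"
proof -
 have \<rho>: "(\<lambda>w. \<rho> g w i) \<in> measurable M (count_space I)"
  unfolding measurable_count_space_eq_countable[OF I(1)]
 proof -
  show "(\<lambda>w. \<rho> g w i) \<in> space M \<rightarrow> I \<and> (\<forall>j\<in>I. (\<lambda>w. \<rho> g w i) -` {j} \<inter> space M \<in> sets M)"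
  proof (intro conjI ballI)
   show "(\<lambda>w. \<rho> g w i) \<in> space M \<rightarrow> I" using \<rho>_in[OF g] i by blast
   fix j assume "j \<in> I"
   from \<rho>_meas[OF g i this] show "(\<lambda>w. \<rho> g w i) -` {j} \<inter> space M \<in> sets M"
    by (simp add: vimage_def Int_def conj_commute)
  qed
 qed
 have "(\<lambda>w. f (act g w) j) \<in> borel_measurable M" if "j \<in> I" for j
  by (rule measurable_compose[OF act_meas[OF g] f[OF that]])
 from measurable_compose_countable'[of I "\<lambda>j w. f (act g w) j" M borel "\<lambda>w. \<rho> g w i", OF this \<rho> I(1)]
 show ?thesis .
qed

lemma avg_meas:
 assumes f: "!!i. i \<in> I ==> (\<lambda>w. f w i) \<in> borel_measurable M" and \<gamma>: "!!k. \<gamma> k \<in> carrier G" and i: "i \<in> I"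
 shows "(\<lambda>w. avg \<gamma> f w i) \<in> borel_measurable M"
 unfolding avg_def using skew_fun_meas[OF f \<gamma> i] by measurable

lemma admissible_half_series:
 assumes Q: "admissible Q" and u: "!!k. Q (u k)" shows "Q (\<lambda>i. \<Sum>k. (1/2)^Suc k * u k i)"
proof -
 have conv: "Q (\<lambda>i. a * u i + (1 - a) * v i)" if "Q u" "Q v" "0 \<le> a" "a \<le> 1" for u v a
  using Q[unfolded admissible_def, THEN conjunct2, THEN conjunct1, rule_format, of u v a] that by simp
 have lim: "Q v" if "!!n. Q (u n)" "!!i. i \<in> I ==> (\<lambda>n. u n i) \<longlonglongrightarrow> v i" for u v
  using Q[unfolded admissible_def, THEN conjunct2, THEN conjunct2, THEN conjunct1, rule_format, of u v] that by simp
 have b: "0 \<le> u k i \<and> u k i \<le> 1" if "i \<in> I" for k i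
  using Q[unfolded admissible_def, THEN conjunct1, rule_format, OF u that] .
 have part: "Q (\<lambda>i. (\<Sum>k<n. (1/2)^Suc k * u k i) + (1/2)^n * v i)" if "Q v" for n v
  using that
 proof (induction n arbitrary: v)
  case (Suc n)
  have "Q (\<lambda>i. (1/2) * u n i + (1 - 1/2) * v i)" by (rule conv[OF u Suc.prems]) auto
  from Suc.IH[OF this] show ?case by (simp add: algebra_simps)
 qed simp
 show ?thesis
 proof (rule lim[of "\<lambda>n i. (\<Sum>k<n. (1/2)^Suc k * u k i) + (1/2)^n * u 0 i", OF part[OF u]])
  fix i assume i: "i \<in> I"
  have "(\<lambda>n. (\<Sum>k<n. (1/2)^Suc k * u k i) + (1/2)^n * u 0 i) \<longlonglongrightarrow> (\<Sum>k. (1/2)^Suc k * u k i) + 0 * u 0 i"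
   using summable_LIMSEQ[OF half_summable[of "\<lambda>k. u k i"]] b[OF i]
   by (intro tendsto_add tendsto_mult tendsto_const LIMSEQ_realpow_zero) auto
  thus "(\<lambda>n. (\<Sum>k<n. (1/2)^Suc k * u k i) + (1/2)^n * u 0 i) \<longlonglongrightarrow> (\<Sum>k. (1/2)^Suc k * u k i)" by simp
 qed
qed

text \<open>Cesaro averages of the iterates of \<open>avg\<close> show that the sets \<open>E n\<close> of admissible functions that are stationary up to
 \<open>1/(n+1)\<close> are nonempty. They are convex and decreasing, so \<open>convex_minimisers_converge\<close> provides a sequence in them that
 converges almost everywhere; it is applied on \<open>I \<times> \<Omega>\<close>, where \<open>I\<close> carries a probability measure that charges all points.
 The limit is stationary.\<close>

theorem ex_stationary:
 assumes \<gamma>: "!!k. \<gamma> k \<in> carrier G" and Q: "admissible Q"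
  and f0: "!!i. i \<in> I ==> (\<lambda>w. f0 w i) \<in> borel_measurable M" "!!w. w \<in> space M ==> Q (f0 w)"
 obtains \<nu> where "!!i. i \<in> I ==> (\<lambda>w. \<nu> w i) \<in> borel_measurable M" "!!w. w \<in> space M ==> Q (\<nu> w)"
  "AE w in M. \<forall>i\<in>I. \<nu> w i = avg \<gamma> \<nu> w i"
proof -
 have conv: "Q (\<lambda>i. a * u i + (1 - a) * v i)" if "Q u" "Q v" "0 \<le> a" "a \<le> 1" for u v a
  using Q[unfolded admissible_def, THEN conjunct2, THEN conjunct1, rule_format, of u v a] that by simp
 have lim: "Q v" if "!!n. Q (u n)" "!!i. i \<in> I ==> (\<lambda>n. u n i) \<longlonglongrightarrow> v i" for u v
  using Q[unfolded admissible_def, THEN conjunct2, THEN conjunct2, THEN conjunct1, rule_format, of u v] that by simp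
 have b: "0 \<le> u i \<and> u i \<le> 1" if "Q u" "i \<in> I" for u i
  using Q[unfolded admissible_def, THEN conjunct1, rule_format, OF that] .
 have Qinv: "Q (\<lambda>i. u (\<rho> g w i))" if "Q u" "g \<in> carrier G" "w \<in> space M" for u g w
  using Q[unfolded admissible_def, THEN conjunct2, THEN conjunct2, THEN conjunct2, rule_format, of g w u] that by simp
 define A where "A = {f. (\<forall>i\<in>I. (\<lambda>w. f w i) \<in> borel_measurable M) \<and> (\<forall>w\<in>space M. Q (f w))}"
 have Ab: "0 \<le> f (act (\<gamma> k) w) (\<rho> (\<gamma> k) w i) \<and> f (act (\<gamma> k) w) (\<rho> (\<gamma> k) w i) \<le> 1" if "f \<in> A" "w \<in> space M" "i \<in> I" for f k w i
  using that b act_in[OF \<gamma>] \<rho>_in[OF \<gamma>] unfolding A_def by blast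
 have Aavg: "avg \<gamma> f \<in> A" if f: "f \<in> A" for f
 proof -
  have "Q (avg \<gamma> f w)" if w: "w \<in> space M" for w
  proof -
   have "Q (\<lambda>i. f (act (\<gamma> k) w) (\<rho> (\<gamma> k) w i))" for k
    using Qinv[OF _ \<gamma> w, of "f (act (\<gamma> k) w)" k] f act_in[OF \<gamma> w] unfolding A_def by blast
   from admissible_half_series[OF Q this] show ?thesis unfolding avg_def[abs_def] .
  qed
  moreover have "(\<lambda>w. avg \<gamma> f w i) \<in> borel_measurable M" if "i \<in> I" for i
   using f \<gamma> that unfolding A_def by (intro avg_meas) auto
  ultimately show ?thesis unfolding A_def by blast
 qed
 have Aconv: "(\<lambda>w i. a * f w i + (1 - a) * g w i) \<in> A" if "f \<in> A" "g \<in> A" "0 \<le> a" "a \<le> 1" for f g a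
  using that conv unfolding A_def by (auto intro!: borel_measurable_add borel_measurable_times)
 have avg_lin: "avg \<gamma> (\<lambda>w i. a * f w i + c * g w i) w i = a * avg \<gamma> f w i + c * avg \<gamma> g w i"
  if "f \<in> A" "g \<in> A" "w \<in> space M" "i \<in> I" for f g a c w i
 proof -
  let ?F = "\<lambda>k. f (act (\<gamma> k) w) (\<rho> (\<gamma> k) w i)" and ?G = "\<lambda>k. g (act (\<gamma> k) w) (\<rho> (\<gamma> k) w i)"
  have sF: "summable (\<lambda>k. (1/2)^Suc k * ?F k)" and sG: "summable (\<lambda>k. (1/2)^Suc k * ?G k)"
   using Ab[OF that(1,3,4)] Ab[OF that(2,3,4)] by (auto intro!: half_summable simp del: power_Suc)
  have "avg \<gamma> (\<lambda>w i. a * f w i + c * g w i) w i = (\<Sum>k. a * ((1/2)^Suc k * ?F k) + c * ((1/2)^Suc k * ?G k))"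
   unfolding avg_def by (simp only: distrib_left mult.left_commute)
  also have "\<dots> = a * (\<Sum>k. (1/2)^Suc k * ?F k) + c * (\<Sum>k. (1/2)^Suc k * ?G k)"
   using suminf_add[OF summable_mult[OF sF] summable_mult[OF sG], of a c] suminf_mult[OF sF, of a] suminf_mult[OF sG, of c] by linarith
  finally show ?thesis unfolding avg_def .
 qed
 define E where "E n = {f \<in> A. \<forall>w\<in>space M. \<forall>i\<in>I. \<bar>avg \<gamma> f w i - f w i\<bar> \<le> 1 / real (Suc n)}" for n
 have E_ne: "E n ~= {}" for n
 proof -
  define p where "p j = (avg \<gamma> ^^ j) f0" for j
  have pS: "p (Suc j) = avg \<gamma> (p j)" for j unfolding p_def by simp
  have p: "p j \<in> A" for j
   by (induction j) (use f0 Aavg in \<open>auto simp: p_def A_def[symmetric]\<close>, simp add: A_def)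
  \<comment> \<open>The Cesaro averages of \<open>p 0, \<dots>, p m\<close>, in recursive form.\<close>
  define c where "c m = rec_nat f0 (\<lambda>m c w i. (1 - 1 / real (Suc (Suc m))) * c w i + (1 / real (Suc (Suc m))) * p (Suc m) w i) m" for m
  have cS: "c (Suc m) = (\<lambda>w i. (1 - 1 / real (Suc (Suc m))) * c m w i + (1 - (1 - 1 / real (Suc (Suc m)))) * p (Suc m) w i)" for m
   unfolding c_def by simp
  have c0: "c 0 = p 0" unfolding c_def p_def by simp
  have cA: "c m \<in> A" for m
  proof (induction m)
   case (Suc m) thus ?case unfolding cS using p by (intro Aconv) auto
  qed (simp add: c0 p)
  have c: "avg \<gamma> (c m) w i - c m w i = (p (Suc m) w i - p 0 w i) / real (Suc m)" if w: "w \<in> space M" "i \<in> I" for w i m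
  proof (induction m)
   case 0 thus ?case by (simp add: c0 pS)
  next
   case (Suc m)
   let ?r = "real (Suc (Suc m))"
   have "avg \<gamma> (c (Suc m)) w i - c (Suc m) w i = (1 - 1 / ?r) * (avg \<gamma> (c m) w i - c m w i) + (1 / ?r) * (p (Suc (Suc m)) w i - p (Suc m) w i)"
    unfolding cS avg_lin[OF cA p w] pS[of "Suc m"] by (simp add: algebra_simps)
   also have "\<dots> = (1 - 1 / ?r) * ((p (Suc m) w i - p 0 w i) / real (Suc m)) + (1 / ?r) * (p (Suc (Suc m)) w i - p (Suc m) w i)"
    unfolding Suc ..
   also have "(1 - 1 / ?r) * ((p (Suc m) w i - p 0 w i) / real (Suc m)) = (1 / ?r) * (p (Suc m) w i - p 0 w i)"
   proof -
    have "1 - 1 / ?r = real (Suc m) / ?r" by (simp add: field_simps)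
    thus ?thesis by simp
   qed
   finally show ?case by (simp add: algebra_simps diff_divide_distrib)
  qed
  have "c n \<in> E n"
  proof -
   have "\<bar>avg \<gamma> (c n) w i - c n w i\<bar> \<le> 1 / real (Suc n)" if w: "w \<in> space M" "i \<in> I" for w i
   proof -
    have "0 \<le> p j w i \<and> p j w i \<le> 1" for j using p[of j] b w unfolding A_def by blast
    from this[of 0] this[of "Suc n"] have "\<bar>p (Suc n) w i - p 0 w i\<bar> \<le> 1" by linarith
    thus ?thesis unfolding c[OF w] abs_divide by (intro frac_le) auto
   qed
   thus ?thesis unfolding E_def using cA by blast
  qed
  thus ?thesis by blast
 qed
 have E_dec: "E (Suc n) \<subseteq> E n" for n
 proof -
  have "1 / real (Suc (Suc n)) \<le> 1 / real (Suc n)" by (intro frac_le) auto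
  thus ?thesis unfolding E_def by (blast intro: order_trans)
 qed
 have E_mid: "(\<lambda>w i. (f w i + g w i) / 2) \<in> E n" if f: "f \<in> E n" and g: "g \<in> E n" for f g n
 proof -
  have fA: "f \<in> A" "g \<in> A" using f g unfolding E_def by auto
  have eq: "(\<lambda>w i. (f w i + g w i) / 2) = (\<lambda>w i. (1/2) * f w i + (1 - 1/2) * g w i)" by (auto simp: field_simps)
  have "(\<lambda>w i. (f w i + g w i) / 2) \<in> A" unfolding eq using fA by (intro Aconv) auto
  moreover have "\<bar>avg \<gamma> (\<lambda>w i. (f w i + g w i) / 2) w i - (f w i + g w i) / 2\<bar> \<le> 1 / real (Suc n)" if w: "w \<in> space M" "i \<in> I" for w i
  using f g w unfolding E_def eq avg_lin[OF fA w] by (fastforce simp: abs_le_iff field_simps)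
  ultimately show ?thesis unfolding E_def by blast
 qed
 define e where "e = from_nat_into I"
 have e: "e k \<in> I" for k unfolding e_def using I(2) by (rule from_nat_into)
 have eI: "\<exists>k. i = e k" if "i \<in> I" for i unfolding e_def using from_nat_into_surj[OF I(1) that] by metis
 define N where "N = measure_pmf (geometric_pmf (1/2)) \<Otimes>\<^sub>M M"
 define toN where "toN f = (\<lambda>(k, w). f w (e k))" for f :: "'w => 'i => real"
 interpret N: prob_space N unfolding N_def by (intro prob_space_pair prob_space_axioms prob_space_measure_pmf)
 have toN_meas: "toN f \<in> borel_measurable N" if "f \<in> A" for f
 proof -
  have "toN f \<in> measurable (count_space UNIV \<Otimes>\<^sub>M M) borel"
  proof (rule measurable_pair_measure_countable1)
   fix k show "(\<lambda>w. toN f (k, w)) \<in> borel_measurable M" using that e unfolding toN_def A_def by simp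
  qed simp
  moreover have "sets N = sets (count_space UNIV \<Otimes>\<^sub>M M)" unfolding N_def by (intro sets_pair_measure_cong) auto
  ultimately show ?thesis by (simp cong: measurable_cong_sets)
 qed
 obtain u where u: "!!j. u j \<in> toN ` E j" and uc: "AE x in N. convergent (\<lambda>j. u j x)"
 proof (rule N.convex_minimisers_converge[of "\<lambda>n. toN ` E n"])
  show "f \<in> borel_measurable N" if "f \<in> toN ` E n" for f n using that toN_meas unfolding E_def by blast
  show "0 \<le> f x \<and> f x \<le> 1" if "f \<in> toN ` E n" "x \<in> space N" for f n x
  proof -
   obtain f' where f': "f' \<in> A" "f = toN f'" using \<open>f \<in> toN ` E n\<close> unfolding E_def by blast
   obtain k w where x: "x = (k, w)" by (cases x)
   show ?thesis
    using that(2) b[OF _ e] f' unfolding N_def x toN_def A_def by (simp add: space_pair_measure)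
  qed
  show "toN ` E (Suc n) \<subseteq> toN ` E n" for n using E_dec by blast
  show "toN ` E n ~= {}" for n using E_ne by blast
  show "(\<lambda>x. (f x + g x) / 2) \<in> toN ` E n" if fg: "f \<in> toN ` E n" "g \<in> toN ` E n" for f g n
  using fg E_mid unfolding toN_def by auto
 qed (rule that)
 have "\<forall>j. \<exists>f. f \<in> E j \<and> u j = toN f" using u by blast
 then obtain v where v: "!!j. v j \<in> E j" "!!j. u j = toN (v j)" by metis
 interpret pair_sigma_finite "measure_pmf (geometric_pmf (1/2))" M
  by (intro pair_sigma_finite.intro sigma_finite_measure_axioms prob_space_imp_sigma_finite prob_space_measure_pmf)
 have "AE k in measure_pmf (geometric_pmf (1/2)). AE w in M. convergent (\<lambda>j. u j (k, w))"
  using uc unfolding N_def by (rule AE_pair)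
 hence "AE w in M. convergent (\<lambda>j. v j w (e k))" for k
  unfolding AE_measure_pmf_iff by (simp add: set_pmf_geometric v toN_def)
 hence "AE w in M. \<forall>k. convergent (\<lambda>j. v j w (e k))" unfolding AE_all_countable by blast
 then obtain Z where Z: "!!w. w \<in> space M - Z ==> \<forall>k. convergent (\<lambda>j. v j w (e k))" "Z \<in> null_sets M" by (rule AE_E3) (rule that)
 have Zm: "Z \<in> sets M" using Z(2) by auto
 define \<nu> where "\<nu> w i = (if w \<in> Z then f0 w i else lim (\<lambda>j. v j w i))" for w i
 have vl: "(\<lambda>j. v j w i) \<longlonglongrightarrow> \<nu> w i" if "w \<in> space M - Z" "i \<in> I" for w i
  using Z(1)[OF that(1)] eI[OF that(2)] that(1) unfolding \<nu>_def by (auto simp: convergent_LIMSEQ_iff)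
 have vA: "v j \<in> A" for j using v(1)[of j] unfolding E_def by blast
 show ?thesis
 proof (rule that[of \<nu>])
  show "(\<lambda>w. \<nu> w i) \<in> borel_measurable M" if "i \<in> I" for i
  proof -
   have "(\<lambda>w. v j w i) \<in> borel_measurable M" for j using vA[of j] that unfolding A_def by blast
   hence "(\<lambda>w. lim (\<lambda>j. v j w i)) \<in> borel_measurable M" by (rule borel_measurable_lim_metric)
   moreover have "{w \<in> space M. w \<in> Z} = Z" using sets.sets_into_space[OF Zm] by blast
   ultimately show ?thesis unfolding \<nu>_def using f0(1)[OF that] Zm by (intro measurable_If) auto
  qed
  show "Q (\<nu> w)" if w: "w \<in> space M" for w
  using f0(2)[OF w] lim[of "\<lambda>j. v j w" "\<nu> w"] vl w vA unfolding \<nu>_def A_def by fastforce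
  have nZ: "AE w in M. w \<notin> Z" using Z(2) by (rule AE_not_in)
  hence "AE w in M. \<forall>k. act (\<gamma> k) w \<notin> Z" unfolding AE_all_countable using AE_act[OF \<gamma> nZ] by blast
  thus "AE w in M. \<forall>i\<in>I. \<nu> w i = avg \<gamma> \<nu> w i" using nZ AE_space
  proof eventually_elim
   case (elim w)
   show ?case
   proof
    fix i assume i: "i \<in> I"
    have "(\<lambda>j. avg \<gamma> (v j) w i) \<longlonglongrightarrow> avg \<gamma> \<nu> w i" unfolding avg_def
    proof (rule half_series_tendsto)
     show "0 \<le> v j (act (\<gamma> k) w) (\<rho> (\<gamma> k) w i) \<and> v j (act (\<gamma> k) w) (\<rho> (\<gamma> k) w i) \<le> 1" for j k
      using Ab[OF vA] elim i by blast
     show "(\<lambda>j. v j (act (\<gamma> k) w) (\<rho> (\<gamma> k) w i)) \<longlonglongrightarrow> \<nu> (act (\<gamma> k) w) (\<rho> (\<gamma> k) w i)" for k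
      using elim i act_in[OF \<gamma>] \<rho>_in[OF \<gamma>] by (intro vl) auto
    qed
    hence l: "(\<lambda>j. avg \<gamma> (v j) w i - v j w i) \<longlonglongrightarrow> avg \<gamma> \<nu> w i - \<nu> w i"
     using elim i by (intro tendsto_diff vl) auto
    have "\<bar>avg \<gamma> (v j) w i - v j w i\<bar> \<le> 1 / real (Suc j)" for j
     using v(1)[of j] elim i unfolding E_def by blast
    hence "(\<lambda>j. avg \<gamma> (v j) w i - v j w i) \<longlonglongrightarrow> 0"
     by (intro Lim_null_comparison[OF _ LIMSEQ_Suc[OF lim_1_over_n]]) (auto intro!: always_eventually)
    from LIMSEQ_unique[OF l this] show "\<nu> w i = avg \<gamma> \<nu> w i" by simp
   qed
  qed
 qed
qed

end

section \<open>Fubini arguments with a right-invariant measure\<close>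

locale mp_action = pmp_action M G act
 for M :: "'w measure" and lam :: "'g measure" and G :: "('g, 'm) monoid_scheme" (structure) and act +
 assumes act_joint: "(\<lambda>(g, w). act g w) \<in> measurable (lam \<Otimes>\<^sub>M M) M"
  and lam_space: "space lam = carrier G" and lam_sf: "sigma_finite_measure lam" and lam_ne: "emeasure lam (carrier G) ~= 0"
  and lam_right: "!!A h. A \<in> sets lam ==> h \<in> carrier G ==> emeasure lam {g\<in>carrier G. g \<otimes> h \<in> A} = emeasure lam A"
begin

sublocale LM: pair_sigma_finite lam M
 by (intro pair_sigma_finite.intro lam_sf sigma_finite_measure_axioms)

text \<open>Joint measurability of a relation between group elements and points.\<close>

definition jmeas :: "('g => 'w => bool) => bool" where
 "jmeas R \<longleftrightarrow> {x\<in>space (lam \<Otimes>\<^sub>M M). R (fst x) (snd x)} \<in> sets (lam \<Otimes>\<^sub>M M)"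

lemma jmeas_cong:
 assumes "jmeas R" "!!g w. g \<in> carrier G ==> w \<in> space M ==> R g w \<longleftrightarrow> R' g w" shows "jmeas R'"
proof -
 have "{x\<in>space (lam \<Otimes>\<^sub>M M). R (fst x) (snd x)} = {x\<in>space (lam \<Otimes>\<^sub>M M). R' (fst x) (snd x)}"
  using assms(2) by (auto simp: space_pair_measure lam_space)
 thus ?thesis using assms(1) unfolding jmeas_def by simp
qed

lemma jmeas_logic:
 "jmeas R ==> jmeas (\<lambda>g w. \<not> R g w)" "jmeas R ==> jmeas R' ==> jmeas (\<lambda>g w. R g w \<and> R' g w)"
 "(!!i. i \<in> J ==> jmeas (Q i)) ==> countable J ==> jmeas (\<lambda>g w. \<exists>i\<in>J. Q i g w)"
 unfolding jmeas_def by (auto intro: sets.sets_Collect sets.sets_Collect_countable_Ex')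

lemma jmeas_act: assumes "A \<in> sets M" shows "jmeas (\<lambda>g w. act g w \<in> A)"
 using measurable_sets[OF act_joint assms] unfolding jmeas_def by (simp add: vimage_def Int_def conj_commute case_prod_unfold)

lemma jmeas_snd: assumes "{w\<in>space M. Q w} \<in> sets M" shows "jmeas (\<lambda>g w. Q w)"
 using assms unfolding jmeas_def by (auto simp: space_pair_measure)

lemma jmeas_sections:
 assumes R: "jmeas R"
 shows "g \<in> carrier G ==> {w\<in>space M. R g w} \<in> sets M" "w \<in> space M ==> {g\<in>carrier G. R g w} \<in> sets lam"
  "{w\<in>space M. emeasure lam {g\<in>carrier G. R g w} ~= 0} \<in> sets M"
proof -
 let ?R = "{x\<in>space (lam \<Otimes>\<^sub>M M). R (fst x) (snd x)}"
 note R' = R[unfolded jmeas_def]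
 have eq: "(\<lambda>g. (g, w)) -` ?R = {g\<in>carrier G. R g w}" if "w \<in> space M" for w
  using that by (auto simp: space_pair_measure lam_space)
 have "Pair g -` ?R = {w\<in>space M. R g w}" if "g \<in> carrier G" using that by (auto simp: space_pair_measure lam_space)
 thus "g \<in> carrier G ==> {w\<in>space M. R g w} \<in> sets M" using sets_Pair1[OF R', of g] by simp
 show "w \<in> space M ==> {g\<in>carrier G. R g w} \<in> sets lam" using sets_Pair2[OF R', of w] eq by simp
 have "{w\<in>space M. emeasure lam ((\<lambda>g. (g, w)) -` ?R) ~= 0} \<in> sets M" using LM.measurable_emeasure_Pair2[OF R'] by measurable
 thus "{w\<in>space M. emeasure lam {g\<in>carrier G. R g w} ~= 0} \<in> sets M" using eq by (simp cong: conj_cong)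
qed

text \<open>Fubini's theorem exchanges \<open>for every g, almost every w\<close> for \<open>for almost every w, almost every g\<close>; this replaces an uncountable union of null sets.\<close>

lemma AE_null_section:
 assumes R: "jmeas R" and ae: "!!g. g \<in> carrier G ==> AE w in M. \<not> R g w"
 shows "AE w in M. emeasure lam {g\<in>carrier G. R g w} = 0"
proof -
 have "AE g in lam. AE w in M. \<not> R g w" by (rule AE_I2) (use ae in \<open>simp add: lam_space\<close>)
 hence "AE w in M. AE g in lam. \<not> R g w"
  using jmeas_logic(1)[OF R] unfolding jmeas_def by (subst (asm) LM.AE_commute)
 thus ?thesis using AE_space
 proof eventually_elim
  case (elim w)
  hence "AE g in lam. g \<notin> {g\<in>carrier G. R g w}" by auto
  thus ?case using AE_iff_null_sets[OF jmeas_sections(2)[OF R elim(2)]] by (simp add: null_setsD1)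
 qed
qed

text \<open>An almost invariant event \<open>A\<close> differs by a null set from the event \<open>A'\<close> of all \<open>w\<close> with \<open>act g w \<in> A\<close> for almost
 every \<open>g\<close>, and \<open>A'\<close> is strictly invariant because the measure on the group is right-invariant.\<close>

lemma ergodic_action_ergodic_on:
 assumes erg: "ergodic_action G M act" shows "ergodic_on (carrier G)"
 unfolding ergodic_on_def
proof (intro ballI impI)
 fix A assume A: "A \<in> sets M" and inv: "\<forall>g\<in>carrier G. AE w in M. act g w \<in> A \<longleftrightarrow> w \<in> A"
 define bad where "bad w = {g\<in>carrier G. act g w \<notin> A}" for w
 define A' where "A' = {w\<in>space M. emeasure lam (bad w) = 0}"
 note jA = jmeas_act[OF A] and jA' = jmeas_snd[of "\<lambda>w. w \<in> A"]
 have A2: "{w\<in>space M. w \<in> A} \<in> sets M" using A by (simp add: Int_absorb1 Int_def[symmetric])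
 note secs = jmeas_sections[OF jmeas_logic(1)[OF jA]]
 have bad_meas: "bad w \<in> sets lam" if "w \<in> space M" for w unfolding bad_def by (rule secs(2)[OF that])
 have "A' = space M - {w\<in>space M. emeasure lam (bad w) ~= 0}" unfolding A'_def by auto
 hence A'M: "A' \<in> sets M" using secs(3) unfolding bad_def by auto
 have A'_iff: "act h w \<in> A' \<longleftrightarrow> w \<in> A'" if h: "h \<in> carrier G" and w: "w \<in> space M" for h w
 proof -
  have "bad (act h w) = {g\<in>carrier G. g \<otimes> h \<in> bad w}" unfolding bad_def using h w act_mult by auto
  thus ?thesis unfolding A'_def using lam_right[OF bad_meas[OF w] h] act_in[OF h w] w by simp
 qed
 have "act h ` A' = A'" if h: "h \<in> carrier G" for h
 proof
  show "act h ` A' \<subseteq> A'" using A'_iff[OF h] unfolding A'_def by blast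
  show "A' \<subseteq> act h ` A'"
  proof
   fix w assume w: "w \<in> A'"
   thus "w \<in> act h ` A'"
    using A'_iff[of "inv h" w] h act_inv(2)[OF h ] unfolding A'_def by force
  qed
 qed
 hence "prob A' = 0 \<or> prob A' = 1" using erg[unfolded ergodic_action_def, rule_format, OF A'M] by simp
 moreover have "AE w in M. w \<in> A' \<longleftrightarrow> w \<in> A"
 proof -
  have "AE w in M. emeasure lam {g\<in>carrier G. act g w \<notin> A \<and> w \<in> A} = 0"
   by (rule AE_null_section[OF jmeas_logic(2)[OF jmeas_logic(1)[OF jA] jA'[OF A2]]]) (use inv in \<open>auto elim: eventually_mono\<close>)
  moreover have "AE w in M. emeasure lam {g\<in>carrier G. act g w \<in> A \<and> w \<notin> A} = 0"
   by (rule AE_null_section[OF jmeas_logic(2)[OF jA jmeas_logic(1)[OF jA'[OF A2]]]]) (use inv in \<open>auto elim: eventually_mono\<close>)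
  ultimately show ?thesis using AE_space
  proof eventually_elim
   case (elim w)
   show ?case
   proof (cases "w \<in> A")
    case True thus ?thesis using elim unfolding A'_def bad_def by simp
   next
    case False
    have m: "carrier G - bad w \<in> sets lam" using bad_meas[OF elim(3)] sets.top[of lam] unfolding lam_space by blast
    have "carrier G - bad w = {g\<in>carrier G. act g w \<in> A \<and> w \<notin> A}" using False unfolding bad_def by auto
    moreover have "carrier G = bad w \<union> (carrier G - bad w)" unfolding bad_def by auto
    hence "emeasure lam (carrier G) \<le> emeasure lam (bad w) + emeasure lam (carrier G - bad w)"
     using emeasure_subadditive[OF bad_meas[OF elim(3)] m] by simp
    ultimately show ?thesis using False lam_ne elim(2) unfolding A'_def by auto
   qed
  qed
 qed
 hence "prob A' = prob A" using A A'M by (intro measure_eq_AE) auto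
 ultimately show "prob A = 0 \<or> prob A = 1" by simp
qed

end

section \<open>Cocycles with values in the isometries of a median space\<close>

text \<open>The action on \<open>X\<close> is now a cocycle. Its isometries are required as maps in the sense of \<open>iso\<close>, and measurability only
 through evaluation at points, which is all that matters on the countable sets of centers and tests.\<close>

locale cocycle_geometry = main_geometry X + mp_action M lam G act
 for X :: "'x metric" and M :: "'w measure" and lam :: "'g measure" and G :: "('g, 'm) monoid_scheme" (structure) and act +
 fixes coc :: "'g => 'w => 'x => 'x" and p q :: 'x
 assumes base: "base p q"
  and coc_iso: "!!g w. g \<in> carrier G ==> w \<in> space M ==> iso (coc g w)"
  and coc_mult: "!!g h w x. g \<in> carrier G ==> h \<in> carrier G ==> w \<in> space M ==> x \<in> S ==>
   coc (g \<otimes> h) w x = coc g (act h w) (coc h w x)"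
  and coc_joint: "!!x y. x \<in> S ==> y \<in> S ==> jmeas (\<lambda>g w. coc g w x = y)"
  and dense: "\<exists>D :: nat => 'w set. (\<forall>n. D n \<in> sets M) \<and> (\<forall>A e. A \<in> sets M --> 0 < e --> (\<exists>n. prob ((A - D n) \<union> (D n - A)) < e))"
  and non_elem: "!!H A. thick H ==> A \<in> sets M ==> 0 < prob A ==> \<exists>g\<in>carrier G. \<exists>w\<in>A. act g w \<in> A \<and> coc g w ` H \<subseteq> S - H"
begin

abbreviation "\<T> \<equiv> tests p q"

lemma coc_one: assumes w: "w \<in> space M" and x: "x \<in> S" shows "coc \<one> w x = x"
 using w coc_mult[of "\<one>" "\<one>" w x] x act_one iso_inj iso_in coc_iso unfolding inj_on_def by force

lemma centers_S: "y \<in> centers ==> y \<in> S" using centers_sub by blast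

lemma image_comp_coc: assumes "g \<in> carrier G" "h \<in> carrier G" "w \<in> space M" "B \<subseteq> S"
 shows "coc (g \<otimes> h) w ` B = coc g (act h w) ` coc h w ` B"
proof -
 have "coc (g \<otimes> h) w x = coc g (act h w) (coc h w x)" if "x \<in> B" for x using coc_mult[OF assms(1-3)] that assms(4) by blast
 thus ?thesis unfolding image_image by (intro image_cong) auto
qed

text \<open>A test set is determined by two centers up to complement, so its translate is determined by the values of the cocycle at two points.\<close>

lemma test_joint: assumes B: "B \<in> \<T>" shows "jmeas (\<lambda>g w. coc g w ` B = B')"
proof -
 have pq: "p \<in> centers" "q \<in> centers" using base unfolding base_def by auto
 have main: "jmeas (\<lambda>g w. R (coc g w x) (coc g w y))" if xy: "x \<in> centers" "y \<in> centers" for R x y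
 proof -
  let ?J = "{z \<in> centers \<times> centers. R (fst z) (snd z)}"
  have "jmeas (\<lambda>g w. \<exists>z\<in>?J. coc g w x = fst z \<and> coc g w y = snd z)"
   using countable_subset[OF _ countable_SIGMA[OF countable_centers countable_centers], of ?J] xy
   by (intro jmeas_logic coc_joint) (auto simp: centers_S)
  moreover have "(\<exists>z\<in>?J. coc g w x = fst z \<and> coc g w y = snd z) \<longleftrightarrow> R (coc g w x) (coc g w y)"
   if "g \<in> carrier G" "w \<in> space M" for g w
   using centers_iso[OF coc_iso[OF that] xy(1)] centers_iso[OF coc_iso[OF that] xy(2)] by force
  ultimately show ?thesis by (rule jmeas_cong)
 qed
 obtain f where f: "iso f" and B': "B = f ` shadow p q \<or> B = S - f ` shadow p q" using B unfolding tests_def by blast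
 have xy: "f p \<in> centers" "f q \<in> centers" using centers_iso[OF f] pq by auto
 have sh: "f ` shadow p q = shadow (f p) (f q)" using shadow_iso[OF f] pq centers_S by blast
 have im: "coc g w ` shadow (f p) (f q) = shadow (coc g w (f p)) (coc g w (f q))"
  "coc g w ` (S - shadow (f p) (f q)) = S - shadow (coc g w (f p)) (coc g w (f q))" if "g \<in> carrier G" "w \<in> space M" for g w
  using shadow_iso[OF coc_iso[OF that]] iso_diff[OF coc_iso[OF that] shadow_sub] xy centers_S by auto
 from B' show ?thesis
 using im jmeas_cong[OF main[OF xy, of "\<lambda>x y. shadow x y = B'"]] jmeas_cong[OF main[OF xy, of "\<lambda>x y. S - shadow x y = B'"]] unfolding sh by auto
qed

lemma tests_nonempty: "\<T> ~= {}"
proof -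
 have "id ` shadow p q \<in> \<T>" unfolding tests_def by (rule UnI1, rule CollectI, rule exI[of _ id], simp add: iso_id)
 thus ?thesis by (metis empty_iff)
qed

sublocale T: skew_action M G act \<T> "\<lambda>g w B. coc g w ` B"
proof unfold_locales
 fix g h w B assume "g \<in> carrier G" "h \<in> carrier G" "w \<in> space M" "B \<in> \<T>"
 thus "coc (g \<otimes> h) w ` B = coc g (act h w) ` coc h w ` B" by (intro image_comp_coc tests_sub)
next
 fix w B assume w: "w \<in> space M" and "B \<in> \<T>"
 hence "coc \<one> w x = x" if "x \<in> B" for x using tests_sub coc_one[OF w] that by blast
 thus "coc \<one> w ` B = B" by simp
next
 fix g B B' assume "g \<in> carrier G" "B \<in> \<T>"
 thus "{w\<in>space M. coc g w ` B = B'} \<in> sets M" using jmeas_sections(1)[OF test_joint] by blast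
qed (use countable_tests[OF base] tests_nonempty tests_iso coc_iso in auto)

text \<open>A random intersecting family of test sets, invariant under a set of group elements.\<close>

definition inv_filter :: "'g set => ('w => 'x set => bool) => bool" where
 "inv_filter R C \<longleftrightarrow> T.meas_field C \<and> (\<forall>g\<in>R. T.inv_field g C) \<and>
  (AE w in M. \<forall>B\<in>\<T>. \<forall>B'\<in>\<T>. C w B \<and> C w B' --> B \<inter> B' ~= {}) \<and> (AE w in M. \<exists>B\<in>\<T>. C w B)"

text \<open>The traces on test sets of finitely additive probability measures satisfy these conditions. Only complements and disjoint sums
 are recorded, which pass to convex combinations, pointwise limits and translates.\<close>

definition mean :: "('x set => real) => bool" where
 "mean u \<longleftrightarrow> (\<forall>B\<in>\<T>. 0 \<le> u B \<and> u B \<le> 1 \<and> u (S - B) = 1 - u B) \<and>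
  (\<forall>F. finite F \<and> F \<subseteq> \<T> \<and> pairwise disjnt F --> sum u F \<le> 1)"

lemma meanD: assumes "mean u" "B \<in> \<T>" shows "0 \<le> u B" "u B \<le> 1" "u (S - B) = 1 - u B"
 using assms unfolding mean_def by auto

lemma mean_sum: assumes "mean u" "finite F" "F \<subseteq> \<T>" "pairwise disjnt F" shows "sum u F \<le> 1"
 using assms unfolding mean_def by simp

lemma mean_admissible: "T.admissible mean"
 unfolding T.admissible_def
proof (intro conjI allI impI ballI)
 fix u B assume "mean u" "B \<in> \<T>" thus "0 \<le> u B" "u B \<le> 1" by (rule meanD)+
next
 fix u v :: "'x set => real" and a :: real assume "mean u \<and> mean v \<and> 0 \<le> a \<and> a \<le> 1"
 hence u: "mean u" and v: "mean v" and a: "0 \<le> a" "a \<le> 1" by auto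
 show "mean (\<lambda>B. a * u B + (1 - a) * v B)" unfolding mean_def
 proof (intro conjI ballI allI impI)
  fix B assume B: "B \<in> \<T>"
  show "0 \<le> a * u B + (1 - a) * v B" using meanD(1)[OF u B] meanD(1)[OF v B] a by simp
  show "a * u B + (1 - a) * v B \<le> 1"
   using meanD(2)[OF u B] meanD(2)[OF v B] a by (intro convex_bound_le) auto
  show "a * u (S - B) + (1 - a) * v (S - B) = 1 - (a * u B + (1 - a) * v B)"
   unfolding meanD(3)[OF u B] meanD(3)[OF v B] by (simp add: algebra_simps)
 next
  fix F assume "finite F \<and> F \<subseteq> \<T> \<and> pairwise disjnt F"
  hence F: "sum u F \<le> 1" "sum v F \<le> 1" using mean_sum[OF u] mean_sum[OF v] by blast+
  have "(\<Sum>B\<in>F. a * u B + (1 - a) * v B) = a * sum u F + (1 - a) * sum v F"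
   by (simp add: sum.distrib sum_distrib_left)
  also have "\<dots> \<le> 1" using F a by (intro convex_bound_le) auto
  finally show "(\<Sum>B\<in>F. a * u B + (1 - a) * v B) \<le> 1" .
 qed
next
 fix u :: "nat => 'x set => real" and v assume "(\<forall>n. mean (u n)) \<and> (\<forall>B\<in>\<T>. (\<lambda>n. u n B) \<longlonglongrightarrow> v B)"
 hence u: "mean (u n)" and l: "B \<in> \<T> ==> (\<lambda>n. u n B) \<longlonglongrightarrow> v B" for n B by auto
 show "mean v" unfolding mean_def
 proof (intro conjI ballI allI impI)
  fix B assume B: "B \<in> \<T>"
  show "0 \<le> v B" by (rule LIMSEQ_le_const[OF l[OF B]]) (use meanD(1)[OF u B] in blast)
  show "v B \<le> 1" by (rule LIMSEQ_le_const2[OF l[OF B]]) (use meanD(2)[OF u B] in blast)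
  have "(\<lambda>n. u n (S - B)) \<longlonglongrightarrow> 1 - v B" unfolding meanD(3)[OF u B] by (intro tendsto_diff tendsto_const l B)
  from LIMSEQ_unique[OF l[OF tests_compl[OF B]] this] show "v (S - B) = 1 - v B" .
 next
  fix F assume F: "finite F \<and> F \<subseteq> \<T> \<and> pairwise disjnt F"
  hence "(\<lambda>n. sum (u n) F) \<longlonglongrightarrow> sum v F" by (intro tendsto_sum l) auto
  thus "sum v F \<le> 1" by (rule LIMSEQ_le_const2) (use mean_sum[OF u] F in blast)
 qed
next
 fix g w u assume g: "g \<in> carrier G" "w \<in> space M" and u: "mean u"
 note i = coc_iso[OF g]
 show "mean (\<lambda>B. u (coc g w ` B))" unfolding mean_def
 proof (intro conjI ballI allI impI)
  fix B assume B: "B \<in> \<T>"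
  note gB = tests_iso[OF i B]
  show "0 \<le> u (coc g w ` B)" "u (coc g w ` B) \<le> 1" using meanD[OF u gB] by auto
  show "u (coc g w ` (S - B)) = 1 - u (coc g w ` B)" using meanD(3)[OF u gB] iso_diff[OF i tests_sub[OF B]] by simp
 next
  fix F assume F: "finite F \<and> F \<subseteq> \<T> \<and> pairwise disjnt F"
  have FS: "B \<subseteq> S" if "B \<in> F" for B using F tests_sub that by blast
  have inj: "inj_on ((`) (coc g w)) F"
   by (rule inj_onI) (use inj_on_image_eq_iff[OF iso_inj[OF i]] FS in blast)
  have "sum u ((`) (coc g w) ` F) \<le> 1"
  proof (rule mean_sum[OF u])
   show "(`) (coc g w) ` F \<subseteq> \<T>" using F tests_iso[OF i] by blast
   show "pairwise disjnt ((`) (coc g w) ` F)"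
   proof (rule pairwise_imageI)
    fix A B assume "A \<in> F" "B \<in> F" "A ~= B"
    thus "disjnt (coc g w ` A) (coc g w ` B)"
     using F FS inj_on_image_Int[OF iso_inj[OF i], of A B] unfolding pairwise_def disjnt_def by simp
   qed
  qed (use F in simp)
  thus "(\<Sum>B\<in>F. u (coc g w ` B)) \<le> 1" using sum.reindex[OF inj, of u] by simp
 qed
qed

lemma mean_point: "mean (\<lambda>B. if p \<in> B then 1 else 0)"
 unfolding mean_def
proof (intro conjI ballI allI impI)
 show "(if p \<in> S - B then 1 else 0) = 1 - (if p \<in> B then 1 else (0::real))" for B
  using base centers_S unfolding base_def by auto
 fix F :: "'x set set" assume F: "finite F \<and> F \<subseteq> \<T> \<and> pairwise disjnt F"
 have "card (F \<inter> {B. p \<in> B}) \<le> 1"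
  using F unfolding card_le_Suc0_iff_eq[of "F \<inter> {B. p \<in> B}", simplified] One_nat_def
  by (subst card_le_Suc0_iff_eq) (auto simp: pairwise_def disjnt_def)
 thus "(\<Sum>B\<in>F. if p \<in> B then 1 else 0) \<le> (1::real)" using F by (simp add: sum.If_cases)
qed auto

text \<open>Suppose that for each of the \<open>N\<close> sets \<open>B i\<close> of \<open>tests_family\<close> the choice \<open>D = S - B i\<close> fails. A set witnessing this
 can be taken, up to complement, inside \<open>U i\<close>; being disjoint, these \<open>N\<close> sets have total mass at most \<open>1\<close> for both means, which
 contradicts a difference above \<open>s > 2 / N\<close> on each.\<close>

lemma large_difference_avoids_test:
 assumes \<mu>: "mean \<mu>" and \<nu>: "mean \<nu>" and s: "0 < s"
 obtains D where "D \<in> \<T>" "!!B. B \<in> \<T> ==> s < \<bar>\<mu> B - \<nu> B\<bar> ==> B \<subset> D \<or> S - B \<subset> D"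
proof -
 obtain N :: nat where N: "2 / s < real N" using reals_Archimedean2 by blast
 obtain U B where UB: "!!i. i < N ==> B i \<in> \<T> \<and> B i \<subseteq> U i"
  and U: "!!i j. i < N ==> j < N ==> i ~= j ==> U i \<inter> U j = {}"
  and cut: "!!i C. i < N ==> C \<in> \<T> ==> C \<inter> B i ~= {} ==> B i - C ~= {} ==> C \<subseteq> U i \<or> S - C \<subseteq> U i"
  by (rule tests_family[OF base, of N]) (rule that)
 define good where "good i \<longleftrightarrow> (\<forall>A\<in>\<T>. s < \<bar>\<mu> A - \<nu> A\<bar> --> A \<subset> S - B i \<or> S - A \<subset> S - B i)" for i
 have "\<exists>i<N. good i"
 proof (rule ccontr)
  assume n: "\<not> ?thesis"
  have ex: "\<exists>A\<in>\<T>. s < \<bar>\<mu> A - \<nu> A\<bar> \<and> \<not> A \<subset> S - B i \<and> \<not> S - A \<subset> S - B i" if "i < N" for i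
  using n that unfolding good_def by auto
  have "\<exists>A\<in>\<T>. s < \<bar>\<mu> A - \<nu> A\<bar> \<and> A \<subseteq> U i" if i: "i < N" for i
  proof -
   obtain A where A: "A \<in> \<T>" "s < \<bar>\<mu> A - \<nu> A\<bar>" "\<not> A \<subset> S - B i" "\<not> S - A \<subset> S - B i" using ex[OF i] by blast
   have AS: "A \<subseteq> S" "B i \<subseteq> S" using tests_sub A(1) UB[OF i] by blast+
   have "A \<subseteq> U i \<or> S - A \<subseteq> U i"
   proof (cases "A \<inter> B i ~= {} \<and> B i - A ~= {}")
    case True thus ?thesis using cut[OF i A(1)] by blast
   next
    case False
    then consider "A \<inter> B i = {}" | "B i \<subseteq> A" by blast
    thus ?thesis
    proof cases
     case 1
     thus ?thesis using A(3) AS UB[OF i] by blast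
    next
     case 2
     thus ?thesis using A(4) AS UB[OF i] by blast
    qed
   qed
   moreover have "s < \<bar>\<mu> (S - A) - \<nu> (S - A)\<bar>" using A(2) meanD(3)[OF \<mu> A(1)] meanD(3)[OF \<nu> A(1)] by simp
   ultimately show ?thesis using A(1,2) tests_compl[OF A(1)] by blast
  qed
  then obtain A where A: "!!i. i < N ==> A i \<in> \<T> \<and> s < \<bar>\<mu> (A i) - \<nu> (A i)\<bar> \<and> A i \<subseteq> U i" by metis
  have disj: "A i \<inter> A j = {}" if "i < N" "j < N" "i ~= j" for i j
   using U[OF that] A[OF that(1)] A[OF that(2)] by (blast 5)
  have inj: "inj_on A {..<N}"
  proof (rule inj_onI)
   fix i j assume "i \<in> {..<N}" "j \<in> {..<N}" "A i = A j"
   thus "i = j" using disj[of i j] tests_ne[OF base, of "A i"] A[of i] by auto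
  qed
  have F: "finite (A ` {..<N})" "A ` {..<N} \<subseteq> \<T>" "pairwise disjnt (A ` {..<N})"
   using A disj by (auto simp: disjnt_def intro!: pairwise_imageI)
  have "(\<Sum>i<N. \<mu> (A i)) \<le> 1" "(\<Sum>i<N. \<nu> (A i)) \<le> 1"
   using mean_sum[OF \<mu> F] mean_sum[OF \<nu> F] by (simp_all add: sum.reindex[OF inj])
  moreover have "real N * s \<le> (\<Sum>i<N. \<mu> (A i) + \<nu> (A i))"
  proof -
   have "(\<Sum>i<N. s) \<le> (\<Sum>i<N. \<mu> (A i) + \<nu> (A i))"
   proof (rule sum_mono)
    fix i assume "i \<in> {..<N}"
    thus "s \<le> \<mu> (A i) + \<nu> (A i)"
     using A meanD(1)[OF \<mu>, of "A i"] meanD(1)[OF \<nu>, of "A i"] by fastforce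
   qed
   thus ?thesis by simp
  qed
  ultimately have "real N * s \<le> 2" by (simp add: sum.distrib)
  thus False using N s by (simp add: field_simps)
 qed
 then obtain i where i: "i < N" "good i" by blast
 show ?thesis
 proof (rule that)
  show "S - B i \<in> \<T>" using UB[OF i(1)] tests_compl by simp
  show "A \<subset> S - B i \<or> S - A \<subset> S - B i" if "A \<in> \<T>" "s < \<bar>\<mu> A - \<nu> A\<bar>" for A
   using i(2) that unfolding good_def by simp
 qed
qed

lemma ex_small: assumes \<nu>: "mean \<nu>" obtains B where "B \<in> \<T>" "\<nu> B < 1/2"
proof -
 obtain U B where UB: "!!i. i < (3::nat) ==> B i \<in> \<T> \<and> B i \<subseteq> U i"
  and U: "!!i j. i < (3::nat) ==> j < 3 ==> i ~= j ==> U i \<inter> U j = {}"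
  by (rule tests_family[OF base, of "3::nat"]) (rule that)
 have disj: "B i \<inter> B j = {}" if "i < 3" "j < 3" "i ~= j" for i j :: nat
  using U[OF that] UB[OF that(1)] UB[OF that(2)] by (blast 5)
 have inj: "inj_on B {..<3}"
 proof (rule inj_onI)
  fix i j :: nat assume "i \<in> {..<3}" "j \<in> {..<3}" "B i = B j"
  thus "i = j" using disj[of i j] tests_ne[OF base, of "B i"] UB[of i] by auto
 qed
 have F: "finite (B ` {..<3})" "B ` {..<3} \<subseteq> \<T>" "pairwise disjnt (B ` {..<3})"
  using UB disj by (auto simp: disjnt_def intro!: pairwise_imageI)
 have "(\<Sum>i<3. \<nu> (B i)) \<le> 1" using mean_sum[OF \<nu> F] by (simp add: sum.reindex[OF inj])
 hence "\<nu> (B 0) < 1/2 \<or> \<nu> (B 1) < 1/2 \<or> \<nu> (B 2) < 1/2" by (auto simp: eval_nat_numeral)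
 thus ?thesis using that UB[of 0] UB[of 1] UB[of 2] by auto
qed

text \<open>Sets of mass above one half intersect, and they exist since some test set has mass below one half.\<close>

lemma filter_of_invariant_mean:
 assumes \<nu>: "!!B. B \<in> \<T> ==> (\<lambda>w. \<nu> w B) \<in> borel_measurable M" "!!w. w \<in> space M ==> mean (\<nu> w)"
  and inv: "!!g. g \<in> Q ==> AE w in M. \<forall>B\<in>\<T>. \<nu> (act g w) (coc g w ` B) = \<nu> w B"
 shows "inv_filter Q (\<lambda>w B. 1/2 < \<nu> w B)"
 unfolding inv_filter_def
proof (intro conjI ballI)
 show "T.meas_field (\<lambda>w B. 1/2 < \<nu> w B)" unfolding T.meas_field_def
 using \<nu> by auto
 show "T.inv_field g (\<lambda>w B. 1/2 < \<nu> w B)" if "g \<in> Q" for g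
  unfolding T.inv_field_def using inv[OF that] by eventually_elim simp
 show "AE w in M. \<forall>B\<in>\<T>. \<forall>B'\<in>\<T>. 1/2 < \<nu> w B \<and> 1/2 < \<nu> w B' --> B \<inter> B' ~= {}"
 proof (intro AE_I2 ballI impI notI)
  fix w B B' assume w: "w \<in> space M" and B: "B \<in> \<T>" "B' \<in> \<T>" "1/2 < \<nu> w B \<and> 1/2 < \<nu> w B'" "B \<inter> B' = {}"
  have "B ~= B'" using B(4) tests_ne[OF base B(1)] by blast
  moreover have "sum (\<nu> w) {B, B'} \<le> 1"
   using B by (intro mean_sum[OF \<nu>(2)[OF w]]) (auto simp: pairwise_def disjnt_def)
  ultimately show False using B(3) by simp
 qed
 show "AE w in M. \<exists>B\<in>\<T>. 1/2 < \<nu> w B"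
 proof (rule AE_I2)
  fix w assume "w \<in> space M"
  hence m: "mean (\<nu> w)" by (rule \<nu>(2))
  obtain B where "B \<in> \<T>" "\<nu> w B < 1/2" by (rule ex_small[OF m])
  thus "\<exists>B\<in>\<T>. 1/2 < \<nu> w B" using meanD(3)[OF m] tests_compl by (intro bexI[of _ "S - B"]) auto
 qed
qed

text \<open>The maximum principle. Take a mean \<open>\<nu>\<close> stationary for \<open>P\<close>. If some \<open>g \<in> Q\<close> does not preserve it, then \<open>\<sigma>\<close>, the change of
 \<open>\<nu>\<close> under \<open>g\<close>, is stationary too because \<open>g\<close> commutes with \<open>P\<close>. Its supremum norm \<open>m\<close> is subharmonic, hence
 invariant, hence positive almost everywhere by ergodicity. A test set where \<open>|\<sigma>|\<close> is close to \<open>m\<close> is moved by each step of the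
 random walk to one where it is still rather close. So the family \<open>C\<close> of test sets \<open>D\<close> that properly contain one side of each
 nearly extremal set is \<open>P\<close>-invariant. Two members intersect, as each properly contains a side of
 a common nearly extremal set; the family is nonempty by \<open>large_difference_avoids_test\<close>.\<close>

theorem commuting_filter:
 assumes P: "P \<subseteq> carrier G" "P ~= {}" "!!g. g \<in> P ==> inv g \<in> P" and erg: "ergodic_on P"
  and Q: "Q \<subseteq> carrier G" and comm: "!!g h. g \<in> P ==> h \<in> Q ==> g \<otimes> h = h \<otimes> g"
 shows "(\<exists>C. inv_filter Q C) \<or> (\<exists>C. inv_filter P C)"
proof -
 obtain D :: "nat => 'w set" where D: "!!n. D n \<in> sets M" "!!A e. A \<in> sets M ==> 0 < e ==> \<exists>n. prob ((A - D n) \<union> (D n - A)) < e"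
  using dense by blast
 obtain \<Gamma> where \<Gamma>: "\<Gamma> \<subseteq> P" "countable \<Gamma>"
  and \<Gamma>_inv: "!!C g. T.meas_field C ==> \<forall>g\<in>\<Gamma>. T.inv_field g C ==> g \<in> P ==> T.inv_field g C"
  by (rule T.countable_subfamily[OF D P(1)]) (assumption, assumption, rule that)
 obtain g0 where g0: "g0 \<in> P" using P(2) by blast
 \<comment> \<open>Closed under inverses, so that invariance in one direction will imply the other.\<close>
 define \<Gamma>' where "\<Gamma>' = insert g0 (insert (inv g0) (\<Gamma> \<union> m_inv G ` \<Gamma>))"
 have \<Gamma>': "countable \<Gamma>'" "\<Gamma>' ~= {}" "\<Gamma>' \<subseteq> P" unfolding \<Gamma>'_def using \<Gamma> g0 P(3) by auto
 have \<Gamma>'_inv: "inv g \<in> \<Gamma>'" if "g \<in> \<Gamma>'" for g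
  using that \<Gamma>(1) g0 P(1) unfolding \<Gamma>'_def by (auto 4 3 simp: subset_iff)
 define \<gamma> where "\<gamma> = from_nat_into \<Gamma>'"
 have \<gamma>': "\<gamma> k \<in> \<Gamma>'" for k unfolding \<gamma>_def by (rule from_nat_into[OF \<Gamma>'(2)])
 hence \<gamma>P: "\<gamma> k \<in> P" for k using \<Gamma>'(3) by blast
 hence \<gamma>: "\<gamma> k \<in> carrier G" for k using P(1) by blast
 have \<gamma>_inv: "\<exists>l. \<gamma> l = inv (\<gamma> k)" for k
  using from_nat_into_surj[OF \<Gamma>'(1) \<Gamma>'_inv[OF \<gamma>']] unfolding \<gamma>_def .
 have P_inv: "T.inv_field g C" if C: "T.meas_field C" "!!k. T.inv_field (\<gamma> k) C" and g: "g \<in> P" for C g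
 proof (rule \<Gamma>_inv[OF C(1) _ g], rule ballI)
  fix g assume "g \<in> \<Gamma>"
  then obtain k where "g = \<gamma> k" using from_nat_into_surj[OF \<Gamma>'(1)] unfolding \<Gamma>'_def \<gamma>_def by blast
  thus "T.inv_field g C" using C(2) by simp
 qed
 obtain \<nu> where \<nu>: "!!B. B \<in> \<T> ==> (\<lambda>w. \<nu> w B) \<in> borel_measurable M" "!!w. w \<in> space M ==> mean (\<nu> w)"
  and stat: "AE w in M. \<forall>B\<in>\<T>. \<nu> w B = T.avg \<gamma> \<nu> w B"
  by (rule T.ex_stationary[where \<gamma> = \<gamma>, OF \<gamma> mean_admissible, of "\<lambda>w B. if p \<in> B then 1 else 0"])
    (auto simp: mean_point)
 show ?thesis
 proof (cases "\<forall>g\<in>Q. AE w in M. \<forall>B\<in>\<T>. \<nu> (act g w) (coc g w ` B) = \<nu> w B")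
  case True
  thus ?thesis using filter_of_invariant_mean[OF \<nu>, of Q] by blast
 next
  case False
  then obtain g where gQ: "g \<in> Q" and ng: "\<not> (AE w in M. \<forall>B\<in>\<T>. \<nu> (act g w) (coc g w ` B) = \<nu> w B)" by blast
  have g: "g \<in> carrier G" using gQ Q by blast
  define \<sigma> where "\<sigma> w B = \<nu> (act g w) (coc g w ` B) - \<nu> w B" for w B
  have \<mu>: "mean (\<lambda>B. \<nu> (act g w) (coc g w ` B))" if w: "w \<in> space M" for w
   using mean_admissible[unfolded T.admissible_def, THEN conjunct2, THEN conjunct2, THEN conjunct2, rule_format, OF g w \<nu>(2)[OF act_in[OF g w]]] .
  have \<sigma>_meas: "(\<lambda>w. \<sigma> w B) \<in> borel_measurable M" if "B \<in> \<T>" for B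
   unfolding \<sigma>_def using T.skew_fun_meas[OF \<nu>(1) g that] \<nu>(1)[OF that] by simp
  have \<sigma>1: "\<bar>\<sigma> w B\<bar> \<le> 1" if w: "w \<in> space M" and B: "B \<in> \<T>" for w B
   using meanD(1,2)[OF \<mu>[OF w] B] meanD(1,2)[OF \<nu>(2)[OF w] B] unfolding \<sigma>_def by linarith
  define m where "m w = (SUP B\<in>\<T>. \<bar>\<sigma> w B\<bar>)" for w
  have bdd: "bdd_above ((\<lambda>B. \<bar>\<sigma> w B\<bar>) ` \<T>)" if "w \<in> space M" for w
   using \<sigma>1[OF that] by (intro bdd_aboveI2[of _ _ 1])
  have m_meas: "m \<in> borel_measurable M"
   unfolding m_def[abs_def] using bdd \<sigma>_meas by (intro borel_measurable_cSUP countable_tests base) auto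
  have \<sigma>_m: "\<bar>\<sigma> w B\<bar> \<le> m w" if "w \<in> space M" "B \<in> \<T>" for w B
   unfolding m_def using bdd that by (intro cSUP_upper)
  have m_le: "m w \<le> c" if "!!B. B \<in> \<T> ==> \<bar>\<sigma> w B\<bar> \<le> c" for w c
   unfolding m_def using that tests_nonempty by (intro cSUP_least)
  have m01: "0 \<le> m w \<and> m w \<le> 1" if w: "w \<in> space M" for w
  proof
   obtain B where "B \<in> \<T>" using tests_nonempty by blast
   thus "0 \<le> m w" using \<sigma>_m[OF w, of B] by linarith
   show "m w \<le> 1" by (rule m_le) (rule \<sigma>1[OF w])
  qed
  have \<sigma>_stat: "AE w in M. \<forall>B\<in>\<T>. \<sigma> w B = T.avg \<gamma> \<sigma> w B"
   using stat AE_act[OF g stat] AE_space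
  proof eventually_elim
   case (elim w)
   show ?case
   proof
    fix B assume B: "B \<in> \<T>"
    note w = elim(3)
    have gB: "coc g w ` B \<in> \<T>" by (rule tests_iso[OF coc_iso[OF g w] B])
    let ?F = "\<lambda>k. \<nu> (act (\<gamma> k) (act g w)) (coc (\<gamma> k) (act g w) ` coc g w ` B)"
    let ?H = "\<lambda>k. \<nu> (act (\<gamma> k) w) (coc (\<gamma> k) w ` B)"
    have \<gamma>B: "coc (\<gamma> k) w ` B \<in> \<T>" and \<gamma>gB: "coc (\<gamma> k) (act g w) ` coc g w ` B \<in> \<T>" for k
     using tests_iso[OF coc_iso[OF \<gamma> w] B] tests_iso[OF coc_iso[OF \<gamma> act_in[OF g w]] gB] by auto
    have F: "summable (\<lambda>k. (1/2)^Suc k * ?F k)"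
     using meanD(1,2)[OF \<nu>(2)[OF act_in[OF \<gamma> act_in[OF g w]]] \<gamma>gB] by (intro half_summable) auto
    have H: "summable (\<lambda>k. (1/2)^Suc k * ?H k)"
     using meanD(1,2)[OF \<nu>(2)[OF act_in[OF \<gamma> w]] \<gamma>B] by (intro half_summable) auto
    have "\<sigma> (act (\<gamma> k) w) (coc (\<gamma> k) w ` B) = ?F k - ?H k" for k
    unfolding act_mult[OF g \<gamma> w, symmetric] act_mult[OF \<gamma> g w, symmetric] comm[OF \<gamma>P gQ] image_comp_coc[OF g \<gamma> w tests_sub[OF B], symmetric] image_comp_coc[OF \<gamma> g w tests_sub[OF B], symmetric] \<sigma>_def by auto
    hence "T.avg \<gamma> \<sigma> w B = (\<Sum>k. (1/2)^Suc k * ?F k - (1/2)^Suc k * ?H k)"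
     unfolding T.avg_def by (simp only: right_diff_distrib)
    also have "\<dots> = T.avg \<gamma> \<nu> (act g w) (coc g w ` B) - T.avg \<gamma> \<nu> w B"
     unfolding T.avg_def by (rule suminf_diff[OF F H, symmetric])
    also have "\<dots> = \<sigma> w B" using elim(1,2) B gB unfolding \<sigma>_def by simp
    finally show "\<sigma> w B = T.avg \<gamma> \<sigma> w B" by simp
   qed
  qed
  have \<sigma>_bound: "\<bar>\<sigma> w B\<bar> \<le> (\<Sum>k. (1/2)^Suc k * \<bar>\<sigma> (act (\<gamma> k) w) (coc (\<gamma> k) w ` B)\<bar>)"
   and \<sigma>_sum: "summable (\<lambda>k. (1/2)^Suc k * \<bar>\<sigma> (act (\<gamma> k) w) (coc (\<gamma> k) w ` B)\<bar>)"
   if w: "w \<in> space M" and B: "B \<in> \<T>" and st: "\<sigma> w B = T.avg \<gamma> \<sigma> w B" for w B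
  proof -
   show s: "summable (\<lambda>k. (1/2)^Suc k * \<bar>\<sigma> (act (\<gamma> k) w) (coc (\<gamma> k) w ` B)\<bar>)"
    using \<sigma>1[OF act_in[OF \<gamma> w] tests_iso[OF coc_iso[OF \<gamma> w] B]] by (intro half_summable) auto
   show "\<bar>\<sigma> w B\<bar> \<le> (\<Sum>k. (1/2)^Suc k * \<bar>\<sigma> (act (\<gamma> k) w) (coc (\<gamma> k) w ` B)\<bar>)"
    using summable_rabs[of "\<lambda>k. (1/2)^Suc k * \<sigma> (act (\<gamma> k) w) (coc (\<gamma> k) w ` B)"] s unfolding st T.avg_def abs_mult by simp
  qed
  have msum: "summable (\<lambda>k. (1/2)^Suc k * m (act (\<gamma> k) w))" if "w \<in> space M" for w
   using m01[OF act_in[OF \<gamma> that]] by (intro half_summable) auto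
  have sub: "AE w in M. m w \<le> (\<Sum>k. (1/2)^Suc k * m (act (\<gamma> k) w))"
   using \<sigma>_stat AE_space
  proof eventually_elim
   case (elim w)
   show ?case
   proof (rule m_le)
    fix B assume B: "B \<in> \<T>"
    have "\<bar>\<sigma> w B\<bar> \<le> (\<Sum>k. (1/2)^Suc k * \<bar>\<sigma> (act (\<gamma> k) w) (coc (\<gamma> k) w ` B)\<bar>)"
     using elim B by (intro \<sigma>_bound) auto
    also have "\<dots> \<le> (\<Sum>k. (1/2)^Suc k * m (act (\<gamma> k) w))"
    proof (rule suminf_le[OF _ \<sigma>_sum msum])
     fix k show "(1/2)^Suc k * \<bar>\<sigma> (act (\<gamma> k) w) (coc (\<gamma> k) w ` B)\<bar> \<le> (1/2)^Suc k * m (act (\<gamma> k) w)"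
      using \<sigma>_m[OF act_in[OF \<gamma> elim(2)] tests_iso[OF coc_iso[OF \<gamma> elim(2)] B]] by (intro mult_left_mono) auto
    qed (use elim B in auto)
    finally show "\<bar>\<sigma> w B\<bar> \<le> (\<Sum>k. (1/2)^Suc k * m (act (\<gamma> k) w))" .
   qed
  qed
  have m_inv: "AE w in M. \<forall>k. m (act (\<gamma> k) w) = m w"
   unfolding AE_all_countable using T.subharmonic_invariant[OF \<gamma> m_meas m01 sub] by blast
  have almost_max: "m w - 2^Suc k * e < \<bar>\<sigma> (act (\<gamma> k) w) (coc (\<gamma> k) w ` B)\<bar>"
   if w: "w \<in> space M" and st: "\<forall>B\<in>\<T>. \<sigma> w B = T.avg \<gamma> \<sigma> w B" and mi: "\<forall>k. m (act (\<gamma> k) w) = m w"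
    and B: "B \<in> \<T>" and e: "m w - e < \<bar>\<sigma> w B\<bar>" for w B k e
  proof -
   let ?s = "\<lambda>k. \<bar>\<sigma> (act (\<gamma> k) w) (coc (\<gamma> k) w ` B)\<bar>"
   have ss: "summable (\<lambda>k. (1/2)^Suc k * ?s k)" using st B by (intro \<sigma>_sum w) auto
   have "(\<lambda>k. (1/2)^Suc k * m w - (1/2)^Suc k * ?s k) sums (1 * m w - (\<Sum>k. (1/2)^Suc k * ?s k))"
    by (intro sums_diff sums_mult2 power_half_series summable_sums ss)
   moreover have "0 \<le> (1/2)^Suc k * m w - (1/2)^Suc k * ?s k" for k
    using \<sigma>_m[OF act_in[OF \<gamma> w] tests_iso[OF coc_iso[OF \<gamma> w] B], of k] mi by (simp add: mult_left_mono)
   ultimately have "(1/2)^Suc k * m w - (1/2)^Suc k * ?s k \<le> 1 * m w - (\<Sum>k. (1/2)^Suc k * ?s k)"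
    using sum_le_suminf[of "\<lambda>k. (1/2)^Suc k * m w - (1/2)^Suc k * ?s k" "{k}"] by (auto simp: sums_iff)
   also have "\<dots> < e" using \<sigma>_bound[OF w B] st B e by fastforce
   finally have "(m w - ?s k) * (1/2)^Suc k < e" by (simp add: algebra_simps)
   hence "(m w - ?s k) * (1/2)^Suc k * 2^Suc k < e * 2^Suc k" by (rule mult_strict_right_mono) simp
   moreover have "(1/2)^Suc k * (2::real)^Suc k = 1" by (simp only: power_mult_distrib[symmetric]) simp
   ultimately have "m w - ?s k < e * 2^Suc k" by (simp only: mult.assoc mult_1_right)
   thus ?thesis by (simp only: mult.commute[of e] less_diff_eq diff_less_eq add.commute)
  qed
  have m_pos: "AE w in M. 0 < m w"
  proof -
   let ?A = "{w\<in>space M. 0 < m w}"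
   have A: "?A \<in> sets M" using m_meas by measurable
   have "T.meas_field (\<lambda>w B. 0 < m w)" unfolding T.meas_field_def using A by blast
   moreover have "T.inv_field (\<gamma> k) (\<lambda>w B. 0 < m w)" for k
    unfolding T.inv_field_def using m_inv by eventually_elim simp
   ultimately have inv: "T.inv_field h (\<lambda>w B. 0 < m w)" if "h \<in> P" for h using P_inv that by blast
   have "AE w in M. act h w \<in> ?A \<longleftrightarrow> w \<in> ?A" if "h \<in> P" for h
    using inv[OF that, unfolded T.inv_field_def] AE_space
   proof eventually_elim
    case (elim w)
    thus ?case using tests_nonempty act_in[of h w] P(1) that by auto
   qed
   hence "prob ?A = 0 \<or> prob ?A = 1" using erg A unfolding ergodic_on_def by blast
   moreover have "prob ?A ~= 0"
   proof
    assume "prob ?A = 0"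
    hence "AE w in M. w \<notin> ?A" using A by (simp add: prob_eq_0)
    hence "AE w in M. \<forall>B\<in>\<T>. \<nu> (act g w) (coc g w ` B) = \<nu> w B" using AE_space
    proof eventually_elim
     case (elim w)
     show ?case
     proof
      fix B assume "B \<in> \<T>"
      thus "\<nu> (act g w) (coc g w ` B) = \<nu> w B"
       using \<sigma>_m[OF elim(2)] elim unfolding \<sigma>_def by fastforce
     qed
    qed
    thus False using ng by blast
   qed
   ultimately have "AE w in M. w \<in> ?A" using A by (simp add: prob_eq_1)
   thus ?thesis by eventually_elim simp
  qed
  define C where "C w D \<longleftrightarrow> (\<exists>n. \<forall>B\<in>\<T>. m w - 1 / real (Suc n) < \<bar>\<sigma> w B\<bar> --> B \<subset> D \<or> S - B \<subset> D)" for w D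
  have C_meas: "T.meas_field C"
   unfolding T.meas_field_def
  proof
   fix D assume "D \<in> \<T>"
   have "{w\<in>space M. m w - 1 / real (Suc n) < \<bar>\<sigma> w B\<bar> --> B \<subset> D \<or> S - B \<subset> D} \<in> sets M" if "B \<in> \<T>" for B n
    using m_meas \<sigma>_meas[OF that] by measurable
   thus "{w\<in>space M. C w D} \<in> sets M"
    unfolding C_def by (intro sets.sets_Collect_countable_Ex sets.sets_Collect_countable_All' countable_tests base)
  qed
  have C_back: "AE w in M. \<forall>k. \<forall>D\<in>\<T>. C (act (\<gamma> k) w) (coc (\<gamma> k) w ` D) --> C w D"
   using \<sigma>_stat m_inv AE_space
  proof eventually_elim
   case (elim w)
   show ?case
   proof (intro allI ballI impI)
    fix k D assume D: "D \<in> \<T>" and "C (act (\<gamma> k) w) (coc (\<gamma> k) w ` D)"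
    then obtain n where n0: "\<forall>B\<in>\<T>. m (act (\<gamma> k) w) - 1 / real (Suc n) < \<bar>\<sigma> (act (\<gamma> k) w) B\<bar> --> B \<subset> coc (\<gamma> k) w ` D \<or> S - B \<subset> coc (\<gamma> k) w ` D"
     unfolding C_def by blast
    have n: "B \<subset> coc (\<gamma> k) w ` D \<or> S - B \<subset> coc (\<gamma> k) w ` D"
     if "B \<in> \<T>" "m w - 1 / real (Suc n) < \<bar>\<sigma> (act (\<gamma> k) w) B\<bar>" for B
     using n0[rule_format, OF that(1)] that(2) unfolding elim(2)[rule_format, of k] by blast
    have i: "iso (coc (\<gamma> k) w)" by (rule coc_iso[OF \<gamma> elim(3)])
    \<comment> \<open>The \<open>k\<close>-th step has weight \<open>2 ^ -(k+1)\<close>, so closeness to \<open>m\<close> is lost by at most a factor \<open>2 ^ (k+1)\<close>.\<close>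
    define n' where "n' = 2^Suc k * Suc n"
    have "2^Suc k * (1 / real (Suc n')) \<le> 2^Suc k * (1 / real (2^Suc k * Suc n))"
     unfolding n'_def by (intro mult_left_mono frac_le) (auto intro: add_pos_nonneg)
    also have "real (2^Suc k * Suc n) = 2^Suc k * real (Suc n)" by (simp only: of_nat_mult of_nat_power of_nat_numeral)
    also have "2^Suc k * (1 / (2^Suc k * real (Suc n))) = 1 / real (Suc n)" by (simp del: power_Suc of_nat_Suc)
    finally have n': "2^Suc k * (1 / real (Suc n')) \<le> 1 / real (Suc n)" .
    have "B \<subset> D \<or> S - B \<subset> D" if B: "B \<in> \<T>" and "m w - 1 / real (Suc n') < \<bar>\<sigma> w B\<bar>" for B
    proof -
     have "m w - 1 / real (Suc n) < \<bar>\<sigma> (act (\<gamma> k) w) (coc (\<gamma> k) w ` B)\<bar>"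
      using almost_max[OF elim(3,1,2) that, of k] n' by linarith
     from n[OF tests_iso[OF i B] this]
     have "coc (\<gamma> k) w ` B \<subset> coc (\<gamma> k) w ` D \<or> coc (\<gamma> k) w ` (S - B) \<subset> coc (\<gamma> k) w ` D"
      unfolding iso_diff[OF i tests_sub[OF B]] .
     moreover have sub: "A \<subset> D" if "A \<subseteq> S" "coc (\<gamma> k) w ` A \<subset> coc (\<gamma> k) w ` D" for A
     proof -
      have "A \<subseteq> D" using that(2) inj_on_image_subset_iff[OF iso_inj[OF i] that(1) tests_sub[OF D]] by blast
      moreover have "A ~= D" using that(2) by blast
      ultimately show ?thesis by (rule psubsetI)
     qed
     ultimately show ?thesis using sub[of B] sub[of "S - B"] tests_sub[OF B] by blast
    qed
    thus "C w D" unfolding C_def by blast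
   qed
  qed
  have shifted: "AE w in M. \<forall>l. \<forall>D\<in>\<T>. C (act (\<gamma> l) (act (\<gamma> k) w)) (coc (\<gamma> l) (act (\<gamma> k) w) ` D) --> C (act (\<gamma> k) w) D" for k
   by (rule AE_act[OF \<gamma> C_back])
  have "T.inv_field (\<gamma> k) C" for k
   using shifted[of k] C_back AE_space unfolding T.inv_field_def
  proof eventually_elim
   case (elim w)
   show ?case
   proof
    fix D assume D: "D \<in> \<T>"
    obtain l where l: "\<gamma> l = inv (\<gamma> k)" using \<gamma>_inv by blast
    have "C (act (\<gamma> l) (act (\<gamma> k) w)) (coc (\<gamma> l) (act (\<gamma> k) w) ` coc (\<gamma> k) w ` D) --> C (act (\<gamma> k) w) (coc (\<gamma> k) w ` D)"
     using elim(1) tests_iso[OF coc_iso[OF \<gamma> elim(3)] D] by blast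
    moreover have "act (\<gamma> l) (act (\<gamma> k) w) = w" unfolding l by (rule act_inv(1)[OF \<gamma> elim(3)])
    moreover have "coc (\<gamma> l) (act (\<gamma> k) w) ` coc (\<gamma> k) w ` D = D" unfolding l by (rule T.\<rho>_inv(1)[OF \<gamma> elim(3) D])
    ultimately show "C (act (\<gamma> k) w) (coc (\<gamma> k) w ` D) \<longleftrightarrow> C w D" using elim(2) D by auto
   qed
  qed
  hence C_inv: "T.inv_field h C" if "h \<in> P" for h using P_inv[OF C_meas] that by blast
  have C_int: "B \<inter> B' ~= {}" if w: "w \<in> space M" and B: "B \<in> \<T>" "B' \<in> \<T>" "C w B" "C w B'" for w B B'
  proof -
   obtain n where n: "!!A. A \<in> \<T> ==> m w - 1 / real (Suc n) < \<bar>\<sigma> w A\<bar> ==> A \<subset> B \<or> S - A \<subset> B" using B(3) unfolding C_def by blast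
   obtain n' where n': "!!A. A \<in> \<T> ==> m w - 1 / real (Suc n') < \<bar>\<sigma> w A\<bar> ==> A \<subset> B' \<or> S - A \<subset> B'" using B(4) unfolding C_def by blast
   define e where "e = min (1 / real (Suc n)) (1 / real (Suc n'))"
   have e: "0 < e" "e \<le> 1 / real (Suc n)" "e \<le> 1 / real (Suc n')" unfolding e_def by auto
   have "\<exists>A\<in>\<T>. m w - e < \<bar>\<sigma> w A\<bar>"
   proof (rule ccontr)
    assume "\<not> ?thesis"
    thus False using e(1) m_le by (fastforce simp: not_less)
   qed
   then obtain A where A: "A \<in> \<T>" "m w - e < \<bar>\<sigma> w A\<bar>" by blast
   have "A \<subset> B \<or> S - A \<subset> B" "A \<subset> B' \<or> S - A \<subset> B'" using n[OF A(1)] n'[OF A(1)] A(2) e by linarith+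
   moreover have "A ~= {}" "S - A ~= {}" "A \<subseteq> S"
    using tests_ne[OF base A(1)] tests_ne[OF base tests_compl[OF A(1)]] tests_sub[OF A(1)] by auto
   moreover have "B \<subseteq> S" "B' \<subseteq> S" using tests_sub B by auto
   ultimately show ?thesis by blast
  qed
  have C_ne: "\<exists>B\<in>\<T>. C w B" if w: "w \<in> space M" and pos: "0 < m w" for w
  proof -
   have half: "0 < m w / 2" using pos by simp
   obtain n where n: "1 / real (Suc n) < m w / 2" by (rule nat_approx_posE[OF half])
   obtain D where D: "D \<in> \<T>" "!!B. B \<in> \<T> ==> m w / 2 < \<bar>\<nu> (act g w) (coc g w ` B) - \<nu> w B\<bar> ==> B \<subset> D \<or> S - B \<subset> D"
    by (rule large_difference_avoids_test[OF \<mu>[OF w] \<nu>(2)[OF w] half]) (rule that)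
   have "C w D" unfolding C_def
   proof (intro exI[of _ n] ballI impI)
    fix B assume B: "B \<in> \<T>" "m w - 1 / real (Suc n) < \<bar>\<sigma> w B\<bar>"
    thus "B \<subset> D \<or> S - B \<subset> D" using n D(2)[OF B(1)] unfolding \<sigma>_def by linarith
   qed
   thus ?thesis using D(1) by blast
  qed
  have "inv_filter P C" unfolding inv_filter_def
  proof (intro conjI ballI)
   show "AE w in M. \<forall>B\<in>\<T>. \<forall>B'\<in>\<T>. C w B \<and> C w B' --> B \<inter> B' ~= {}" using C_int by (intro AE_I2) auto
   show "AE w in M. \<exists>B\<in>\<T>. C w B" using m_pos AE_space by eventually_elim (rule C_ne)
  qed (use C_meas C_inv in auto)
  thus ?thesis by blast
 qed
qed

end

section \<open>Equivariant sections\<close>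

inductive_set ternary_closure :: "('a => 'a => 'a => 'a) => 'a set => 'a set" for op A where
 base: "a \<in> A ==> a \<in> ternary_closure op A"
| step: "x \<in> ternary_closure op A ==> y \<in> ternary_closure op A ==> z \<in> ternary_closure op A ==> op x y z \<in> ternary_closure op A"

text \<open>Median terms, to see that the closure of a countable set is countable.\<close>

datatype tterm = Leaf nat | Node tterm tterm tterm

instance tterm :: countable by countable_datatype

primrec tval :: "('a => 'a => 'a => 'a) => (nat => 'a) => tterm => 'a" where
 "tval op e (Leaf n) = e n"
| "tval op e (Node s t u) = op (tval op e s) (tval op e t) (tval op e u)"

lemma countable_ternary_closure:
 assumes "countable A" shows "countable (ternary_closure op A)"
proof -
 have "x \<in> range (tval op (from_nat_into A))" if "x \<in> ternary_closure op A" for x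
  using that
 proof induction
  case (base a)
  then obtain n where "from_nat_into A n = a" using from_nat_into_surj[OF assms] by blast
  thus ?case by (intro range_eqI[of _ _ "Leaf n"]) simp
 next
  case (step x y z)
  then obtain s t u where "x = tval op (from_nat_into A) s" "y = tval op (from_nat_into A) t" "z = tval op (from_nat_into A) u" by blast
  thus ?case by (intro range_eqI[of _ _ "Node s t u"]) simp
 qed
 thus ?thesis by (intro countable_subset[OF _ countable_image[of UNIV "tval op (from_nat_into A)"]]) auto
qed

text \<open>A countable subfamily whose union has maximal probability leaves out only a null set.\<close>

lemma (in prob_space) countable_exhaustion:
 assumes sets: "\<S> \<subseteq> events" and meet: "!!A. A \<in> events ==> 0 < prob A ==> \<exists>B\<in>\<S>. 0 < prob (A \<inter> B)"
 obtains F where "F \<subseteq> \<S>" "countable F" "AE x in M. x \<in> \<Union>F"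
proof -
 let ?\<F> = "{F. F \<subseteq> \<S> \<and> countable F}"
 have ev: "\<Union>F \<in> events" if "F \<in> ?\<F>" for F using that sets by (intro sets.countable_Union) auto
 define s where "s = (SUP F\<in>?\<F>. prob (\<Union>F))"
 have bdd: "bdd_above ((\<lambda>F. prob (\<Union>F)) ` ?\<F>)" by (intro bdd_aboveI2[of _ _ 1]) simp
 have le: "prob (\<Union>F) \<le> s" if "F \<in> ?\<F>" for F unfolding s_def using bdd that by (intro cSUP_upper)
 have "\<exists>F\<in>?\<F>. s - 1 / real (Suc n) < prob (\<Union>F)" for n
 proof (rule ccontr)
  assume "\<not> ?thesis"
  hence "prob (\<Union>F) \<le> s - 1 / real (Suc n)" if "F \<in> ?\<F>" for F using that not_less by blast
  hence "s \<le> s - 1 / real (Suc n)" unfolding s_def by (intro cSUP_least) auto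
  thus False by simp
 qed
 hence "\<forall>n. \<exists>F. F \<in> ?\<F> \<and> s - 1 / real (Suc n) < prob (\<Union>F)" by (auto simp only: Bex_def)
 from choice[OF this] obtain F where F: "!!n. F n \<in> ?\<F>" "!!n. s - 1 / real (Suc n) < prob (\<Union>(F n))" by (auto simp only:)
 define F' where "F' = (\<Union>n. F n)"
 have F': "F' \<in> ?\<F>" unfolding F'_def using F(1) by auto
 have F'_gt: "s - 1 / real (Suc n) < prob (\<Union>F')" for n
  by (rule less_le_trans[OF F(2) finite_measure_mono[OF _ ev[OF F']]]) (auto simp: F'_def)
 have ge: "s \<le> prob (\<Union>F')"
 using LIMSEQ_le_const2[of "\<lambda>n. s - 1 / real (Suc n)" s "prob (\<Union>F')"] less_imp_le[OF F'_gt] tendsto_diff tendsto_const LIMSEQ_Suc[OF lim_1_over_n] by fastforce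
 have "prob (space M - \<Union>F') = 0"
 proof (rule ccontr)
  assume "prob (space M - \<Union>F') ~= 0"
  then obtain B where B: "B \<in> \<S>" "0 < prob ((space M - \<Union>F') \<inter> B)"
   using meet[of "space M - \<Union>F'"] ev[OF F'] by (auto simp: order_less_le)
  have B': "insert B F' \<in> ?\<F>" using B(1) F' by auto
  have BM: "B \<in> events" using B(1) sets by blast
  have eq: "\<Union>(insert B F') = \<Union>F' \<union> ((space M - \<Union>F') \<inter> B)" using sets.sets_into_space[OF BM] by auto
  have "prob (\<Union>(insert B F')) = prob (\<Union>F') + prob ((space M - \<Union>F') \<inter> B)"
   unfolding eq using BM ev[OF F'] by (intro finite_measure_Union) auto
  thus False using le[OF B'] ge B(2) by linarith
 qed
 hence "AE x in M. x \<notin> space M - \<Union>F'" using ev[OF F'] by (simp add: prob_eq_0)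
 hence "AE x in M. x \<in> \<Union>F'" using AE_space by eventually_elim auto
 thus ?thesis using that[of F'] F' by simp
qed

context cocycle_geometry begin

text \<open>The median subspace generated by the centers.\<close>

definition core where "core = ternary_closure m centers"

lemma centers_core: "centers \<subseteq> core" unfolding core_def by (auto intro: ternary_closure.base)

lemma core_S: "y \<in> core ==> y \<in> S"
 unfolding core_def by (induction rule: ternary_closure.induct) (auto simp: centers_S med_in)

lemma countable_core: "countable core" unfolding core_def by (rule countable_ternary_closure[OF countable_centers])

lemma core_med: "x \<in> core ==> y \<in> core ==> z \<in> core ==> m x y z \<in> core"
 unfolding core_def by (rule ternary_closure.step)

lemma core_ne: "core ~= {}" using ex_center centers_core by blast

lemma core_iso: assumes f: "iso f" and y: "y \<in> core" shows "f y \<in> core"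
 using y unfolding core_def
proof (induction rule: ternary_closure.induct)
 case (base a) thus ?case by (intro ternary_closure.base centers_iso[OF f])
next
 case (step x y z)
 thus ?case
  using core_S iso_med[OF f] unfolding core_def by (auto intro: ternary_closure.step)
qed

text \<open>A measurable map to the core that is equivariant under \<open>P\<close>, an invariant section of \<open>\<Omega> \<times> core\<close>.\<close>

definition is_section :: "'g set => ('w => 'x) => bool" where
 "is_section P s \<longleftrightarrow> (\<forall>w\<in>space M. s w \<in> core) \<and> (\<forall>y\<in>core. {w\<in>space M. s w = y} \<in> sets M) \<and>
  (\<forall>g\<in>P. AE w in M. s (act g w) = coc g w (s w))"

lemma sectionD: assumes "is_section P s"
 shows "!!w. w \<in> space M ==> s w \<in> core" "!!y. y \<in> core ==> {w\<in>space M. s w = y} \<in> sets M"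
  "!!g. g \<in> P ==> AE w in M. s (act g w) = coc g w (s w)"
 using assms unfolding is_section_def by auto

lemma section_pred_meas:
 assumes s: "is_section P s" and t: "is_section P' t" shows "{w\<in>space M. R (s w) (t w)} \<in> sets M"
proof -
 have "{w\<in>space M. R (s w) (t w)} = (\<Union>y\<in>core. \<Union>z\<in>{z\<in>core. R y z}. {w\<in>space M. s w = y} \<inter> {w\<in>space M. t w = z})"
  using sectionD(1)[OF s] sectionD(1)[OF t] by auto
 also have "\<dots> \<in> sets M"
  using sectionD(2)[OF s] sectionD(2)[OF t] countable_subset[OF _ countable_core, of "{z\<in>core. R _ z}"]
  by (intro sets.countable_UN'' countable_core sets.Int) auto
 finally show ?thesis .
qed

lemma section_med:
 assumes P: "P \<subseteq> carrier G" and s: "is_section P s" "is_section P t" "is_section P u"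
 shows "is_section P (\<lambda>w. m (s w) (t w) (u w))"
 unfolding is_section_def
proof (intro conjI ballI)
 show "m (s w) (t w) (u w) \<in> core" if "w \<in> space M" for w
  using s[THEN sectionD(1), OF that] by (rule core_med)
 fix y assume "y \<in> core"
 have "{w\<in>space M. m (s w) (t w) (u w) = y} = (\<Union>z\<in>core. {w\<in>space M. m (s w) (t w) z = y} \<inter> {w\<in>space M. u w = z})"
  using sectionD(1)[OF s(3)] by auto
 also have "\<dots> \<in> sets M"
  using section_pred_meas[OF s(1,2), of "\<lambda>a b. m a b _ = y"] sectionD(2)[OF s(3)]
  by (intro sets.countable_UN'' countable_core sets.Int) auto
 finally show "{w\<in>space M. m (s w) (t w) (u w) = y} \<in> sets M" .
next
 fix g assume g: "g \<in> P"
 show "AE w in M. m (s (act g w)) (t (act g w)) (u (act g w)) = coc g w (m (s w) (t w) (u w))"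
  using s[THEN sectionD(3), OF g] AE_space
 proof eventually_elim
  case (elim w)
  have "iso (coc g w)" using g P elim(4) by (intro coc_iso) auto
  thus ?case using iso_med[of "coc g w" "s w" "t w" "u w"] elim s[THEN sectionD(1), OF elim(4)] core_S by simp
 qed
qed

subsection \<open>From an invariant family to sections\<close>

text \<open>The translate of a field by a group element that need not preserve it. If \<open>P\<close> is normalised, translates of \<open>P\<close>-invariant fields
 are \<open>P\<close>-invariant (\<open>pull_inv\<close>).\<close>

definition pull :: "('w => 'x set => bool) => 'g => 'w => 'x set => bool" where
 "pull C g w B \<longleftrightarrow> C (act g w) (coc g w ` B)"

lemma pull_joint:
 assumes C: "T.meas_field C" and B: "B \<in> \<T>" shows "jmeas (\<lambda>g w. pull C g w B)"
proof -
 have "jmeas (\<lambda>g w. \<exists>B'\<in>\<T>. coc g w ` B = B' \<and> act g w \<in> {w\<in>space M. C w B'})"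
  using C unfolding T.meas_field_def by (intro jmeas_logic test_joint[OF B] jmeas_act countable_tests[OF base]) blast
 moreover have "(\<exists>B'\<in>\<T>. coc g w ` B = B' \<and> act g w \<in> {w\<in>space M. C w B'}) \<longleftrightarrow> pull C g w B"
  if "g \<in> carrier G" "w \<in> space M" for g w
  unfolding pull_def using tests_iso[OF coc_iso[OF that] B] act_in[OF that] by auto
 ultimately show ?thesis by (rule jmeas_cong)
qed

lemma pull_meas: "T.meas_field C ==> g \<in> carrier G ==> T.meas_field (pull C g)"
 unfolding T.meas_field_def[of "pull C g"] using jmeas_sections(1)[OF pull_joint] by blast

lemma pull_comp:
 assumes "g \<in> carrier G" "h \<in> carrier G" "w \<in> space M" "B \<subseteq> S"
 shows "pull C g (act h w) (coc h w ` B) \<longleftrightarrow> pull C (g \<otimes> h) w B"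
 unfolding pull_def image_comp_coc[OF assms] act_mult[OF assms(1-3)] ..

definition normalized :: "'g set => bool" where
 "normalized P \<longleftrightarrow> (\<forall>g\<in>carrier G. \<forall>h\<in>P. g \<otimes> h \<otimes> inv g \<in> P)"

lemma pull_inv:
 assumes P: "P \<subseteq> carrier G" "normalized P" and C: "!!h. h \<in> P ==> T.inv_field h C" and g: "g \<in> carrier G" and h: "h \<in> P"
 shows "T.inv_field h (pull C g)"
proof -
 have hG: "h \<in> carrier G" using h P by blast
 let ?k = "g \<otimes> h \<otimes> inv g"
 have k: "?k \<in> P" "?k \<in> carrier G" using P g h unfolding normalized_def by auto
 have gh: "g \<otimes> h = ?k \<otimes> g" using g hG by (simp add: group.m_assoc)
 have "AE w in M. \<forall>B\<in>\<T>. C (act ?k w) (coc ?k w ` B) \<longleftrightarrow> C w B" using C[OF k(1)] unfolding T.inv_field_def .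
 from AE_act[OF g this] have "AE w in M. \<forall>B\<in>\<T>. C (act ?k (act g w)) (coc ?k (act g w) ` B) \<longleftrightarrow> C (act g w) B" .
 thus ?thesis unfolding T.inv_field_def using AE_space
 proof eventually_elim
  case (elim w)
  show ?case
  proof
   fix B assume B: "B \<in> \<T>"
   have "pull C g (act h w) (coc h w ` B) \<longleftrightarrow> pull C (?k \<otimes> g) w B"
    unfolding gh[symmetric] by (rule pull_comp[OF g hG elim(2) tests_sub[OF B]])
   also have "\<dots> \<longleftrightarrow> C (act ?k (act g w)) (coc ?k (act g w) ` coc g w ` B)"
    unfolding pull_def image_comp_coc[OF k(2) g elim(2) tests_sub[OF B]] act_mult[OF k(2) g elim(2)] ..
   also have "\<dots> \<longleftrightarrow> pull C g w B" unfolding pull_def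
    using elim(1) tests_iso[OF coc_iso[OF g elim(2)] B] by blast
   finally show "pull C g (act h w) (coc h w ` B) \<longleftrightarrow> pull C g w B" .
  qed
 qed
qed

text \<open>The translates of the field that have a member inside \<open>K\<close>. Measuring their set, instead of asking whether it is nonempty, makes
 \<open>reach\<close> measurable and equivariant.\<close>

definition below where "below C K w = {g\<in>carrier G. \<exists>B\<in>\<T>. B \<subseteq> K \<and> pull C g w B}"

definition reach where "reach C K = {w\<in>space M. emeasure lam (below C K w) ~= 0}"

lemma below_joint:
 assumes C: "T.meas_field C" shows "jmeas (\<lambda>g w. g \<in> below C K w)"
proof -
 have "jmeas (\<lambda>g w. \<exists>B\<in>{B\<in>\<T>. B \<subseteq> K}. pull C g w B)"
  using countable_subset[OF _ countable_tests[OF base], of "{B\<in>\<T>. B \<subseteq> K}"] by (intro jmeas_logic pull_joint[OF C]) auto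
 thus ?thesis by (rule jmeas_cong) (auto simp: below_def)
qed

lemma below_Collect: "{g\<in>carrier G. g \<in> below C K w} = below C K w" unfolding below_def by blast

lemma below_meas: assumes C: "T.meas_field C" and w: "w \<in> space M" shows "below C K w \<in> sets lam"
 using jmeas_sections(2)[OF below_joint[OF C] w, of K] unfolding below_Collect .

lemma reach_meas: assumes C: "T.meas_field C" shows "reach C K \<in> sets M"
 using jmeas_sections(3)[OF below_joint[OF C], of K] unfolding below_Collect reach_def .

lemma reach_mono: assumes C: "T.meas_field C" and K: "K \<subseteq> K'" shows "reach C K \<subseteq> reach C K'"
proof
 fix w assume w: "w \<in> reach C K"
 hence wM: "w \<in> space M" unfolding reach_def by blast
 have "emeasure lam (below C K w) \<le> emeasure lam (below C K' w)"
  using K by (intro emeasure_mono below_meas C wM) (auto simp: below_def)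
 thus "w \<in> reach C K'" using w unfolding reach_def by auto
qed

text \<open>Right multiplication by \<open>h\<close> turns one set of translates into the other.\<close>

lemma reach_act:
 assumes C: "T.meas_field C" and h: "h \<in> carrier G" and w: "w \<in> space M" and K: "K \<subseteq> S"
 shows "act h w \<in> reach C (coc h w ` K) \<longleftrightarrow> w \<in> reach C K"
proof -
 note i = coc_iso[OF h w]
 have "below C (coc h w ` K) (act h w) = {g\<in>carrier G. g \<otimes> h \<in> below C K w}"
 proof (intro equalityI subsetI)
  fix g assume "g \<in> below C (coc h w ` K) (act h w)"
  then obtain B where g: "g \<in> carrier G" and B: "B \<in> \<T>" "B \<subseteq> coc h w ` K" "pull C g (act h w) B" unfolding below_def by blast
  let ?B = "inv_into S (coc h w) ` B"
  have B': "?B \<in> \<T>" by (rule tests_iso[OF iso_inv(1)[OF i] B(1)])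
  have eq: "coc h w ` ?B = B" unfolding image_image using iso_inv(2)[OF i] tests_sub[OF B(1)] by force
  have "?B \<subseteq> K"
  using B(2) iso_inv(3)[OF i] K by fastforce
  moreover have "pull C (g \<otimes> h) w ?B" using pull_comp[OF g h w tests_sub[OF B'], of C] B(3) unfolding eq by simp
  ultimately show "g \<in> {g\<in>carrier G. g \<otimes> h \<in> below C K w}" unfolding below_def using g h B' by auto
 next
  fix g assume "g \<in> {g\<in>carrier G. g \<otimes> h \<in> below C K w}"
  then obtain B where g: "g \<in> carrier G" and B: "B \<in> \<T>" "B \<subseteq> K" "pull C (g \<otimes> h) w B" unfolding below_def by blast
  show "g \<in> below C (coc h w ` K) (act h w)"
   using pull_comp[OF g h w tests_sub[OF B(1)]] B(3) g tests_iso[OF i B(1)] image_mono[OF B(2), of "coc h w"] unfolding below_def by blast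
 qed
 thus ?thesis unfolding reach_def using lam_right[OF below_meas[OF C w] h] act_in[OF h w] w by simp
qed

text \<open>Were the event of reaching \<open>K\<close> but not \<open>S - K\<close> of positive probability, non-elementarity would provide \<open>g\<close> and a point \<open>w\<close>
 such that \<open>w\<close> and \<open>act g w\<close> are in it and \<open>g\<close> flips \<open>K\<close> over \<open>w\<close>. By equivariance \<open>act g w\<close> then reaches \<open>S - K\<close>.\<close>

lemma reach_compl:
 assumes C: "T.meas_field C" and K: "thick K"
 shows "AE w in M. w \<in> reach C K --> w \<in> reach C (S - K)"
proof -
 let ?A = "reach C K - reach C (S - K)"
 have A: "?A \<in> sets M" using reach_meas[OF C] by auto
 have KS: "K \<subseteq> S" using thick_ne[OF K] by blast
 have "prob ?A = 0"
 proof (rule ccontr)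
  assume "prob ?A ~= 0"
  then obtain g w where g: "g \<in> carrier G" and w: "w \<in> ?A" "act g w \<in> ?A" "coc g w ` K \<subseteq> S - K"
   using non_elem[OF K A ] by (auto simp: order_less_le)
  have wM: "w \<in> space M" using w(1) unfolding reach_def by blast
  have "act g w \<in> reach C (coc g w ` K)" using reach_act[OF C g wM KS] w(1) by blast
  thus False using reach_mono[OF C w(3)] w(2) by blast
 qed
 hence "AE w in M. w \<notin> ?A" using A by (simp add: prob_eq_0)
 thus ?thesis by eventually_elim blast
qed

lemma filter_reaches:
 assumes C: "T.meas_field C" and ne: "AE w in M. \<exists>B\<in>\<T>. C w B"
 shows "AE w in M. \<exists>B\<in>\<T>. w \<in> reach C B"
proof -
 let ?R = "\<lambda>g w. \<exists>B\<in>\<T>. pull C g w B"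
 have "AE w in M. \<not> \<not> ?R g w" if g: "g \<in> carrier G" for g
  using AE_act[OF g ne] AE_space
 proof eventually_elim
  case (elim w)
  then obtain B where B: "B \<in> \<T>" "C (act g w) B" by blast
  note i = coc_iso[OF g elim(2)]
  let ?B = "inv_into S (coc g w) ` B"
  have "coc g w ` ?B = B" unfolding image_image using iso_inv(2)[OF i] tests_sub[OF B(1)] by force
  thus ?case using B(2) tests_iso[OF iso_inv(1)[OF i] B(1)] unfolding pull_def by fastforce
 qed
 hence "AE w in M. emeasure lam {g\<in>carrier G. \<not> ?R g w} = 0"
  by (intro AE_null_section jmeas_logic pull_joint[OF C] countable_tests[OF base])
 thus ?thesis using AE_space
 proof eventually_elim
  case (elim w)
  have m: "{g\<in>carrier G. \<not> ?R g w} \<in> sets lam"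
   by (intro jmeas_sections(2) jmeas_logic pull_joint[OF C] countable_tests[OF base] elim(2))
  show ?case
  proof (rule ccontr)
   assume n: "\<not> (\<exists>B\<in>\<T>. w \<in> reach C B)"
   have z: "below C B w \<in> null_sets lam" if "B \<in> \<T>" for B
    using n that elim(2) below_meas[OF C elim(2)] unfolding reach_def by (auto intro!: null_setsI)
   have "{g\<in>carrier G. \<not> ?R g w} \<union> (\<Union>B\<in>\<T>. below C B w) \<in> null_sets lam"
    using null_setsI[OF elim(1) m] null_sets_UN'[OF countable_tests[OF base] z] by auto
   moreover have "{g\<in>carrier G. \<not> ?R g w} \<union> (\<Union>B\<in>\<T>. below C B w) = carrier G" unfolding below_def by auto
   ultimately show False using lam_ne by (auto simp: null_setsD1)
  qed
 qed
qed

text \<open>By \<open>reach_compl\<close>, the halfspaces reached almost surely whenever \<open>K0\<close> is reached form a wall class, so they are all halfspaces.\<close>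

lemma reach_all:
 assumes C: "T.meas_field C" and ne: "AE w in M. \<exists>B\<in>\<T>. C w B" and K: "thick K"
 shows "AE w in M. w \<in> reach C K"
proof -
 have transfer: "AE w in M. w \<in> reach C K0 --> w \<in> reach C K1" if K0: "thick K0" and K1: "thick K1" for K0 K1
 proof -
  define \<H> where "\<H> = {K. thick K \<and> (AE w in M. w \<in> reach C K0 --> w \<in> reach C K)}"
  have "wall_class \<H>" unfolding wall_class_def
  proof (intro ballI conjI allI impI)
   fix K assume "K \<in> \<H>"
   hence K: "thick K" "AE w in M. w \<in> reach C K0 --> w \<in> reach C K" unfolding \<H>_def by auto
   show "thick K" by (rule K(1))
   have "AE w in M. w \<in> reach C K0 --> w \<in> reach C (S - K)" using K(2) reach_compl[OF C K(1)] by eventually_elim blast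
   thus "S - K \<in> \<H>" unfolding \<H>_def using thick_compl[OF K(1)] by blast
   fix U assume U: "thick U \<and> K \<subseteq> U"
   have "AE w in M. w \<in> reach C K0 --> w \<in> reach C U"
    using K(2) by eventually_elim (use reach_mono[OF C conjunct2[OF U]] in blast)
   thus "U \<in> \<H>" unfolding \<H>_def using U by blast
  qed
  moreover have "K0 \<in> \<H>" unfolding \<H>_def using K0 by simp
  ultimately have "K1 \<in> \<H>" using wall_class_all[OF irreducible _ _ K1, of \<H>] by blast
  thus ?thesis unfolding \<H>_def by blast
 qed
 have "AE w in M. \<forall>B\<in>\<T>. w \<in> reach C B --> w \<in> reach C K"
  unfolding AE_ball_countable[OF countable_tests[OF base]]
 proof
  fix B assume "B \<in> \<T>"
  then obtain V where V: "thick V" "B \<subseteq> V" using tests_in_thick[OF base] by blast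
  show "AE w in M. w \<in> reach C B --> w \<in> reach C K"
   using transfer[OF V(1) K] by eventually_elim (use reach_mono[OF C V(2)] in blast)
 qed
 with filter_reaches[OF C ne] show ?thesis by eventually_elim blast
qed

lemma below_meas_in:
 assumes C: "T.meas_field C" and g: "g \<in> carrier G" shows "{w\<in>space M. g \<in> below C K w} \<in> sets M"
 by (rule jmeas_sections(1)[OF below_joint[OF C] g])

lemma ex_translate:
 assumes C: "T.meas_field C" and ne: "AE w in M. \<exists>B\<in>\<T>. C w B" and K: "thick K"
  and A: "A \<in> sets M" "0 < prob A"
 obtains g where "g \<in> carrier G" "0 < prob (A \<inter> {w\<in>space M. g \<in> below C K w})"
proof -
 have "\<exists>g\<in>carrier G. 0 < prob (A \<inter> {w\<in>space M. g \<in> below C K w})"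
 proof (rule ccontr)
  assume n: "\<not> ?thesis"
  have "AE w in M. \<not> (g \<in> below C K w \<and> w \<in> A)" if g: "g \<in> carrier G" for g
  using n g A(1) below_meas_in[OF C g] by (fastforce simp: order_less_le prob_eq_0)
  moreover have "{w\<in>space M. w \<in> A} \<in> sets M" using A(1) by simp
  ultimately have "AE w in M. emeasure lam {g\<in>carrier G. g \<in> below C K w \<and> w \<in> A} = 0"
   by (intro AE_null_section jmeas_logic below_joint[OF C] jmeas_snd)
  hence "AE w in M. w \<notin> A" using reach_all[OF C ne K]
  proof eventually_elim
   case (elim w)
   show ?case
   proof
    assume "w \<in> A"
    thus False using elim unfolding below_def reach_def by simp
   qed
  qed
  thus False using A by (simp add: prob_eq_0[symmetric])
 qed
 thus ?thesis using that by blast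
qed

text \<open>Three translates of the field with members inside the three halfspaces of a center determine the center: any other members meet
 these, so their medians are the same point.\<close>

definition located where
 "located C g1 g2 g3 w y \<longleftrightarrow> (\<exists>B1\<in>\<T>. \<exists>B2\<in>\<T>. \<exists>B3\<in>\<T>. pull C g1 w B1 \<and> pull C g2 w B2 \<and> pull C g3 w B3 \<and> centered y B1 B2 B3)"

lemma located_meas:
 assumes C: "T.meas_field C" and g: "g1 \<in> carrier G" "g2 \<in> carrier G" "g3 \<in> carrier G"
 shows "{w\<in>space M. located C g1 g2 g3 w y} \<in> sets M"
proof -
 have "{w\<in>space M. pull C g w B} \<in> sets M" if "g \<in> carrier G" "B \<in> \<T>" for g B
  using pull_meas[OF C that(1)] that(2) unfolding T.meas_field_def by blast
 thus ?thesis unfolding located_def using g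
  by (intro sets.sets_Collect_countable_Ex' countable_tests base sets.sets_Collect_conj sets.sets_Collect_const) auto
qed

lemma centered_image:
 assumes f: "iso f" and B: "B1 \<subseteq> S" "B2 \<subseteq> S" "B3 \<subseteq> S" and c: "centered y B1 B2 B3"
 shows "centered (f y) (f ` B1) (f ` B2) (f ` B3)"
 unfolding centered_def
proof (intro ballI)
 fix x1 x2 x3 assume "x1 \<in> f ` B1" "x2 \<in> f ` B2" "x3 \<in> f ` B3"
 then obtain b1 b2 b3 where b: "b1 \<in> B1" "b2 \<in> B2" "b3 \<in> B3" "x1 = f b1" "x2 = f b2" "x3 = f b3" by blast
 show "m x1 x2 x3 = f y"
  using c iso_med[OF f subsetD[OF B(1) b(1)] subsetD[OF B(2) b(2)] subsetD[OF B(3) b(3)]] b unfolding centered_def by simp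
qed

lemma located_act:
 assumes h: "h \<in> carrier G" and w: "w \<in> space M"
  and inv: "!!g B. g \<in> {g1, g2, g3} ==> B \<in> \<T> ==> pull C g (act h w) (coc h w ` B) \<longleftrightarrow> pull C g w B"
  and l: "located C g1 g2 g3 w y"
 shows "located C g1 g2 g3 (act h w) (coc h w y)"
proof -
 obtain B1 B2 B3 where B: "B1 \<in> \<T>" "B2 \<in> \<T>" "B3 \<in> \<T>" "pull C g1 w B1" "pull C g2 w B2" "pull C g3 w B3" "centered y B1 B2 B3"
  using l unfolding located_def by blast
 note i = coc_iso[OF h w]
 have "pull C g1 (act h w) (coc h w ` B1)" "pull C g2 (act h w) (coc h w ` B2)" "pull C g3 (act h w) (coc h w ` B3)"
  using inv B by auto
 moreover have "centered (coc h w y) (coc h w ` B1) (coc h w ` B2) (coc h w ` B3)"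
  by (rule centered_image[OF i tests_sub[OF B(1)] tests_sub[OF B(2)] tests_sub[OF B(3)] B(7)])
 ultimately show ?thesis unfolding located_def
  using tests_iso[OF i B(1)] tests_iso[OF i B(2)] tests_iso[OF i B(3)] by blast
qed

lemma located_unique:
 assumes int: "!!g B B'. g \<in> {g1, g2, g3} ==> B \<in> \<T> ==> B' \<in> \<T> ==> pull C g w B ==> pull C g w B' ==> B \<inter> B' ~= {}"
  and l: "located C g1 g2 g3 w y" "located C g1 g2 g3 w z"
 shows "y = z"
proof -
 obtain B1 B2 B3 where B: "B1 \<in> \<T>" "B2 \<in> \<T>" "B3 \<in> \<T>" "pull C g1 w B1" "pull C g2 w B2" "pull C g3 w B3" "centered y B1 B2 B3"
  using l(1) unfolding located_def by blast
 obtain D1 D2 D3 where D: "D1 \<in> \<T>" "D2 \<in> \<T>" "D3 \<in> \<T>" "pull C g1 w D1" "pull C g2 w D2" "pull C g3 w D3" "centered z D1 D2 D3"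
  using l(2) unfolding located_def by blast
 obtain x1 x2 x3 where "x1 \<in> B1 \<inter> D1" "x2 \<in> B2 \<inter> D2" "x3 \<in> B3 \<inter> D3"
  using int[of g1 B1 D1] int[of g2 B2 D2] int[of g3 B3 D3] B D by blast
 hence "m x1 x2 x3 = y" "m x1 x2 x3 = z" using B(7) D(7) unfolding centered_def by blast+
 thus ?thesis by simp
qed

text \<open>Choose three translates that locate \<open>y\<close> with positive probability on \<open>A\<close>. The point located by them is unique, depends
 equivariantly on \<open>w\<close>, and by ergodicity exists almost everywhere.\<close>

lemma ex_section:
 assumes P: "P \<subseteq> carrier G" "P ~= {}" "!!g. g \<in> P ==> inv g \<in> P" "normalized P" and erg: "ergodic_on P" and C: "inv_filter P C"
  and y: "y \<in> centers" and A: "A \<in> sets M" "0 < prob A"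
 obtains s where "is_section P s" "0 < prob (A \<inter> {w\<in>space M. s w = y})"
proof -
 have Cm: "T.meas_field C" and Ci: "!!h. h \<in> P ==> T.inv_field h C"
  and Cx: "AE w in M. \<forall>B\<in>\<T>. \<forall>B'\<in>\<T>. C w B \<and> C w B' --> B \<inter> B' ~= {}" and Cn: "AE w in M. \<exists>B\<in>\<T>. C w B"
  using C unfolding inv_filter_def by auto
 obtain K1 K2 K3 where K: "thick K1" "thick K2" "thick K3" "centered y K1 K2 K3"
  using y unfolding centers_def by blast
 have step: "A \<inter> {w\<in>space M. g \<in> below C K w} \<in> sets M" if "A \<in> sets M" "g \<in> carrier G" for A g K
  using that below_meas_in[OF Cm that(2)] by blast
 obtain g1 where g1: "g1 \<in> carrier G" "0 < prob (A \<inter> {w\<in>space M. g1 \<in> below C K1 w})" by (rule ex_translate[OF Cm Cn K(1) A])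
 let ?A1 = "A \<inter> {w\<in>space M. g1 \<in> below C K1 w}"
 note A1 = step[OF A(1) g1(1), of K1]
 obtain g2 where g2: "g2 \<in> carrier G" "0 < prob (?A1 \<inter> {w\<in>space M. g2 \<in> below C K2 w})" by (rule ex_translate[OF Cm Cn K(2) A1 g1(2)])
 let ?A2 = "?A1 \<inter> {w\<in>space M. g2 \<in> below C K2 w}"
 note A2 = step[OF A1 g2(1), of K2]
 obtain g3 where g3: "g3 \<in> carrier G" "0 < prob (?A2 \<inter> {w\<in>space M. g3 \<in> below C K3 w})" by (rule ex_translate[OF Cm Cn K(3) A2 g2(2)])
 let ?A3 = "?A2 \<inter> {w\<in>space M. g3 \<in> below C K3 w}"
 note A3 = step[OF A2 g3(1), of K3]
 note g = g1(1) g2(1) g3(1)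
 let ?L = "located C g1 g2 g3"
 have Ly: "?L w y" if w: "w \<in> ?A3" for w
 using w K(4) unfolding below_def centered_def located_def by blast
 have L_meas: "{w\<in>space M. ?L w z} \<in> sets M" for z by (rule located_meas[OF Cm g])
 have L_inv: "AE w in M. \<forall>g\<in>{g1, g2, g3}. \<forall>B\<in>\<T>. pull C g (act h w) (coc h w ` B) \<longleftrightarrow> pull C g w B" if h: "h \<in> P" for h
 proof -
  have "AE w in M. \<forall>B\<in>\<T>. pull C g (act h w) (coc h w ` B) \<longleftrightarrow> pull C g w B" if "g \<in> {g1, g2, g3}" for g
   using pull_inv[OF P(1,4) Ci, of g h] that g h unfolding T.inv_field_def by auto
  thus ?thesis by (simp add: AE_ball_countable)
 qed
 have L_int: "AE w in M. \<forall>g\<in>{g1, g2, g3}. \<forall>B\<in>\<T>. \<forall>B'\<in>\<T>. pull C g w B \<and> pull C g w B' --> B \<inter> B' ~= {}"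
 proof -
  have "AE w in M. \<forall>B\<in>\<T>. \<forall>B'\<in>\<T>. pull C g w B \<and> pull C g w B' --> B \<inter> B' ~= {}" if gg: "g \<in> {g1, g2, g3}" for g
  proof -
   have gG: "g \<in> carrier G" using gg g by auto
   show ?thesis using AE_act[OF gG Cx] AE_space
   proof eventually_elim
    case (elim w)
    show ?case
    proof (intro ballI impI)
     fix B B' assume B: "B \<in> \<T>" "B' \<in> \<T>" "pull C g w B \<and> pull C g w B'"
     note i = coc_iso[OF gG elim(2)]
     show "B \<inter> B' ~= {}"
      using elim(1) tests_iso[OF i B(1)] tests_iso[OF i B(2)] B(3) inj_on_image_Int[OF iso_inj[OF i] tests_sub[OF B(1)] tests_sub[OF B(2)]] unfolding pull_def by auto
    qed
   qed
  qed
  thus ?thesis by (simp add: AE_ball_countable)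
 qed
 have y_core: "y \<in> core" using y centers_core by blast
 have uniq: "AE w in M. \<forall>z z'. ?L w z --> ?L w z' --> z = z'"
  using L_int
 proof eventually_elim
  case (elim w)
  show ?case
  proof (intro allI impI)
   fix z z' assume "?L w z" "?L w z'"
   thus "z = z'" by (rule located_unique[rotated]) (use elim in blast)
  qed
 qed
 let ?D = "{w\<in>space M. \<exists>z\<in>core. ?L w z}"
 have D: "?D \<in> sets M" using L_meas by (intro sets.sets_Collect_countable_Ex' countable_core)
 have fwd: "AE w in M. \<forall>z\<in>core. ?L w z --> ?L (act h w) (coc h w z)" if h: "h \<in> P" for h
  using L_inv[OF h] AE_space
 proof eventually_elim
  case (elim w)
  have hG: "h \<in> carrier G" using h P by blast
  show ?case
  proof (intro ballI impI)
   fix z assume l: "?L w z"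
   show "?L (act h w) (coc h w z)" by (rule located_act[OF hG elim(2) _ l]) (use elim(1) in blast)
  qed
 qed
 have "prob ?D = 0 \<or> prob ?D = 1"
 proof (rule erg[unfolded ergodic_on_def, rule_format, OF D])
  fix h assume h: "h \<in> P"
  have hG: "h \<in> carrier G" "inv h \<in> carrier G" "inv h \<in> P" using h P by auto
  show "AE w in M. act h w \<in> ?D \<longleftrightarrow> w \<in> ?D"
   using fwd[OF h] AE_act[OF hG(1) fwd[OF hG(3)]] AE_space
  proof eventually_elim
   case (elim w)
   have bk: "act (inv h) (act h w) = w" by (rule act_inv(1)[OF hG(1) elim(3)])
   show ?case
   proof
    assume "act h w \<in> ?D"
    then obtain z where "z \<in> core" "?L (act h w) z" by blast
    hence "?L w (coc (inv h) (act h w) z)" using elim(2) unfolding bk by blast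
    thus "w \<in> ?D" using core_iso[OF coc_iso[OF hG(2) act_in[OF hG(1) elim(3)]] \<open>z \<in> core\<close>] elim(3) by blast
   next
    assume "w \<in> ?D"
    then obtain z where z: "z \<in> core" "?L w z" by blast
    thus "act h w \<in> ?D"
     using elim(1) core_iso[OF coc_iso[OF hG(1) elim(3)] z(1)] act_in[OF hG(1) elim(3)] by blast
   qed
  qed
 qed
 moreover have "prob ?A3 \<le> prob ?D" using Ly y_core by (intro finite_measure_mono D) auto
 ultimately have D1: "AE w in M. w \<in> ?D" using g3(2) D by (simp add: prob_eq_1)
 let ?U = "\<lambda>w. \<exists>!z\<in>core. ?L w z"
 have U: "AE w in M. ?U w" using uniq D1 by eventually_elim blast
 \<comment> \<open>The default value \<open>y\<close> is used on a null set only.\<close>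
 define s where "s w = (if ?U w then THE z. z \<in> core \<and> ?L w z else y)" for w
 have s_iff: "s w = z \<longleftrightarrow> z \<in> core \<and> (if ?U w then ?L w z else z = y)" for w z
 proof (cases "?U w")
  case True
  then obtain x where x: "x \<in> core \<and> ?L w x" "!!x'. x' \<in> core \<and> ?L w x' ==> x' = x" by blast
  have "s w = x" unfolding s_def using the_equality[of "\<lambda>z. z \<in> core \<and> ?L w z", OF x] True by simp
  thus ?thesis using x by metis
 next
  case False
  thus ?thesis using y_core unfolding s_def by (simp only: if_False) blast
 qed
 show ?thesis
 proof (rule that[of s])
  have s_meas: "{w\<in>space M. s w = z} \<in> sets M" for z unfolding s_iff if_bool_eq_conj
   by (intro sets.sets_Collect_conj sets.sets_Collect_imp sets.sets_Collect_neg sets.sets_Collect_const sets.sets_Collect_countable_Ex1' L_meas countable_core)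
  show "is_section P s" unfolding is_section_def
  proof (intro conjI ballI)
   show "s w \<in> core" for w using s_iff by blast
  next
   fix h assume h: "h \<in> P"
   have hG: "h \<in> carrier G" using h P by blast
   show "AE w in M. s (act h w) = coc h w (s w)"
    using fwd[OF h] U AE_act[OF hG U] AE_space
   proof eventually_elim
    case (elim w)
    have "s w \<in> core" "?L w (s w)" using s_iff[of w "s w"] elim(2) by simp_all
    thus ?case using s_iff elim(1,3) core_iso[OF coc_iso[OF hG elim(4)]] by simp
   qed
  qed (rule s_meas)
  have "prob ?A3 \<le> prob (A \<inter> {w\<in>space M. s w = y})"
  proof (rule finite_measure_mono_AE)
   show "AE w in M. w \<in> ?A3 --> w \<in> A \<inter> {w\<in>space M. s w = y}"
    using U by eventually_elim (use Ly y_core s_iff in auto)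
  qed (use s_meas A(1) in auto)
  thus "0 < prob (A \<inter> {w\<in>space M. s w = y})" using g3(2) by linarith
 qed
qed

subsection \<open>Frames\<close>

lemma section_agree:
 assumes P: "P \<subseteq> carrier G" and erg: "ergodic_on P" and s: "is_section P s" and t: "is_section P t"
 shows "(AE w in M. s w = t w) \<or> (AE w in M. s w ~= t w)"
proof -
 let ?E = "{w\<in>space M. s w = t w}"
 have E: "?E \<in> sets M" by (rule section_pred_meas[OF s t])
 have "prob ?E = 0 \<or> prob ?E = 1"
 proof (rule erg[unfolded ergodic_on_def, rule_format, OF E])
  fix h assume h: "h \<in> P"
  have hG: "h \<in> carrier G" using h P by blast
  show "AE w in M. act h w \<in> ?E \<longleftrightarrow> w \<in> ?E"
   using sectionD(3)[OF s h] sectionD(3)[OF t h] AE_space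
  proof eventually_elim
   case (elim w)
   show ?case
    using sectionD(1)[OF s elim(3)] sectionD(1)[OF t elim(3)] core_S inj_on_eq_iff[OF iso_inj[OF coc_iso[OF hG elim(3)]]] elim act_in[OF hG elim(3)] by simp
  qed
 qed
 thus ?thesis
 using E by (auto simp: prob_eq_0 prob_eq_1)
qed

text \<open>A frame trivialises the bundle \<open>\<Omega> \<times> core\<close>: over almost every point, its sections label the points of the core.\<close>

definition is_frame :: "'g set => ('w => 'x) set => bool" where
 "is_frame P F \<longleftrightarrow> countable F \<and> (\<forall>s\<in>F. is_section P s) \<and> (AE w in M. bij_betw (\<lambda>s. s w) F core)"

lemma not_AE_False: "\<not> (AE w in M. False)"
 using AE_False by blast

text \<open>Sections that agree somewhere with positive probability agree almost everywhere, so one representative of each class of almost everywhere equal sections suffices.\<close>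

lemma frame_of_cover:
 assumes P: "P \<subseteq> carrier G" and erg: "ergodic_on P"
  and F: "countable F" "!!s. s \<in> F ==> is_section P s" and cov: "AE w in M. \<forall>y\<in>core. \<exists>s\<in>F. s w = y"
 shows "\<exists>F. is_frame P F"
proof -
 define eqv where "eqv s t \<longleftrightarrow> (AE w in M. s w = t w)" for s t :: "'w => 'x"
 define rep where "rep s = (SOME t. t \<in> F \<and> eqv s t)" for s
 have rep: "rep s \<in> F \<and> eqv s (rep s)" if "s \<in> F" for s
  unfolding rep_def by (rule someI[of _ s]) (use that in \<open>simp add: eqv_def\<close>)
 have sym: "eqv t s" if "eqv s t" for s t using that unfolding eqv_def by eventually_elim simp
 have trans: "eqv s u" if "eqv s t" "eqv t u" for s t u using that unfolding eqv_def by eventually_elim simp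
 have rep_eq: "rep s = rep t" if "eqv s t" for s t
 proof -
  have "eqv s u \<longleftrightarrow> eqv t u" for u using trans[OF that, of u] trans[OF sym[OF that], of u] by blast
  thus ?thesis unfolding rep_def by simp
 qed
 let ?F = "rep ` F"
 have cF: "countable ?F" using F(1) by blast
 have sec: "is_section P s" if "s \<in> ?F" for s using that rep F(2) by blast
 have "AE w in M. \<forall>s\<in>F. s w = rep s w"
  unfolding AE_ball_countable[OF F(1)] using rep unfolding eqv_def by blast
 moreover have "AE w in M. \<forall>s\<in>?F. \<forall>t\<in>?F. s w = t w --> s = t"
  unfolding AE_ball_countable[OF cF]
 proof (intro ballI)
  fix s t assume s: "s \<in> ?F" and t: "t \<in> ?F"
  show "AE w in M. s w = t w --> s = t"
  proof (cases "eqv s t")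
   case True
   obtain s' t' where "s' \<in> F" "s = rep s'" "t' \<in> F" "t = rep t'" using s t by blast
   hence "rep s' = rep t'" using rep_eq[OF trans[OF _ trans[OF True sym]], of s' t'] rep by blast
   hence "s = t" using \<open>s = rep s'\<close> \<open>t = rep t'\<close> by simp
   thus ?thesis by simp
  next
   case False
   hence "AE w in M. s w ~= t w" using section_agree[OF P erg sec[OF s] sec[OF t]] unfolding eqv_def by blast
   thus ?thesis by eventually_elim simp
  qed
 qed
 ultimately have "AE w in M. bij_betw (\<lambda>s. s w) ?F core"
  using cov AE_space
 proof eventually_elim
  case (elim w)
  show ?case unfolding bij_betw_def
  proof
   show "inj_on (\<lambda>s. s w) ?F" using elim(2) by (auto intro!: inj_onI)
   show "(\<lambda>s. s w) ` ?F = core"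
   proof
    show "(\<lambda>s. s w) ` ?F \<subseteq> core" using sectionD(1)[OF sec elim(4)] by blast
    show "core \<subseteq> (\<lambda>s. s w) ` ?F"
    proof
     fix y assume "y \<in> core"
     then obtain s where s: "s \<in> F" "s w = y" using elim(3) by blast
     thus "y \<in> (\<lambda>s. s w) ` ?F" using elim(1) by force
    qed
   qed
  qed
 qed
 thus ?thesis unfolding is_frame_def using cF sec by blast
qed

text \<open>Sections through a given center cover it by exhaustion; medians of sections then pass through all points of the core.\<close>

theorem ex_frame:
 assumes P: "P \<subseteq> carrier G" "P ~= {}" "!!g. g \<in> P ==> inv g \<in> P" "normalized P" and erg: "ergodic_on P" and C: "inv_filter P C"
 shows "\<exists>F. is_frame P F"
proof -
 have "\<exists>F. countable F \<and> (\<forall>s\<in>F. is_section P s) \<and> (AE w in M. \<exists>s\<in>F. s w = y)" if y: "y \<in> centers" for y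
 proof -
  let ?\<S> = "{{w\<in>space M. s w = y} |s. is_section P s}"
  have "?\<S> \<subseteq> sets M" using sectionD(2) y centers_core by blast
  moreover have "\<exists>B\<in>?\<S>. 0 < prob (A \<inter> B)" if A: "A \<in> sets M" "0 < prob A" for A
  proof -
   obtain s where "is_section P s" "0 < prob (A \<inter> {w\<in>space M. s w = y})" by (rule ex_section[OF P erg C y A])
   thus ?thesis by blast
  qed
  ultimately obtain \<F> where \<F>: "\<F> \<subseteq> ?\<S>" "countable \<F>" "AE w in M. w \<in> \<Union>\<F>" by (rule countable_exhaustion)
  define sec where "sec B = (SOME s. is_section P s \<and> B = {w\<in>space M. s w = y})" for B
  have sec: "is_section P (sec B) \<and> B = {w\<in>space M. sec B w = y}" if "B \<in> \<F>" for B
   unfolding sec_def by (rule someI_ex[of "\<lambda>s. is_section P s \<and> B = {w\<in>space M. s w = y}"]) (use that \<F>(1) in blast)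
  have "AE w in M. \<exists>s\<in>sec ` \<F>. s w = y"
   using \<F>(3) by eventually_elim (use sec in blast)
  thus ?thesis using \<F>(2) sec by (intro exI[of _ "sec ` \<F>"]) auto
 qed
 hence "\<forall>y\<in>centers. \<exists>F. countable F \<and> (\<forall>s\<in>F. is_section P s) \<and> (AE w in M. \<exists>s\<in>F. s w = y)" by blast
 from bchoice[OF this] obtain F where F0: "\<forall>y\<in>centers. countable (F y) \<and> (\<forall>s\<in>F y. is_section P s) \<and> (AE w in M. \<exists>s\<in>F y. s w = y)" ..
 have F: "countable (F y)" "s \<in> F y ==> is_section P s" "AE w in M. \<exists>s\<in>F y. s w = y" if "y \<in> centers" for y s
  using F0[rule_format, OF that] by simp_all
 let ?m = "\<lambda>s t u w. m (s w) (t w) (u w)"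
 define F' where "F' = ternary_closure ?m (\<Union>y\<in>centers. F y)"
 have "countable F'" unfolding F'_def using F(1) countable_centers by (intro countable_ternary_closure countable_UN)
 moreover have "is_section P s" if "s \<in> F'" for s
  using that unfolding F'_def by induction (auto intro: F(2) section_med[OF P(1)])
 moreover have "AE w in M. \<forall>y\<in>core. \<exists>s\<in>F'. s w = y"
 proof -
  have "AE w in M. \<forall>y\<in>centers. \<exists>s\<in>F y. s w = y" unfolding AE_ball_countable[OF countable_centers] using F(3) by blast
  thus ?thesis
  proof eventually_elim
   case (elim w)
   show ?case
   proof
    fix y assume "y \<in> core"
    thus "\<exists>s\<in>F'. s w = y" unfolding core_def
    proof induction
     case (base y)
     then obtain s where "s \<in> F y" "s w = y" using elim by blast
     thus ?case unfolding F'_def using base by (auto intro: ternary_closure.base)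
    next
     case (step x y z)
     then obtain s t u where "s \<in> F'" "s w = x" "t \<in> F'" "t w = y" "u \<in> F'" "u w = z" by blast
     thus ?case unfolding F'_def by (intro bexI[of _ "?m s t u"] ternary_closure.step) auto
    qed
   qed
  qed
 qed
 ultimately show ?thesis by (rule frame_of_cover[OF P(1) erg])
qed

lemma frame_member:
 assumes P: "P \<subseteq> carrier G" and erg: "ergodic_on P" and F: "is_frame P F" and u: "is_section P u"
 obtains s where "s \<in> F" "AE w in M. u w = s w"
proof -
 have cF: "countable F" and sec: "!!s. s \<in> F ==> is_section P s" and bij: "AE w in M. bij_betw (\<lambda>s. s w) F core"
  using F unfolding is_frame_def by auto
 have "\<exists>s\<in>F. AE w in M. u w = s w"
 proof (rule ccontr)
  assume "\<not> ?thesis"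
  hence "AE w in M. u w ~= s w" if "s \<in> F" for s using section_agree[OF P erg u sec[OF that]] that by blast
  hence "AE w in M. \<forall>s\<in>F. u w ~= s w" unfolding AE_ball_countable[OF cF] by blast
  hence "AE w in M. False" using bij AE_space
  proof eventually_elim
   case (elim w)
   have "u w \<in> core" by (rule sectionD(1)[OF u elim(3)])
   thus ?case using elim(1,2) unfolding bij_betw_def by force
  qed
  thus False using not_AE_False by blast
 qed
 thus ?thesis using that by blast
qed

text \<open>An element that normalises \<open>P\<close> moves \<open>P\<close>-sections to \<open>P\<close>-sections, hence permutes a frame.\<close>

lemma section_pull:
 assumes P: "P \<subseteq> carrier G" and g: "g \<in> carrier G" and norm: "!!h. h \<in> P ==> g \<otimes> h \<otimes> inv g \<in> P" and s: "is_section P s"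
 shows "is_section P (\<lambda>w. inv_into S (coc g w) (s (act g w)))"
 unfolding is_section_def
proof (intro conjI ballI)
 show "inv_into S (coc g w) (s (act g w)) \<in> core" if "w \<in> space M" for w
  using core_iso[OF iso_inv(1)[OF coc_iso[OF g that]]] sectionD(1)[OF s act_in[OF g that]] by blast
 fix y assume y: "y \<in> core"
 have "inv_into S (coc g w) (s (act g w)) = y \<longleftrightarrow> s (act g w) = coc g w y" if w: "w \<in> space M" for w
  using iso_inv(2,3)[OF coc_iso[OF g w]] core_S[OF sectionD(1)[OF s act_in[OF g w]]] core_S[OF y] by metis
 hence "{w\<in>space M. inv_into S (coc g w) (s (act g w)) = y} = (\<Union>z\<in>core. {w\<in>space M. act g w \<in> {w\<in>space M. s w = z}} \<inter> {w\<in>space M. coc g w y = z})"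
  using core_iso[OF coc_iso[OF g] y] act_in[OF g] by auto
 also have "\<dots> \<in> sets M"
 proof (rule sets.countable_UN''[OF countable_core])
  fix z assume z: "z \<in> core"
  show "{w\<in>space M. act g w \<in> {w\<in>space M. s w = z}} \<inter> {w\<in>space M. coc g w y = z} \<in> sets M"
   by (intro sets.Int act_vimage g sectionD(2)[OF s z] jmeas_sections(1)[OF coc_joint g] core_S y z)
 qed
 finally show "{w\<in>space M. inv_into S (coc g w) (s (act g w)) = y} \<in> sets M" .
next
 fix h assume h: "h \<in> P"
 have hG: "h \<in> carrier G" using h P by blast
 let ?k = "g \<otimes> h \<otimes> inv g"
 have k: "?k \<in> P" "?k \<in> carrier G" using norm[OF h] P by auto
 have gh: "?k \<otimes> g = g \<otimes> h" using g hG by (simp add: group.m_assoc)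
 show "AE w in M. inv_into S (coc g (act h w)) (s (act g (act h w))) = coc h w (inv_into S (coc g w) (s (act g w)))"
  using AE_act[OF g sectionD(3)[OF s k(1)]] AE_space
 proof eventually_elim
  case (elim w)
  note w = elim(2)
  let ?x = "inv_into S (coc g w) (s (act g w))"
  have xS: "?x \<in> S" using iso_in[OF iso_inv(1)[OF coc_iso[OF g w]]] core_S[OF sectionD(1)[OF s act_in[OF g w]]] by blast
  have x: "coc g w ?x = s (act g w)" using iso_inv(2)[OF coc_iso[OF g w]] core_S[OF sectionD(1)[OF s act_in[OF g w]]] by blast
  have "s (act g (act h w)) = s (act ?k (act g w))" unfolding act_mult[OF g hG w, symmetric] act_mult[OF k(2) g w, symmetric] gh ..
  also have "\<dots> = coc ?k (act g w) (coc g w ?x)" using elim(1) x by simp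
  also have "\<dots> = coc g (act h w) (coc h w ?x)" unfolding coc_mult[OF g hG w xS, symmetric] coc_mult[OF k(2) g w xS, symmetric] gh ..
  finally show ?case using iso_inv(3)[OF coc_iso[OF g act_in[OF hG w]]] iso_in[OF coc_iso[OF hG w] xS] by simp
 qed
qed

lemma frame_permutation:
 assumes P: "P \<subseteq> carrier G" and erg: "ergodic_on P" and F: "is_frame P F"
  and g: "g \<in> carrier G" and norm: "!!h. h \<in> P ==> g \<otimes> h \<otimes> inv g \<in> P"
 obtains \<pi> where "bij_betw \<pi> F F" "AE w in M. \<forall>s\<in>F. s (act g w) = coc g w (\<pi> s w)"
proof -
 have cF: "countable F" and sec: "!!s. s \<in> F ==> is_section P s" and bij: "AE w in M. bij_betw (\<lambda>s. s w) F core"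
  using F unfolding is_frame_def by auto
 have "\<exists>t\<in>F. AE w in M. inv_into S (coc g w) (s (act g w)) = t w" if "s \<in> F" for s
  using frame_member[OF P erg F section_pull[OF P g norm sec[OF that]]] by metis
 then obtain \<pi> where \<pi>: "!!s. s \<in> F ==> \<pi> s \<in> F" "!!s. s \<in> F ==> AE w in M. inv_into S (coc g w) (s (act g w)) = \<pi> s w" by metis
 have "AE w in M. \<forall>s\<in>F. inv_into S (coc g w) (s (act g w)) = \<pi> s w"
  unfolding AE_ball_countable[OF cF] using \<pi>(2) by blast
 hence main: "AE w in M. \<forall>s\<in>F. s (act g w) = coc g w (\<pi> s w)" using AE_space
 proof eventually_elim
  case (elim w)
  show ?case
  proof
   fix s assume s: "s \<in> F"
   show "s (act g w) = coc g w (\<pi> s w)"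
    using iso_inv(2)[OF coc_iso[OF g elim(2)]] core_S[OF sectionD(1)[OF sec[OF s] act_in[OF g elim(2)]]] elim(1) s by fastforce
  qed
 qed
 have "\<exists>w. w \<in> space M \<and> (\<forall>s\<in>F. s (act g w) = coc g w (\<pi> s w)) \<and> bij_betw (\<lambda>s. s w) F core \<and> bij_betw (\<lambda>s. s (act g w)) F core"
 proof (rule ccontr)
  assume n: "\<not> ?thesis"
  have "AE w in M. False" using main bij AE_act[OF g bij] AE_space by eventually_elim (use n in blast)
  thus False using not_AE_False by blast
 qed
 then obtain w where w: "w \<in> space M" "\<forall>s\<in>F. s (act g w) = coc g w (\<pi> s w)" "bij_betw (\<lambda>s. s w) F core" "bij_betw (\<lambda>s. s (act g w)) F core"
  by blast
 note i = coc_iso[OF g w(1)]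
 have "bij_betw \<pi> F F" unfolding bij_betw_def
 proof
  show "inj_on \<pi> F"
  proof (rule inj_onI)
   fix s t assume st: "s \<in> F" "t \<in> F" "\<pi> s = \<pi> t"
   hence "s (act g w) = t (act g w)" using w(2) by metis
   thus "s = t" by (rule inj_onD[OF bij_betw_imp_inj_on[OF w(4)] _ st(1,2)])
  qed
  show "\<pi> ` F = F"
  proof
   show "\<pi> ` F \<subseteq> F" using \<pi>(1) by blast
   show "F \<subseteq> \<pi> ` F"
   proof
    fix t assume t: "t \<in> F"
    hence tc: "t w \<in> core" using sectionD(1)[OF sec w(1)] by blast
    hence "coc g w (t w) \<in> (\<lambda>s. s (act g w)) ` F" using core_iso[OF i] w(4) unfolding bij_betw_def by blast
    then obtain s where s: "s \<in> F" "s (act g w) = coc g w (t w)" by auto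
    hence "coc g w (\<pi> s w) = coc g w (t w)" using w(2) by simp
    hence "\<pi> s w = t w"
     using inj_onD[OF iso_inj[OF i]] core_S[OF tc] core_S[OF sectionD(1)[OF sec[OF \<pi>(1)[OF s(1)]] w(1)]] by blast
    hence "\<pi> s = t" using inj_onD[OF bij_betw_imp_inj_on[OF w(3)], of "\<pi> s" t] \<pi>(1)[OF s(1)] t by simp
    thus "t \<in> \<pi> ` F" using s(1) by blast
   qed
  qed
 qed
 thus ?thesis using that main by blast
qed

text \<open>The \<open>P\<close>-frame identifies almost every fibre with the set \<open>F\<close>. In this coordinate \<open>t\<close> is a map \<open>\<Omega> \<rightarrow> F\<close> and pushes the
 measure forward to a probability on \<open>F\<close>, hence to one on the core over each \<open>w\<close>. It is \<open>P\<close>-invariant as the frame is, and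
 \<open>Q\<close>-invariant as \<open>Q\<close> permutes the frame and fixes \<open>t\<close>.\<close>

theorem merge_filter:
 assumes P: "P \<subseteq> carrier G" and erg: "ergodic_on P" and F: "is_frame P F"
  and Q: "Q \<subseteq> carrier G" and t: "is_section Q t" and comm: "!!g h. g \<in> Q ==> h \<in> P ==> g \<otimes> h = h \<otimes> g"
 shows "\<exists>C. inv_filter (P \<union> Q) C"
proof -
 have cF: "countable F" and sec: "!!s. s \<in> F ==> is_section P s" and bij: "AE w in M. bij_betw (\<lambda>s. s w) F core"
  using F unfolding is_frame_def by auto
 obtain Z where Z: "!!w. w \<in> space M - Z ==> bij_betw (\<lambda>s. s w) F core" "Z \<in> null_sets M"
  using bij by (rule AE_E3) (rule that)
 have nZ: "AE w in M. w \<notin> Z" using Z(2) by (rule AE_not_in)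
 have ZM: "Z \<in> sets M" using Z(2) by auto
 have ex1: "\<exists>s\<in>F. s w = t w" if "w \<in> space M - Z" for w
 using bij_betw_imp_surj_on[OF Z(1)[OF that]] sectionD(1)[OF t, of w] that by (auto simp: eq_commute)
 have uniq: "s = s'" if "w \<in> space M - Z" "s \<in> F" "s' \<in> F" "s w = s' w" for s s' w
  by (rule inj_onD[OF bij_betw_imp_inj_on[OF Z(1)[OF that(1)]] _ that(2,3)]) (rule that(4))
 have st: "{w\<in>space M. s w = t w} \<in> sets M" if "s \<in> F" for s by (rule section_pred_meas[OF sec[OF that] t])
 \<comment> \<open>The event that the label of \<open>t\<close> in the frame satisfies \<open>R\<close>.\<close>
 define N where "N R = {w'\<in>space M - Z. \<exists>s\<in>F. R s \<and> s w' = t w'}" for R :: "('w => 'x) => bool"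
 have N_meas: "N R \<in> sets M" for R
 proof -
  have "N R = (\<Union>s\<in>{s\<in>F. R s}. {w\<in>space M. s w = t w}) - Z" unfolding N_def by auto
  moreover have "(\<Union>s\<in>{s\<in>F. R s}. {w\<in>space M. s w = t w}) \<in> sets M"
   using countable_subset[OF _ cF, of "{s\<in>F. R s}"] st by (intro sets.countable_UN'') auto
  ultimately show ?thesis using ZM by auto
 qed
 have N_compl: "prob (N (\<lambda>s. \<not> R s)) = 1 - prob (N R)" for R
 proof -
  have "AE w in M. w \<in> N (\<lambda>s. \<not> R s) \<longleftrightarrow> w \<in> space M - N R" using nZ AE_space
  proof eventually_elim
   case (elim w)
   hence w: "w \<in> space M - Z" by blast
   obtain s where s: "s \<in> F" "s w = t w" using ex1[OF w] by blast
   have "w \<in> N R \<longleftrightarrow> R s" for R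
   proof
    assume "w \<in> N R"
    then obtain s' where "s' \<in> F" "R s'" "s' w = t w" unfolding N_def by blast
    thus "R s" using uniq[OF w s(1), of s'] s(2) by simp
   qed (use s w in \<open>auto simp: N_def\<close>)
   thus ?case using w by simp
  qed
  hence "prob (N (\<lambda>s. \<not> R s)) = prob (space M - N R)" by (intro measure_eq_AE N_meas sets.compl_sets)
  also have "\<dots> = 1 - prob (N R)" by (rule prob_compl[OF N_meas])
  finally show ?thesis .
 qed
 have N_disj: "N R \<inter> N R' = {}" if disj: "!!s. s \<in> F ==> \<not> (R s \<and> R' s)" for R R'
 proof -
  have False if w: "w \<in> N R" "w \<in> N R'" for w
  proof -
   obtain s where s: "s \<in> F" "R s" "s w = t w" "w \<in> space M - Z" using w(1) unfolding N_def by blast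
   obtain s' where s': "s' \<in> F" "R' s'" "s' w = t w" using w(2) unfolding N_def by blast
   show False using uniq[OF s(4,1) s'(1)] s(3) s'(3) disj[OF s(1)] s(2) s'(2) by simp
  qed
  thus ?thesis by blast
 qed
 define \<nu> where "\<nu> w B = (if w \<in> Z then if p \<in> B then 1 else 0 else prob (N (\<lambda>s. s w \<in> B)))" for w B
 have \<nu>: "\<nu> w B = prob (N (\<lambda>s. s w \<in> B))" if "w \<notin> Z" for w B using that unfolding \<nu>_def by simp
 have sS: "s w \<in> S" if "s \<in> F" "w \<in> space M" for s w using sectionD(1)[OF sec[OF that(1)] that(2)] by (rule core_S)
 have \<nu>_mean: "mean (\<nu> w)" if w: "w \<in> space M" for w
 proof (cases "w \<in> Z")
  case True
  thus ?thesis using mean_point unfolding \<nu>_def by simp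
 next
  case False
  show ?thesis unfolding mean_def \<nu>[OF False]
  proof (intro conjI ballI allI impI)
   fix B
   show "prob (N (\<lambda>s. s w \<in> S - B)) = 1 - prob (N (\<lambda>s. s w \<in> B))"
    using sS w N_compl unfolding N_def by simp
  next
   fix \<B> :: "'x set set" assume \<B>: "finite \<B> \<and> \<B> \<subseteq> \<T> \<and> pairwise disjnt \<B>"
   have "(\<Sum>B\<in>\<B>. prob (N (\<lambda>s. s w \<in> B))) = prob (\<Union>B\<in>\<B>. N (\<lambda>s. s w \<in> B))"
   proof (rule finite_measure_finite_Union[symmetric])
    show "disjoint_family_on (\<lambda>B. N (\<lambda>s. s w \<in> B)) \<B>" unfolding disjoint_family_on_def
    proof (intro ballI impI)
     fix B B' assume "B \<in> \<B>" "B' \<in> \<B>" "B ~= B'"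
     hence "B \<inter> B' = {}" using \<B> unfolding pairwise_def disjnt_def by blast
     thus "N (\<lambda>s. s w \<in> B) \<inter> N (\<lambda>s. s w \<in> B') = {}" by (intro N_disj) blast
    qed
   qed (use \<B> N_meas in auto)
   thus "(\<Sum>B\<in>\<B>. prob (N (\<lambda>s. s w \<in> B))) \<le> 1" by simp
  qed auto
 qed
 have \<nu>_meas: "(\<lambda>w. \<nu> w B) \<in> borel_measurable M" for B
 proof -
  let ?N = "\<Union>s\<in>F. {w\<in>space M. s w \<in> B} \<times> ({w\<in>space M. s w = t w} - Z)"
  have "{w\<in>space M. s w \<in> B} \<in> sets M" if "s \<in> F" for s
   using section_pred_meas[OF sec[OF that] sec[OF that], of "\<lambda>y z. y \<in> B"] .
  hence "?N \<in> sets (M \<Otimes>\<^sub>M M)" using st ZM by (intro sets.countable_UN'' cF pair_measureI) auto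
  hence "(\<lambda>w. measure M (Pair w -` ?N)) \<in> borel_measurable M"
   using measurable_emeasure_Pair unfolding measure_def by fastforce
  hence m: "(\<lambda>w. if w \<in> Z then if p \<in> B then 1 else 0 else measure M (Pair w -` ?N)) \<in> borel_measurable M"
   using ZM by (intro measurable_If_set) auto
  have "Pair w -` ?N = N (\<lambda>s. s w \<in> B)" if "w \<in> space M" for w using that unfolding N_def by auto
  hence "(if w \<in> Z then if p \<in> B then 1 else 0 else measure M (Pair w -` ?N)) = \<nu> w B" if "w \<in> space M" for w
   using that unfolding \<nu>_def by simp
  thus ?thesis using m by (simp cong: measurable_cong)
 qed
 have "inv_filter (P \<union> Q) (\<lambda>w B. 1/2 < \<nu> w B)"
 proof (rule filter_of_invariant_mean[OF \<nu>_meas \<nu>_mean])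
  fix g assume "g \<in> P \<union> Q"
  then consider "g \<in> P" | "g \<in> Q" by blast
  thus "AE w in M. \<forall>B\<in>\<T>. \<nu> (act g w) (coc g w ` B) = \<nu> w B"
  proof cases
   case 1
   hence g: "g \<in> carrier G" using P by blast
   have "AE w in M. \<forall>s\<in>F. s (act g w) = coc g w (s w)"
    unfolding AE_ball_countable[OF cF] using sectionD(3)[OF sec 1] by blast
   thus ?thesis using nZ AE_act[OF g nZ] AE_space
   proof eventually_elim
    case (elim w)
    show ?case
    proof
     fix B assume B: "B \<in> \<T>"
     have "s (act g w) \<in> coc g w ` B \<longleftrightarrow> s w \<in> B" if "s \<in> F" for s
      using iso_mem[OF coc_iso[OF g elim(4)] tests_sub[OF B] sS[OF that elim(4)]] elim(1) that by simp
     thus "\<nu> (act g w) (coc g w ` B) = \<nu> w B" using \<nu> elim(2,3) unfolding N_def by simp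
    qed
   qed
  next
   case 2
   hence g: "g \<in> carrier G" using Q by blast
   have norm: "g \<otimes> h \<otimes> inv g \<in> P" if "h \<in> P" for h
   using g that P unfolding comm[OF 2 that] by (simp add: group.m_assoc subset_iff)
   obtain \<pi> where \<pi>: "bij_betw \<pi> F F" "AE w in M. \<forall>s\<in>F. s (act g w) = coc g w (\<pi> s w)"
    using frame_permutation[OF P erg F g norm] by blast
   have \<pi>F: "\<pi> s \<in> F" if "s \<in> F" for s using bij_betwE[OF \<pi>(1)] that by blast
   have shift: "prob (N (\<lambda>s. R (\<pi> s))) = prob (N R)" for R
   proof -
    have "prob (N (\<lambda>s. R (\<pi> s))) = prob {w\<in>space M. act g w \<in> N (\<lambda>s. R (\<pi> s))}"
     by (rule prob_act[OF g N_meas, symmetric])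
    also have "\<dots> = prob (N R)"
    proof (rule measure_eq_AE)
     show "AE w in M. w \<in> {w\<in>space M. act g w \<in> N (\<lambda>s. R (\<pi> s))} \<longleftrightarrow> w \<in> N R"
      using \<pi>(2) sectionD(3)[OF t 2] nZ AE_act[OF g nZ] AE_space
     proof eventually_elim
      case (elim w)
      note w = elim(5)
      have tS: "t w \<in> S" using sectionD(1)[OF t w] by (rule core_S)
      have "s (act g w) = t (act g w) \<longleftrightarrow> \<pi> s w = t w" if s: "s \<in> F" for s
      using elim(1) s inj_on_eq_iff[OF iso_inj[OF coc_iso[OF g w]] sS[OF \<pi>F[OF s] w] tS] unfolding elim(2) by simp
      hence "act g w \<in> N (\<lambda>s. R (\<pi> s)) \<longleftrightarrow> (\<exists>s\<in>F. R (\<pi> s) \<and> \<pi> s w = t w)"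
       unfolding N_def using elim(4) act_in[OF g w] by auto
      also have "\<dots> \<longleftrightarrow> (\<exists>s\<in>\<pi> ` F. R s \<and> s w = t w)" by simp
      also have "\<dots> \<longleftrightarrow> w \<in> N R" unfolding bij_betw_imp_surj_on[OF \<pi>(1)] N_def using elim(3) w by simp
      finally show ?case using w by simp
     qed
    qed (intro act_vimage g N_meas)+
    finally show ?thesis .
   qed
   show ?thesis using \<pi>(2) nZ AE_act[OF g nZ] AE_space
   proof eventually_elim
    case (elim w)
    show ?case
    proof
     fix B assume B: "B \<in> \<T>"
     have "s (act g w) \<in> coc g w ` B \<longleftrightarrow> \<pi> s w \<in> B" if s: "s \<in> F" for s
      using iso_mem[OF coc_iso[OF g elim(4)] tests_sub[OF B] sS[OF \<pi>F[OF s] elim(4)]] elim(1) s by simp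
     thus "\<nu> (act g w) (coc g w ` B) = \<nu> w B"
      using \<nu> elim(2,3) shift[of "\<lambda>s. s w \<in> B"] unfolding N_def by simp
    qed
   qed
  qed
 qed
 thus ?thesis by blast
qed

lemma ergodic_on_mono: "P \<subseteq> Q ==> ergodic_on P ==> ergodic_on Q"
 unfolding ergodic_on_def by blast

text \<open>If the union over some \<open>J - {i}\<close> has an invariant filter, it has a frame. Otherwise \<open>commuting_filter\<close> gives each
 \<open>P i\<close> a filter, hence a frame, and these are merged one after the other.\<close>

theorem frame_of_commuting:
 assumes J: "finite J" "2 \<le> card J"
  and P: "!!j. j \<in> J ==> P j \<subseteq> carrier G" "!!j. j \<in> J ==> P j ~= {}" "!!j g. j \<in> J ==> g \<in> P j ==> inv g \<in> P j"
   "!!j. j \<in> J ==> normalized (P j)" "!!j. j \<in> J ==> ergodic_on (P j)"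
  and comm: "!!j k g h. j \<in> J ==> k \<in> J ==> j ~= k ==> g \<in> P j ==> h \<in> P k ==> g \<otimes> h = h \<otimes> g"
 obtains i F where "i \<in> J" "is_frame (\<Union>j\<in>J - {i}. P j) F"
  "(\<Union>j\<in>J - {i}. P j) \<subseteq> carrier G" "normalized (\<Union>j\<in>J - {i}. P j)" "ergodic_on (\<Union>j\<in>J - {i}. P j)"
proof -
 have U: "(\<Union>j\<in>K. P j) \<subseteq> carrier G" "(\<Union>j\<in>K. P j) ~= {}" "!!g. g \<in> (\<Union>j\<in>K. P j) ==> inv g \<in> (\<Union>j\<in>K. P j)"
  "normalized (\<Union>j\<in>K. P j)" "ergodic_on (\<Union>j\<in>K. P j)" if K: "K \<subseteq> J" "K ~= {}" for K
 proof -
  show "(\<Union>j\<in>K. P j) \<subseteq> carrier G" using P(1) K(1) by blast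
  obtain k where k: "k \<in> K" "k \<in> J" using K by blast
  show "(\<Union>j\<in>K. P j) ~= {}" using P(2)[OF k(2)] k(1) by blast
  show "inv g \<in> (\<Union>j\<in>K. P j)" if "g \<in> (\<Union>j\<in>K. P j)" for g using that P(3) K(1) by blast
  show "normalized (\<Union>j\<in>K. P j)" unfolding normalized_def
  proof (intro ballI)
   fix g h assume g: "g \<in> carrier G" and "h \<in> (\<Union>j\<in>K. P j)"
   then obtain j where j: "j \<in> K" "j \<in> J" "h \<in> P j" using K(1) by blast
   show "g \<otimes> h \<otimes> inv g \<in> (\<Union>j\<in>K. P j)"
    using P(4)[OF j(2)] g j(3) j(1) unfolding normalized_def by blast
  qed
  show "ergodic_on (\<Union>j\<in>K. P j)" by (rule ergodic_on_mono[OF _ P(5)[OF k(2)]]) (use k in blast)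
 qed
 have rest: "J - {i} ~= {}" for i
 proof
  assume "J - {i} = {}"
  hence "J \<subseteq> {i}" by blast
  hence "card J \<le> card {i}" by (intro card_mono) auto
  thus False using J(2) by simp
 qed
 have ex: "\<exists>i\<in>J. \<exists>F. is_frame (\<Union>j\<in>J - {i}. P j) F"
 proof (cases "\<exists>i\<in>J. \<exists>C. inv_filter (\<Union>j\<in>J - {i}. P j) C")
  case True
  then obtain i C where i: "i \<in> J" and C: "inv_filter (\<Union>j\<in>J - {i}. P j) C" by blast
  have "J - {i} \<subseteq> J" by blast
  from ex_frame[OF U(1,2) _ U(4,5) C, OF this rest this rest _ this rest this rest] U(3)[OF this rest]
  show ?thesis using i by blast
 next
  case False
  have "\<exists>F. is_frame (P i) F" if i: "i \<in> J" for i
  proof -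
   have "J - {i} \<subseteq> J" by blast
   note Ui = U[OF this rest]
   have "(\<exists>C. inv_filter (\<Union>j\<in>J - {i}. P j) C) \<or> (\<exists>C. inv_filter (P i) C)"
   proof (rule commuting_filter[OF P(1)[OF i] P(2)[OF i] P(3)[OF i] P(5)[OF i] Ui(1)])
    fix g h assume g: "g \<in> P i" and "h \<in> (\<Union>j\<in>J - {i}. P j)"
    then obtain j where "j \<in> J" "i ~= j" "h \<in> P j" by blast
    thus "g \<otimes> h = h \<otimes> g" using comm[OF i _ _ g] by blast
   qed
   then obtain C where C: "inv_filter (P i) C" using False i by blast
   show ?thesis by (rule ex_frame[OF P(1)[OF i] P(2)[OF i] P(3)[OF i] P(4)[OF i] P(5)[OF i] C])
  qed
  note single = this
  have all: "\<exists>F. is_frame (\<Union>j\<in>K. P j) F" if "finite K" "K ~= {}" "K \<subseteq> J" for K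
   using that
  proof (induction K rule: finite_ne_induct)
   case (singleton i) thus ?case using single[of i] by simp
  next
   case (insert i K)
   hence i: "i \<in> J" "i \<notin> K" and K: "K \<subseteq> J" "K ~= {}" by auto
   obtain F where F: "is_frame (\<Union>j\<in>K. P j) F" using insert by blast
   obtain F' where F': "is_frame (P i) F'" using single[OF i(1)] by blast
   obtain t where t: "is_section (P i) t"
   proof -
    have "AE w in M. bij_betw (\<lambda>s. s w) F' core" using F' unfolding is_frame_def by blast
    then obtain w where "bij_betw (\<lambda>s. s w) F' core" using not_AE_False eventually_mono by blast
    thus ?thesis using core_ne F' that unfolding bij_betw_def is_frame_def by blast
   qed
   note UK = U[OF K]
   have "\<exists>C. inv_filter ((\<Union>j\<in>K. P j) \<union> P i) C"
   proof (rule merge_filter[OF UK(1,5) F P(1)[OF i(1)] t])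
    fix g h assume g: "g \<in> P i" and "h \<in> (\<Union>j\<in>K. P j)"
    then obtain j where "j \<in> J" "i ~= j" "h \<in> P j" using K i by blast
    thus "g \<otimes> h = h \<otimes> g" using comm[OF i(1) _ _ g] by blast
   qed
   moreover have "(\<Union>j\<in>K. P j) \<union> P i = (\<Union>j\<in>insert i K. P j)" by blast
   ultimately obtain C where C: "inv_filter (\<Union>j\<in>insert i K. P j) C" by auto
   have K': "insert i K \<subseteq> J" "insert i K ~= {}" using i K by auto
   note UK' = U[OF K']
   show ?case by (rule ex_frame[OF UK'(1,2) UK'(3) UK'(4,5) C])
  qed
  obtain i where i: "i \<in> J" using J(2) by fastforce
  show ?thesis using all[OF _ rest[of i]] J(1) i by blast
 qed
 then obtain i F where i: "i \<in> J" "is_frame (\<Union>j\<in>J - {i}. P j) F" by blast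
 have "J - {i} \<subseteq> J" by blast
 from that[OF i] U(1,4,5)[OF this rest] show ?thesis by blast
qed

text \<open>By ergodicity the distance of two sections in the frame is almost surely constant, so \<open>F\<close> is a metric space isometric to almost every
 fibre. The group permutes \<open>F\<close> by \<open>\<theta>\<close>, isometrically, and \<open>Q\<close> acts trivially. Evaluation at a generic point
 \<open>w0\<close> identifies \<open>F\<close> with the core and turns \<open>\<theta>\<close> into \<open>h\<close>; \<open>\<phi> w\<close> compares the fibre over \<open>w\<close> with
 that over \<open>w0\<close>.\<close>

theorem trivialisation:
 assumes Q: "Q \<subseteq> carrier G" "normalized Q" and erg: "ergodic_on Q" and F: "is_frame Q F"
 obtains h \<phi> where
  "!!g. g \<in> carrier G ==> h g \<in> isometries (submetric X core)"
  "!!g k. g \<in> carrier G ==> k \<in> carrier G ==> h (g \<otimes> k) = compose core (h g) (h k)"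
  "!!g. g \<in> Q ==> h g = (\<lambda>y\<in>core. y)"
  "!!y y'. y \<in> core ==> y' \<in> core ==> {g\<in>carrier G. h g y = y'} \<in> sets lam"
  "!!w. w \<in> space M ==> \<phi> w \<in> isometries (submetric X core)"
  "!!y y'. y \<in> core ==> y' \<in> core ==> {w\<in>space M. \<phi> w y = y'} \<in> sets M"
  "!!g. g \<in> carrier G ==> AE w in M. \<forall>y\<in>core. \<phi> (act g w) (coc g w y) = h g (\<phi> w y)"
proof -
 have cF: "countable F" and sec: "!!s. s \<in> F ==> is_section Q s" and bij: "AE w in M. bij_betw (\<lambda>s. s w) F core"
  using F unfolding is_frame_def by auto
 have sS: "s w \<in> S" and sc: "s w \<in> core" if "s \<in> F" "w \<in> space M" for s w
  using sectionD(1)[OF sec[OF that(1)] that(2)] core_S by auto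
 have "\<exists>c. AE w in M. d (s w) (t w) = c" if s: "s \<in> F" and t: "t \<in> F" for s t
 proof (rule ccontr)
  assume n: "\<not> ?thesis"
  have "AE w in M. d (s w) (t w) ~= r" for r
  proof -
   let ?E = "{w\<in>space M. d (s w) (t w) = r}"
   have E: "?E \<in> sets M" by (rule section_pred_meas[OF sec[OF s] sec[OF t]])
   have "prob ?E = 0 \<or> prob ?E = 1"
   proof (rule erg[unfolded ergodic_on_def, rule_format, OF E])
    fix k assume k: "k \<in> Q"
    have kG: "k \<in> carrier G" using k Q by blast
    show "AE w in M. act k w \<in> ?E \<longleftrightarrow> w \<in> ?E"
     using sectionD(3)[OF sec[OF s] k] sectionD(3)[OF sec[OF t] k] AE_space
    proof eventually_elim
     case (elim w)
     thus ?case using iso_dist[OF coc_iso[OF kG elim(3)] sS[OF s elim(3)] sS[OF t elim(3)]] act_in[OF kG elim(3)] by simp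
    qed
   qed
   moreover have "prob ?E ~= 1"
   proof
    assume "prob ?E = 1"
    hence "AE w in M. w \<in> ?E" using E by (simp add: prob_eq_1)
    hence "AE w in M. d (s w) (t w) = r" by eventually_elim simp
    thus False using n by blast
   qed
   ultimately have "AE w in M. w \<notin> ?E" using E by (simp add: prob_eq_0)
   thus ?thesis using AE_space by eventually_elim simp
  qed
  hence "AE w in M. \<forall>z\<in>core \<times> core. d (s w) (t w) ~= d (fst z) (snd z)"
   using countable_core by (subst AE_ball_countable) auto
  hence "AE w in M. False" using AE_space
  proof eventually_elim
   case (elim w)
   thus ?case using sc[OF s elim(2)] sc[OF t elim(2)] by force
  qed
  thus False using not_AE_False by blast
 qed
 then obtain c where c: "!!s t. s \<in> F ==> t \<in> F ==> AE w in M. d (s w) (t w) = c s t" by metis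
 have "AE w in M. \<forall>s\<in>F. \<forall>t\<in>F. d (s w) (t w) = c s t"
  unfolding AE_ball_countable[OF cF] using c by blast
 with bij have "AE w in M. bij_betw (\<lambda>s. s w) F core \<and> (\<forall>s\<in>F. \<forall>t\<in>F. d (s w) (t w) = c s t)" by eventually_elim blast
 then obtain Z where Z: "!!w. w \<in> space M - Z ==> bij_betw (\<lambda>s. s w) F core \<and> (\<forall>s\<in>F. \<forall>t\<in>F. d (s w) (t w) = c s t)" "Z \<in> null_sets M"
  by (rule AE_E3) (rule that)
 have nZ: "AE w in M. w \<notin> Z" using Z(2) by (rule AE_not_in)
 have ZM: "Z \<in> sets M" using Z(2) by auto
 have Zb: "bij_betw (\<lambda>s. s w) F core" and Zd: "s \<in> F ==> t \<in> F ==> d (s w) (t w) = c s t"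
  if "w \<in> space M" "w \<notin> Z" for w s t using Z(1)[of w] that by auto
 have pick: "\<exists>w. w \<in> space M \<and> R w" if "AE w in M. R w" for R
 proof (rule ccontr)
  assume n: "\<not> ?thesis"
  have "AE w in M. False" using that AE_space by eventually_elim (use n in blast)
  thus False using not_AE_False by blast
 qed
 obtain w0 where w0: "w0 \<in> space M" "w0 \<notin> Z" using pick[OF nZ] by blast
 \<comment> \<open>The section through \<open>y\<close> over \<open>w\<close>.\<close>
 define lab where "lab w y = inv_into F (\<lambda>s. s w) y" for w y
 have lab: "lab w y \<in> F" "(lab w y) w = y" if "w \<in> space M" "w \<notin> Z" "y \<in> core" for w y
  using inv_into_into[of y "\<lambda>s. s w" F] f_inv_into_f[of y "\<lambda>s. s w" F] bij_betw_imp_surj_on[OF Zb[OF that(1,2)]] that(3)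
  unfolding lab_def by auto
 have inj: "s = t" if "w \<in> space M" "w \<notin> Z" "s \<in> F" "t \<in> F" "s w = t w" for s t w
  by (rule inj_onD[OF bij_betw_imp_inj_on[OF Zb[OF that(1,2)]] _ that(3,4)]) (rule that(5))
 have lab_eq: "lab w (s w) = s" if "w \<in> space M" "w \<notin> Z" "s \<in> F" for w s
  by (rule inj[OF that(1,2) lab(1)[OF that(1,2) sc[OF that(3,1)]] that(3) lab(2)[OF that(1,2) sc[OF that(3,1)]]])
 have "\<exists>\<theta>. bij_betw \<theta> F F \<and> (AE w in M. \<forall>s\<in>F. (\<theta> s) (act g w) = coc g w (s w))" if g: "g \<in> carrier G" for g
 proof -
  have norm: "g \<otimes> k \<otimes> inv g \<in> Q" if "k \<in> Q" for k using Q(2) g that unfolding normalized_def by blast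
  obtain \<pi> where \<pi>: "bij_betw \<pi> F F" "AE w in M. \<forall>s\<in>F. s (act g w) = coc g w (\<pi> s w)"
   using frame_permutation[OF Q(1) erg F g norm] by blast
  have "bij_betw (inv_into F \<pi>) F F" by (rule bij_betw_inv_into[OF \<pi>(1)])
  moreover have "AE w in M. \<forall>s\<in>F. (inv_into F \<pi> s) (act g w) = coc g w (s w)"
   using \<pi>(2)
  proof eventually_elim
   case (elim w)
   show ?case
   proof
    fix s assume s: "s \<in> F"
    show "(inv_into F \<pi> s) (act g w) = coc g w (s w)"
     using inv_into_into[of s \<pi> F] f_inv_into_f[of s \<pi> F] bij_betw_imp_surj_on[OF \<pi>(1)] s elim by metis
   qed
  qed
  ultimately show ?thesis by blast
 qed
 hence "\<forall>g\<in>carrier G. \<exists>\<theta>. bij_betw \<theta> F F \<and> (AE w in M. \<forall>s\<in>F. (\<theta> s) (act g w) = coc g w (s w))" by blast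
 from bchoice[OF this] obtain \<theta> where \<theta>0: "\<forall>g\<in>carrier G. bij_betw (\<theta> g) F F \<and> (AE w in M. \<forall>s\<in>F. (\<theta> g s) (act g w) = coc g w (s w))" ..
 have \<theta>b: "bij_betw (\<theta> g) F F" and \<theta>: "AE w in M. \<forall>s\<in>F. (\<theta> g s) (act g w) = coc g w (s w)" if "g \<in> carrier G" for g
  using \<theta>0 that by auto
 have \<theta>F: "\<theta> g s \<in> F" if "g \<in> carrier G" "s \<in> F" for g s using bij_betwE[OF \<theta>b[OF that(1)]] that(2) by blast
 have \<theta>_eq: "\<theta> g s = t \<longleftrightarrow> (AE w in M. t (act g w) = coc g w (s w))" if g: "g \<in> carrier G" and s: "s \<in> F" and t: "t \<in> F" for g s t
 proof
  assume eq: "\<theta> g s = t"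
  show "AE w in M. t (act g w) = coc g w (s w)" using \<theta>[OF g] by eventually_elim (use s eq in blast)
 next
  assume "AE w in M. t (act g w) = coc g w (s w)"
  with \<theta>[OF g] AE_act[OF g nZ] have "AE w in M. act g w \<notin> Z \<and> (\<theta> g s) (act g w) = t (act g w)"
   by eventually_elim (use s in auto)
  from pick[OF this] obtain w where w: "w \<in> space M" "act g w \<notin> Z" "(\<theta> g s) (act g w) = t (act g w)" by blast
  show "\<theta> g s = t" by (rule inj[OF act_in[OF g w(1)] w(2) \<theta>F[OF g s] t w(3)])
 qed
 have \<theta>_mult: "\<theta> (g \<otimes> k) s = \<theta> g (\<theta> k s)" if g: "g \<in> carrier G" and k: "k \<in> carrier G" and s: "s \<in> F" for g k s
 proof -
  have "AE w in M. (\<theta> g (\<theta> k s)) (act (g \<otimes> k) w) = coc (g \<otimes> k) w (s w)"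
   using \<theta>[OF k] AE_act[OF k \<theta>[OF g]] AE_space
  proof eventually_elim
   case (elim w)
   note w = elim(3)
   have "(\<theta> g (\<theta> k s)) (act g (act k w)) = coc g (act k w) ((\<theta> k s) (act k w))" using elim(2) \<theta>F[OF k s] by blast
   thus ?case using elim(1) s unfolding act_mult[OF g k w] coc_mult[OF g k w sS[OF s w]] by simp
  qed
  thus ?thesis using \<theta>_eq[of "g \<otimes> k" s] g k s \<theta>F by simp
 qed
 have \<theta>_Q: "\<theta> g s = s" if "g \<in> Q" "s \<in> F" for g s
 proof -
  have "g \<in> carrier G" using that Q by blast
  thus ?thesis using \<theta>_eq[of g s s] sectionD(3)[OF sec[OF that(2)] that(1)] that(2) by simp
 qed
 have \<theta>_c: "c (\<theta> g s) (\<theta> g t) = c s t" if g: "g \<in> carrier G" and s: "s \<in> F" and t: "t \<in> F" for g s t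
 proof -
  have "AE w in M. w \<notin> Z \<and> act g w \<notin> Z \<and> (\<forall>s\<in>F. (\<theta> g s) (act g w) = coc g w (s w))"
   using \<theta>[OF g] nZ AE_act[OF g nZ] by eventually_elim blast
  from pick[OF this] obtain w where w: "w \<in> space M" "w \<notin> Z" "act g w \<notin> Z" "\<forall>s\<in>F. (\<theta> g s) (act g w) = coc g w (s w)" by blast
  have "c (\<theta> g s) (\<theta> g t) = d ((\<theta> g s) (act g w)) ((\<theta> g t) (act g w))"
   using Zd[OF act_in[OF g w(1)] w(3) \<theta>F[OF g s] \<theta>F[OF g t]] by simp
  also have "\<dots> = d (s w) (t w)" using w(4) s t iso_dist[OF coc_iso[OF g w(1)] sS[OF s w(1)] sS[OF t w(1)]] by simp
  also have "\<dots> = c s t" by (rule Zd[OF w(1,2) s t])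
  finally show ?thesis .
 qed
 define h where "h g = (\<lambda>y\<in>core. (\<theta> g (lab w0 y)) w0)" for g
 define \<phi> where "\<phi> w = (\<lambda>y\<in>core. if w \<in> Z then y else (lab w y) w0)" for w
 have sub: "mspace (submetric X core) = core" "mdist (submetric X core) = d"
  using core_S by (auto simp: mspace_submetric)
 have labw0: "lab w0 y \<in> F" "(lab w0 y) w0 = y" if "y \<in> core" for y using lab[OF w0 that] by auto
 have isometry: "(\<lambda>y\<in>core. (\<theta>' (lab w y)) w0) \<in> isometries (submetric X core)"
  if w: "w \<in> space M" "w \<notin> Z" and b: "bij_betw \<theta>' F F" and cc: "!!s t. s \<in> F ==> t \<in> F ==> c (\<theta>' s) (\<theta>' t) = c s t" for w \<theta>'
 proof -
  have bF: "\<theta>' s \<in> F" if "s \<in> F" for s using bij_betwE[OF b] that by blast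
  have "bij_betw (\<lambda>y. (\<theta>' (lab w y)) w0) core core"
  proof -
   have "bij_betw (lab w) core F" using bij_betw_inv_into[OF Zb[OF w]] unfolding lab_def[abs_def] .
   from bij_betw_trans[OF bij_betw_trans[OF this b] Zb[OF w0]] show ?thesis by (simp add: comp_def)
  qed
  hence "bij_betw (\<lambda>y\<in>core. (\<theta>' (lab w y)) w0) core core" by (simp cong: bij_betw_cong)
  hence "(\<lambda>y\<in>core. (\<theta>' (lab w y)) w0) \<in> Bij core" unfolding Bij_def by auto
  moreover have "d ((\<theta>' (lab w y)) w0) ((\<theta>' (lab w z)) w0) = d y z" if yz: "y \<in> core" "z \<in> core" for y z
  proof -
   have "d ((\<theta>' (lab w y)) w0) ((\<theta>' (lab w z)) w0) = c (lab w y) (lab w z)"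
    using Zd[OF w0 bF bF] cc lab[OF w] yz by simp
   also have "\<dots> = d ((lab w y) w) ((lab w z) w)" by (rule Zd[OF w lab(1)[OF w yz(1)] lab(1)[OF w yz(2)], symmetric])
   also have "\<dots> = d y z" using lab(2)[OF w] yz by simp
   finally show ?thesis .
  qed
  ultimately show ?thesis unfolding isometries_def sub by simp
 qed
 show ?thesis
 proof (rule that[of h \<phi>])
  fix g assume g: "g \<in> carrier G"
  show "h g \<in> isometries (submetric X core)" unfolding h_def by (rule isometry[OF w0 \<theta>b[OF g] \<theta>_c[OF g]])
 next
  fix g k assume g: "g \<in> carrier G" and k: "k \<in> carrier G"
  show "h (g \<otimes> k) = compose core (h g) (h k)"
  proof (rule extensionalityI[of _ core])
   fix y assume y: "y \<in> core"
   have kF: "\<theta> k (lab w0 y) \<in> F" by (rule \<theta>F[OF k labw0(1)[OF y]])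
   have "lab w0 ((\<theta> k (lab w0 y)) w0) = \<theta> k (lab w0 y)" by (rule lab_eq[OF w0 kF])
   thus "h (g \<otimes> k) y = compose core (h g) (h k) y"
    unfolding h_def using \<theta>_mult[OF g k labw0(1)[OF y]] sc[OF kF w0(1)] by (simp add: compose_def)
  qed (auto simp: h_def compose_def)
 next
  fix g assume "g \<in> Q"
  thus "h g = (\<lambda>y\<in>core. y)" unfolding h_def using \<theta>_Q labw0 by (intro restrict_ext) simp
 next
  fix y y' assume y: "y \<in> core" and y': "y' \<in> core"
  let ?s = "lab w0 y" and ?t = "lab w0 y'"
  note s = labw0(1)[OF y] and t = labw0(1)[OF y']
  let ?R = "\<lambda>g w. ?t (act g w) = coc g w (?s w)"
  have "jmeas (\<lambda>g w. \<exists>u\<in>core. \<exists>v\<in>core. act g w \<in> {w\<in>space M. ?t w = v} \<and> coc g w u = v \<and> ?s w = u)"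
   by (intro jmeas_logic countable_core jmeas_act coc_joint jmeas_snd sectionD(2)[OF sec[OF s]] sectionD(2)[OF sec[OF t]] core_S)
  moreover have "(\<exists>u\<in>core. \<exists>v\<in>core. act g w \<in> {w\<in>space M. ?t w = v} \<and> coc g w u = v \<and> ?s w = u) \<longleftrightarrow> ?R g w"
   if "g \<in> carrier G" "w \<in> space M" for g w
   using sc[OF s that(2)] sc[OF t act_in[OF that]] act_in[OF that] by auto
  ultimately have jR: "jmeas ?R" by (rule jmeas_cong)
  let ?E = "{x\<in>space (lam \<Otimes>\<^sub>M M). ?R (fst x) (snd x)}"
  note E = jR[unfolded jmeas_def]
  have "{g\<in>carrier G. h g y = y'} = {g\<in>space lam. emeasure M (Pair g -` ?E) = 1}"
  proof (rule Collect_cong, simp only: lam_space, rule conj_cong[OF refl])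
   fix g assume g: "g \<in> carrier G"
   have "h g y = y' \<longleftrightarrow> \<theta> g ?s = ?t"
   proof
    assume "h g y = y'"
    hence "(\<theta> g ?s) w0 = ?t w0" unfolding h_def using y labw0(2)[OF y'] by simp
    thus "\<theta> g ?s = ?t" by (rule inj[OF w0 \<theta>F[OF g s] t])
   qed (use y labw0(2)[OF y'] in \<open>simp add: h_def\<close>)
   also have "\<dots> \<longleftrightarrow> (AE w in M. ?t (act g w) = coc g w (?s w))" by (rule \<theta>_eq[OF g s t])
   also have "\<dots> \<longleftrightarrow> (AE w in M. w \<in> Pair g -` ?E)"
    by (rule AE_cong) (use g in \<open>simp add: space_pair_measure lam_space\<close>)
   also have "\<dots> \<longleftrightarrow> prob (Pair g -` ?E) = 1"
    by (rule prob_eq_1[OF sets_Pair1[OF E], symmetric])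
   finally show "h g y = y' \<longleftrightarrow> emeasure M (Pair g -` ?E) = 1" by (simp add: emeasure_eq_measure)
  qed
  moreover have "(\<lambda>g. emeasure M (Pair g -` ?E)) \<in> borel_measurable lam" by (rule measurable_emeasure_Pair[OF E])
  ultimately show "{g\<in>carrier G. h g y = y'} \<in> sets lam" by simp
 next
  fix w assume w: "w \<in> space M"
  show "\<phi> w \<in> isometries (submetric X core)"
  proof (cases "w \<in> Z")
   case True
   thus ?thesis unfolding \<phi>_def isometries_def sub by (auto simp: Bij_def bij_betw_def inj_on_def cong: bij_betw_cong)
  next
   case False
   hence "\<phi> w = (\<lambda>y\<in>core. ((\<lambda>s. s) (lab w y)) w0)" unfolding \<phi>_def by auto
   thus ?thesis using isometry[OF w False, of "\<lambda>s. s"] by (simp add: bij_betw_def inj_on_def)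
  qed
 next
  fix y y' assume y: "y \<in> core" and y': "y' \<in> core"
  have "(lab w y) w0 = y' \<longleftrightarrow> (lab w0 y') w = y" if w: "w \<in> space M" "w \<notin> Z" for w
  proof
   assume "(lab w y) w0 = y'"
   thus "(lab w0 y') w = y" using lab_eq[OF w0 lab(1)[OF w y]] lab(2)[OF w y] by simp
  next
   assume "(lab w0 y') w = y"
   thus "(lab w y) w0 = y'" using lab_eq[OF w labw0(1)[OF y']] labw0(2)[OF y'] by simp
  qed
  hence "{w\<in>space M. \<phi> w y = y'} = {w\<in>space M. w \<in> Z \<and> y = y'} \<union> ({w\<in>space M. (lab w0 y') w = y} - Z)"
   unfolding \<phi>_def using y by auto
  also have "{w\<in>space M. w \<in> Z \<and> y = y'} = (if y = y' then Z else {})" using sets.sets_into_space[OF ZM] by auto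
  finally show "{w\<in>space M. \<phi> w y = y'} \<in> sets M" using ZM sectionD(2)[OF sec[OF labw0(1)[OF y']] y] by auto
 next
  fix g assume g: "g \<in> carrier G"
  show "AE w in M. \<forall>y\<in>core. \<phi> (act g w) (coc g w y) = h g (\<phi> w y)"
   using \<theta>[OF g] nZ AE_act[OF g nZ] AE_space
  proof eventually_elim
   case (elim w)
   note w = elim(4) and gw = act_in[OF g elim(4)]
   show ?case
   proof
    fix y assume y: "y \<in> core"
    let ?s = "lab w y"
    have s: "?s \<in> F" "?s w = y" using lab[OF w elim(2) y] by auto
    have "\<phi> w y = ?s w0" unfolding \<phi>_def using y elim(2) by simp
    hence "h g (\<phi> w y) = (\<theta> g ?s) w0" unfolding h_def using sc[OF s(1) w0(1)] lab_eq[OF w0 s(1)] by simp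
    moreover have "coc g w y = (\<theta> g ?s) (act g w)" using elim(1) s by metis
    hence "\<phi> (act g w) (coc g w y) = (\<theta> g ?s) w0"
     unfolding \<phi>_def using lab_eq[OF gw elim(3) \<theta>F[OF g s(1)]] sc[OF \<theta>F[OF g s(1)] gw] elim(3) by simp
    ultimately show "\<phi> (act g w) (coc g w y) = h g (\<phi> w y)" by simp
   qed
  qed
 qed
qed

end

section \<open>Products of locally compact groups\<close>

lemma second_countable_product_topology:
 assumes fin: "finite I" and sc: "!!i. i \<in> I ==> second_countable (T i)"
 shows "second_countable (product_topology T I)"
proof -
 have "\<forall>i\<in>I. \<exists>\<B>. countable \<B> \<and> (\<forall>V\<in>\<B>. openin (T i) V) \<and> (\<forall>U x. openin (T i) U \<and> x \<in> U --> (\<exists>V\<in>\<B>. x \<in> V \<and> V \<subseteq> U))"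
  using sc unfolding second_countable_def by blast
 from bchoice[OF this] obtain \<B> where \<B>: "\<forall>i\<in>I. countable (\<B> i) \<and> (\<forall>V\<in>\<B> i. openin (T i) V) \<and> (\<forall>U x. openin (T i) U \<and> x \<in> U --> (\<exists>V\<in>\<B> i. x \<in> V \<and> V \<subseteq> U))" ..
 have cB: "countable (\<B> i)" and oB: "!!V. V \<in> \<B> i ==> openin (T i) V"
  and bB: "!!U x. openin (T i) U ==> x \<in> U ==> \<exists>V\<in>\<B> i. x \<in> V \<and> V \<subseteq> U" if "i \<in> I" for i
  using \<B> that by blast+
 let ?\<C> = "Pi\<^sub>E I ` Pi\<^sub>E I \<B>"
 show ?thesis unfolding second_countable_def
 proof (intro exI[of _ ?\<C>] conjI ballI allI impI)
  show "countable ?\<C>" using fin cB by (intro countable_image countable_PiE) auto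
  show "openin (product_topology T I) V" if "V \<in> ?\<C>" for V
   using that oB fin by (auto simp: openin_PiE_gen PiE_iff)
  fix U x assume U: "openin (product_topology T I) U \<and> x \<in> U"
  obtain W where "finite {i \<in> I. W i ~= topspace (T i)} \<and> (\<forall>i\<in>I. openin (T i) (W i)) \<and> x \<in> Pi\<^sub>E I W \<and> Pi\<^sub>E I W \<subseteq> U"
   using bspec[OF openin_product_topology_alt[THEN iffD1, OF conjunct1[OF U]] conjunct2[OF U]] ..
  hence W: "!!i. i \<in> I ==> openin (T i) (W i)" "x \<in> Pi\<^sub>E I W" "Pi\<^sub>E I W \<subseteq> U" by auto
  have "\<forall>i\<in>I. \<exists>V. V \<in> \<B> i \<and> x i \<in> V \<and> V \<subseteq> W i" using bB[OF _ W(1)] W(2) by (auto simp: PiE_iff Bex_def)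
  from bchoice[OF this] obtain V where V: "\<forall>i\<in>I. V i \<in> \<B> i \<and> x i \<in> V i \<and> V i \<subseteq> W i" ..
  let ?V = "restrict V I"
  have "Pi\<^sub>E I ?V \<in> ?\<C>" using V by (intro imageI) auto
  moreover have "x \<in> Pi\<^sub>E I ?V" using V W(2) by (auto simp: PiE_iff)
  moreover have "Pi\<^sub>E I ?V \<subseteq> U" by (rule subset_trans[OF PiE_mono W(3)]) (use V in auto)
  ultimately show "\<exists>V\<in>?\<C>. x \<in> V \<and> V \<subseteq> U" by blast
 qed
qed

lemma topological_group_product:
 assumes G: "!!i. i \<in> I ==> topological_group (G i) (T i)"
 shows "topological_group (product_group I G) (product_topology T I)"
proof -
 have gr: "group (G i)" and top: "topspace (T i) = carrier (G i)"
  and mult: "continuous_map (prod_topology (T i) (T i)) (T i) (\<lambda>(x, y). x \<otimes>\<^bsub>G i\<^esub> y)"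
  and inv: "continuous_map (T i) (T i) (\<lambda>x. inv\<^bsub>G i\<^esub> x)" if "i \<in> I" for i
  using G[OF that] unfolding topological_group_def by auto
 let ?T = "product_topology T I"
 have topP: "topspace ?T = carrier (product_group I G)"
  using top by (auto simp: carrier_product_group intro!: PiE_cong)
 have "continuous_map (prod_topology ?T ?T) ?T (\<lambda>z. \<lambda>i\<in>I. fst z i \<otimes>\<^bsub>G i\<^esub> snd z i)"
  unfolding continuous_map_componentwise
 proof (intro conjI ballI)
  fix i assume i: "i \<in> I"
  have "continuous_map (prod_topology ?T ?T) (prod_topology (T i) (T i)) (\<lambda>z. (fst z i, snd z i))"
   using continuous_map_compose[OF continuous_map_fst continuous_map_product_projection[OF i, of T], of ?T]
    continuous_map_compose[OF continuous_map_snd continuous_map_product_projection[OF i, of T], of ?T]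
   by (intro continuous_map_pairedI) (simp_all add: o_def)
  from continuous_map_compose[OF this mult[OF i]] show "continuous_map (prod_topology ?T ?T) (T i) (\<lambda>z. (\<lambda>i\<in>I. fst z i \<otimes>\<^bsub>G i\<^esub> snd z i) i)"
   using i by (simp add: o_def)
 qed auto
 moreover have "continuous_map ?T ?T (\<lambda>x. \<lambda>i\<in>I. inv\<^bsub>G i\<^esub> (x i))"
  unfolding continuous_map_componentwise
 proof (intro conjI ballI)
  fix i assume i: "i \<in> I"
  from continuous_map_compose[OF continuous_map_product_projection[OF i, of T] inv[OF i]]
  show "continuous_map ?T (T i) (\<lambda>x. (\<lambda>i\<in>I. inv\<^bsub>G i\<^esub> (x i)) i)" using i by (simp add: o_def)
 qed auto
 hence "continuous_map ?T ?T (\<lambda>x. inv\<^bsub>product_group I G\<^esub> x)"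
 proof (rule continuous_map_eq)
  fix x assume "x \<in> topspace ?T"
  hence "x \<in> (\<Pi>\<^sub>E i\<in>I. carrier (G i))" unfolding topP carrier_product_group .
  thus "(\<lambda>i\<in>I. inv\<^bsub>G i\<^esub> (x i)) = inv\<^bsub>product_group I G\<^esub> x" by (simp add: inv_product_group gr)
 qed
 ultimately show ?thesis unfolding topological_group_def using gr topP
  by (simp add: mult_product_group case_prod_unfold)
qed

lemma lc_group_product:
 assumes "finite I" and G: "!!i. i \<in> I ==> lc_group (G i) (T i)"
 shows "lc_group (product_group I G) (product_topology T I)"
 using assms unfolding lc_group_def
 by (auto intro: topological_group_product second_countable_product_topology simp: Hausdorff_space_product_topology locally_compact_space_product_topology)

text \<open>The image of a left Haar measure under inversion.\<close>

lemma (in lc_group) ex_right_Haar: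
 obtains lam where "space lam = carrier G" "sets lam = sets (borel_of T)" "sigma_finite_measure lam" "emeasure lam (carrier G) ~= 0"
  "!!A h. A \<in> sets lam ==> h \<in> carrier G ==> emeasure lam {g\<in>carrier G. g \<otimes>\<^bsub>G\<^esub> h \<in> A} = emeasure lam A"
proof -
 obtain \<mu> where sp: "space \<mu> = carrier G" and se: "sets \<mu> = sets (borel_of T)" and sf: "sigma_finite_measure \<mu>"
  and ne: "emeasure \<mu> (carrier G) ~= 0" and left: "!!x A. x \<in> carrier G ==> A \<in> sets \<mu> ==> emeasure \<mu> (tr x A) = emeasure \<mu> A"
  by (rule ex_Haar) (rule that)
 have cm: "f \<in> measurable \<mu> \<mu>" if "continuous_map T T f" for f
  using continuous_measurable_borel_of[OF that] se by (simp cong: measurable_cong_sets)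
 have im: "m_inv G \<in> measurable \<mu> \<mu>" by (rule cm[OF cont_inv])
 define lam where "lam = distr \<mu> \<mu> (m_inv G)"
 have l: "space lam = carrier G" "sets lam = sets \<mu>" unfolding lam_def using sp by auto
 have em: "emeasure lam A = emeasure \<mu> {g\<in>carrier G. inv g \<in> A}" if "A \<in> sets \<mu>" for A
 proof -
  have "m_inv G -` A \<inter> space \<mu> = {g\<in>carrier G. inv g \<in> A}" using sp by auto
  thus ?thesis unfolding lam_def using emeasure_distr[OF im that] by simp
 qed
 have "distr lam \<mu> (m_inv G) = distr \<mu> \<mu> (\<lambda>g. inv (inv g))"
  unfolding lam_def by (subst distr_distr[OF im im]) (simp add: o_def)
 also have "\<dots> = distr \<mu> \<mu> (\<lambda>g. g)" by (rule distr_cong) (auto simp: sp)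
 finally have "distr lam \<mu> (m_inv G) = \<mu>" by simp
 hence "sigma_finite_measure lam"
  using sf im l(2) by (intro sigma_finite_measure_distr[of lam \<mu> "m_inv G"]) (auto cong: measurable_cong_sets)
 moreover have "emeasure lam (carrier G) ~= 0"
 proof -
  have "carrier G \<in> sets \<mu>" using sets.top[of \<mu>] sp by simp
  moreover have "{g\<in>carrier G. inv g \<in> carrier G} = carrier G" by auto
  ultimately show ?thesis using em ne by simp
 qed
 moreover have "emeasure lam {g\<in>carrier G. g \<otimes>\<^bsub>G\<^esub> h \<in> A} = emeasure lam A" if AM: "A \<in> sets \<mu>" and h: "h \<in> carrier G" for A h
 proof -
  have rm: "(\<lambda>g. g \<otimes>\<^bsub>G\<^esub> h) \<in> measurable \<mu> \<mu>"
  proof (rule cm)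
   have "continuous_map T (prod_topology T T) (\<lambda>y. (y, h))" using h top by (intro continuous_map_pairedI) auto
   from continuous_map_compose[OF this cont_mult] show "continuous_map T T (\<lambda>g. g \<otimes>\<^bsub>G\<^esub> h)" by (simp add: o_def)
  qed
  let ?B = "{g\<in>carrier G. inv g \<in> A}" and ?A = "{g\<in>carrier G. g \<otimes>\<^bsub>G\<^esub> h \<in> A}"
  have A': "?A \<in> sets \<mu>" using measurable_sets[OF rm AM] by (simp add: sp vimage_def Int_def conj_commute)
  have B: "?B \<in> sets \<mu>" using measurable_sets[OF im AM] by (simp add: sp vimage_def Int_def conj_commute)
  have "{g\<in>carrier G. inv g \<in> ?A} = tr h ?B"
  proof
   show "{g\<in>carrier G. inv g \<in> ?A} \<subseteq> tr h ?B"
   proof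
    fix g assume g: "g \<in> {g\<in>carrier G. inv g \<in> ?A}"
    hence "inv h \<otimes>\<^bsub>G\<^esub> g \<in> ?B" using h by (simp add: inv_mult_group)
    moreover have "g = h \<otimes>\<^bsub>G\<^esub> (inv h \<otimes>\<^bsub>G\<^esub> g)" using g h by (simp add: m_assoc[symmetric])
    ultimately show "g \<in> tr h ?B" unfolding tr_def by blast
   qed
   show "tr h ?B \<subseteq> {g\<in>carrier G. inv g \<in> ?A}"
    unfolding tr_def using h by (auto simp: inv_mult_group m_assoc)
  qed
  thus ?thesis using em[OF A'] em[OF AM] left[OF h B] by simp
 qed
 ultimately show ?thesis using that[of lam] l se by simp
qed

section \<open>Measurability of families of isometries\<close>

lemma isom_group_simps:
 "carrier (isom_group X) = isometries X"
 "f \<in> isometries X ==> g \<in> isometries X ==> f \<otimes>\<^bsub>isom_group X\<^esub> g = compose (mspace X) f g"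
 unfolding isom_group_def BijGroup_def isometries_def by auto

text \<open>A basic open set constrains finitely many values, and there are only countably many finite lists of constraints.\<close>

lemma measurable_isometries_countable:
 assumes Y: "countable (mspace Y)" and f: "!!x. x \<in> space N ==> f x \<in> isometries Y"
  and m: "!!y z. y \<in> mspace Y ==> z \<in> mspace Y ==> {x\<in>space N. f x y = z} \<in> sets N"
 shows "f \<in> measurable N (borel_of (isom_topology Y))"
proof (rule measurable_borel_ofI)
 show "f \<in> space N \<rightarrow> topspace (isom_topology Y)" using f unfolding topspace_isom_topology by blast
 fix U assume "openin (isom_topology Y) U"
 then obtain W where W: "openin (product_topology (\<lambda>_. mtopology_of Y) (mspace Y)) W" "U = W \<inter> isometries Y"
  unfolding isom_topology_def openin_subtopology by blast
 define cyl where "cyl xs = {h \<in> isometries Y. \<forall>(a, b)\<in>set xs. h a = b}" for xs :: "('a \<times> 'a) list"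
 let ?L = "{xs \<in> lists (mspace Y \<times> mspace Y). cyl xs \<subseteq> U}"
 have ex: "\<exists>xs\<in>?L. h \<in> cyl xs" if h: "h \<in> U" for h
 proof -
  have hi: "h \<in> isometries Y" using h W(2) by blast
  obtain V where V: "finite {i \<in> mspace Y. V i ~= mspace Y}" "h \<in> Pi\<^sub>E (mspace Y) V" "Pi\<^sub>E (mspace Y) V \<subseteq> W"
   using W h unfolding openin_product_topology_alt by force
  obtain js where js: "set js = {i \<in> mspace Y. V i ~= mspace Y}" using finite_list[OF V(1)] by blast
  have hY: "h y \<in> mspace Y" if "y \<in> mspace Y" for y
   using hi that unfolding isometries_def Bij_def bij_betw_def by auto
  let ?xs = "map (\<lambda>j. (j, h j)) js"
  have "cyl ?xs \<subseteq> U"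
  proof
   fix k assume k: "k \<in> cyl ?xs"
   hence ki: "k \<in> isometries Y" unfolding cyl_def by blast
   have "k \<in> Pi\<^sub>E (mspace Y) V"
   proof (rule PiE_I)
    fix y assume y: "y \<in> mspace Y"
    show "k y \<in> V y"
    proof (cases "V y = mspace Y")
     case True thus ?thesis using ki y unfolding isometries_def Bij_def bij_betw_def by auto
    next
     case False
     thus ?thesis using k js y V(2) unfolding cyl_def by auto
    qed
   qed (use ki in \<open>auto simp: isometries_def Bij_def extensional_def\<close>)
   thus "k \<in> U" using V(3) W(2) ki by blast
  qed
  moreover have "?xs \<in> lists (mspace Y \<times> mspace Y)" using js hY by (auto simp: lists_eq_set)
  moreover have "h \<in> cyl ?xs" unfolding cyl_def using hi by auto
  ultimately show ?thesis by blast
 qed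
 have "f -` U \<inter> space N = (\<Union>xs\<in>?L. {x\<in>space N. \<forall>z\<in>set xs. f x (fst z) = snd z})"
 proof
  show "f -` U \<inter> space N \<subseteq> (\<Union>xs\<in>?L. {x\<in>space N. \<forall>z\<in>set xs. f x (fst z) = snd z})"
  proof
   fix x assume x: "x \<in> f -` U \<inter> space N"
   then obtain xs where xs: "xs \<in> ?L" "f x \<in> cyl xs" using ex[of "f x"] by blast
   show "x \<in> (\<Union>xs\<in>?L. {x\<in>space N. \<forall>z\<in>set xs. f x (fst z) = snd z})"
    using xs(2) x xs(1) unfolding cyl_def by fastforce
  qed
  show "(\<Union>xs\<in>?L. {x\<in>space N. \<forall>z\<in>set xs. f x (fst z) = snd z}) \<subseteq> f -` U \<inter> space N"
  proof
   fix x assume "x \<in> (\<Union>xs\<in>?L. {x\<in>space N. \<forall>z\<in>set xs. f x (fst z) = snd z})"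
   then obtain xs where xs: "cyl xs \<subseteq> U" "x \<in> space N" "\<forall>z\<in>set xs. f x (fst z) = snd z" by blast
   thus "x \<in> f -` U \<inter> space N" using f[OF xs(2)] unfolding cyl_def by fastforce
  qed
 qed
 also have "\<dots> \<in> sets N"
 proof (rule sets.countable_UN'')
  have "countable (lists (mspace Y \<times> mspace Y))" using Y by (intro countable_lists countable_SIGMA)
  thus "countable ?L" by (rule countable_subset[rotated]) blast
  fix xs assume "xs \<in> ?L"
  hence "fst z \<in> mspace Y" "snd z \<in> mspace Y" if "z \<in> set xs" for z using that by (auto simp: lists_eq_set)
  thus "{x\<in>space N. \<forall>z\<in>set xs. f x (fst z) = snd z} \<in> sets N"
   by (intro sets.sets_Collect_finite_All m) auto
 qed
 finally show "f -` U \<inter> space N \<in> sets N" .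
qed

lemma closed_evaluation:
 assumes x: "x \<in> mspace X" and y: "y \<in> mspace X" shows "closedin (isom_topology X) {f \<in> isometries X. f x = y}"
proof -
 have c: "continuous_map (isom_topology X) (mtopology_of X) (\<lambda>f. f x)"
  unfolding isom_topology_def by (intro continuous_map_from_subtopology continuous_map_product_projection x)
 have "Hausdorff_space (mtopology_of X)"
  unfolding mtopology_of_def by (rule Metric_space.Hausdorff_space_mtopology[OF Metric_space_mspace_mdist])
 hence "closedin (mtopology_of X) {y}" by (rule closedin_Hausdorff_singleton) (use y in simp)
 from closedin_continuous_map_preimage[OF c this] show ?thesis by (simp add: topspace_isom_topology)
qed

section \<open>Embeddings of the factors and the main result\<close>

context
 fixes I :: "'i set" and G :: "'i => ('g, 'm) monoid_scheme"
 assumes gr: "!!i. i \<in> I ==> group (G i)"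
begin

lemma factor_embedding_in: "i \<in> I ==> x \<in> carrier (G i) ==> factor_embedding I G i x \<in> carrier (product_group I G)"
 using group.is_monoid[OF gr] by (auto simp: factor_embedding_def carrier_product_group monoid.one_closed)

lemma factor_embedding_hom: assumes i: "i \<in> I" shows "factor_embedding I G i \<in> hom (G i) (product_group I G)"
proof (rule homI)
 show "factor_embedding I G i x \<in> carrier (product_group I G)" if "x \<in> carrier (G i)" for x using factor_embedding_in i that .
 fix x y assume "x \<in> carrier (G i)" "y \<in> carrier (G i)"
 show "factor_embedding I G i (x \<otimes>\<^bsub>G i\<^esub> y) = factor_embedding I G i x \<otimes>\<^bsub>product_group I G\<^esub> factor_embedding I G i y"
  using group.is_monoid[OF gr] by (auto simp: factor_embedding_def mult_product_group monoid.one_closed monoid.l_one intro!: restrict_ext)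
qed

lemma factor_embedding_inv:
 assumes i: "i \<in> I" and x: "x \<in> carrier (G i)"
 shows "inv\<^bsub>product_group I G\<^esub> (factor_embedding I G i x) = factor_embedding I G i (inv\<^bsub>G i\<^esub> x)"
using factor_embedding_in[OF i x] gr by (auto simp: inv_product_group factor_embedding_def group.is_monoid monoid.inv_one intro!: restrict_ext)

lemma factor_embedding_commute:
 assumes "i \<in> I" "j \<in> I" "i ~= j" "x \<in> carrier (G i)" "y \<in> carrier (G j)"
 shows "factor_embedding I G i x \<otimes>\<^bsub>product_group I G\<^esub> factor_embedding I G j y =
  factor_embedding I G j y \<otimes>\<^bsub>product_group I G\<^esub> factor_embedding I G i x"
 using assms group.is_monoid[OF gr]
 by (auto simp: factor_embedding_def mult_product_group monoid.one_closed monoid.l_one monoid.r_one intro!: restrict_ext)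

lemma factor_embedding_conj:
 assumes i: "i \<in> I" and g: "g \<in> carrier (product_group I G)" and x: "x \<in> carrier (G i)"
 shows "g \<otimes>\<^bsub>product_group I G\<^esub> factor_embedding I G i x \<otimes>\<^bsub>product_group I G\<^esub> inv\<^bsub>product_group I G\<^esub> g =
  factor_embedding I G i (g i \<otimes>\<^bsub>G i\<^esub> x \<otimes>\<^bsub>G i\<^esub> inv\<^bsub>G i\<^esub> g i)"
proof -
 have g': "g \<in> (\<Pi>\<^sub>E i\<in>I. carrier (G i))" using g by (simp add: carrier_product_group)
 hence gi: "g j \<in> carrier (G j)" if "j \<in> I" for j using that by auto
 have "inv\<^bsub>product_group I G\<^esub> g = (\<lambda>i\<in>I. inv\<^bsub>G i\<^esub> g i)" by (rule inv_product_group[OF g']) (rule gr)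
 thus ?thesis using gi gr
  by (auto simp: factor_embedding_def mult_product_group monoid.r_one[OF group.is_monoid] group.r_inv intro!: restrict_ext)
qed

text \<open>Modulo \<open>e\<^sub>i (g i)\<close>, an element of the product is a finite product of elements of the other factors.\<close>

lemma hom_factors:
 assumes "finite I" and i: "i \<in> I" and h: "h \<in> hom (product_group I G) H" and H: "group H"
  and triv: "!!j x. j \<in> I ==> j ~= i ==> x \<in> carrier (G j) ==> h (factor_embedding I G j x) = \<one>\<^bsub>H\<^esub>"
  and g: "g \<in> carrier (product_group I G)"
 shows "h g = h (factor_embedding I G i (g i))"
proof -
 have "h g = h (factor_embedding I G i (g i))"
  if "finite J" "J \<subseteq> I - {i}" "g \<in> carrier (product_group I G)" "!!j. j \<in> I ==> j \<notin> insert i J ==> g j = \<one>\<^bsub>G j\<^esub>" for J g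
  using that
 proof (induction J arbitrary: g rule: finite_induct)
  case empty
  have "g \<in> (\<Pi>\<^sub>E i\<in>I. carrier (G i))" using empty by (simp add: carrier_product_group)
  hence "g = factor_embedding I G i (g i)" unfolding factor_embedding_def using empty(3)
   by (intro extensionalityI[of _ I]) (auto simp: PiE_iff)
  thus ?case by simp
 next
  case (insert j J)
  have j: "j \<in> I" "j ~= i" using insert.prems(1) by auto
  have g: "g k \<in> carrier (G k)" if "k \<in> I" for k using insert.prems(2) that by (auto simp: carrier_product_group)
  have ge: "g \<in> extensional I" using insert.prems(2) by (simp add: carrier_product_group PiE_iff)
  define g' where "g' = (\<lambda>k\<in>I. if k = j then \<one>\<^bsub>G k\<^esub> else g k)"
  have g': "g' \<in> carrier (product_group I G)"
   using g group.is_monoid[OF gr] by (auto simp: g'_def carrier_product_group monoid.one_closed)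
  have "g = factor_embedding I G j (g j) \<otimes>\<^bsub>product_group I G\<^esub> g'"
  proof (rule extensionalityI[of _ I])
   fix k assume k: "k \<in> I"
   show "g k = (factor_embedding I G j (g j) \<otimes>\<^bsub>product_group I G\<^esub> g') k"
    using k g[OF k] group.is_monoid[OF gr[OF k]] by (auto simp: mult_product_group factor_embedding_def g'_def monoid.l_one monoid.r_one)
  qed (use ge in \<open>auto simp: mult_product_group\<close>)
  hence "h g = h (factor_embedding I G j (g j)) \<otimes>\<^bsub>H\<^esub> h g'"
   using hom_mult[OF h factor_embedding_in[OF j(1) g[OF j(1)]] g'] by simp
  also have "\<dots> = h g'" using triv[OF j g[OF j(1)]] hom_in_carrier[OF h g'] group.is_monoid[OF H] by (simp add: monoid.l_one)
  also have "\<dots> = h (factor_embedding I G i (g' i))"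
  proof (rule insert.IH[OF _ g'])
   show "J \<subseteq> I - {i}" using insert.prems(1) by auto
   show "g' k = \<one>\<^bsub>G k\<^esub>" if "k \<in> I" "k \<notin> insert i J" for k using that insert.prems(3)[of k] unfolding g'_def by auto
  qed
  also have "g' i = g i" unfolding g'_def using i j by simp
  finally show ?case .
 qed
 from this[of "I - {i}" g] show ?thesis using assms by auto
qed

lemma continuous_factor_embedding:
 assumes i: "i \<in> I" and T: "!!i. i \<in> I ==> topspace (T i) = carrier (G i)"
 shows "continuous_map (T i) (product_topology T I) (factor_embedding I G i)"
 unfolding continuous_map_componentwise factor_embedding_def
proof (intro conjI ballI)
 fix k assume k: "k \<in> I"
 have "\<one>\<^bsub>G k\<^esub> \<in> topspace (T k)" using T[OF k] group.is_monoid[OF gr[OF k]] by (simp add: monoid.one_closed)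
 thus "continuous_map (T i) (T k) (\<lambda>x. (\<lambda>j\<in>I. if j = i then x else \<one>\<^bsub>G j\<^esub>) k)"
  using k by (cases "k = i") auto
qed auto

end

lemma mp_action_of:
 assumes "prob_space M" and act: "measurable_mp_action G T M act"
  and lam: "space lam = carrier G" "sets lam = sets (borel_of T)" "sigma_finite_measure lam" "emeasure lam (carrier G) ~= 0"
  "!!A h. A \<in> sets lam ==> h \<in> carrier G ==> emeasure lam {g\<in>carrier G. g \<otimes>\<^bsub>G\<^esub> h \<in> A} = emeasure lam A"
 shows "mp_action M lam G act"
proof -
 have "sets (lam \<Otimes>\<^sub>M M) = sets (borel_of T \<Otimes>\<^sub>M M)" using lam(2) by (intro sets_pair_measure_cong) auto
 hence j: "(\<lambda>(g, w). act g w) \<in> measurable (lam \<Otimes>\<^sub>M M) M"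
  using act unfolding measurable_mp_action_def by (simp cong: measurable_cong_sets)
 have "act g \<in> measurable M M" if "g \<in> carrier G" for g
  using measurable_compose[OF measurable_Pair1' j, of g] lam(1) that by simp
 with j show ?thesis using assms unfolding measurable_mp_action_def
  by (intro mp_action.intro pmp_action.intro pmp_action_axioms.intro mp_action_axioms.intro) auto
qed

text \<open>A Haar measure of the group serves as the right-invariant measure.\<close>

lemma ergodic_on_of_ergodic_action:
 assumes lc: "lc_group G T" and "prob_space M" and act: "measurable_mp_action G T M act" and erg: "ergodic_action G M act"
  and A: "A \<in> sets M" and inv: "!!g. g \<in> carrier G ==> AE w in M. act g w \<in> A \<longleftrightarrow> w \<in> A"
 shows "measure M A = 0 \<or> measure M A = 1"
proof -
 obtain lam where lam: "space lam = carrier G" "sets lam = sets (borel_of T)" "sigma_finite_measure lam" "emeasure lam (carrier G) ~= 0"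
  "!!A h. A \<in> sets lam ==> h \<in> carrier G ==> emeasure lam {g\<in>carrier G. g \<otimes>\<^bsub>G\<^esub> h \<in> A} = emeasure lam A"
  by (rule lc_group.ex_right_Haar[OF lc]) (rule that)
 interpret mp_action M lam G act by (rule mp_action_of[OF assms(2) act lam])
 show ?thesis using ergodic_action_ergodic_on[OF erg] A inv unfolding ergodic_on_def by blast
qed

lemma measurable_mp_action_comp:
 assumes act: "measurable_mp_action G T M act" and f: "f \<in> hom H G" "continuous_map U T f" and H: "group H"
 shows "measurable_mp_action H U M (\<lambda>x. act (f x))"
proof -
 have ga: "group_action G (space M) act" and j: "(\<lambda>(g, w). act g w) \<in> measurable (borel_of T \<Otimes>\<^sub>M M) M"
  and mp: "!!g. g \<in> carrier G ==> distr M M (act g) = M" using act unfolding measurable_mp_action_def by auto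
 have "group_action H (space M) (\<lambda>x. act (f x))"
  using ga f(1) H unfolding group_action_def group_hom_def group_hom_axioms_def hom_def by (auto simp: Pi_iff)
 moreover have "(\<lambda>(x, w). act (f x) w) \<in> measurable (borel_of U \<Otimes>\<^sub>M M) M"
 proof -
  have fm: "f \<in> measurable (borel_of U) (borel_of T)" by (rule continuous_measurable_borel_of[OF f(2)])
  have "(\<lambda>z. (f (fst z), snd z)) \<in> measurable (borel_of U \<Otimes>\<^sub>M M) (borel_of T \<Otimes>\<^sub>M M)" using fm by measurable
  from measurable_compose[OF this j] show ?thesis by (simp add: case_prod_unfold)
 qed
 moreover have "distr M M (act (f x)) = M" if "x \<in> carrier H" for x using mp hom_in_carrier[OF f(1) that] by blast
 ultimately show ?thesis unfolding measurable_mp_action_def by blast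
qed

lemma standard_dense_events:
 assumes "standard_probability_space M"
 shows "\<exists>D :: nat => 'w set. (\<forall>n. D n \<in> sets M) \<and> (\<forall>A e. A \<in> sets M --> 0 < e --> (\<exists>n. measure M ((A - D n) \<union> (D n - A)) < e))"
proof -
 obtain T where T: "second_countable T" "space M = topspace T" "sets M = sets (borel_of T)" and M: "prob_space M"
  using assms unfolding standard_probability_space_def by blast
 interpret prob_space M by (rule M)
 obtain B :: "nat => _" where B: "!!n. openin T (B n)" "sets (borel_of T) = sigma_sets (topspace T) (range B)"
  by (rule borel_of_countable_generators[OF T(1)]) (rule that)
 obtain D :: "nat => 'w set" where D: "!!n. D n \<in> sets M" "!!A e. A \<in> sets M ==> 0 < e ==> \<exists>n. measure M ((A - D n) \<union> (D n - A)) < e"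
 proof (rule countable_dense_sets[of B])
  show "sets M = sigma_sets (space M) (range B)" using T(2,3) B(2) by simp
  show "B n \<subseteq> space M" for n using openin_subset[OF B(1)] T(2) by simp
 qed (rule that)
 thus ?thesis by blast
qed

lemma cocycle_evaluation:
 assumes coc: "cocycle G T M act X coc" and T: "topspace T = carrier G"
  and lam: "space lam = carrier G" "sets lam = sets (borel_of T)"
 shows "g \<in> carrier G ==> w \<in> space M ==> coc g w \<in> isometries X"
  and "x \<in> mspace X ==> y \<in> mspace X ==> {z\<in>space (lam \<Otimes>\<^sub>M M). coc (fst z) (snd z) x = y} \<in> sets (lam \<Otimes>\<^sub>M M)"
proof -
 have m: "(\<lambda>(g, w). coc g w) \<in> measurable (borel_of T \<Otimes>\<^sub>M M) (borel_of (isom_topology X))"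
  using coc unfolding cocycle_def by blast
 have sp: "space (borel_of T \<Otimes>\<^sub>M M) = carrier G \<times> space M" by (simp add: space_pair_measure space_borel_of T)
 show iso: "coc g w \<in> isometries X" if "g \<in> carrier G" "w \<in> space M" for g w
  using measurable_space[OF m, of "(g, w)"] that by (simp add: sp space_borel_of topspace_isom_topology)
 assume xy: "x \<in> mspace X" "y \<in> mspace X"
 have "(\<lambda>(g, w). coc g w) -` {f \<in> isometries X. f x = y} \<inter> space (borel_of T \<Otimes>\<^sub>M M) \<in> sets (borel_of T \<Otimes>\<^sub>M M)"
  by (rule measurable_sets[OF m closed_in_borel_of[OF closed_evaluation[OF xy]]])
 moreover have "(\<lambda>(g, w). coc g w) -` {f \<in> isometries X. f x = y} \<inter> space (borel_of T \<Otimes>\<^sub>M M) =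
  {z\<in>space (lam \<Otimes>\<^sub>M M). coc (fst z) (snd z) x = y}" using iso unfolding sp by (auto simp: space_pair_measure lam(1))
 moreover have "sets (lam \<Otimes>\<^sub>M M) = sets (borel_of T \<Otimes>\<^sub>M M)" using lam(2) by (intro sets_pair_measure_cong) auto
 ultimately show "{z\<in>space (lam \<Otimes>\<^sub>M M). coc (fst z) (snd z) x = y} \<in> sets (lam \<Otimes>\<^sub>M M)" by simp
qed

theorem theorem1:
  fixes n :: nat
    and G :: "nat \<Rightarrow> 'g monoid"
    and T :: "nat \<Rightarrow> 'g topology"
    and M :: "'w measure"
    and act :: "(nat \<Rightarrow> 'g) \<Rightarrow> 'w \<Rightarrow> 'w"
    and X :: "'x metric"
    and \<alpha> :: "(nat \<Rightarrow> 'g) \<Rightarrow> 'w \<Rightarrow> 'x \<Rightarrow> 'x"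
  assumes "n \<ge> 2"
    and "\<And>i. i < n \<Longrightarrow> topological_group (G i) (T i)"
    and "\<And>i. i < n \<Longrightarrow> Hausdorff_space (T i)"
    and "\<And>i. i < n \<Longrightarrow> second_countable (T i)"
    and "\<And>i. i < n \<Longrightarrow> locally_compact_space (T i)"
    and "\<And>i. i < n \<Longrightarrow> \<not> compact_space (T i)"
    and "standard_probability_space M"
    and "measurable_mp_action (product_group {..<n} G) (product_topology T {..<n}) M act"
    and "\<And>i. i < n \<Longrightarrow> ergodic_action (G i) M (\<lambda>x. act (factor_embedding {..<n} G i x))"
    and "irreducible_median_space X"
    and "mcomplete_of X"
    and "separable_space (mtopology_of X)"
    and "finite_rank X"
    and "cocycle (product_group {..<n} G) (product_topology T {..<n}) M act X \<alpha>"
    and "non_elementary (product_group {..<n} G) M act X \<alpha>"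
  shows "\<exists>Y h. median_subspace X Y \<and> (\<forall>f \<in> isometries X. f ` Y = Y) \<and>
    h \<in> hom (product_group {..<n} G) (isom_group (submetric X Y)) \<and>
    (\<exists>i<n. \<exists>h'. h' \<in> hom (G i) (isom_group (submetric X Y)) \<and>
       (\<forall>g \<in> carrier (product_group {..<n} G). h g = h' (g i))) \<and>
    cohomologous (product_group {..<n} G) (product_topology T {..<n}) M act (submetric X Y)
      (\<lambda>g \<omega>. restrict (\<alpha> g \<omega>) Y) (\<lambda>g \<omega>. h g)"
proof -
 note carrier_product_group[simp del] mult_product_group[simp del] one_product_group[simp del]
 let ?I = "{..<n}"
 let ?G = "product_group ?I G" and ?T = "product_topology T ?I"
 have lc: "lc_group (G i) (T i)" if "i \<in> ?I" for i using assms(2-5)[of i] that by (intro lc_group.intro) auto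
 have lcP: "lc_group ?G ?T" by (rule lc_group_product[OF _ lc]) auto
 have gr: "group (G i)" and Ttop: "topspace (T i) = carrier (G i)" if "i \<in> ?I" for i
  using lc_group.group[OF lc[OF that]] lc_group.top[OF lc[OF that]] by auto
 have topP: "topspace ?T = carrier ?G" by (rule lc_group.top[OF lcP])
 have prob: "prob_space M" using assms(7) unfolding standard_probability_space_def by blast
 obtain lam where lam: "space lam = carrier ?G" "sets lam = sets (borel_of ?T)" "sigma_finite_measure lam" "emeasure lam (carrier ?G) ~= 0"
  "!!A h. A \<in> sets lam ==> h \<in> carrier ?G ==> emeasure lam {g\<in>carrier ?G. g \<otimes>\<^bsub>?G\<^esub> h \<in> A} = emeasure lam A"
  by (rule lc_group.ex_right_Haar[OF lcP]) (rule that)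
 interpret mp_action M lam ?G act by (rule mp_action_of[OF prob assms(8) lam])
 note coc_isom = cocycle_evaluation(1)[OF assms(14) topP lam(1,2)]
 note coc_eval = cocycle_evaluation(2)[OF assms(14) topP lam(1,2)]
 have coc_mult: "\<alpha> (g \<otimes>\<^bsub>?G\<^esub> h) w x = \<alpha> g (act h w) (\<alpha> h w x)"
  if "g \<in> carrier ?G" "h \<in> carrier ?G" "w \<in> space M" "x \<in> mspace X" for g h w x
 proof -
  have "\<alpha> (g \<otimes>\<^bsub>?G\<^esub> h) w = \<alpha> g (act h w) \<otimes>\<^bsub>isom_group X\<^esub> \<alpha> h w" using assms(14) that unfolding cocycle_def by blast
  also have "\<dots> = compose (mspace X) (\<alpha> g (act h w)) (\<alpha> h w)"
   by (rule isom_group_simps(2)[OF coc_isom[OF that(1) act_in[OF that(2,3)]] coc_isom[OF that(2,3)]])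
  finally show ?thesis using that(4) by (simp add: compose_def)
 qed
 interpret fr_median_geometry X
  using assms(10,11,13) unfolding irreducible_median_space_def by unfold_locales auto
 have isometries_iso: "iso f" if "f \<in> isometries X" for f
  using that unfolding isometries_def iso_def Bij_def by auto
 interpret main_geometry X
 proof unfold_locales
  show "irreducible_median_space X" by (rule assms(10))
  show "\<not> lineal X" using assms(15) unfolding non_elementary_def by blast
  show "separable_space (mtopology_of X)" by (rule assms(12))
  fix H assume H: "thick H"
  have "0 < prob (space M)" by (simp add: prob_space)
  then obtain g w where "g \<in> carrier ?G" "w \<in> space M" "\<alpha> g w ` H \<subseteq> mspace X - H"
   using assms(15) H sets.top[of M] unfolding non_elementary_def by metis
  thus "\<exists>f. iso f \<and> f ` H \<subseteq> mspace X - H" using isometries_iso[OF coc_isom] by blast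
 qed
 obtain p q where pq: "base p q" by (rule ex_base)
 interpret cocycle_geometry X M lam ?G act \<alpha> p q
 proof unfold_locales
  show "base p q" by (rule pq)
  show "iso (\<alpha> g w)" if "g \<in> carrier ?G" "w \<in> space M" for g w by (rule isometries_iso[OF coc_isom[OF that]])
  show "\<exists>D :: nat => 'w set. (\<forall>n. D n \<in> events) \<and> (\<forall>A e. A \<in> events --> 0 < e --> (\<exists>n. prob (A - D n \<union> (D n - A)) < e))"
   by (rule standard_dense_events[OF assms(7)])
  show "\<exists>g\<in>carrier ?G. \<exists>w\<in>A. act g w \<in> A \<and> \<alpha> g w ` H \<subseteq> mspace X - H" if "thick H" "A \<in> events" "0 < prob A" for H A
   using assms(15) that unfolding non_elementary_def by blast
 qed (use coc_mult coc_eval in \<open>auto simp: jmeas_def\<close>)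
 let ?e = "factor_embedding ?I G"
 note e_in = factor_embedding_in[where I = ?I and G = G, OF gr]
 define P where "P i = ?e i ` carrier (G i)" for i
 have P_ergodic: "ergodic_on (P i)" if i: "i \<in> ?I" for i
  unfolding ergodic_on_def
 proof (intro ballI impI)
  fix A assume A: "A \<in> events" "\<forall>g\<in>P i. AE w in M. act g w \<in> A \<longleftrightarrow> w \<in> A"
  have act_i: "measurable_mp_action (G i) (T i) M (\<lambda>x. act (?e i x))"
   by (rule measurable_mp_action_comp[OF assms(8) factor_embedding_hom[where I = ?I and G = G, OF gr i] continuous_factor_embedding[where I = ?I and G = G, OF gr i Ttop] gr[OF i]])
  have "i < n" using i by simp
  show "prob A = 0 \<or> prob A = 1"
   by (rule ergodic_on_of_ergodic_action[OF lc[OF i] prob act_i assms(9)[OF \<open>i < n\<close>] A(1)]) (use A(2) in \<open>auto simp: P_def\<close>)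
 qed
 obtain i F where i: "i \<in> ?I" and F: "is_frame (\<Union>j\<in>?I - {i}. P j) F"
  and Q: "(\<Union>j\<in>?I - {i}. P j) \<subseteq> carrier ?G" "normalized (\<Union>j\<in>?I - {i}. P j)" "ergodic_on (\<Union>j\<in>?I - {i}. P j)"
 proof (rule frame_of_commuting[of ?I P])
  show "P j \<subseteq> carrier ?G" if "j \<in> ?I" for j using e_in[OF _ that] unfolding P_def by blast
  show "P j ~= {}" if "j \<in> ?I" for j using Group.group.is_monoid[OF gr[OF that]] unfolding P_def by blast
  show "inv\<^bsub>?G\<^esub> g \<in> P j" if "j \<in> ?I" "g \<in> P j" for j g
   using that factor_embedding_inv[where I = ?I and G = G, OF gr that(1)] Group.group.inv_closed[OF gr[OF that(1)]] unfolding P_def by auto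
  show "normalized (P j)" if j: "j \<in> ?I" for j unfolding normalized_def
  proof (intro ballI)
   fix g h assume g: "g \<in> carrier ?G" and "h \<in> P j"
   then obtain x where x: "x \<in> carrier (G j)" "h = ?e j x" unfolding P_def by blast
   have "g j \<in> carrier (G j)" using g j by (auto simp: carrier_product_group)
   hence "g j \<otimes>\<^bsub>G j\<^esub> x \<otimes>\<^bsub>G j\<^esub> inv\<^bsub>G j\<^esub> g j \<in> carrier (G j)"
    using x(1) Group.group.is_monoid[OF gr[OF j]] Group.group.inv_closed[OF gr[OF j]] by (simp add: monoid.m_closed)
   moreover have "g \<otimes>\<^bsub>?G\<^esub> h \<otimes>\<^bsub>?G\<^esub> inv\<^bsub>?G\<^esub> g = ?e j (g j \<otimes>\<^bsub>G j\<^esub> x \<otimes>\<^bsub>G j\<^esub> inv\<^bsub>G j\<^esub> g j)"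
    unfolding x(2) by (rule factor_embedding_conj[where I = ?I and G = G, OF gr j g x(1)])
   ultimately show "g \<otimes>\<^bsub>?G\<^esub> h \<otimes>\<^bsub>?G\<^esub> inv\<^bsub>?G\<^esub> g \<in> P j" unfolding P_def by simp
  qed
  show "g \<otimes>\<^bsub>?G\<^esub> h = h \<otimes>\<^bsub>?G\<^esub> g" if "j \<in> ?I" "k \<in> ?I" "j ~= k" "g \<in> P j" "h \<in> P k" for j k g h
   using that factor_embedding_commute[where I = ?I and G = G, OF gr that(1-3)] unfolding P_def by auto
 qed (use assms(1) P_ergodic in auto)
 define Q where "Q = (\<Union>j\<in>?I - {i}. P j)"
 let ?Y = "submetric X core"
 let ?L = "isom_group ?Y"
 have core_Int[simp]: "core \<inter> mspace X = core" using core_S by blast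
 have Y: "mspace ?Y = core" by simp
 obtain h \<phi> where h_isom: "!!g. g \<in> carrier ?G ==> h g \<in> isometries ?Y"
  and h_mult: "!!g k. g \<in> carrier ?G ==> k \<in> carrier ?G ==> h (g \<otimes>\<^bsub>?G\<^esub> k) = compose core (h g) (h k)"
  and h_triv: "!!g. g \<in> Q ==> h g = (\<lambda>y\<in>core. y)"
  and h_meas: "!!y y'. y \<in> core ==> y' \<in> core ==> {g\<in>carrier ?G. h g y = y'} \<in> sets lam"
  and \<phi>_isom: "!!w. w \<in> space M ==> \<phi> w \<in> isometries ?Y"
  and \<phi>_meas: "!!y y'. y \<in> core ==> y' \<in> core ==> {w\<in>space M. \<phi> w y = y'} \<in> sets M"
  and conj: "!!g. g \<in> carrier ?G ==> AE w in M. \<forall>y\<in>core. \<phi> (act g w) (\<alpha> g w y) = h g (\<phi> w y)"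
  by (rule trivialisation[OF Q[folded Q_def] F[folded Q_def]]) (rule that)
 have grY: "group (?L)" by (rule group_isom_group)
 note multY = isom_group_simps(2)[of _ ?Y, unfolded Y]
 have h_hom: "h \<in> hom ?G (?L)"
 proof (rule homI)
  fix g k assume g: "g \<in> carrier ?G" and k: "k \<in> carrier ?G"
  show "h g \<in> carrier (?L)" unfolding isom_group_simps(1) by (rule h_isom[OF g])
  show "h (g \<otimes>\<^bsub>?G\<^esub> k) = h g \<otimes>\<^bsub>?L\<^esub> h k"
   unfolding multY[OF h_isom[OF g] h_isom[OF k]] by (rule h_mult[OF g k])
 qed
 have oneY: "\<one>\<^bsub>?L\<^esub> = (\<lambda>y\<in>core. y)" unfolding isom_group_def BijGroup_def by (simp add: Y)
 have sub_core: "f ` core = core" if f: "iso f" for f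
 proof
  show "f ` core \<subseteq> core" using core_iso[OF f] by blast
  show "core \<subseteq> f ` core"
  proof
   fix y assume y: "y \<in> core"
   have "f (inv_into (mspace X) f y) = y" using iso_inv(2)[OF f] core_S[OF y] by blast
   thus "y \<in> f ` core" using core_iso[OF iso_inv(1)[OF f] y] by (metis imageI)
  qed
 qed
 let ?\<alpha> = "\<lambda>g w. restrict (\<alpha> g w) core"
 have \<alpha>Y: "?\<alpha> g w \<in> isometries ?Y" if g: "g \<in> carrier ?G" and w: "w \<in> space M" for g w
 proof -
  have f: "iso (\<alpha> g w)" by (rule coc_iso[OF g w])
  have "core \<subseteq> mspace X" using core_S by blast
  hence "inj_on (\<alpha> g w) core" by (rule inj_on_subset[OF iso_inj[OF f]])
  hence "bij_betw (\<alpha> g w) core core" using sub_core[OF f] unfolding bij_betw_def by blast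
  hence "bij_betw (?\<alpha> g w) core core" by (simp cong: bij_betw_cong)
  hence "?\<alpha> g w \<in> Bij core" unfolding Bij_def by auto
  thus ?thesis unfolding isometries_def Y using iso_dist[OF f] core_S by simp
 qed
 have sp: "space (borel_of ?T \<Otimes>\<^sub>M M) = carrier ?G \<times> space M" unfolding space_pair_measure space_borel_of topP ..
 have se: "sets (borel_of ?T \<Otimes>\<^sub>M M) = sets (lam \<Otimes>\<^sub>M M)" using lam(2) by (intro sets_pair_measure_cong) auto
 have cY: "countable (mspace ?Y)" unfolding Y by (rule countable_core)
 have coc_cocycle: "cocycle ?G ?T M act ?Y ?\<alpha>" unfolding cocycle_def
 proof (intro conjI ballI)
  show "(\<lambda>(g, w). ?\<alpha> g w) \<in> measurable (borel_of ?T \<Otimes>\<^sub>M M) (borel_of (isom_topology ?Y))"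
  proof (rule measurable_isometries_countable[OF cY])
   fix y z assume yz: "y \<in> mspace ?Y" "z \<in> mspace ?Y"
   hence "{x \<in> space (borel_of ?T \<Otimes>\<^sub>M M). (case x of (g, w) => ?\<alpha> g w) y = z} = {x\<in>space (lam \<Otimes>\<^sub>M M). \<alpha> (fst x) (snd x) y = z}"
    unfolding sp Y by (auto simp: space_pair_measure lam(1))
   thus "{x \<in> space (borel_of ?T \<Otimes>\<^sub>M M). (case x of (g, w) => ?\<alpha> g w) y = z} \<in> sets (borel_of ?T \<Otimes>\<^sub>M M)"
    unfolding se using coc_joint[unfolded jmeas_def] core_S yz unfolding Y by simp
  qed (auto simp: sp \<alpha>Y)
  fix g k w assume g: "g \<in> carrier ?G" and k: "k \<in> carrier ?G" and w: "w \<in> space M"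
  have "?\<alpha> (g \<otimes>\<^bsub>?G\<^esub> k) w = compose core (?\<alpha> g (act k w)) (?\<alpha> k w)"
   unfolding compose_def using coc_mult[OF g k w] core_iso[OF coc_iso[OF k w]] core_S by (intro restrict_ext) simp
  thus "?\<alpha> (g \<otimes>\<^bsub>?G\<^esub> k) w = ?\<alpha> g (act k w) \<otimes>\<^bsub>?L\<^esub> ?\<alpha> k w"
   using multY[OF \<alpha>Y[OF g act_in[OF k w]] \<alpha>Y[OF k w]] by simp
 qed
 have h_cocycle: "cocycle ?G ?T M act ?Y (\<lambda>g w. h g)" unfolding cocycle_def
 proof (intro conjI ballI)
  show "(\<lambda>(g, w). h g) \<in> measurable (borel_of ?T \<Otimes>\<^sub>M M) (borel_of (isom_topology ?Y))"
  proof (rule measurable_isometries_countable[OF cY])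
   fix y z assume yz: "y \<in> mspace ?Y" "z \<in> mspace ?Y"
   have "{x \<in> space (borel_of ?T \<Otimes>\<^sub>M M). (case x of (g, w) => h g) y = z} = {g\<in>carrier ?G. h g y = z} \<times> space M"
    unfolding sp by auto
   thus "{x \<in> space (borel_of ?T \<Otimes>\<^sub>M M). (case x of (g, w) => h g) y = z} \<in> sets (borel_of ?T \<Otimes>\<^sub>M M)"
    unfolding se using h_meas yz unfolding Y by (auto intro: pair_measureI)
  qed (auto simp: sp h_isom)
  fix g k w assume "g \<in> carrier ?G" "k \<in> carrier ?G"
  thus "h (g \<otimes>\<^bsub>?G\<^esub> k) = h g \<otimes>\<^bsub>?L\<^esub> h k" using h_mult multY[OF h_isom h_isom] by simp
 qed
 have "cohomologous ?G ?T M act ?Y ?\<alpha> (\<lambda>g w. h g)" unfolding cohomologous_def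
 proof (intro conjI bexI[of _ \<phi>] ballI)
  show "\<phi> \<in> measurable M (borel_of (isom_topology ?Y))"
   by (rule measurable_isometries_countable[OF cY]) (auto simp: Y \<phi>_isom \<phi>_meas)
  fix g assume g: "g \<in> carrier ?G"
  show "AE w in M. ?\<alpha> g w = inv\<^bsub>?L\<^esub> (\<phi> (act g w)) \<otimes>\<^bsub>?L\<^esub> h g \<otimes>\<^bsub>?L\<^esub> \<phi> w"
   using conj[OF g] AE_space
  proof eventually_elim
   case (elim w)
   interpret L: group "?L" by (rule grY)
   have c: "\<phi> (act g w) \<in> carrier (?L)" "h g \<in> carrier (?L)" "\<phi> w \<in> carrier (?L)" "?\<alpha> g w \<in> carrier (?L)"
    using \<phi>_isom[OF act_in[OF g elim(2)]] \<phi>_isom[OF elim(2)] h_isom[OF g] \<alpha>Y[OF g elim(2)] by (auto simp: isom_group_simps(1))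
   have "compose core (\<phi> (act g w)) (?\<alpha> g w) = compose core (h g) (\<phi> w)"
    unfolding compose_def using elim(1) by (intro restrict_ext) simp
   hence "\<phi> (act g w) \<otimes>\<^bsub>?L\<^esub> ?\<alpha> g w = h g \<otimes>\<^bsub>?L\<^esub> \<phi> w"
    using multY c unfolding isom_group_simps(1) by simp
   hence "inv\<^bsub>?L\<^esub> (\<phi> (act g w)) \<otimes>\<^bsub>?L\<^esub> (\<phi> (act g w) \<otimes>\<^bsub>?L\<^esub> ?\<alpha> g w) =
    inv\<^bsub>?L\<^esub> (\<phi> (act g w)) \<otimes>\<^bsub>?L\<^esub> (h g \<otimes>\<^bsub>?L\<^esub> \<phi> w)" by simp
   thus ?case using c by (simp add: L.m_assoc[symmetric])
  qed
 qed (rule coc_cocycle h_cocycle)+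
 moreover have "median_subspace X core" unfolding median_subspace_def using core_S core_ne core_med by blast
 moreover have "\<forall>f\<in>isometries X. f ` core = core" using sub_core isometries_iso by blast
 moreover have "\<exists>i<n. \<exists>h'. h' \<in> hom (G i) (?L) \<and> (\<forall>g\<in>carrier ?G. h g = h' (g i))"
 proof (intro exI[of _ i] exI[of _ "\<lambda>x. h (?e i x)"] conjI ballI)
  show "i < n" using i by simp
  show "(\<lambda>x. h (?e i x)) \<in> hom (G i) (?L)"
   using hom_compose[OF factor_embedding_hom[where I = ?I and G = G, OF gr i] h_hom] by (simp add: o_def)
  fix g assume g: "g \<in> carrier ?G"
  show "h g = h (?e i (g i))"
  proof (rule hom_factors[where I = ?I and G = G, OF gr _ i h_hom grY _ g])
   fix j x assume "j \<in> ?I" "j ~= i" "x \<in> carrier (G j)"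
   hence "?e j x \<in> Q" unfolding Q_def P_def by blast
   thus "h (?e j x) = \<one>\<^bsub>?L\<^esub>" unfolding oneY by (rule h_triv)
  qed auto
 qed
 ultimately show ?thesis using h_hom by blast
qed

end
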